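(* Let $K$ be a biquadratic bicyclic number field (a Galois extension of $\mathbb{Q}$ with group $(\mathbb{Z}/2\mathbb{Z})^2$) with quadratic subfields $k_1,k_2,k_3$. Let $\psi:\mathcal{P}o(k_1)\times\mathcal{P}o(k_2)\times\mathcal{P}o(k_3)\to\mathcal{P}o(K)$ be the morphism induced by $(\mathfrak a_1,\mathfrak a_2,\mathfrak a_3)\mapsto \mathfrak a_1\mathfrak a_2\mathfrak a_3\mathcal{O}_K$. Then $$|\mathrm{Ker}\,\psi|=\begin{cases}\dfrac{1}{q_K}\prod_p e_p(K/\mathbb{Q}) & \text{if } K \text{ is real and } \nu_1=\nu_2=\nu_3=0,\\[2mm] \dfrac{1}{2q_K}\prod_p e_p(K/\mathbb{Q}) & \text{otherwise,}\end{cases}$$ where the product runs over all prime numbers $p$.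
   Context: For a number field $k$: $\mathcal{O}_k$ is its ring of integers, $\mathcal{O}_k^\times$ its unit group, $\mathcal I_k$ its group of nonzero fractional ideals, $\mathcal P_k$ its subgroup of nonzero principal fractional ideals. For $q\ge 1$, $\Pi_q(k)$ is the product of all prime ideals of $k$ of absolute norm $q$ if there are some, and $\mathcal{O}_k$ otherwise. For $k$ Galois over $\mathbb{Q}$, $\mathcal I_k^{G}$ denotes the subgroup of $\mathcal I_k$ generated by all $\Pi_q(k)$ (the ideals stable under $\mathrm{Gal}(k/\mathbb{Q})$), and the Pólya group is $\mathcal{P}o(k)=\mathcal I_k^{G}/(\mathcal P_k\cap\mathcal I_k^{G})$ (the subgroup of the class group generated by the classes of the $\Pi_q(k)$). For a real quadratic $k_i$, $\varepsilon_i>1$ denotes its fundamental unit; $\nu_i=1$ if $k_i$ is real and $N_{k_i/\mathbb{Q}}(\varepsilon_i)=1$, and $\nu_i=0$ otherwise. $q_K=(\mathcal{O}_K^\times:\mathcal{O}_{k_1}^\times\mathcal{O}_{k_2}^\times\mathcal{O}_{k_3}^\times)$ is the unit index of $K$. $e_p(K/\mathbb{Q})$ is the ramification index of $p$ in $K/\mathbb{Q}$. *)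

theory Defs
  imports "HOL-Computational_Algebra.Polynomial" Complex_Main
begin

definition subfield :: "complex set \<Rightarrow> bool" where
  "subfield K \<longleftrightarrow> 1 \<in> K \<and> (\<forall>x\<in>K. \<forall>y\<in>K. x + y \<in> K \<and> x * y \<in> K)
     \<and> (\<forall>x\<in>K. - x \<in> K \<and> inverse x \<in> K)"

definition qdim_eq :: "complex set \<Rightarrow> nat \<Rightarrow> bool" where
  "qdim_eq K n \<longleftrightarrow> (\<exists>b :: nat \<Rightarrow> complex. (\<forall>i<n. b i \<in> K)
     \<and> (\<forall>c :: nat \<Rightarrow> rat. (\<Sum>i<n. of_rat (c i) * b i) = 0 \<longrightarrow> (\<forall>i<n. c i = 0))
     \<and> (\<forall>x\<in>K. \<exists>c :: nat \<Rightarrow> rat. x = (\<Sum>i<n. of_rat (c i) * b i)))"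

definition aut :: "complex set \<Rightarrow> (complex \<Rightarrow> complex) set" where
  "aut K = {\<sigma>. bij_betw \<sigma> K K \<and> \<sigma> 1 = 1
     \<and> (\<forall>x\<in>K. \<forall>y\<in>K. \<sigma> (x + y) = \<sigma> x + \<sigma> y \<and> \<sigma> (x * y) = \<sigma> x * \<sigma> y)
     \<and> (\<forall>x. x \<notin> K \<longrightarrow> \<sigma> x = x)}"

definition biquadratic_bicyclic :: "complex set \<Rightarrow> bool" where
  "biquadratic_bicyclic K \<longleftrightarrow> subfield K \<and> qdim_eq K 4 \<and> card (aut K) = 4
     \<and> (\<forall>\<sigma>\<in>aut K. \<forall>x. \<sigma> (\<sigma> x) = x)"

definition quadratic_subfield :: "complex set \<Rightarrow> complex set \<Rightarrow> bool" where
  "quadratic_subfield k K \<longleftrightarrow> subfield k \<and> k \<subseteq> K \<and> qdim_eq k 2"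

definition OK :: "complex set \<Rightarrow> complex set" where
  "OK K = {x\<in>K. algebraic_int x}"

definition unit_set :: "complex set \<Rightarrow> complex set" where
  "unit_set K = {x\<in>OK K. x \<noteq> 0 \<and> inverse x \<in> OK K}"

definition fid_mult :: "complex set \<Rightarrow> complex set \<Rightarrow> complex set" where
  "fid_mult I J = {(\<Sum>i<n. a i * b i) | (n::nat) a b. \<forall>i<n. a i \<in> I \<and> b i \<in> J}"

definition fid_pow :: "complex set \<Rightarrow> complex set \<Rightarrow> nat \<Rightarrow> complex set" where
  "fid_pow K I e = ((fid_mult I) ^^ e) (OK K)"

definition frac_ideal :: "complex set \<Rightarrow> complex set \<Rightarrow> bool" where
  "frac_ideal K I \<longleftrightarrow> I \<subseteq> K \<and> I \<noteq> {0} \<and> 0 \<in> I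
     \<and> (\<forall>x\<in>I. \<forall>y\<in>I. x + y \<in> I) \<and> (\<forall>a\<in>OK K. \<forall>x\<in>I. a * x \<in> I)
     \<and> (\<exists>d\<in>OK K. d \<noteq> 0 \<and> (\<forall>x\<in>I. d * x \<in> OK K))"

definition inv_ideal :: "complex set \<Rightarrow> complex set \<Rightarrow> complex set" where
  "inv_ideal K I = {x\<in>K. \<forall>y\<in>I. x * y \<in> OK K}"

definition principal :: "complex set \<Rightarrow> complex set \<Rightarrow> bool" where
  "principal K I \<longleftrightarrow> (\<exists>x\<in>K. x \<noteq> 0 \<and> I = (\<lambda>y. x * y) ` OK K)"

definition prime_ideal :: "complex set \<Rightarrow> complex set \<Rightarrow> bool" where
  "prime_ideal K P \<longleftrightarrow> frac_ideal K P \<and> P \<subseteq> OK K \<and> P \<noteq> OK K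
     \<and> (\<forall>a\<in>OK K. \<forall>b\<in>OK K. a * b \<in> P \<longrightarrow> a \<in> P \<or> b \<in> P)"

definition ideal_norm :: "complex set \<Rightarrow> complex set \<Rightarrow> nat" where
  "ideal_norm K P = card {(\<lambda>y. a + y) ` P | a. a \<in> OK K}"

definition Pi_q :: "complex set \<Rightarrow> nat \<Rightarrow> complex set" where
  "Pi_q K q = Finite_Set.fold fid_mult (OK K) {P. prime_ideal K P \<and> ideal_norm K P = q}"

inductive_set IG :: "complex set \<Rightarrow> complex set set" for K where
  IG_one: "OK K \<in> IG K"
| IG_gen: "q \<ge> 1 \<Longrightarrow> Pi_q K q \<in> IG K"
| IG_inv: "I \<in> IG K \<Longrightarrow> inv_ideal K I \<in> IG K"
| IG_mult: "I \<in> IG K \<Longrightarrow> J \<in> IG K \<Longrightarrow> fid_mult I J \<in> IG K"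

text \<open>Class of I in the Polya group I_K^G / (P_K \<inter> I_K^G).\<close>
definition polya_class :: "complex set \<Rightarrow> complex set \<Rightarrow> complex set set" where
  "polya_class K I = {J\<in>IG K. \<exists>x\<in>K. x \<noteq> 0 \<and> J = (\<lambda>y. x * y) ` I}"

definition polya_group :: "complex set \<Rightarrow> complex set set set" where
  "polya_group K = polya_class K ` IG K"

definition ker_psi :: "complex set \<Rightarrow> complex set \<Rightarrow> complex set \<Rightarrow> complex set
    \<Rightarrow> (complex set set \<times> complex set set \<times> complex set set) set" where
  "ker_psi K k1 k2 k3 = {(polya_class k1 a1, polya_class k2 a2, polya_class k3 a3) | a1 a2 a3.
      a1 \<in> IG k1 \<and> a2 \<in> IG k2 \<and> a3 \<in> IG k3 \<and>
      principal K (fid_mult (fid_mult (fid_mult a1 a2) a3) (OK K))}"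

definition unit_index :: "complex set \<Rightarrow> complex set \<Rightarrow> complex set \<Rightarrow> complex set \<Rightarrow> nat" where
  "unit_index K k1 k2 k3 =
     (let H = {a * b * c | a b c. a \<in> unit_set k1 \<and> b \<in> unit_set k2 \<and> c \<in> unit_set k3}
      in card {(\<lambda>h. u * h) ` H | u. u \<in> unit_set K})"

definition fund_unit :: "complex set \<Rightarrow> complex" where
  "fund_unit k = (THE e. e \<in> unit_set k \<and> e \<in> \<real> \<and> Re e > 1 \<and>
      (\<forall>u\<in>unit_set k. u \<in> \<real> \<and> Re u > 1 \<longrightarrow> Re e \<le> Re u))"

definition field_norm :: "complex set \<Rightarrow> complex \<Rightarrow> complex" where
  "field_norm k x = (\<Prod>\<sigma>\<in>aut k. \<sigma> x)"

definition nu :: "complex set \<Rightarrow> nat" where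
  "nu k = (if k \<subseteq> \<real> \<and> field_norm k (fund_unit k) = 1 then 1 else 0)"

text \<open>e_p(K/Q): exponent of a prime P above p in p O_K (all equal since K/Q is Galois).\<close>
definition ram_index :: "complex set \<Rightarrow> nat \<Rightarrow> nat" where
  "ram_index K p = (GREATEST e. \<exists>P. prime_ideal K P \<and> of_nat p \<in> P \<and>
       (\<lambda>y. of_nat p * y) ` OK K \<subseteq> fid_pow K P e)"

end

theory Submission
  imports "Jordan_Normal_Form.Char_Poly" "HOL-Computational_Algebra.Squarefree" Defs
begin

text \<open>
  The class of a product of ramified primes is governed by squares: a set \<open>A\<close> of ramified primes of a
  quadratic field \<open>k\<close> gives an ideal whose square is generated by \<open>\<Prod>A\<close>, and this ideal is principal iff
  \<open>\<Prod>A \<cdot> u\<close> is a square in \<open>k\<close> for some unit \<open>u\<close>.  The same holds in \<open>K\<close> for the extension of a product of three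
  such ideals.  Writing \<open>CC F\<close> for the finite sets of primes whose product is a unit times a square in \<open>F\<close>, the order of the
  kernel is therefore \<open>card (CC K) \<cdot> \<Prod>e\<^sub>p / \<Prod>card (CC k\<^sub>i)\<close>, because every \<open>p\<close> ramified in \<open>K\<close> is ramified in exactly two of the
  \<open>k\<^sub>i\<close> (\<open>e\<^sub>p = 2\<close>) or in all three (\<open>e\<^sub>p = 4\<close>).  Finally \<open>card (CC F)\<close> is an index of unit groups: a
  Hilbert 90 argument shows that the units of \<open>K\<close> which become squares after multiplication with a positive rational
  are, modulo squares, the products of units of the \<open>k\<^sub>i\<close> of a common norm, and this brings in \<open>q\<^sub>K\<close> and the \<open>\<nu>\<^sub>i\<close>.
\<close>

section \<open>Algebraic integers\<close>

text \<open>Only ideals stable under the Galois group matter, so unique factorization of ideals is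
  not developed. Its substitute is the radical of \<open>p\<close>: by the symmetric functions of
  conjugates, every proper stable ideal containing \<open>p\<close> lies in it. This maximality
  yields that the radical is invertible, that a power Rad^e equals (p), and that it is the product
  of the primes above \<open>p\<close>; so e is \<open>ram_index\<close> and \<open>Pi_q\<close> is
  a radical. Squares control ideal classes because M^2 = O forces M = O, so that an ideal with
  principal square is determined by that square. Signs are the obstacle on the side of units: sets
  of primes represent positive rationals only, so real and imaginary fields are counted apart. The
  exceptional case of the formula has one source. In a real K, units b1, b2, b3 of common norm -1
  exist exactly when all three fundamental units have norm -1. Then the norm signs of products of
  units matter only up to the diagonal sign, a factor 2 is lost in one index, and
  \<open>card (CC K)\<close> times the unit index is 8 instead of 4.\<close>

lemma algebraic_int_if_int_module:
  fixes z :: complex and v :: "nat \<Rightarrow> complex" and a :: "nat \<Rightarrow> nat \<Rightarrow> int"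
  assumes "\<And>i. i < N \<Longrightarrow> z * v i = (\<Sum>j<N. of_int (a i j) * v j)"
    and "k < N" "v k \<noteq> 0"
  shows "algebraic_int z"
proof -
  define A :: "int mat" where "A = mat N N (\<lambda>(i, j). a i j)"
  have A: "A \<in> carrier_mat N N" by (simp add: A_def)
  \<comment> \<open>Determinant trick: the relations say that \<open>v\<close> is an eigenvector of
    the integer matrix \<open>A\<close>, so \<open>z\<close> is a root of its monic integral
    characteristic polynomial.\<close>
  have "eigenvector (map_mat of_int A) (vec N v) z"
    unfolding eigenvector_def
  proof (intro conjI)
    show "vec N v \<in> carrier_vec (dim_row (map_mat complex_of_int A))" by (simp add: A_def)
    show "vec N v \<noteq> 0\<^sub>v (dim_row (map_mat complex_of_int A))"
    proof
      assume "vec N v = 0\<^sub>v (dim_row (map_mat complex_of_int A))"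
      then have "vec N v $ k = 0" using assms by (simp add: A_def)
      then show False using assms by simp
    qed
    show "map_mat complex_of_int A *\<^sub>v vec N v = z \<cdot>\<^sub>v vec N v"
      by (rule eq_vecI) (auto simp: A_def scalar_prod_def assms(1) atLeast0LessThan)
  qed
  then have "eigenvalue (map_mat complex_of_int A) z" by (auto simp: eigenvalue_def)
  then have "poly (char_poly (map_mat complex_of_int A)) z = 0"
    using eigenvalue_root_char_poly[of "map_mat complex_of_int A" N z] A by simp
  then have "poly (map_poly of_int (char_poly A)) z = 0"
    by (simp add: of_int_hom.char_poly_hom[OF A])
  moreover have "lead_coeff (char_poly A) = 1"
    using degree_monic_char_poly[OF A] by simp
  ultimately show ?thesis
    by (auto simp: algebraic_int_altdef_ipoly)
qed

lemma algebraic_int_power_relation: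
  assumes "algebraic_int (x :: complex)"
  obtains n and c :: "nat \<Rightarrow> int" where "n > 0" "x ^ n = (\<Sum>i<n. of_int (c i) * x ^ i)"
proof -
  obtain p where p: "poly (map_poly of_int p) x = 0" "lead_coeff p = 1"
    using assms by (auto simp: algebraic_int_altdef_ipoly)
  define n where "n = degree p"
  have "n > 0"
  proof (rule ccontr)
    assume "\<not> n > 0"
    then have "p = 1" using p(2) by (auto simp: n_def elim!: degree_eq_zeroE)
    then show False using p(1) by simp
  qed
  have "0 = (\<Sum>i\<le>n. of_int (coeff p i) * x ^ i)"
    using p(1) by (simp add: poly_altdef n_def)
  also have "\<dots> = (\<Sum>i<n. of_int (coeff p i) * x ^ i) + x ^ n"
    using p(2) by (simp add: lessThan_Suc_atMost[symmetric] n_def)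
  finally have "x ^ n = (\<Sum>i<n. of_int (- coeff p i) * x ^ i)"
    by (simp add: sum_negf) (metis add.commute eq_neg_iff_add_eq_0)
  then show ?thesis by (rule that[OF \<open>n > 0\<close>])
qed

text \<open>Multiplication by \<open>x\<close> acts on 1, x, ..., x^(n-1) through the companion
  matrix; the entry 1 at index 0 is the required nonzero one.\<close>

lemma algebraic_int_if_power_relation:
  assumes "n > 0" "x ^ n = (\<Sum>i<n. of_int (c i) * x ^ i)"
  shows "algebraic_int (x :: complex)"
proof (rule algebraic_int_if_int_module[where N = n and v = "\<lambda>i. x ^ i" and k = 0
      and a = "\<lambda>i j. if Suc i < n then (if j = Suc i then 1 else 0) else c j"])
  fix i assume i: "i < n"
  show "x * x ^ i = (\<Sum>j<n. of_int (if Suc i < n then (if j = Suc i then 1 else 0) else c j) * x ^ j)"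
  proof (cases "Suc i < n")
    case True
    then have "(\<Sum>j<n. of_int (if Suc i < n then (if j = Suc i then 1 else 0) else c j) * x ^ j)
      = (\<Sum>j<n. if j = Suc i then x ^ Suc i else 0)" by (intro sum.cong) auto
    then show ?thesis using True by simp
  next
    case False
    then have "n = Suc i" using i by simp
    then show ?thesis using assms(2) by simp
  qed
qed (use assms in auto)

text \<open>The additive group \<open>M\<close> spanned by the x^i y^j with i < m, j < n is stable
  under \<open>x\<close> and \<open>y\<close>, hence under sum and product, which therefore act on
  the spanning family by integer matrices.\<close>

lemma algebraic_int_combination:
  fixes x y :: complex
  assumes "algebraic_int x" "algebraic_int y" and z: "z = x + y \<or> z = x * y"
  shows "algebraic_int z"
proof -
  obtain m c where c: "m > 0" "x ^ m = (\<Sum>i<m. of_int (c i) * x ^ i)"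
    using algebraic_int_power_relation[OF assms(1)] by blast
  obtain n d where d: "n > 0" "y ^ n = (\<Sum>i<n. of_int (d i) * y ^ i)"
    using algebraic_int_power_relation[OF assms(2)] by blast
  define M where "M = {w. \<exists>a :: nat \<Rightarrow> nat \<Rightarrow> int. w = (\<Sum>i<m. \<Sum>j<n. of_int (a i j) * (x ^ i * y ^ j))}"
  have M_add: "u + w \<in> M" if "u \<in> M" "w \<in> M" for u w
  proof -
    obtain a b :: "nat \<Rightarrow> nat \<Rightarrow> int" where "u = (\<Sum>i<m. \<Sum>j<n. of_int (a i j) * (x ^ i * y ^ j))"
      "w = (\<Sum>i<m. \<Sum>j<n. of_int (b i j) * (x ^ i * y ^ j))" using \<open>u \<in> M\<close> \<open>w \<in> M\<close> by (auto simp: M_def)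
    then have "u + w = (\<Sum>i<m. \<Sum>j<n. of_int (a i j + b i j) * (x ^ i * y ^ j))"
      by (simp add: sum.distrib algebra_simps)
    then show ?thesis unfolding M_def by (intro CollectI exI[of _ "\<lambda>i j. a i j + b i j"])
  qed
  have M_scale: "of_int k * u \<in> M" if "u \<in> M" for u k
  proof -
    obtain a :: "nat \<Rightarrow> nat \<Rightarrow> int" where "u = (\<Sum>i<m. \<Sum>j<n. of_int (a i j) * (x ^ i * y ^ j))"
      using \<open>u \<in> M\<close> by (auto simp: M_def)
    then have "of_int k * u = (\<Sum>i<m. \<Sum>j<n. of_int (k * a i j) * (x ^ i * y ^ j))"
      by (simp add: sum_distrib_left algebra_simps)
    then show ?thesis unfolding M_def by (intro CollectI exI[of _ "\<lambda>i j. k * a i j"])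
  qed
  have M_0: "0 \<in> M" unfolding M_def by (intro CollectI exI[of _ "\<lambda>_ _. 0"]) simp
  have M_sum: "(\<Sum>i\<in>I. f i) \<in> M" if "\<And>i. i \<in> I \<Longrightarrow> f i \<in> M" for f and I :: "nat set"
    using that by (induction I rule: infinite_finite_induct) (auto simp: M_0 M_add)
  have mono: "x ^ i * y ^ j \<in> M" if "i < m" "j < n" for i j
  proof -
    have "x ^ i * y ^ j = (\<Sum>i'<m. \<Sum>j'<n. of_int (if i' = i \<and> j' = j then 1 else 0) * (x ^ i' * y ^ j'))"
    proof -
      have "(\<Sum>i'<m. \<Sum>j'<n. of_int (if i' = i \<and> j' = j then 1 else 0) * (x ^ i' * y ^ j'))
        = (\<Sum>i'<m. \<Sum>j'<n. (if j' = j then (if i' = i then x ^ i * y ^ j else 0) else 0))"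
        by (intro sum.cong) auto
      also have "\<dots> = x ^ i * y ^ j" using that by (simp add: sum.delta)
      finally show ?thesis by simp
    qed
    then show ?thesis unfolding M_def
      by (intro CollectI exI[of _ "\<lambda>i' j'. if i' = i \<and> j' = j then 1 else 0"])
  qed
  have x_mono: "x * (x ^ i * y ^ j) \<in> M" if "i < m" "j < n" for i j
  proof (cases "Suc i < m")
    case True
    then show ?thesis using mono[of "Suc i" j] that by (simp add: mult.assoc)
  next
    case False
    then have "Suc i = m" using that by simp
    then have "x * (x ^ i * y ^ j) = x ^ m * y ^ j" by auto
    also have "\<dots> = (\<Sum>k<m. of_int (c k) * (x ^ k * y ^ j))"
      by (simp add: c(2) sum_distrib_right mult.assoc)
    finally show ?thesis using that by (auto intro!: M_sum M_scale mono)
  qed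
  have y_mono: "y * (x ^ i * y ^ j) \<in> M" if "i < m" "j < n" for i j
  proof (cases "Suc j < n")
    case True
    then show ?thesis using mono[of i "Suc j"] that by (simp add: algebra_simps)
  next
    case False
    then have "Suc j = n" using that by simp
    then have "y * (x ^ i * y ^ j) = x ^ i * y ^ n" by auto
    also have "\<dots> = (\<Sum>k<n. of_int (d k) * (x ^ i * y ^ k))"
      by (simp add: d(2) sum_distrib_left algebra_simps)
    finally show ?thesis using that by (auto intro!: M_sum M_scale mono)
  qed
  have y_M: "y * u \<in> M" if "u \<in> M" for u
  proof -
    obtain a :: "nat \<Rightarrow> nat \<Rightarrow> int" where "u = (\<Sum>i<m. \<Sum>j<n. of_int (a i j) * (x ^ i * y ^ j))"
      using \<open>u \<in> M\<close> by (auto simp: M_def)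
    then have "y * u = (\<Sum>i<m. \<Sum>j<n. of_int (a i j) * (y * (x ^ i * y ^ j)))"
      by (simp add: sum_distrib_left algebra_simps)
    then show ?thesis by (auto intro!: M_sum M_scale y_mono)
  qed
  have x_M: "x * u \<in> M" if "u \<in> M" for u
  proof -
    obtain a :: "nat \<Rightarrow> nat \<Rightarrow> int" where "u = (\<Sum>i<m. \<Sum>j<n. of_int (a i j) * (x ^ i * y ^ j))"
      using \<open>u \<in> M\<close> by (auto simp: M_def)
    then have "x * u = (\<Sum>i<m. \<Sum>j<n. of_int (a i j) * (x * (x ^ i * y ^ j)))"
      by (simp add: sum_distrib_left algebra_simps)
    then show ?thesis by (auto intro!: M_sum M_scale x_mono)
  qed
  have z_M: "z * u \<in> M" if "u \<in> M" for u
    using z x_M y_M M_add that by (auto simp: distrib_right mult.assoc)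
  \<comment> \<open>The pair (i, j) is flattened to k = i n + j, to match the single index of
    \<open>algebraic_int_if_int_module\<close>.\<close>
  define v where "v k = x ^ (k div n) * y ^ (k mod n)" for k
  have "\<exists>b :: nat \<Rightarrow> int. z * v k = (\<Sum>l<m*n. of_int (b l) * v l)" if "k < m * n" for k
  proof -
    have "v k \<in> M" unfolding v_def
      using that d(1) by (intro mono) (auto simp: less_mult_imp_div_less)
    then obtain a :: "nat \<Rightarrow> nat \<Rightarrow> int"
      where "z * v k = (\<Sum>i<m. \<Sum>j<n. of_int (a i j) * (x ^ i * y ^ j))"
      using z_M by (auto simp: M_def)
    also have "\<dots> = (\<Sum>i<m. \<Sum>l=i*n..<i*n+n. of_int (a (l div n) (l mod n)) * v l)"
    proof (rule sum.cong)
      fix i assume "i \<in> {..<m}"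
      have "(\<Sum>l=i*n..<i*n+n. of_int (a (l div n) (l mod n)) * v l)
        = (\<Sum>j<n. of_int (a ((i*n+j) div n) ((i*n+j) mod n)) * v (i*n+j))"
        using sum.shift_bounds_nat_ivl[of "\<lambda>l. of_int (a (l div n) (l mod n)) * v l" 0 "i*n" n]
        by (simp add: atLeast0LessThan add.commute)
      then show "(\<Sum>j<n. of_int (a i j) * (x ^ i * y ^ j))
        = (\<Sum>l=i*n..<i*n+n. of_int (a (l div n) (l mod n)) * v l)"
        using d(1) by (auto simp: v_def intro!: sum.cong)
    qed auto
    also have "\<dots> = (\<Sum>l<m*n. of_int (a (l div n) (l mod n)) * v l)"
      by (rule sum.nat_group)
    finally show ?thesis by (intro exI[of _ "\<lambda>l. a (l div n) (l mod n)"])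
  qed
  then obtain b :: "nat \<Rightarrow> nat \<Rightarrow> int"
    where "\<And>k. k < m * n \<Longrightarrow> z * v k = (\<Sum>l<m*n. of_int (b k l) * v l)" by metis
  then show ?thesis
    using algebraic_int_if_int_module[of "m * n" z v b 0] c(1) d(1) by (simp add: v_def)
qed

lemma algebraic_int_add: "algebraic_int x \<Longrightarrow> algebraic_int y \<Longrightarrow> algebraic_int (x + y :: complex)"
  and algebraic_int_mult: "algebraic_int x \<Longrightarrow> algebraic_int y \<Longrightarrow> algebraic_int (x * y :: complex)"
  by (erule (1) algebraic_int_combination, simp)+

lemma algebraic_int_diff: "algebraic_int x \<Longrightarrow> algebraic_int y \<Longrightarrow> algebraic_int (x - y :: complex)"
  using algebraic_int_add[of x "- y"] by simp

lemma algebraic_int_of_power: 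
  assumes "algebraic_int (x ^ n :: complex)" "n > 0" shows "algebraic_int x"
proof -
  obtain p where p: "poly (map_poly of_int p) (x ^ n) = 0" "lead_coeff p = 1"
    using assms(1) by (auto simp: algebraic_int_altdef_ipoly)
  show ?thesis
    by (rule algebraic_int_root[OF assms(1), of "monom 1 n"])
       (use assms(2) in \<open>auto simp: poly_monom degree_monom_eq\<close>)
qed

lemma subfield_zero: "subfield K \<Longrightarrow> 0 \<in> K"
  unfolding subfield_def by (metis add.right_inverse)

locale subfield_of_complex =
  fixes K :: "complex set"
  assumes subfield: "subfield K"
begin

lemma K_1 [simp]: "1 \<in> K"
  and K_add [intro]: "x \<in> K \<Longrightarrow> y \<in> K \<Longrightarrow> x + y \<in> K"
  and K_mult [intro]: "x \<in> K \<Longrightarrow> y \<in> K \<Longrightarrow> x * y \<in> K"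
  and K_uminus [intro]: "x \<in> K \<Longrightarrow> - x \<in> K"
  and K_inverse [intro]: "x \<in> K \<Longrightarrow> inverse x \<in> K"
  using subfield by (auto simp: subfield_def)

lemma K_0 [simp]: "0 \<in> K"
  by (rule subfield_zero[OF subfield])

lemma K_diff [intro]: "x \<in> K \<Longrightarrow> y \<in> K \<Longrightarrow> x - y \<in> K"
  using K_add[of x "- y"] by auto

lemma K_divide [intro]: "x \<in> K \<Longrightarrow> y \<in> K \<Longrightarrow> x / y \<in> K"
  unfolding divide_inverse by auto

lemma K_power [intro]: "x \<in> K \<Longrightarrow> x ^ n \<in> K"
  by (induction n) auto

lemma K_sum [intro]: "(\<And>i. i \<in> I \<Longrightarrow> f i \<in> K) \<Longrightarrow> sum f I \<in> K"
  by (induction I rule: infinite_finite_induct) auto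

lemma K_prod [intro]: "(\<And>i. i \<in> I \<Longrightarrow> f i \<in> K) \<Longrightarrow> prod f I \<in> K"
  by (induction I rule: infinite_finite_induct) auto

lemma K_of_nat [simp]: "of_nat n \<in> K"
  by (induction n) auto

lemma K_of_int [simp]: "of_int n \<in> K"
  by (cases n rule: int_diff_cases) auto

lemma K_numeral [simp]: "numeral n \<in> K"
  using K_of_nat[of "numeral n"] by simp

lemma K_of_rat [simp]: "of_rat q \<in> K"
  by (cases q) (auto simp: of_rat_rat)

lemma K_Rats: "x \<in> \<rat> \<Longrightarrow> x \<in> K"
  by (auto elim!: Rats_cases)

lemma OK_iff: "x \<in> OK K \<longleftrightarrow> x \<in> K \<and> algebraic_int x"
  by (auto simp: OK_def)

lemma OK_imp_K: "x \<in> OK K \<Longrightarrow> x \<in> K"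
  by (auto simp: OK_def)

lemma OK_0 [simp]: "0 \<in> OK K"
  and OK_1 [simp]: "1 \<in> OK K"
  and OK_of_nat [simp]: "of_nat n \<in> OK K"
  and OK_of_int [simp]: "of_int z \<in> OK K"
  and OK_add [intro]: "x \<in> OK K \<Longrightarrow> y \<in> OK K \<Longrightarrow> x + y \<in> OK K"
  and OK_mult [intro]: "x \<in> OK K \<Longrightarrow> y \<in> OK K \<Longrightarrow> x * y \<in> OK K"
  and OK_uminus [intro]: "x \<in> OK K \<Longrightarrow> - x \<in> OK K"
  and OK_diff [intro]: "x \<in> OK K \<Longrightarrow> y \<in> OK K \<Longrightarrow> x - y \<in> OK K"
  by (auto simp: OK_iff int_imp_algebraic_int intro: algebraic_int_add algebraic_int_mult algebraic_int_diff)

lemma OK_power [intro]: "x \<in> OK K \<Longrightarrow> x ^ n \<in> OK K"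
  by (induction n) auto

lemma OK_sum [intro]: "(\<And>i. i \<in> I \<Longrightarrow> f i \<in> OK K) \<Longrightarrow> sum f I \<in> OK K"
  by (induction I rule: infinite_finite_induct) auto

lemma OK_prod [intro]: "(\<And>i. i \<in> I \<Longrightarrow> f i \<in> OK K) \<Longrightarrow> prod f I \<in> OK K"
  by (induction I rule: infinite_finite_induct) auto

lemma OK_Rats: "x \<in> OK K \<Longrightarrow> x \<in> \<rat> \<Longrightarrow> x \<in> \<int>"
  by (auto simp: OK_iff intro: rational_algebraic_int_is_int)

end

section \<open>Additive subgroups and linear dependence modulo a prime\<close>

definition zmodule :: "complex set \<Rightarrow> bool" where
  "zmodule M \<longleftrightarrow> 0 \<in> M \<and> (\<forall>x\<in>M. \<forall>y\<in>M. x + y \<in> M) \<and> (\<forall>x\<in>M. - x \<in> M)"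

lemma zmodule_0: "zmodule M \<Longrightarrow> 0 \<in> M"
  and zmodule_add: "zmodule M \<Longrightarrow> x \<in> M \<Longrightarrow> y \<in> M \<Longrightarrow> x + y \<in> M"
  and zmodule_uminus: "zmodule M \<Longrightarrow> x \<in> M \<Longrightarrow> - x \<in> M"
  by (auto simp: zmodule_def)

lemma zmodule_diff: "zmodule M \<Longrightarrow> x \<in> M \<Longrightarrow> y \<in> M \<Longrightarrow> x - y \<in> M"
  using zmodule_add[of M x "- y"] zmodule_uminus[of M y] by simp

lemma zmodule_of_nat: "zmodule M \<Longrightarrow> x \<in> M \<Longrightarrow> of_nat k * x \<in> M"
  by (induction k) (auto simp: zmodule_0 distrib_right zmodule_add)

lemma zmodule_of_int: "zmodule M \<Longrightarrow> x \<in> M \<Longrightarrow> of_int k * x \<in> M"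
  by (cases k rule: int_diff_cases) (auto simp: left_diff_distrib intro: zmodule_diff zmodule_of_nat)

lemma zmodule_sum: "zmodule M \<Longrightarrow> (\<And>i. i \<in> I \<Longrightarrow> f i \<in> M) \<Longrightarrow> sum f I \<in> M"
  by (induction I rule: infinite_finite_induct) (auto simp: zmodule_0 zmodule_add)

locale finite_dim_subfield = subfield_of_complex +
  fixes n :: nat
  assumes dim: "qdim_eq K n"
begin

text \<open>Stated for families, so a repeated value is treated apart: it gives the relation with
  coefficients 1 and -1.\<close>

lemma rational_dependence:
  assumes "\<And>i. i \<le> n \<Longrightarrow> f i \<in> K"
  shows "\<exists>c :: nat \<Rightarrow> rat. (\<exists>i\<le>n. c i \<noteq> 0) \<and> (\<Sum>i\<le>n. of_rat (c i) * f i) = 0"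
proof -
  interpret Q: vector_space "\<lambda>(q::rat) (x::complex). of_rat q * x"
    by standard (auto simp: algebra_simps of_rat_add of_rat_mult)
  obtain b where b: "\<forall>x\<in>K. \<exists>c :: nat \<Rightarrow> rat. x = (\<Sum>i<n. of_rat (c i) * b i)"
    using dim by (auto simp: qdim_eq_def)
  show ?thesis
  proof (cases "inj_on f {..n}")
    case True
    have "f ` {..n} \<subseteq> Q.span (b ` {..<n})"
    proof (rule image_subsetI)
      fix i assume "i \<in> {..n}"
      then obtain c :: "nat \<Rightarrow> rat" where "f i = (\<Sum>i<n. of_rat (c i) * b i)"
        using b assms by auto
      then show "f i \<in> Q.span (b ` {..<n})"
        by (simp, intro Q.span_sum Q.span_scale Q.span_base) auto
    qed
    moreover have "card (b ` {..<n}) \<le> n" using card_image_le[of "{..<n}" b] by simp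
    moreover have "card (f ` {..n}) = Suc n" using True by (simp add: card_image)
    ultimately have "Q.dependent (f ` {..n})"
      using Q.independent_span_bound[of "b ` {..<n}" "f ` {..n}"] by auto
    then obtain u where u: "\<exists>v\<in>f ` {..n}. u v \<noteq> 0" "(\<Sum>v\<in>f ` {..n}. of_rat (u v) * v) = 0"
      by (auto simp: Q.dependent_finite)
    then show ?thesis using True
      by (intro exI[of _ "\<lambda>i. u (f i)"]) (auto simp: sum.reindex)
  next
    case False
    then obtain i j where ij: "i \<le> n" "j \<le> n" "i \<noteq> j" "f i = f j" by (auto simp: inj_on_def)
    define c :: "nat \<Rightarrow> rat" where "c k = (if k = i then 1 else if k = j then -1 else 0)" for k
    have "(\<Sum>k\<le>n. of_rat (c k) * f k) = (\<Sum>k\<in>{i,j}. of_rat (c k) * f k)"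
      using ij by (intro sum.mono_neutral_right) (auto simp: c_def)
    also have "\<dots> = 0" using ij by (simp add: c_def)
    finally show ?thesis using ij by (intro exI[of _ c]) (auto simp: c_def)
  qed
qed

lemma common_denominator:
  "finite I \<Longrightarrow> \<exists>D::int. D \<noteq> 0 \<and> (\<forall>i\<in>I. \<exists>z::int. of_int D * (c i :: rat) = of_int z)"
proof (induction I rule: finite_induct)
  case empty
  then show ?case by (intro exI[of _ 1]) auto
next
  case (insert i I)
  then obtain D where D: "D \<noteq> 0" "\<forall>i\<in>I. \<exists>z::int. of_int D * c i = of_int z" by blast
  obtain a b where ab: "c i = of_int a / of_int b" "b \<noteq> 0"
    by (metis Fract_of_int_quotient Rat_cases less_irrefl)
  show ?case
  proof (rule exI[of _ "D * b"], intro conjI ballI)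
    fix j assume "j \<in> insert i I"
    then consider "j = i" | "j \<in> I" by auto
    then show "\<exists>z::int. of_int (D * b) * c j = of_int z"
    proof cases
      case 1
      then have "of_int (D * b) * c j = of_int (D * a)" using ab by simp
      then show ?thesis by blast
    next
      case 2
      then obtain z :: int where "of_int D * c j = of_int z" using D by blast
      then have "of_int (D * b) * c j = of_int (z * b)" by (simp add: mult.assoc mult.left_commute)
      then show ?thesis by blast
    qed
  qed (use D ab in auto)
qed

text \<open>Clear denominators and choose an integral relation with the least sum of absolute values
  of the coefficients. If \<open>p\<close> divided all of them, dividing by \<open>p\<close> would
  give a smaller relation.\<close>

lemma dependence_mod:
  assumes "\<And>i. i \<le> n \<Longrightarrow> f i \<in> K" and p: "p > (1::int)"
  shows "\<exists>c :: nat \<Rightarrow> int. (\<exists>i\<le>n. \<not> p dvd c i) \<and> (\<Sum>i\<le>n. of_int (c i) * f i) = 0"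
proof -
  obtain c :: "nat \<Rightarrow> rat" where c: "\<exists>i\<le>n. c i \<noteq> 0" "(\<Sum>i\<le>n. of_rat (c i) * f i) = 0"
    using rational_dependence[of f] assms(1) by metis
  obtain D :: int where D: "D \<noteq> 0" "\<forall>i\<in>{..n}. \<exists>z::int. of_int D * c i = of_int z"
    using common_denominator[of "{..n}" c] by auto
  then have "\<forall>i. \<exists>z::int. i \<le> n \<longrightarrow> of_int D * c i = of_int z" by auto
  then obtain z :: "nat \<Rightarrow> int" where z: "\<And>i. i \<le> n \<Longrightarrow> of_int D * c i = of_int (z i)"
    using choice[of "\<lambda>i z. i \<le> n \<longrightarrow> of_int D * c i = of_int z"] by blast
  define P where "P z \<longleftrightarrow> (\<exists>i\<le>n. z i \<noteq> 0) \<and> (\<Sum>i\<le>n. of_int (z i) * f i) = 0" for z :: "nat \<Rightarrow> int"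
  have "(\<Sum>i\<le>n. of_int (z i) * f i) = (\<Sum>i\<le>n. of_rat (of_int D * c i) * f i)"
    by (intro sum.cong) (auto simp: z)
  also have "\<dots> = of_int D * (\<Sum>i\<le>n. of_rat (c i) * f i)"
    by (simp add: of_rat_mult sum_distrib_left mult.assoc)
  finally have "(\<Sum>i\<le>n. of_int (z i) * f i) = 0" using c by simp
  moreover obtain i where "i \<le> n" "c i \<noteq> 0" using c by blast
  then have "z i \<noteq> 0" using z[of i] D by auto
  ultimately have "P z" using \<open>i \<le> n\<close> unfolding P_def by auto
  then obtain w where w: "P w" "\<And>w'. P w' \<Longrightarrow> (\<Sum>i\<le>n. nat \<bar>w i\<bar>) \<le> (\<Sum>i\<le>n. nat \<bar>w' i\<bar>)"
    using ex_has_least_nat[of P z "\<lambda>w. \<Sum>i\<le>n. nat \<bar>w i\<bar>"] by blast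
  have "\<exists>i\<le>n. \<not> p dvd w i"
  proof (rule ccontr)
    assume *: "\<not> ?thesis"
    define v where "v i = w i div p" for i
    have v: "\<And>i. i \<le> n \<Longrightarrow> w i = p * v i" using * by (auto simp: v_def)
    have "of_int p * (\<Sum>i\<le>n. of_int (v i) * f i) = (\<Sum>i\<le>n. of_int (w i) * f i)"
      by (auto simp: sum_distrib_left v mult.assoc intro!: sum.cong)
    then have "P v" using w(1) p v unfolding P_def by auto
    have "(\<Sum>i\<le>n. nat \<bar>v i\<bar>) < (\<Sum>i\<le>n. nat \<bar>w i\<bar>)"
    proof (rule sum_strict_mono_ex1)
      have *: "\<bar>v i\<bar> \<le> \<bar>p * v i\<bar>" for i using p by (cases "v i = 0") (simp_all add: abs_mult)
      show "\<forall>i\<in>{..n}. nat \<bar>v i\<bar> \<le> nat \<bar>w i\<bar>" using * v by (auto intro!: nat_mono)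
      obtain i where i: "i \<le> n" "v i \<noteq> 0" using \<open>P v\<close> by (auto simp: P_def)
      have "\<bar>v i\<bar> < \<bar>p * v i\<bar>" using p i by (simp add: abs_mult)
      then show "\<exists>i\<in>{..n}. nat \<bar>v i\<bar> < nat \<bar>w i\<bar>" using i v by auto
    qed auto
    then show False using w(2)[OF \<open>P v\<close>] by simp
  qed
  then show ?thesis using w(1) by (auto simp: P_def)
qed

text \<open>Modulo \<open>N\<close> the group \<open>M\<close> becomes a vector space over the field
  with \<open>p\<close> elements, of dimension at most \<open>n\<close> by
  \<open>dependence_mod\<close>; the \<open>x i\<close> are a basis. Applied to the radical modulo
  \<open>p\<close> and to residue rings of primes.\<close>

lemma basis_mod:
  assumes M: "zmodule M" "M \<subseteq> K" and N: "zmodule N" 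
    and p: "prime (p::nat)" and pM: "\<And>x. x \<in> M \<Longrightarrow> of_nat p * x \<in> N"
  obtains m and x :: "nat \<Rightarrow> complex" where "m \<le> n" "\<And>i. i < m \<Longrightarrow> x i \<in> M"
    "\<And>c :: nat \<Rightarrow> int. (\<Sum>i<m. of_int (c i) * x i) \<in> N \<Longrightarrow> \<forall>i<m. int p dvd c i"
    "\<And>y. y \<in> M \<Longrightarrow> \<exists>c :: nat \<Rightarrow> int. y - (\<Sum>i<m. of_int (c i) * x i) \<in> N"
proof -
  define ind where "ind m x \<longleftrightarrow> (\<forall>i<m. x i \<in> M) \<and> 
     (\<forall>c :: nat \<Rightarrow> int. (\<Sum>i<m. of_int (c i) * x i) \<in> N \<longrightarrow> (\<forall>i<m. int p dvd c i))" for m x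
  have bound: "m \<le> n" if "ind m x" for m x
  proof (rule ccontr)
    assume "\<not> m \<le> n"
    then have "\<And>i. i \<le> n \<Longrightarrow> x i \<in> K" using that M by (auto simp: ind_def)
    then obtain c :: "nat \<Rightarrow> int" where c: "\<exists>i\<le>n. \<not> int p dvd c i" "(\<Sum>i\<le>n. of_int (c i) * x i) = 0"
      using dependence_mod[of x "int p"] p prime_gt_1_nat by auto
    define c' where "c' i = (if i \<le> n then c i else 0)" for i
    have "(\<Sum>i<m. of_int (c' i) * x i) = (\<Sum>i\<le>n. of_int (c i) * x i)"
      using \<open>\<not> m \<le> n\<close> by (intro sum.mono_neutral_cong_right) (auto simp: c'_def)
    then have "\<forall>i<m. int p dvd c' i" using that c(2) zmodule_0[OF N] by (auto simp: ind_def)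
    moreover obtain i where "i \<le> n" "\<not> int p dvd c i" using c(1) by blast
    ultimately show False using \<open>\<not> m \<le> n\<close> by (auto simp: c'_def dest!: spec[of _ i])
  qed
  have "ind 0 (\<lambda>_. 0)" by (simp add: ind_def)
  then have "\<exists>x. ind 0 x" by blast
  then obtain m where m: "\<exists>x. ind m x" "\<And>m'. \<exists>x. ind m' x \<Longrightarrow> m' \<le> m"
    using GreatestI_nat[of "\<lambda>m. \<exists>x. ind m x" 0 n] Greatest_le_nat[of "\<lambda>m. \<exists>x. ind m x" _ n] bound
    by blast
  then obtain x where x: "ind m x" by blast
  have "\<exists>c :: nat \<Rightarrow> int. y - (\<Sum>i<m. of_int (c i) * x i) \<in> N" if y: "y \<in> M" for y
  proof -
    define x' where "x' i = (if i < m then x i else y)" for i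
    have "\<not> ind (Suc m) x'" using m(2)[of "Suc m"] by auto
    moreover have "\<forall>i<Suc m. x' i \<in> M" using x y by (auto simp: x'_def ind_def)
    ultimately obtain c :: "nat \<Rightarrow> int" and j where c: "(\<Sum>i<Suc m. of_int (c i) * x' i) \<in> N" "j < Suc m" "\<not> int p dvd c j"
      by (auto simp: ind_def)
    have eq: "(\<Sum>i<Suc m. of_int (c i) * x' i) = (\<Sum>i<m. of_int (c i) * x i) + of_int (c m) * y"
      by (simp add: x'_def)
    have "\<not> int p dvd c m"
    proof
      assume "int p dvd c m"
      then obtain k where "c m = int p * k" by blast
      then have "of_int (c m) * y = of_int k * (of_nat p * y)" by simp
      then have "of_int (c m) * y \<in> N" using zmodule_of_int[OF N pM[OF y], of k] by metis
      then have "(\<Sum>i<m. of_int (c i) * x i) \<in> N" using zmodule_diff[OF N c(1)[unfolded eq] \<open>of_int (c m) * y \<in> N\<close>] by simp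
      then have "\<forall>i<m. int p dvd c i" using x by (auto simp: ind_def)
      then show False using c \<open>int p dvd c m\<close> by (auto simp: less_Suc_eq)
    qed
    \<comment> \<open>The coefficient of \<open>y\<close> is invertible modulo \<open>p\<close>, so
      Bezout solves the relation for \<open>y\<close> modulo \<open>N\<close>.\<close>
    then have "coprime (int p) (c m)" using p by (simp add: prime_imp_coprime)
    then obtain u v where uv: "u * int p + v * c m = 1"
      by (metis bezout_int coprime_imp_gcd_eq_1)
    have "y - (\<Sum>i<m. of_int (- v * c i) * x i) = of_int v * (\<Sum>i<Suc m. of_int (c i) * x' i) + of_int u * (of_nat p * y)"
    proof -
      have "y = of_int (u * int p + v * c m) * y" using uv by simp
      then have "y = of_int u * (of_nat p * y) + of_int v * (of_int (c m) * y)"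
        by (simp add: algebra_simps)
      then show ?thesis unfolding eq by (simp add: sum_negf sum_distrib_left algebra_simps)
    qed
    also have "\<dots> \<in> N" by (intro zmodule_add[OF N] zmodule_of_int[OF N] c pM y)
    finally show ?thesis by (rule exI[where x = "\<lambda>i. - v * c i"])
  qed
  then show ?thesis using that[of m x] x bound by (auto simp: ind_def)
qed

end

section \<open>Automorphisms of subfields\<close>

lemma aut_comp:
  assumes "\<sigma> \<in> aut K" "\<tau> \<in> aut K"
  shows "\<sigma> \<circ> \<tau> \<in> aut K"
proof -
  have t: "\<tau> x \<in> K" if "x \<in> K" for x using assms that by (auto simp: aut_def bij_betw_def)
  show ?thesis
    using assms t bij_betw_trans[of \<tau> K K \<sigma> K] by (simp add: aut_def)
qed

lemma aut_inv:
  assumes "\<sigma> \<in> aut K" "subfield K"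
  obtains \<tau> where "\<tau> \<in> aut K" "\<sigma> \<circ> \<tau> = id" "\<tau> \<circ> \<sigma> = id"
proof -
  interpret subfield_of_complex K by standard fact
  \<comment> \<open>Elements of \<open>aut K\<close> are the identity outside \<open>K\<close>; the
    inverse has to be extended in the same way, and then it is inverse on all complex
    numbers.\<close>
  define \<tau> where "\<tau> x = (if x \<in> K then the_inv_into K \<sigma> x else x)" for x
  have bij: "bij_betw \<sigma> K K" and out: "\<And>x. x \<notin> K \<Longrightarrow> \<sigma> x = x" and 1: "\<sigma> 1 = 1"
    and add: "\<And>x y. x \<in> K \<Longrightarrow> y \<in> K \<Longrightarrow> \<sigma> (x + y) = \<sigma> x + \<sigma> y"
    and mult: "\<And>x y. x \<in> K \<Longrightarrow> y \<in> K \<Longrightarrow> \<sigma> (x * y) = \<sigma> x * \<sigma> y"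
    using assms(1) by (auto simp: aut_def)
  have \<tau>K: "\<tau> x \<in> K" if "x \<in> K" for x
    using bij that by (auto simp: \<tau>_def bij_betw_def intro: the_inv_into_into)
  have \<sigma>K: "\<sigma> x \<in> K" if "x \<in> K" for x using bij that by (auto simp: bij_betw_def)
  have \<sigma>\<tau>: "\<sigma> (\<tau> x) = x" for x
    using bij out by (auto simp: \<tau>_def bij_betw_def f_the_inv_into_f)
  have \<tau>\<sigma>: "\<tau> (\<sigma> x) = x" for x
    using bij out[of x] \<sigma>K[of x] the_inv_into_f_f[of \<sigma> K x]
    by (cases "x \<in> K") (simp_all add: \<tau>_def bij_betw_def)
  have inj: "\<sigma> x = \<sigma> y \<Longrightarrow> x = y" for x y by (metis \<tau>\<sigma>)
  have "\<tau> \<in> aut K"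
    unfolding aut_def
  proof (intro CollectI conjI ballI allI impI)
    show "bij_betw \<tau> K K"
      by (rule bij_betwI[of _ _ _ \<sigma>]) (auto simp: \<sigma>\<tau> \<tau>\<sigma> \<sigma>K \<tau>K)
    show "\<tau> 1 = 1" by (rule inj) (simp add: \<sigma>\<tau> 1)
    show "\<tau> (x + y) = \<tau> x + \<tau> y" if "x \<in> K" "y \<in> K" for x y
      by (rule inj) (simp add: \<sigma>\<tau> add \<tau>K that)
    show "\<tau> (x * y) = \<tau> x * \<tau> y" if "x \<in> K" "y \<in> K" for x y
      by (rule inj) (simp add: \<sigma>\<tau> mult \<tau>K that)
    show "\<tau> x = x" if "x \<notin> K" for x using that by (simp add: \<tau>_def)
  qed
  then show ?thesis using that \<sigma>\<tau> \<tau>\<sigma> by (auto simp: fun_eq_iff)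
qed

context subfield_of_complex
begin

lemma id_aut: "id \<in> aut K"
  by (auto simp: aut_def)

context
  fixes \<sigma> assumes \<sigma>: "\<sigma> \<in> aut K"
begin

lemma aut_1 [simp]: "\<sigma> 1 = 1"
  and aut_add: "x \<in> K \<Longrightarrow> y \<in> K \<Longrightarrow> \<sigma> (x + y) = \<sigma> x + \<sigma> y"
  and aut_mult: "x \<in> K \<Longrightarrow> y \<in> K \<Longrightarrow> \<sigma> (x * y) = \<sigma> x * \<sigma> y"
  and aut_K: "x \<in> K \<Longrightarrow> \<sigma> x \<in> K"
  and aut_outside: "x \<notin> K \<Longrightarrow> \<sigma> x = x"
  and aut_bij: "bij_betw \<sigma> K K"
  using \<sigma> by (auto simp: aut_def bij_betw_def)

lemma aut_inj: "\<sigma> x = \<sigma> y \<longleftrightarrow> x = y"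
  using aut_bij aut_outside aut_K by (metis bij_betw_def inj_on_def)

lemma aut_0 [simp]: "\<sigma> 0 = 0"
  using aut_add[of 0 0] by simp

lemma aut_eq_0: "\<sigma> x = 0 \<longleftrightarrow> x = 0"
  using aut_inj[of x 0] by simp

lemma aut_uminus: "x \<in> K \<Longrightarrow> \<sigma> (- x) = - \<sigma> x"
  using aut_add[of x "- x"] by (simp add: K_uminus eq_neg_iff_add_eq_0 add.commute)

lemma aut_diff: "x \<in> K \<Longrightarrow> y \<in> K \<Longrightarrow> \<sigma> (x - y) = \<sigma> x - \<sigma> y"
  using aut_add[of x "- y"] by (simp add: K_uminus aut_uminus)

lemma aut_inverse: "x \<in> K \<Longrightarrow> \<sigma> (inverse x) = inverse (\<sigma> x)"
proof (cases "x = 0")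
  case False
  assume "x \<in> K"
  then have "\<sigma> x * \<sigma> (inverse x) = 1" using aut_mult[of x "inverse x"] False by (simp add: K_inverse)
  then show ?thesis by (metis inverse_unique)
qed simp

lemma aut_divide: "x \<in> K \<Longrightarrow> y \<in> K \<Longrightarrow> \<sigma> (x / y) = \<sigma> x / \<sigma> y"
  by (simp add: divide_inverse aut_mult aut_inverse K_inverse)

lemma aut_power: "x \<in> K \<Longrightarrow> \<sigma> (x ^ k) = \<sigma> x ^ k"
  by (induction k) (auto simp: aut_mult K_power)

lemma aut_sum: "(\<And>i. i \<in> I \<Longrightarrow> f i \<in> K) \<Longrightarrow> \<sigma> (sum f I) = (\<Sum>i\<in>I. \<sigma> (f i))"
  by (induction I rule: infinite_finite_induct) (auto simp: aut_add K_sum)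

lemma aut_prod: "(\<And>i. i \<in> I \<Longrightarrow> f i \<in> K) \<Longrightarrow> \<sigma> (prod f I) = (\<Prod>i\<in>I. \<sigma> (f i))"
  by (induction I rule: infinite_finite_induct) (auto simp: aut_mult K_prod)

lemma aut_of_nat: "\<sigma> (of_nat k) = of_nat k"
  by (induction k) (auto simp: aut_add)

lemma aut_of_int: "\<sigma> (of_int k) = of_int k"
  by (cases k rule: int_diff_cases) (auto simp: aut_diff aut_of_nat)

lemma aut_Rats: "x \<in> \<rat> \<Longrightarrow> \<sigma> x = x"
proof -
  assume "x \<in> \<rat>"
  then obtain a b where "x = of_int a / of_int b" by (metis Rats_cases')
  then show ?thesis by (simp add: aut_divide aut_of_int)
qed

lemma aut_OK: "x \<in> OK K \<Longrightarrow> \<sigma> x \<in> OK K"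
proof -
  assume x: "x \<in> OK K"
  then obtain m c where m: "m > 0" "x ^ m = (\<Sum>i<m. of_int (c i) * x ^ i)"
    using algebraic_int_power_relation by (metis OK_iff)
  have "\<sigma> x ^ m = \<sigma> (\<Sum>i<m. of_int (c i) * x ^ i)"
    using m x by (metis OK_iff aut_power)
  also have "\<dots> = (\<Sum>i<m. of_int (c i) * \<sigma> x ^ i)"
    using x by (subst aut_sum) (auto simp: aut_mult aut_power aut_of_int OK_imp_K K_mult K_power)
  finally have "algebraic_int (\<sigma> x)"
    using m(1) algebraic_int_if_power_relation by blast
  then show ?thesis using x aut_K by (auto simp: OK_iff)
qed

lemma bij_comp_aut: "bij_betw (\<lambda>\<tau>. \<sigma> \<circ> \<tau>) (aut K) (aut K)"
proof -
  obtain \<tau> where t: "\<tau> \<in> aut K" "\<sigma> \<circ> \<tau> = id" "\<tau> \<circ> \<sigma> = id" using aut_inv[OF \<sigma> subfield] .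
  show ?thesis
  proof (rule bij_betwI[of _ _ _ "\<lambda>f. \<tau> \<circ> f"])
    show "\<tau> \<circ> (\<sigma> \<circ> f) = f" for f using t(3) by (metis comp_assoc comp_id id_comp)
    show "\<sigma> \<circ> (\<tau> \<circ> f) = f" for f using t(2) by (metis comp_assoc comp_id id_comp)
  qed (auto intro: aut_comp \<sigma> t)
qed

end

end

section \<open>Symmetric functions of the conjugates and almost integral elements\<close>

locale galois_field = finite_dim_subfield +
  assumes finite_aut: "finite (aut K)"
    and fixed_Rats: "x \<in> K \<Longrightarrow> (\<And>\<sigma>. \<sigma> \<in> aut K \<Longrightarrow> \<sigma> x = x) \<Longrightarrow> x \<in> \<rat>"
begin

text \<open>The coefficient of T^(n-k) in the product of the T - \<sigma> x over the n
  automorphisms, with the sign built in.\<close>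

definition esym :: "complex \<Rightarrow> nat \<Rightarrow> complex" where
  "esym x k = (\<Sum>A | A \<subseteq> aut K \<and> card A = k. \<Prod>\<sigma>\<in>A. - \<sigma> x)"

text \<open>Expand the product of the x - \<sigma> x, which vanishes because of the factor for
  \<open>id\<close>, and sort the subsets by size.\<close>

lemma esym_relation:
  "(\<Sum>k\<le>card (aut K). esym x k * x ^ (card (aut K) - k)) = 0"
proof -
  have "0 = (\<Prod>\<sigma>\<in>aut K. - \<sigma> x + x)"
    using id_aut finite_aut by (intro prod_zero[symmetric]) (auto intro!: bexI[of _ id])
  also have "\<dots> = (\<Sum>X\<in>Pow (aut K). (\<Prod>\<sigma>\<in>X. - \<sigma> x) * (\<Prod>\<sigma>\<in>aut K - X. x))"
    by (rule prod_add[OF finite_aut])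
  also have "\<dots> = (\<Sum>X\<in>Pow (aut K). (\<Prod>\<sigma>\<in>X. - \<sigma> x) * x ^ (card (aut K) - card X))"
    using finite_aut by (intro sum.cong) (auto simp: card_Diff_subset finite_subset)
  also have "\<dots> = (\<Sum>k\<le>card (aut K). \<Sum>X | X \<in> Pow (aut K) \<and> card X = k.
      (\<Prod>\<sigma>\<in>X. - \<sigma> x) * x ^ (card (aut K) - card X))"
    using finite_aut by (intro sum.group[symmetric]) (auto intro: card_mono)
  also have "\<dots> = (\<Sum>k\<le>card (aut K). esym x k * x ^ (card (aut K) - k))"
    unfolding esym_def by (intro sum.cong) (auto simp: sum_distrib_right)
  finally show ?thesis by simp
qed

lemma esym_0: "esym x 0 = 1"
proof -
  have "{A. A \<subseteq> aut K \<and> card A = 0} = {{}}"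
    using finite_aut by (auto simp: card_eq_0_iff dest: finite_subset)
  then show ?thesis by (simp add: esym_def)
qed

lemma esym_power_relation:
  "x ^ card (aut K) = (\<Sum>k=1..card (aut K). - esym x k * x ^ (card (aut K) - k))"
proof -
  have "{..card (aut K)} = insert 0 {1..card (aut K)}" by auto
  then show ?thesis using esym_relation[of x]
    by (simp add: esym_0 sum_negf eq_neg_iff_add_eq_0)
qed

lemma card_aut_pos: "card (aut K) > 0"
  using finite_aut id_aut by (auto simp: card_gt_0_iff)

text \<open>Composition with \<sigma> permutes the subsets of \<open>aut K\<close> of a given size,
  so the sum is fixed by every \<sigma>.\<close>

lemma esym_Rats:
  assumes x: "x \<in> K" shows "esym x k \<in> \<rat>"
proof (rule fixed_Rats)
  show "esym x k \<in> K" unfolding esym_def using x aut_K by (auto intro!: K_sum K_prod K_uminus)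
  fix \<sigma> assume \<sigma>: "\<sigma> \<in> aut K"
  let ?f = "\<lambda>\<tau>. \<sigma> \<circ> \<tau>"
  let ?S = "{A. A \<subseteq> aut K \<and> card A = k}"
  have bij: "bij_betw ?f (aut K) (aut K)" by (rule bij_comp_aut[OF \<sigma>])
  have inj: "inj_on ?f A" if "A \<subseteq> aut K" for A
    using bij that by (auto simp: bij_betw_def intro: inj_on_subset)
  have "bij_betw (\<lambda>A. ?f ` A) ?S ?S"
  proof (rule bij_betw_imageI)
    show "inj_on (\<lambda>A. ?f ` A) ?S"
    proof (rule inj_onI)
      fix A B assume "A \<in> ?S" "B \<in> ?S" "?f ` A = ?f ` B"
      then show "A = B" using inj_on_image_eq_iff[OF inj[OF order_refl], of A B] by simp
    qed
    show "(\<lambda>A. ?f ` A) ` ?S = ?S"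
    proof (intro equalityI subsetI)
      fix B assume "B \<in> (\<lambda>A. ?f ` A) ` ?S"
      then obtain A where A: "A \<subseteq> aut K" "card A = k" "B = ?f ` A" by auto
      then show "B \<in> ?S" using inj[OF A(1)] bij by (auto simp: card_image bij_betw_def)
    next
      fix B assume B: "B \<in> ?S"
      let ?A = "{\<tau> \<in> aut K. ?f \<tau> \<in> B}"
      have "?f ` ?A = B" using B bij by (force simp: bij_betw_def)
      moreover have "card (?f ` ?A) = card ?A" by (rule card_image[OF inj]) auto
      ultimately show "B \<in> (\<lambda>A. ?f ` A) ` ?S" using B by (auto intro!: image_eqI[of _ _ ?A])
    qed
  qed
  then have "esym x k = (\<Sum>A\<in>?S. \<Prod>\<tau>\<in>?f ` A. - \<tau> x)"
    unfolding esym_def by (rule sum.reindex_bij_betw[symmetric])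
  also have "\<dots> = (\<Sum>A\<in>?S. \<Prod>\<tau>\<in>A. - \<sigma> (\<tau> x))"
    by (intro sum.cong refl, subst prod.reindex) (auto intro: inj)
  also have "\<dots> = \<sigma> (esym x k)"
    unfolding esym_def using x \<sigma>
  proof (subst aut_sum[OF \<sigma>])
    have K: "\<tau> x \<in> K" if "\<tau> \<in> aut K" for \<tau> using aut_K[OF that x] .
    show "(\<Prod>\<tau>\<in>A. - \<tau> x) \<in> K" if "A \<in> ?S" for A
      using that K by (intro K_prod K_uminus) auto
    show "(\<Sum>A\<in>?S. \<Prod>\<tau>\<in>A. - \<sigma> (\<tau> x)) = (\<Sum>A\<in>?S. \<sigma> (\<Prod>\<tau>\<in>A. - \<tau> x))"
    proof (rule sum.cong[OF refl])
      fix A assume A: "A \<in> ?S"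
      have "\<sigma> (\<Prod>\<tau>\<in>A. - \<tau> x) = (\<Prod>\<tau>\<in>A. \<sigma> (- \<tau> x))"
        using A K by (intro aut_prod[OF \<sigma>] K_uminus) auto
      also have "\<dots> = (\<Prod>\<tau>\<in>A. - \<sigma> (\<tau> x))"
        using A K by (intro prod.cong refl aut_uminus[OF \<sigma>]) auto
      finally show "(\<Prod>\<tau>\<in>A. - \<sigma> (\<tau> x)) = \<sigma> (\<Prod>\<tau>\<in>A. - \<tau> x)" by simp
    qed
  qed
  finally show "\<sigma> (esym x k) = esym x k" by simp
qed

lemma esym_integral_imp_OK:
  assumes x: "x \<in> K" and int: "\<And>k. k \<le> card (aut K) \<Longrightarrow> esym x k \<in> \<int>"
  shows "x \<in> OK K"
proof -
  let ?n = "card (aut K)"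
  define c where "c i = (SOME z::int. - esym x (?n - i) = of_int z)" for i
  have c: "of_int (c i) = - esym x (?n - i)" if "i < ?n" for i
  proof -
    have "- esym x (?n - i) \<in> \<int>" using int[of "?n - i"] by simp
    then have "\<exists>z::int. - esym x (?n - i) = of_int z" by (metis Ints_cases)
    then show ?thesis unfolding c_def by (metis (mono_tags, lifting) someI_ex)
  qed
  have "x ^ ?n = (\<Sum>i<?n. - esym x (?n - i) * x ^ i)"
    unfolding esym_power_relation[of x]
    by (rule sum.reindex_bij_witness[of _ "\<lambda>i. ?n - i" "\<lambda>i. ?n - i"]) auto
  also have "\<dots> = (\<Sum>i<?n. of_int (c i) * x ^ i)" by (intro sum.cong) (auto simp: c)
  finally have "algebraic_int x"
    using card_aut_pos by (intro algebraic_int_if_power_relation)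
  then show ?thesis using x by (simp add: OK_iff)
qed

definition nrm :: "complex \<Rightarrow> complex" where
  "nrm x = (\<Prod>\<sigma>\<in>aut K. \<sigma> x)"

lemma fixed_prod: "x \<in> K \<Longrightarrow> nrm x \<in> \<rat>"
proof -
  assume x: "x \<in> K"
  have "{A. A \<subseteq> aut K \<and> card A = card (aut K)} = {aut K}"
    using finite_aut by (auto dest: card_subset_eq)
  then have "esym x (card (aut K)) = (\<Prod>\<sigma>\<in>aut K. - \<sigma> x)" by (simp add: esym_def)
  also have "\<dots> = (-1) ^ card (aut K) * nrm x"
    by (simp add: nrm_def prod_uminus)
  finally have "nrm x = (-1) ^ card (aut K) * esym x (card (aut K))"
    by (simp add: mult.assoc[symmetric] power_mult_distrib[symmetric])
  moreover have "((-1) ^ card (aut K) :: complex) \<in> \<rat>" by (rule Rats_power) simp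
  ultimately show ?thesis using esym_Rats[OF x] by simp
qed

text \<open>The cofactor is the product of the other conjugates. So every nonzero ideal contains a
  nonzero integer, and denominators may be taken in Z.\<close>

lemma nrm_cofactor:
  assumes x: "x \<in> OK K" "x \<noteq> 0"
  obtains y m where "y \<in> OK K" "x * y = of_int m" "m \<noteq> 0"
proof -
  define y where "y = (\<Prod>\<sigma>\<in>aut K - {id}. \<sigma> x)"
  have y: "y \<in> OK K" unfolding y_def
    by (rule OK_prod, rule aut_OK[OF _ x(1)]) simp
  have eq: "x * y = nrm x"
    unfolding nrm_def y_def using prod.remove[OF finite_aut id_aut, of "\<lambda>\<sigma>. \<sigma> x"] by simp
  then have "nrm x \<in> OK K" using x y by (metis OK_mult)
  then have "nrm x \<in> \<int>" using fixed_prod x OK_imp_K OK_Rats by blast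
  then obtain m where m: "nrm x = of_int m" by (auto elim: Ints_cases)
  moreover have "nrm x \<noteq> 0" using x finite_aut by (auto simp: nrm_def aut_eq_0)
  ultimately show ?thesis using that[OF y] eq by auto
qed

text \<open>All powers of \<open>x\<close> share the denominator \<open>d\<close>. This is what the
  proof of \<open>Rad_invertible\<close> produces, and \<open>almost_integral_imp_OK\<close> turns
  it into integrality.\<close>

definition almost_integral :: "complex \<Rightarrow> bool" where
  "almost_integral x \<longleftrightarrow> x \<in> K \<and> (\<exists>d\<in>OK K. d \<noteq> 0 \<and> (\<forall>k. d * x ^ k \<in> OK K))"

lemma almost_integral_of_int: "almost_integral (of_int z)"
  unfolding almost_integral_def by (auto intro!: bexI[of _ 1] OK_power)

lemma almost_integral_mult:
  assumes "almost_integral x" "almost_integral y" shows "almost_integral (x * y)"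
proof -
  obtain d e where *: "d \<in> OK K" "d \<noteq> 0" "\<And>k. d * x ^ k \<in> OK K" "e \<in> OK K" "e \<noteq> 0" "\<And>k. e * y ^ k \<in> OK K"
    "x \<in> K" "y \<in> K" using assms unfolding almost_integral_def by blast
  have "d * e * (x * y) ^ k \<in> OK K" for k
  proof -
    have "d * e * (x * y) ^ k = (d * x ^ k) * (e * y ^ k)"
      by (simp add: power_mult_distrib)
    then show ?thesis using * by (metis OK_mult)
  qed
  then show ?thesis using * unfolding almost_integral_def
    by (intro conjI bexI[of _ "d * e"]) auto
qed

lemma almost_integral_add:
  assumes "almost_integral x" "almost_integral y" shows "almost_integral (x + y)"
proof -
  obtain d e where *: "d \<in> OK K" "d \<noteq> 0" "\<And>k. d * x ^ k \<in> OK K" "e \<in> OK K" "e \<noteq> 0" "\<And>k. e * y ^ k \<in> OK K"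
    "x \<in> K" "y \<in> K" using assms unfolding almost_integral_def by blast
  have "d * e * (x + y) ^ k \<in> OK K" for k
  proof -
    have "d * e * (x + y) ^ k = (\<Sum>i\<le>k. of_nat (k choose i) * ((d * x ^ i) * (e * y ^ (k - i))))"
      by (simp add: binomial_ring sum_distrib_left algebra_simps)
    also have "\<dots> \<in> OK K" by (rule OK_sum) (rule OK_mult[OF OK_of_nat OK_mult[OF *(3) *(6)]])
    finally show ?thesis .
  qed
  then show ?thesis using * unfolding almost_integral_def
    by (intro conjI bexI[of _ "d * e"]) auto
qed

lemma almost_integral_uminus: "almost_integral x \<Longrightarrow> almost_integral (- x)"
  using almost_integral_mult[OF almost_integral_of_int[of "-1"], of x] by simp

lemma almost_integral_sum:
  "(\<And>i. i \<in> I \<Longrightarrow> almost_integral (f i)) \<Longrightarrow> almost_integral (sum f I)"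
  using almost_integral_of_int[of 0]
  by (induction I rule: infinite_finite_induct) (auto simp: almost_integral_add)

lemma almost_integral_prod:
  "(\<And>i. i \<in> I \<Longrightarrow> almost_integral (f i)) \<Longrightarrow> almost_integral (prod f I)"
  using almost_integral_of_int[of 1]
  by (induction I rule: infinite_finite_induct) (auto simp: almost_integral_mult)

lemma almost_integral_aut:
  assumes \<sigma>: "\<sigma> \<in> aut K" and x: "almost_integral x" shows "almost_integral (\<sigma> x)"
proof -
  obtain d where d: "d \<in> OK K" "d \<noteq> 0" "\<And>k. d * x ^ k \<in> OK K" "x \<in> K"
    using x unfolding almost_integral_def by blast
  have "\<sigma> (d * x ^ k) = \<sigma> d * \<sigma> x ^ k" for k
    using d by (simp add: aut_mult[OF \<sigma>] aut_power[OF \<sigma>] K_power OK_imp_K)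
  then show ?thesis using d aut_OK[OF \<sigma>] aut_K[OF \<sigma>] aut_eq_0[OF \<sigma>]
    unfolding almost_integral_def by (metis)
qed

text \<open>Let b be the reduced denominator of x and m a nonzero integer that is a multiple of the
  common denominator of the powers. Every b^k divides m, which forces b = 1.\<close>

lemma almost_integral_Rats:
  assumes "almost_integral x" "x \<in> \<rat>" shows "x \<in> \<int>"
proof -
  obtain d where d: "d \<in> OK K" "d \<noteq> 0" "\<And>k. d * x ^ k \<in> OK K"
    using assms(1) unfolding almost_integral_def by blast
  obtain e m where e: "e \<in> OK K" "d * e = of_int m" "m \<noteq> 0" using nrm_cofactor[OF d(1,2)] .
  obtain a b where ab: "b > 0" "coprime a b" "x = of_int a / of_int b"
    using assms(2) by (metis Rats_cases')
  have dvd: "b ^ k dvd m" for k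
  proof -
    have "of_int m * x ^ k = e * (d * x ^ k)" by (simp add: e(2)[symmetric])
    then have "of_int m * x ^ k \<in> OK K" using d e by (metis OK_mult)
    moreover have "of_int m * x ^ k \<in> \<rat>" using assms(2) by auto
    ultimately obtain z where z: "of_int m * x ^ k = of_int z" by (metis OK_Rats Ints_cases)
    then have "of_int m * of_int a ^ k = (of_int z * of_int b ^ k :: complex)"
      using ab by (simp add: power_divide field_simps)
    then have "of_int (m * a ^ k) = (of_int (z * b ^ k) :: complex)" by simp
    then have "m * a ^ k = z * b ^ k" using of_int_eq_iff by blast
    then have "b ^ k dvd m * a ^ k" by simp
    moreover have "coprime (b ^ k) (a ^ k)" using ab by (simp add: coprime_commute)
    ultimately show ?thesis by (simp add: coprime_dvd_mult_left_iff)
  qed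
  have "b = 1"
  proof (rule ccontr)
    assume "b \<noteq> 1"
    then have b: "b \<ge> 2" using ab by simp
    have "int k < b ^ k" for k
    proof -
      have "int k < 2 ^ k" by (simp add: of_nat_less_two_power)
      also have "\<dots> \<le> b ^ k" using b by (intro power_mono) auto
      finally show ?thesis .
    qed
    from this[of "nat \<bar>m\<bar>"] have "\<bar>m\<bar> < b ^ nat \<bar>m\<bar>" by simp
    moreover have "b ^ nat \<bar>m\<bar> \<le> \<bar>m\<bar>" using dvd[of "nat \<bar>m\<bar>"] e(3) by (metis abs_of_pos ab(1) zero_less_power dvd_imp_le_int)
    ultimately show False by simp
  qed
  then show ?thesis using ab by simp
qed

text \<open>The coefficients of the characteristic polynomial are polynomials in the conjugates,
  hence almost integral; being rational, they are integers.\<close>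

lemma almost_integral_imp_OK:
  assumes "almost_integral x" shows "x \<in> OK K"
proof (rule esym_integral_imp_OK)
  show x: "x \<in> K" using assms by (simp add: almost_integral_def)
  fix k
  have "almost_integral (- \<sigma> x)" if "\<sigma> \<in> aut K" for \<sigma>
    by (rule almost_integral_uminus[OF almost_integral_aut[OF that assms]])
  then have "almost_integral (esym x k)" unfolding esym_def
    by (intro almost_integral_sum almost_integral_prod) auto
  then show "esym x k \<in> \<int>" using almost_integral_Rats esym_Rats[OF x] by blast
qed

end

section \<open>Ideals and ramification in Galois fields\<close>

abbreviation smul :: "complex \<Rightarrow> complex set \<Rightarrow> complex set" where
  "smul x I \<equiv> (\<lambda>y. x * y) ` I"

section \<open>Products of additive sets\<close>

lemma fid_mult_intro: "a \<in> I \<Longrightarrow> b \<in> J \<Longrightarrow> a * b \<in> fid_mult I J"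
  unfolding fid_mult_def
  by (intro CollectI exI[of _ "1::nat"] exI[of _ "\<lambda>_. a"] exI[of _ "\<lambda>_. b"]) auto

lemma fid_mult_0: "0 \<in> fid_mult I J"
  unfolding fid_mult_def by (intro CollectI exI[of _ "0::nat"]) auto

lemma fid_mult_add:
  assumes "x \<in> fid_mult I J" "y \<in> fid_mult I J" shows "x + y \<in> fid_mult I J"
proof -
  obtain n :: nat and a b where 1: "x = (\<Sum>i<n. a i * b i)" "\<forall>i<n. a i \<in> I \<and> b i \<in> J"
    using assms(1) by (auto simp: fid_mult_def)
  obtain m :: nat and c d where 2: "y = (\<Sum>i<m. c i * d i)" "\<forall>i<m. c i \<in> I \<and> d i \<in> J"
    using assms(2) by (auto simp: fid_mult_def)
  have split: "(\<Sum>i<n+k. f i) = (\<Sum>i<n. f i) + (\<Sum>i<k. f (n + i))" for f :: "nat \<Rightarrow> complex" and k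
    by (induction k) (auto simp: add.assoc)
  define a' where "a' i = (if i < n then a i else c (i - n))" for i
  define b' where "b' i = (if i < n then b i else d (i - n))" for i
  have "x + y = (\<Sum>i<n+m. a' i * b' i)"
    unfolding split 1 2 by (auto simp: a'_def b'_def intro!: arg_cong2[of _ _ _ _ "(+)"] sum.cong)
  moreover have "\<forall>i<n+m. a' i \<in> I \<and> b' i \<in> J" using 1 2 by (auto simp: a'_def b'_def)
  ultimately show ?thesis unfolding fid_mult_def by blast
qed

text \<open>The universal property of the product: an inclusion is checked on products of two
  elements, provided that the target is closed under addition.\<close>

lemma fid_mult_least:
  assumes "\<And>a b. a \<in> I \<Longrightarrow> b \<in> J \<Longrightarrow> a * b \<in> S" "0 \<in> S" "\<And>x y. x \<in> S \<Longrightarrow> y \<in> S \<Longrightarrow> x + y \<in> S"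
  shows "fid_mult I J \<subseteq> S"
proof
  fix x assume "x \<in> fid_mult I J"
  then obtain n :: nat and a b where x: "x = (\<Sum>i<n. a i * b i)" "\<forall>i<n. a i \<in> I \<and> b i \<in> J"
    by (auto simp: fid_mult_def)
  have "k \<le> n \<Longrightarrow> (\<Sum>i<k. a i * b i) \<in> S" for k
    by (induction k) (use assms x in auto)
  then show "x \<in> S" using x by simp
qed

lemma fid_mult_mono: "I \<subseteq> I' \<Longrightarrow> J \<subseteq> J' \<Longrightarrow> fid_mult I J \<subseteq> fid_mult I' J'"
  by (rule fid_mult_least) (auto intro: fid_mult_intro fid_mult_0 fid_mult_add)

lemma fid_mult_commute: "fid_mult I J = fid_mult J I"
proof -
  have "fid_mult I J \<subseteq> fid_mult J I" for I J
  proof (rule fid_mult_least)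
    fix a b assume "a \<in> I" "b \<in> J"
    then show "a * b \<in> fid_mult J I" using fid_mult_intro[of b J a I] by (simp add: mult.commute)
  qed (auto intro: fid_mult_0 fid_mult_add)
  then show ?thesis by (simp add: subset_antisym)
qed

lemma fid_mult_assoc: "fid_mult (fid_mult I J) L = fid_mult I (fid_mult J L)"
proof -
  have *: "fid_mult (fid_mult I J) L \<subseteq> fid_mult I (fid_mult J L)" for I J L
  proof (rule fid_mult_least)
    fix x c assume x: "x \<in> fid_mult I J" and c: "c \<in> L"
    have "fid_mult I J \<subseteq> {x. x * c \<in> fid_mult I (fid_mult J L)}"
    proof (rule fid_mult_least)
      fix a b assume "a \<in> I" "b \<in> J"
      then show "a * b \<in> {x. x * c \<in> fid_mult I (fid_mult J L)}"
        using c by (auto simp: mult.assoc intro: fid_mult_intro)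
    qed (auto simp: fid_mult_0 distrib_right fid_mult_add)
    then show "x * c \<in> fid_mult I (fid_mult J L)" using x by auto
  qed (auto simp: fid_mult_0 fid_mult_add)
  show ?thesis
  proof (rule subset_antisym[OF *])
    have "fid_mult (fid_mult J L) I \<subseteq> fid_mult J (fid_mult L I)" by (rule *)
    also have "\<dots> = fid_mult (fid_mult L I) J" by (rule fid_mult_commute)
    also have "\<dots> \<subseteq> fid_mult L (fid_mult I J)" by (rule *)
    finally show "fid_mult I (fid_mult J L) \<subseteq> fid_mult (fid_mult I J) L"
      by (simp only: fid_mult_commute[of "fid_mult J L" I] fid_mult_commute[of L "fid_mult I J"])
  qed
qed

lemma fid_mult_left_commute: "fid_mult I (fid_mult J L) = fid_mult J (fid_mult I L)"
  by (metis fid_mult_assoc fid_mult_commute)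

lemma fid_mult_smul: "fid_mult (smul x I) J = smul x (fid_mult I J)"
proof
  show "fid_mult (smul x I) J \<subseteq> smul x (fid_mult I J)"
  proof (rule fid_mult_least)
    fix u v assume "u \<in> smul x (fid_mult I J)" "v \<in> smul x (fid_mult I J)"
    then show "u + v \<in> smul x (fid_mult I J)"
      by (auto simp: distrib_left[symmetric] intro!: imageI fid_mult_add)
  next
    fix a b assume "a \<in> smul x I" "b \<in> J"
    then show "a * b \<in> smul x (fid_mult I J)"
      by (auto simp: mult.assoc intro!: imageI fid_mult_intro)
  next
    show "0 \<in> smul x (fid_mult I J)" using fid_mult_0[of I J] by (metis image_eqI mult_zero_right)
  qed
  have "fid_mult I J \<subseteq> {y. x * y \<in> fid_mult (smul x I) J}"
  proof (rule fid_mult_least)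
    fix a b assume "a \<in> I" "b \<in> J"
    then have "(x * a) * b \<in> fid_mult (smul x I) J" by (intro fid_mult_intro) auto
    then show "a * b \<in> {y. x * y \<in> fid_mult (smul x I) J}" by (simp add: mult.assoc)
  qed (auto simp: fid_mult_0 distrib_left fid_mult_add)
  then show "smul x (fid_mult I J) \<subseteq> fid_mult (smul x I) J" by auto
qed

lemma fid_mult_smul_right: "fid_mult I (smul x J) = smul x (fid_mult I J)"
  using fid_mult_smul[of x J I] by (simp add: fid_mult_commute)

lemma smul_smul: "smul x (smul y I) = smul (x * y) I"
  by (auto simp: image_image mult.assoc)

lemma smul_1 [simp]: "smul 1 I = I"
  by simp

lemma smul_cancel: "x \<noteq> 0 \<Longrightarrow> smul x I = smul x J \<longleftrightarrow> I = J"
  by (rule inj_image_eq_iff) (auto intro: injI)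

section \<open>Modules over the ring of integers\<close>

context subfield_of_complex
begin

text \<open>Weaker than \<open>frac_ideal\<close>: neither a nonzero element nor a common
  denominator is demanded, so that \<open>inv_ideal\<close> and its powers qualify at once.\<close>

definition omod :: "complex set \<Rightarrow> bool" where
  "omod M \<longleftrightarrow> M \<subseteq> K \<and> 0 \<in> M \<and> (\<forall>x\<in>M. \<forall>y\<in>M. x + y \<in> M) \<and> (\<forall>a\<in>OK K. \<forall>x\<in>M. a * x \<in> M)"

lemma omod_K: "omod M \<Longrightarrow> x \<in> M \<Longrightarrow> x \<in> K"
  and omod_0: "omod M \<Longrightarrow> 0 \<in> M"
  and omod_add: "omod M \<Longrightarrow> x \<in> M \<Longrightarrow> y \<in> M \<Longrightarrow> x + y \<in> M"
  and omod_mult: "omod M \<Longrightarrow> a \<in> OK K \<Longrightarrow> x \<in> M \<Longrightarrow> a * x \<in> M"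
  by (auto simp: omod_def)

lemma omod_mult2: "omod M \<Longrightarrow> a \<in> OK K \<Longrightarrow> x \<in> M \<Longrightarrow> x * a \<in> M"
  using omod_mult[of M a x] by (simp add: mult.commute)

lemma omod_uminus: "omod M \<Longrightarrow> x \<in> M \<Longrightarrow> - x \<in> M"
  using omod_mult[OF _ OK_uminus[OF OK_1], of M x] by simp

lemma omod_zmodule: "omod M \<Longrightarrow> zmodule M"
  by (simp add: zmodule_def omod_0 omod_add omod_uminus)

lemma omod_diff: "omod M \<Longrightarrow> x \<in> M \<Longrightarrow> y \<in> M \<Longrightarrow> x - y \<in> M"
  by (rule zmodule_diff[OF omod_zmodule])

lemma omod_OK: "omod (OK K)"
  by (auto simp: omod_def OK_imp_K)

lemma omod_smul: "omod M \<Longrightarrow> x \<in> K \<Longrightarrow> omod (smul x M)"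
  unfolding omod_def
  apply (intro conjI)
     apply (auto)[1]
    apply (metis image_eqI mult_zero_right)
   apply (auto simp: distrib_left[symmetric])[1]
  apply (auto simp: mult.left_commute[of _ x])
  done

lemma omod_fid_mult:
  assumes "omod I" "J \<subseteq> K" shows "omod (fid_mult I J)"
proof -
  have "fid_mult I J \<subseteq> K" by (rule fid_mult_least) (use assms omod_K in auto)
  moreover have "a * x \<in> fid_mult I J" if "a \<in> OK K" "x \<in> fid_mult I J" for a x
  proof -
    have "fid_mult I J \<subseteq> {x. a * x \<in> fid_mult I J}"
    proof (rule fid_mult_least)
      fix u v assume "u \<in> I" "v \<in> J"
      then have "(a * u) * v \<in> fid_mult I J" using assms that by (intro fid_mult_intro omod_mult)
      then show "u * v \<in> {x. a * x \<in> fid_mult I J}" by (simp add: mult.assoc)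
    qed (auto simp: fid_mult_0 distrib_left fid_mult_add)
    then show ?thesis using that by auto
  qed
  ultimately show ?thesis by (auto simp: omod_def fid_mult_0 fid_mult_add)
qed

lemma omod_fid_mult': "omod I \<Longrightarrow> omod J \<Longrightarrow> omod (fid_mult I J)"
  by (rule omod_fid_mult) (auto simp: omod_def)

lemma fid_mult_OK: "omod M \<Longrightarrow> fid_mult (OK K) M = M"
proof
  assume M: "omod M"
  show "fid_mult (OK K) M \<subseteq> M"
    by (rule fid_mult_least) (auto intro: omod_mult[OF M] omod_0[OF M] omod_add[OF M])
  show "M \<subseteq> fid_mult (OK K) M" using fid_mult_intro[OF OK_1] by force
qed

lemma fid_mult_OK2: "omod M \<Longrightarrow> fid_mult M (OK K) = M"
  using fid_mult_OK by (simp add: fid_mult_commute)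

lemma fid_pow_0 [simp]: "fid_pow K I 0 = OK K"
  and fid_pow_Suc: "fid_pow K I (Suc e) = fid_mult I (fid_pow K I e)"
  by (auto simp: fid_pow_def)

lemma fid_pow_1: "omod I \<Longrightarrow> fid_pow K I (Suc 0) = I"
  by (simp add: fid_pow_Suc fid_mult_OK2)

lemma omod_fid_pow: "omod I \<Longrightarrow> omod (fid_pow K I e)"
  by (induction e) (auto simp: omod_OK fid_pow_Suc omod_fid_mult')

lemma fid_pow_add: "omod I \<Longrightarrow> fid_pow K I (a + b) = fid_mult (fid_pow K I a) (fid_pow K I b)"
  by (induction a) (auto simp: fid_pow_Suc fid_mult_assoc fid_mult_OK omod_fid_pow)

lemma fid_pow_mult: "fid_pow K (fid_mult I J) e = fid_mult (fid_pow K I e) (fid_pow K J e)"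
proof (induction e)
  case 0
  show ?case using fid_mult_OK[OF omod_OK] by simp
next
  case (Suc e)
  have "fid_mult (fid_mult I J) (fid_mult A B) = fid_mult (fid_mult I A) (fid_mult J B)" for A B
    by (simp only: fid_mult_assoc fid_mult_left_commute[of J A])
  then show ?case by (simp add: fid_pow_Suc Suc)
qed

lemma fid_pow_mono: "I \<subseteq> J \<Longrightarrow> fid_pow K I e \<subseteq> fid_pow K J e"
  by (induction e) (simp_all add: fid_pow_Suc fid_mult_mono)

lemma fid_pow_OK: "fid_pow K (OK K) e = OK K"
  by (induction e) (auto simp: fid_pow_Suc fid_mult_OK omod_OK)

lemma fid_mult_subset_left: "omod I \<Longrightarrow> J \<subseteq> OK K \<Longrightarrow> fid_mult I J \<subseteq> I"
  using fid_mult_mono[of I I J "OK K"] fid_mult_OK2[of I] by simp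

lemma fid_pow_subset_OK: "I \<subseteq> OK K \<Longrightarrow> fid_pow K I e \<subseteq> OK K"
  using fid_pow_mono[of I "OK K" e] by (simp add: fid_pow_OK)

lemma fid_pow_decreasing:
  assumes "omod I" "I \<subseteq> OK K" "i \<le> j" shows "fid_pow K I j \<subseteq> fid_pow K I i"
proof -
  have "fid_pow K I j = fid_mult (fid_pow K I i) (fid_pow K I (j - i))"
    using fid_pow_add[OF assms(1), of i "j - i"] assms(3) by simp
  then show ?thesis
    using fid_mult_subset_left[OF omod_fid_pow[OF assms(1)] fid_pow_subset_OK[OF assms(2)]] by simp
qed

lemma fid_pow_power: "x \<in> I \<Longrightarrow> x ^ e \<in> fid_pow K I e"
  by (induction e) (auto simp: fid_pow_Suc intro: fid_mult_intro)

lemma cancel_subset: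
  assumes "fid_mult I J = OK K" "omod A" "omod B" "fid_mult I A \<subseteq> fid_mult I B"
  shows "A \<subseteq> B"
proof -
  have "fid_mult J (fid_mult I A) \<subseteq> fid_mult J (fid_mult I B)" by (rule fid_mult_mono[OF order_refl assms(4)])
  moreover have *: "fid_mult J (fid_mult I M) = M" if "omod M" for M
    using assms(1) that fid_mult_OK by (metis fid_mult_assoc fid_mult_commute)
  ultimately show ?thesis by (simp only: *[OF assms(2)] *[OF assms(3)])
qed

lemma omod_1: "omod M \<Longrightarrow> 1 \<in> M \<Longrightarrow> OK K \<subseteq> M"
  using omod_mult2[of M _ 1] by auto

text \<open>If x lies in M, then x^2 lies in O, so x is integral and M is contained in O; then O = M
  M is contained in M. Square roots of ideals are unique for this reason, without any factorization
  into primes.\<close>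

lemma square_eq_OK:
  assumes M: "omod M" and sq: "fid_mult M M = OK K" shows "M = OK K"
proof
  show "M \<subseteq> OK K"
  proof
    fix x assume x: "x \<in> M"
    then have "x ^ 2 \<in> OK K" using sq fid_mult_intro[OF x x] by (simp add: power2_eq_square)
    then show "x \<in> OK K" using algebraic_int_of_power[of x 2] omod_K[OF M x] by (simp add: OK_iff)
  qed
  from fid_mult_subset_left[OF M this] show "OK K \<subseteq> M" unfolding sq .
qed

lemma square_eq_principal:
  assumes M: "omod M" and x: "x \<in> K" "x \<noteq> 0" and sq: "fid_mult M M = smul (x ^ 2) (OK K)"
  shows "M = smul x (OK K)"
proof -
  let ?N = "smul (inverse x) M"
  have "fid_mult ?N ?N = smul (inverse x) (smul (inverse x) (smul (x ^ 2) (OK K)))"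
    by (simp only: fid_mult_smul fid_mult_smul_right sq)
  also have "\<dots> = smul (inverse x * (inverse x * x ^ 2)) (OK K)" by (simp only: smul_smul)
  also have "inverse x * (inverse x * x ^ 2) = 1" using x by (simp add: field_simps power2_eq_square)
  finally have sqN: "fid_mult ?N ?N = OK K" by simp
  have "?N = OK K" by (rule square_eq_OK[OF omod_smul[OF M K_inverse[OF x(1)]] sqN])
  then have "smul x (OK K) = smul (x * inverse x) M" by (simp only: smul_smul[symmetric])
  also have "x * inverse x = 1" using x by simp
  finally show ?thesis by simp
qed

end

section \<open>The radical of p: invertibility and powers\<close>

context galois_field
begin

text \<open>The radical of \<open>p\<close>, that is, the product of the prime ideals above \<open>p\<close>.\<close>
definition Rad :: "nat \<Rightarrow> complex set" where
  "Rad p = {x \<in> OK K. \<exists>m>0. x ^ m \<in> smul (of_nat p) (OK K)}"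

lemma omod_pO: "omod (smul (of_nat p) (OK K))"
  by (simp add: omod_smul omod_OK)

lemma Rad_OK: "Rad p \<subseteq> OK K"
  by (auto simp: Rad_def)

lemma p_in_pO: "of_nat p \<in> smul (of_nat p) (OK K)"
  using imageI[OF OK_1, of "\<lambda>y. of_nat p * y"] by simp

lemma pO_subset_Rad: "smul (of_nat p) (OK K) \<subseteq> Rad p"
  by (auto simp: Rad_def intro!: exI[of _ "1::nat"])

lemma p_in_Rad: "of_nat p \<in> Rad p"
  using p_in_pO pO_subset_Rad by blast

lemma omod_Rad: "omod (Rad p)"
  unfolding omod_def
proof (intro conjI ballI)
  show "Rad p \<subseteq> K" using Rad_OK OK_imp_K by blast
  show "0 \<in> Rad p" using omod_0[OF omod_pO] pO_subset_Rad by blast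
  fix x assume x: "x \<in> Rad p"
  then obtain m where m: "m > 0" "x ^ m \<in> smul (of_nat p) (OK K)" "x \<in> OK K" by (auto simp: Rad_def)
  { fix a assume a: "a \<in> OK K"
    then have "(a * x) ^ m \<in> smul (of_nat p) (OK K)"
      using m by (simp only: power_mult_distrib) (intro omod_mult[OF omod_pO] OK_power)
    then show "a * x \<in> Rad p" using a m by (auto simp: Rad_def) }
  fix y assume "y \<in> Rad p"
  then obtain k where k: "k > 0" "y ^ k \<in> smul (of_nat p) (OK K)" "y \<in> OK K" by (auto simp: Rad_def)
  have "(x + y) ^ (m + k) = (\<Sum>i\<le>m+k. of_nat ((m + k) choose i) * (x ^ i * y ^ (m + k - i)))"
    by (simp add: binomial_ring mult.assoc)
  also have "\<dots> \<in> smul (of_nat p) (OK K)"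
  proof (intro zmodule_sum[OF omod_zmodule[OF omod_pO]] omod_mult[OF omod_pO OK_of_nat])
    \<comment> \<open>In each term either x has exponent at least m or y has exponent at least
      k.\<close>
    fix i assume i: "i \<in> {..m+k}"
    show "x ^ i * y ^ (m + k - i) \<in> smul (of_nat p) (OK K)"
    proof (cases "m \<le> i")
      case True
      then have "x ^ i = x ^ (i - m) * x ^ m" by (simp add: power_add[symmetric])
      then have "x ^ i \<in> smul (of_nat p) (OK K)" using m omod_mult[OF omod_pO OK_power] by simp
      then show ?thesis using k by (intro omod_mult2[OF omod_pO] OK_power)
    next
      case False
      then have "y ^ (m + k - i) = y ^ (m - i) * y ^ k" by (simp add: power_add[symmetric])
      then have "y ^ (m + k - i) \<in> smul (of_nat p) (OK K)" using k omod_mult[OF omod_pO OK_power] by simp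
      then show ?thesis using m by (intro omod_mult[OF omod_pO] OK_power)
    qed
  qed
  finally show "x + y \<in> Rad p" using m k by (auto simp: Rad_def intro!: exI[of _ "m + k"])
qed

lemma aut_pO: "\<sigma> \<in> aut K \<Longrightarrow> x \<in> smul (of_nat p) (OK K) \<Longrightarrow> \<sigma> x \<in> smul (of_nat p) (OK K)"
  by (auto simp: aut_mult aut_of_nat OK_imp_K aut_OK)

lemma aut_Rad: "\<sigma> \<in> aut K \<Longrightarrow> x \<in> Rad p \<Longrightarrow> \<sigma> x \<in> Rad p"
  unfolding Rad_def by (auto simp: aut_OK OK_imp_K aut_power[symmetric] dest!: aut_pO[of \<sigma> _ p])

lemma of_int_in_pO:
  assumes "p > 0" "of_int z \<in> smul (of_nat p) (OK K)" shows "int p dvd z"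
proof -
  obtain y where y: "of_int z = of_nat p * y" "y \<in> OK K" using assms by auto
  then have "y = of_int z / of_nat p" using assms(1) by (simp add: field_simps)
  then have "y \<in> \<rat>" by simp
  then obtain w where "y = of_int w" using y OK_Rats by (auto elim: Ints_cases)
  then have "of_int z = (of_int (int p * w) :: complex)" using y by simp
  then have "z = int p * w" using of_int_eq_iff by blast
  then show ?thesis by simp
qed

context
  fixes p :: nat assumes p: "prime p"
begin

lemma one_notin_Rad: "1 \<notin> Rad p"
proof
  assume "1 \<in> Rad p"
  then have "of_int 1 \<in> smul (of_nat p) (OK K)" by (auto simp: Rad_def)
  then have "int p dvd 1" using of_int_in_pO p prime_gt_0_nat by blast
  then show False using p by (simp add: prime_nat_iff)
qed

lemma int_in_proper_ideal:
  assumes L: "omod L" "of_nat p \<in> L" "1 \<notin> L" and z: "of_int z \<in> L"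
  shows "int p dvd z"
proof (rule ccontr)
  assume "\<not> int p dvd z"
  then have "coprime (int p) z" using p by (simp add: prime_imp_coprime)
  then obtain u v where "u * int p + v * z = 1" by (metis bezout_int coprime_imp_gcd_eq_1)
  then have "of_int (u * int p + v * z) = (1::complex)" by simp
  then have "1 = of_int u * of_nat p + of_int v * (of_int z :: complex)" by simp
  also have "\<dots> \<in> L" using L z by (intro omod_add omod_mult) auto
  finally show False using L by simp
qed

text \<open>For x in L and k at least 1 the k-th symmetric function of the conjugates of x lies in L
  and in Z, hence in p Z. By the characteristic equation a power of x is divisible by p. So the
  radical is the largest proper stable ideal over p.\<close>

lemma invariant_subset_Rad:
  assumes L: "omod L" "L \<subseteq> OK K" "of_nat p \<in> L" "1 \<notin> L"
    and inv: "\<forall>\<sigma>\<in>aut K. \<forall>x\<in>L. \<sigma> x \<in> L"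
  shows "L \<subseteq> Rad p"
proof
  fix x assume x: "x \<in> L"
  then have xO: "x \<in> OK K" using L by blast
  have "esym x k \<in> smul (of_nat p) (OK K)" if "k \<ge> 1" for k
  proof -
    have "(\<Prod>\<sigma>\<in>A. - \<sigma> x) \<in> L" if A: "A \<subseteq> aut K" "card A = k" for A
    proof -
      have "A \<noteq> {}" "finite A" using A \<open>k \<ge> 1\<close> finite_aut by (auto dest: finite_subset)
      then obtain \<tau> where t: "\<tau> \<in> A" by blast
      have "(\<Prod>\<sigma>\<in>A. - \<sigma> x) = - \<tau> x * (\<Prod>\<sigma>\<in>A - {\<tau>}. - \<sigma> x)"
        by (rule prod.remove[OF \<open>finite A\<close> t])
      moreover have "- \<tau> x \<in> L" using inv x t A omod_uminus[OF L(1)] by auto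
      moreover have "(\<Prod>\<sigma>\<in>A - {\<tau>}. - \<sigma> x) \<in> OK K"
        using A by (intro OK_prod OK_uminus aut_OK[OF _ xO]) auto
      ultimately show ?thesis using omod_mult2[OF L(1)] by metis
    qed
    then have eL: "esym x k \<in> L" unfolding esym_def
      by (intro zmodule_sum[OF omod_zmodule[OF L(1)]]) auto
    moreover have "esym x k \<in> \<int>" using OK_Rats esym_Rats[OF OK_imp_K[OF xO]] eL L by blast
    then obtain z where z: "esym x k = of_int z" by (auto elim: Ints_cases)
    ultimately have "int p dvd z" using int_in_proper_ideal[OF L(1,3,4)] by simp
    then obtain w where "z = int p * w" by blast
    then have "esym x k = of_nat p * of_int w" using z by simp
    then show ?thesis by auto
  qed
  then have "x ^ card (aut K) \<in> smul (of_nat p) (OK K)"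
    unfolding esym_power_relation[of x]
    by (intro zmodule_sum[OF omod_zmodule[OF omod_pO]] omod_mult2[OF omod_pO] omod_uminus[OF omod_pO] OK_power xO) auto
  then show "x \<in> Rad p" using xO card_aut_pos by (auto simp: Rad_def)
qed

text \<open>Elements of the radical are nilpotent modulo p. Starting from 1, multiply for each x by
  the highest power of x that keeps the product nonzero modulo p.\<close>

lemma annihilator_of_finite_set:
  "finite F \<Longrightarrow> F \<subseteq> Rad p \<Longrightarrow> \<exists>b\<in>OK K. b \<notin> smul (of_nat p) (OK K) \<and> (\<forall>x\<in>F. b * x \<in> smul (of_nat p) (OK K))"
proof (induction F rule: finite_induct)
  case empty
  have "1 \<notin> smul (of_nat p) (OK K)" using one_notin_Rad pO_subset_Rad by blast
  then show ?case by auto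
next
  case (insert x F)
  let ?N = "smul (of_nat p) (OK K)"
  obtain b where b: "b \<in> OK K" "b \<notin> ?N" "\<forall>y\<in>F. b * y \<in> ?N" using insert by auto
  obtain m where m: "m > 0" "x ^ m \<in> ?N" "x \<in> OK K" using insert.prems by (auto simp: Rad_def)
  define k where "k = (LEAST k. b * x ^ k \<in> ?N)"
  have "b * x ^ m \<in> ?N" using m b omod_mult[OF omod_pO] by blast
  then have k: "b * x ^ k \<in> ?N" unfolding k_def by (rule LeastI)
  have "k \<noteq> 0" using k b(2) by (cases k) auto
  then obtain j where j: "k = Suc j" by (cases k) auto
  have nj: "b * x ^ j \<notin> ?N" using not_less_Least[of j "\<lambda>k. b * x ^ k \<in> ?N"] j unfolding k_def by auto
  show ?case
  proof (intro bexI[of _ "b * x ^ j"] conjI ballI)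
    show "b * x ^ j \<in> OK K" using b m by auto
    fix y assume "y \<in> insert x F"
    then show "b * x ^ j * y \<in> ?N"
    proof
      assume "y = x"
      then show ?thesis using k j by (simp add: mult.assoc mult.commute[of x])
    next
      assume "y \<in> F"
      then have "(b * y) * x ^ j \<in> ?N"
        using b(3) by (intro omod_mult2[OF omod_pO OK_power[OF m(3)]]) blast
      then show ?thesis by (simp add: algebra_simps)
    qed
  qed (rule nj)
qed

text \<open>The radical is finitely generated modulo p by \<open>basis_mod\<close>, so it suffices
  to annihilate generators. The quotient b / p will be a non-integral element of the inverse
  ideal.\<close>

lemma Rad_annihilator:
  obtains b where "b \<in> OK K" "b \<notin> smul (of_nat p) (OK K)" "\<And>x. x \<in> Rad p \<Longrightarrow> b * x \<in> smul (of_nat p) (OK K)"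
proof -
  let ?N = "smul (of_nat p) (OK K)"
  note N = omod_zmodule[OF omod_pO[of p]]
  have pM: "of_nat p * x \<in> ?N" if "x \<in> Rad p" for x using that Rad_OK by auto
  have RK: "Rad p \<subseteq> K" using Rad_OK OK_imp_K by blast
  show thesis
  proof (rule basis_mod[OF omod_zmodule[OF omod_Rad] RK N p])
    show "of_nat p * x \<in> ?N" if "x \<in> Rad p" for x using pM that .
  fix m and x :: "nat \<Rightarrow> complex" assume x: "\<And>i. i < m \<Longrightarrow> x i \<in> Rad p"
    "\<And>y. y \<in> Rad p \<Longrightarrow> \<exists>c :: nat \<Rightarrow> int. y - (\<Sum>i<m. of_int (c i) * x i) \<in> ?N"
  obtain b where b: "b \<in> OK K" "b \<notin> ?N" "\<forall>y\<in>x ` {..<m}. b * y \<in> ?N"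
    using annihilator_of_finite_set[of "x ` {..<m}"] x(1) by auto
  have "b * y \<in> ?N" if y: "y \<in> Rad p" for y
  proof -
    obtain c :: "nat \<Rightarrow> int" where c: "y - (\<Sum>i<m. of_int (c i) * x i) \<in> ?N" using x(2)[OF y] by blast
    have "b * y = b * (y - (\<Sum>i<m. of_int (c i) * x i)) + (\<Sum>i<m. of_int (c i) * (b * x i))"
      by (simp add: sum_distrib_left algebra_simps)
    also have "\<dots> \<in> ?N"
    proof (rule zmodule_add[OF N omod_mult[OF omod_pO b(1) c] zmodule_sum[OF N]])
      show "of_int (c i) * (b * x i) \<in> ?N" if "i \<in> {..<m}" for i
        using b(3) that by (intro zmodule_of_int[OF N]) blast
    qed
    finally show ?thesis .
  qed
  then show ?thesis using that b by blast
  qed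
qed

text \<open>If R R^(-1) were proper, it would be a stable ideal over p and so be contained in R. Let
  c = b / p with the annihilator b; then c lies in R^(-1) and c R in R, so all p c^k lie in R. Thus
  c is almost integral, hence integral, against b not being divisible by p.\<close>

lemma Rad_invertible: "fid_mult (Rad p) (inv_ideal K (Rad p)) = OK K"
  and omod_inv_Rad: "omod (inv_ideal K (Rad p))"
  and one_in_inv_Rad: "1 \<in> inv_ideal K (Rad p)"
  and aut_inv_Rad: "\<sigma> \<in> aut K \<Longrightarrow> x \<in> inv_ideal K (Rad p) \<Longrightarrow> \<sigma> x \<in> inv_ideal K (Rad p)"
proof -
  let ?R = "Rad p" and ?J = "inv_ideal K (Rad p)"
  show J: "omod ?J" unfolding omod_def inv_ideal_def
    by (auto simp: distrib_right mult.assoc OK_imp_K)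
  show 1: "1 \<in> ?J" using Rad_OK by (auto simp: inv_ideal_def)
  show autJ: "\<sigma> x \<in> ?J" if \<sigma>: "\<sigma> \<in> aut K" and x: "x \<in> ?J" for \<sigma> x
  proof -
    obtain \<tau> where t: "\<tau> \<in> aut K" "\<sigma> \<circ> \<tau> = id" using aut_inv[OF \<sigma> subfield] by blast
    have xK: "x \<in> K" using x by (auto simp: inv_ideal_def)
    have "\<sigma> x * y \<in> OK K" if y: "y \<in> ?R" for y
    proof -
      have "\<tau> y \<in> ?R" using aut_Rad[OF t(1) y] .
      then have "\<sigma> (x * \<tau> y) \<in> OK K" using x by (intro aut_OK[OF \<sigma>]) (auto simp: inv_ideal_def)
      moreover have "\<sigma> (x * \<tau> y) = \<sigma> x * \<sigma> (\<tau> y)"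
        using xK \<open>\<tau> y \<in> ?R\<close> Rad_OK OK_imp_K by (intro aut_mult[OF \<sigma>]) auto
      moreover have "\<sigma> (\<tau> y) = y" using t(2) by (metis comp_apply id_apply)
      ultimately show ?thesis by simp
    qed
    then show ?thesis using aut_K[OF \<sigma> xK] by (auto simp: inv_ideal_def)
  qed
  let ?L = "fid_mult ?R ?J"
  have L: "omod ?L" by (intro omod_fid_mult' omod_Rad J)
  have LO: "?L \<subseteq> OK K"
    by (rule fid_mult_least) (auto simp: inv_ideal_def mult.commute)
  have pL: "of_nat p \<in> ?L" using fid_mult_intro[OF p_in_Rad 1] by simp
  have Linv: "\<forall>\<sigma>\<in>aut K. \<forall>x\<in>?L. \<sigma> x \<in> ?L"
  proof (intro ballI)
    fix \<sigma> x assume \<sigma>: "\<sigma> \<in> aut K" and x: "x \<in> ?L"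
    have "?L \<subseteq> {x \<in> K. \<sigma> x \<in> ?L}"
    proof (rule fid_mult_least)
      fix a b assume ab: "a \<in> ?R" "b \<in> ?J"
      then have K: "a \<in> K" "b \<in> K" using omod_K[OF omod_Rad] omod_K[OF J] by auto
      then show "a * b \<in> {x \<in> K. \<sigma> x \<in> ?L}"
        using ab by (auto simp: aut_mult[OF \<sigma>] intro!: fid_mult_intro aut_Rad[OF \<sigma>] autJ[OF \<sigma>])
    next
      fix u v assume "u \<in> {x \<in> K. \<sigma> x \<in> ?L}" "v \<in> {x \<in> K. \<sigma> x \<in> ?L}"
      then show "u + v \<in> {x \<in> K. \<sigma> x \<in> ?L}" by (auto simp: aut_add[OF \<sigma>] intro: fid_mult_add)
    qed (auto simp: aut_0[OF \<sigma>] fid_mult_0)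
    then show "\<sigma> x \<in> ?L" using x by auto
  qed
  show "?L = OK K"
  proof (cases "1 \<in> ?L")
    case True
    then show ?thesis using omod_1[OF L] LO by auto
  next
    case False
    have LR: "?L \<subseteq> ?R" by (rule invariant_subset_Rad[OF L LO pL False Linv])
    obtain b where b: "b \<in> OK K" "b \<notin> smul (of_nat p) (OK K)" "\<And>x. x \<in> ?R \<Longrightarrow> b * x \<in> smul (of_nat p) (OK K)"
      using Rad_annihilator by blast
    define c where "c = b / of_nat p"
    have p0: "(of_nat p :: complex) \<noteq> 0" using p by (simp add: prime_gt_0_nat[THEN less_imp_neq, symmetric] prime_gt_0_nat)
    have bc: "b = of_nat p * c" using p0 by (simp add: c_def)
    have cK: "c \<in> K" using b OK_imp_K by (auto simp: c_def intro: K_divide)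
    have cJ: "c \<in> ?J"
    proof -
      have "c * y \<in> OK K" if y: "y \<in> ?R" for y
      proof -
        obtain w where "w \<in> OK K" "b * y = of_nat p * w" using b(3)[OF y] by auto
        then show ?thesis using p0 by (simp add: bc mult.assoc)
      qed
      then show ?thesis using cK by (auto simp: inv_ideal_def)
    qed
    have "of_nat p * c ^ k \<in> ?R" for k
    proof (induction k)
      case 0
      then show ?case using p_in_Rad by simp
    next
      case (Suc k)
      then have "(of_nat p * c ^ k) * c \<in> ?L" using cJ by (intro fid_mult_intro)
      then show ?case using LR by (auto simp: mult.assoc mult.commute[of c])
    qed
    then have "almost_integral c" unfolding almost_integral_def
      using cK p0 Rad_OK by (intro conjI bexI[of _ "of_nat p"]) auto
    then have "c \<in> OK K" by (rule almost_integral_imp_OK)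
    then show ?thesis using b(2) bc by auto
  qed
qed

lemma Rad_pow_invertible:
  "fid_mult (fid_pow K (Rad p) j) (fid_pow K (inv_ideal K (Rad p)) j) = OK K"
  using fid_pow_mult[of "Rad p" "inv_ideal K (Rad p)" j] by (simp add: Rad_invertible fid_pow_OK)

text \<open>Cancelling the invertible power would put 1 into the radical.\<close>

lemma Rad_pow_strict: "\<not> fid_pow K (Rad p) j \<subseteq> fid_pow K (Rad p) (Suc j)"
proof
  assume "fid_pow K (Rad p) j \<subseteq> fid_pow K (Rad p) (Suc j)"
  moreover have "fid_mult (fid_pow K (Rad p) j) (OK K) = fid_pow K (Rad p) j"
    by (rule fid_mult_OK2[OF omod_fid_pow[OF omod_Rad]])
  moreover have "fid_mult (fid_pow K (Rad p) j) (Rad p) = fid_pow K (Rad p) (Suc j)"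
    by (metis fid_pow_Suc fid_mult_commute)
  ultimately have "fid_mult (fid_pow K (Rad p) j) (OK K) \<subseteq> fid_mult (fid_pow K (Rad p) j) (Rad p)"
    by (simp only:)
  then have "OK K \<subseteq> Rad p" by (rule cancel_subset[OF Rad_pow_invertible omod_OK omod_Rad])
  then show False using one_notin_Rad OK_1 by blast
qed

text \<open>For each i pick \<open>x i\<close> in the power i of the radical but not in the next
  one, and take a relation of x 0, ..., x n whose coefficients are not all divisible by p. At the
  first index i with coefficient prime to p all other terms lie in the power i + 1, which contains
  p; hence so does \<open>x i\<close>, a contradiction.\<close>

lemma Rad_pow_bound:
  assumes pj: "of_nat p \<in> fid_pow K (Rad p) j" shows "j \<le> n"
proof (rule ccontr)
  assume "\<not> j \<le> n"
  let ?I = "\<lambda>i. fid_pow K (Rad p) i"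
  note dec = fid_pow_decreasing[OF omod_Rad Rad_OK]
  note oI = omod_fid_pow[OF omod_Rad]
  have "\<forall>i. \<exists>x. x \<in> ?I i \<and> x \<notin> ?I (Suc i)" using Rad_pow_strict by blast
  then obtain x where x: "\<And>i. x i \<in> ?I i" "\<And>i. x i \<notin> ?I (Suc i)" by metis
  have "int p > 1" using p prime_gt_1_nat by simp
  moreover have "x i \<in> K" for i using x(1) omod_K[OF oI] by blast
  ultimately obtain c :: "nat \<Rightarrow> int" where c: "\<exists>i\<le>n. \<not> int p dvd c i" "(\<Sum>i\<le>n. of_int (c i) * x i) = 0"
    using dependence_mod[of x "int p"] by blast
  define i where "i = (LEAST i. \<not> int p dvd c i)"
  have i: "\<not> int p dvd c i" "i \<le> n"
    using c(1) LeastI_ex[of "\<lambda>i. \<not> int p dvd c i"] Least_le[of "\<lambda>i. \<not> int p dvd c i"]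
    unfolding i_def by (blast, meson order_trans)
  have p_in: "of_nat p \<in> ?I (Suc i)" using dec[of "Suc i" j] pj i \<open>\<not> j \<le> n\<close> by auto
  have "of_int (c k) * x k \<in> ?I (Suc i)" if "k \<noteq> i" for k
  proof (cases "k < i")
    case True
    then obtain w where "c k = int p * w" using not_less_Least[of k "\<lambda>i. \<not> int p dvd c i"] unfolding i_def by auto
    then have eq: "of_int (c k) * x k = (of_int w * x k) * of_nat p" by simp
    have "x k \<in> OK K" using x(1) fid_pow_subset_OK[OF Rad_OK] by blast
    then show ?thesis unfolding eq by (intro omod_mult[OF oI _ p_in] OK_mult OK_of_int)
  next
    case False
    then have "x k \<in> ?I (Suc i)" using that x(1)[of k] dec[of "Suc i" k] by auto
    then show ?thesis using omod_mult[OF oI] by simp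
  qed
  then have "(\<Sum>k\<in>{..n} - {i}. of_int (c k) * x k) \<in> ?I (Suc i)"
    by (intro zmodule_sum[OF omod_zmodule[OF oI]]) auto
  moreover have "(\<Sum>k\<le>n. of_int (c k) * x k) = of_int (c i) * x i + (\<Sum>k\<in>{..n} - {i}. of_int (c k) * x k)"
    using i by (intro sum.remove) auto
  ultimately have "- (of_int (c i) * x i) \<in> ?I (Suc i)" using c(2) by (simp add: eq_neg_iff_add_eq_0 minus_unique)
  then have ci: "of_int (c i) * x i \<in> ?I (Suc i)" using omod_uminus[OF oI] by fastforce
  have "coprime (int p) (c i)" using p i by (simp add: prime_imp_coprime)
  then obtain u v where "u * int p + v * c i = 1" by (metis bezout_int coprime_imp_gcd_eq_1)
  then have "of_int (u * int p + v * c i) = (1::complex)" by simp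
  then have "x i = (of_int u * of_nat p + of_int v * of_int (c i)) * x i" by simp
  then have "x i = (of_int u * x i) * of_nat p + of_int v * (of_int (c i) * x i)" by (simp add: algebra_simps)
  also have "\<dots> \<in> ?I (Suc i)"
  proof (rule omod_add[OF oI omod_mult[OF oI _ p_in] omod_mult[OF oI OK_of_int ci]])
    show "of_int u * x i \<in> OK K" using x(1)[of i] fid_pow_subset_OK[OF Rad_OK]
      by (intro OK_mult OK_of_int) blast
  qed
  finally show False using x(2) by blast
qed

text \<open>The maximum exists by \<open>Rad_pow_bound\<close>; \<open>ram_index_eq\<close>
  identifies it with the ramification index.\<close>

definition ramif :: nat where
  "ramif = (GREATEST j. of_nat p \<in> fid_pow K (Rad p) j)"

lemma ramif_in: "of_nat p \<in> fid_pow K (Rad p) ramif"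
  and ramif_greatest: "of_nat p \<in> fid_pow K (Rad p) j \<Longrightarrow> j \<le> ramif"
proof -
  have "of_nat p \<in> fid_pow K (Rad p) 0" by simp
  then show "of_nat p \<in> fid_pow K (Rad p) ramif" unfolding ramif_def
    by (rule GreatestI_nat[where b = n]) (rule Rad_pow_bound)
  show "of_nat p \<in> fid_pow K (Rad p) j \<Longrightarrow> j \<le> ramif" unfolding ramif_def
    by (rule Greatest_le_nat[where b = n]) (auto dest: Rad_pow_bound)
qed

lemma ramif_le: "ramif \<le> n"
  using Rad_pow_bound ramif_in by blast

lemma ramif_ge_1: "ramif \<ge> 1"
  using ramif_greatest[of 1] p_in_Rad by (simp add: fid_pow_1 omod_Rad)

lemma aut_inv_Rad_pow:
  "\<sigma> \<in> aut K \<Longrightarrow> x \<in> fid_pow K (inv_ideal K (Rad p)) j \<Longrightarrow> \<sigma> x \<in> fid_pow K (inv_ideal K (Rad p)) j"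
proof (induction j arbitrary: x)
  case 0
  then show ?case by (simp add: aut_OK)
next
  case (Suc j)
  note \<sigma> = \<open>\<sigma> \<in> aut K\<close>
  let ?J = "inv_ideal K (Rad p)"
  have "fid_pow K ?J (Suc j) \<subseteq> {x \<in> K. \<sigma> x \<in> fid_pow K ?J (Suc j)}"
    unfolding fid_pow_Suc
  proof (rule fid_mult_least)
    fix a b assume ab: "a \<in> ?J" "b \<in> fid_pow K ?J j"
    then have K: "a \<in> K" "b \<in> K" using omod_K omod_inv_Rad omod_fid_pow by blast+
    then show "a * b \<in> {x \<in> K. \<sigma> x \<in> fid_mult ?J (fid_pow K ?J j)}"
      using ab by (auto simp: aut_mult[OF \<sigma>] intro!: fid_mult_intro aut_inv_Rad[OF \<sigma>] Suc.IH[OF \<sigma>])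
  next
    fix u v assume "u \<in> {x \<in> K. \<sigma> x \<in> fid_mult ?J (fid_pow K ?J j)}" "v \<in> {x \<in> K. \<sigma> x \<in> fid_mult ?J (fid_pow K ?J j)}"
    then show "u + v \<in> {x \<in> K. \<sigma> x \<in> fid_mult ?J (fid_pow K ?J j)}"
      by (auto simp: aut_add[OF \<sigma>] intro: fid_mult_add)
  qed (auto simp: aut_0[OF \<sigma>] fid_mult_0)
  then show ?case using Suc.prems by auto
qed

text \<open>L = p Rad^(-e) is integral, stable and contains p. Were it proper, it would lie in the
  radical, and p would lie in Rad^(e+1), against the choice of e. So L is the unit ideal.\<close>

lemma Rad_pow_ramif: "fid_pow K (Rad p) ramif = smul (of_nat p) (OK K)"
proof -
  let ?I = "fid_pow K (Rad p) ramif" and ?J = "fid_pow K (inv_ideal K (Rad p)) ramif"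
  have oI: "omod ?I" by (rule omod_fid_pow[OF omod_Rad])
  have oJ: "omod ?J" by (rule omod_fid_pow[OF omod_inv_Rad])
  have IJ: "fid_mult ?I ?J = OK K" by (rule Rad_pow_invertible)
  let ?L = "smul (of_nat p) ?J"
  have L: "omod ?L" using oJ by (simp add: omod_smul)
  have "smul (of_nat p) (OK K) \<subseteq> ?I" using omod_mult2[OF oI _ ramif_in] by auto
  then have "fid_mult (smul (of_nat p) (OK K)) ?J \<subseteq> fid_mult ?I ?J" by (intro fid_mult_mono) auto
  then have LO: "?L \<subseteq> OK K" by (simp add: fid_mult_smul fid_mult_OK oJ IJ)
  have "1 \<in> ?J" using fid_pow_power[OF one_in_inv_Rad, of ramif] by simp
  then have pL: "of_nat p \<in> ?L" by (metis image_eqI mult.right_neutral)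
  have eq: "fid_mult ?I ?L = smul (of_nat p) (OK K)" by (simp add: fid_mult_smul_right IJ)
  have inv: "\<forall>\<sigma>\<in>aut K. \<forall>x\<in>?L. \<sigma> x \<in> ?L"
  proof (intro ballI)
    fix \<sigma> x assume \<sigma>: "\<sigma> \<in> aut K" and x: "x \<in> ?L"
    obtain y where y: "y \<in> ?J" "x = of_nat p * y" using x by auto
    then have "\<sigma> x = of_nat p * \<sigma> y" using omod_K[OF oJ] by (simp add: aut_mult[OF \<sigma>] aut_of_nat[OF \<sigma>])
    then show "\<sigma> x \<in> ?L" using aut_inv_Rad_pow[OF \<sigma> y(1)] by auto
  qed
  have "1 \<in> ?L"
  proof (rule ccontr)
    assume n1: "1 \<notin> ?L"
    have "?L \<subseteq> Rad p" by (rule invariant_subset_Rad[OF L LO pL n1 inv])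
    then have "fid_mult ?I ?L \<subseteq> fid_mult ?I (Rad p)" by (intro fid_mult_mono) auto
    then have "of_nat p \<in> fid_mult ?I (Rad p)" using p_in_pO[of p] eq by blast
    then have "of_nat p \<in> fid_pow K (Rad p) (Suc ramif)" by (simp add: fid_pow_Suc fid_mult_commute)
    then show False using ramif_greatest[of "Suc ramif"] by simp
  qed
  then have "?L = OK K" using omod_1[OF L] LO by auto
  then show ?thesis using eq by (simp add: fid_mult_OK2 oI)
qed

end

end

section \<open>Prime ideals above p and their conjugates\<close>

context galois_field
begin

context
  fixes p :: nat assumes p: "prime p"
begin

definition primes_over :: "complex set set" where
  "primes_over = {P. prime_ideal K P \<and> of_nat p \<in> P}"

lemma prime_ideal_omod: "prime_ideal K P \<Longrightarrow> omod P"
  by (auto simp: prime_ideal_def frac_ideal_def omod_def)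

lemma prime_ideal_OK: "prime_ideal K P \<Longrightarrow> P \<subseteq> OK K"
  by (simp add: prime_ideal_def)

lemma prime_ideal_1: "prime_ideal K P \<Longrightarrow> 1 \<notin> P"
  using omod_1[OF prime_ideal_omod] by (auto simp: prime_ideal_def)

lemma prime_ideal_mult:
  "prime_ideal K P \<Longrightarrow> a \<in> OK K \<Longrightarrow> b \<in> OK K \<Longrightarrow> a * b \<in> P \<Longrightarrow> a \<in> P \<or> b \<in> P"
  by (simp add: prime_ideal_def)

lemma prime_ideal_power:
  "prime_ideal K P \<Longrightarrow> a \<in> OK K \<Longrightarrow> a ^ k \<in> P \<Longrightarrow> a \<in> P"
  by (induction k) (auto dest: prime_ideal_1 prime_ideal_mult[of P a] intro: OK_power)

lemma prime_ideal_prod: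
  assumes "prime_ideal K P" "finite I" "\<And>i. i \<in> I \<Longrightarrow> f i \<in> OK K" "prod f I \<in> P"
  shows "\<exists>i\<in>I. f i \<in> P"
  using assms(2,3,4)
proof (induction I rule: finite_induct)
  case empty
  then show ?case using prime_ideal_1[OF assms(1)] by simp
next
  case (insert i I)
  then have "f i \<in> P \<or> prod f I \<in> P"
    using prime_ideal_mult[OF assms(1), of "f i" "prod f I"] by (auto intro: OK_prod)
  then show ?case using insert by auto
qed

lemma prime_idealI:
  assumes "omod P" "P \<subseteq> OK K" "1 \<notin> P" "of_nat p \<in> P"
    "\<And>a b. a \<in> OK K \<Longrightarrow> b \<in> OK K \<Longrightarrow> a * b \<in> P \<Longrightarrow> a \<notin> P \<Longrightarrow> b \<in> P"
  shows "prime_ideal K P"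
  unfolding prime_ideal_def frac_ideal_def
proof (intro conjI ballI impI)
  have "(of_nat p :: complex) \<noteq> 0" using p by (auto dest: prime_gt_0_nat)
  then show "P \<noteq> {0}" using assms(4) by auto
  show "\<exists>d\<in>OK K. d \<noteq> 0 \<and> (\<forall>x\<in>P. d * x \<in> OK K)" using assms(2) by (intro bexI[of _ 1]) auto
  show "P \<noteq> OK K" using assms(3) OK_1 by blast
  show "P \<subseteq> K" "0 \<in> P" "P \<subseteq> OK K" using assms(1,2) by (auto simp: omod_def)
  show "x + y \<in> P" if "x \<in> P" "y \<in> P" for x y using omod_add[OF assms(1) that] .
  show "a * x \<in> P" if "a \<in> OK K" "x \<in> P" for a x using omod_mult[OF assms(1) that] .
  show "a \<in> P \<or> b \<in> P" if "a \<in> OK K" "b \<in> OK K" "a * b \<in> P" for a b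
    using assms(5)[OF that] by blast
qed

lemma primes_over_pO: "P \<in> primes_over \<Longrightarrow> smul (of_nat p) (OK K) \<subseteq> P"
proof (rule image_subsetI)
  fix y assume "P \<in> primes_over" "y \<in> OK K"
  then show "of_nat p * y \<in> P" using omod_mult2[OF prime_ideal_omod, of P y "of_nat p"] by (simp add: primes_over_def)
qed

lemma Rad_subset_prime: "P \<in> primes_over \<Longrightarrow> Rad p \<subseteq> P"
proof
  fix x assume P: "P \<in> primes_over" and "x \<in> Rad p"
  then obtain m where "x \<in> OK K" "x ^ m \<in> smul (of_nat p) (OK K)" unfolding Rad_def by blast
  then show "x \<in> P" using primes_over_pO[OF P] P prime_ideal_power[of P x m] unfolding primes_over_def by blast
qed

text \<open>By \<open>basis_mod\<close> for O modulo P, the sums of the f i x i with digits 0 \<le>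
  f i < p represent every residue class exactly once. The f are extensional, so that equality on the
  index set is equality.\<close>

lemma residues:
  assumes P: "P \<in> primes_over"
  obtains m and a :: "(nat \<Rightarrow> nat) \<Rightarrow> complex" where
    "\<And>f. f \<in> ({..<m} \<rightarrow>\<^sub>E {..<p}) \<Longrightarrow> a f \<in> OK K"
    "\<And>f g. f \<in> ({..<m} \<rightarrow>\<^sub>E {..<p}) \<Longrightarrow> g \<in> ({..<m} \<rightarrow>\<^sub>E {..<p}) \<Longrightarrow> a f - a g \<in> P \<Longrightarrow> f = g"
    "\<And>y. y \<in> OK K \<Longrightarrow> \<exists>f\<in>{..<m} \<rightarrow>\<^sub>E {..<p}. y - a f \<in> P"
proof -
  have pr: "prime_ideal K P" and pP: "of_nat p \<in> P" using P by (auto simp: primes_over_def)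
  note oP = prime_ideal_omod[OF pr] 
  note zP = omod_zmodule[OF oP]
  have OKK: "OK K \<subseteq> K" using OK_imp_K by blast
  show thesis
  proof (rule basis_mod[OF omod_zmodule[OF omod_OK] OKK zP p])
    show "of_nat p * x \<in> P" if "x \<in> OK K" for x using omod_mult2[OF oP that pP] .
    fix m and x :: "nat \<Rightarrow> complex"
    assume x: "\<And>i. i < m \<Longrightarrow> x i \<in> OK K"
      and ind: "\<And>c :: nat \<Rightarrow> int. (\<Sum>i<m. of_int (c i) * x i) \<in> P \<Longrightarrow> \<forall>i<m. int p dvd c i"
      and span: "\<And>y. y \<in> OK K \<Longrightarrow> \<exists>c :: nat \<Rightarrow> int. y - (\<Sum>i<m. of_int (c i) * x i) \<in> P"
    define a where "a f = (\<Sum>i<m. of_nat (f i) * x i)" for f :: "nat \<Rightarrow> nat"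
    show thesis
    proof (rule that[of m a])
      show "a f \<in> OK K" for f unfolding a_def using x by (intro OK_sum OK_mult) auto
    next
      fix f g assume fg: "f \<in> ({..<m} \<rightarrow>\<^sub>E {..<p})" "g \<in> ({..<m} \<rightarrow>\<^sub>E {..<p})" "a f - a g \<in> P"
      have "a f - a g = (\<Sum>i<m. of_int (int (f i) - int (g i)) * x i)"
        by (simp add: a_def sum_subtractf algebra_simps)
      then have dvd: "\<forall>i<m. int p dvd int (f i) - int (g i)" using ind[of "\<lambda>i. int (f i) - int (g i)"] fg(3) by simp
      show "f = g"
      proof (rule PiE_ext[OF fg(1,2)])
        fix i assume i: "i \<in> {..<m}"
        then have "f i < p" "g i < p" using fg by (auto simp: PiE_iff)
        moreover have "int (f i) mod int p = int (g i) mod int p" using dvd i by (simp add: mod_eq_dvd_iff)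
        ultimately show "f i = g i" by simp
      qed
    next
      fix y assume "y \<in> OK K"
      then obtain c :: "nat \<Rightarrow> int" where c: "y - (\<Sum>i<m. of_int (c i) * x i) \<in> P" using span by blast
      define f where "f = (\<lambda>i\<in>{..<m}. nat (c i mod int p))"
      have p0: "int p > 0" using p by (simp add: prime_gt_0_nat)
      have f: "f \<in> {..<m} \<rightarrow>\<^sub>E {..<p}" using p0 by (auto simp: f_def nat_less_iff)
      have "(\<Sum>i<m. of_int (c i) * x i) - a f = (\<Sum>i<m. (of_int (c i div int p) * x i) * of_nat p)"
      proof -
        have "of_int (c i) * x i - of_nat (f i) * x i = (of_int (c i div int p) * x i) * of_nat p" if "i < m" for i
        proof -
          have "c i = c i div int p * int p + c i mod int p" by simp
          then have "c i = c i div int p * int p + int (f i)" using that p0 by (simp add: f_def)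
          then have "of_int (c i) = (of_int (c i div int p) * of_nat p + of_nat (f i) :: complex)"
            by (metis of_int_add of_int_mult of_int_of_nat_eq)
          then show ?thesis by (simp add: algebra_simps)
        qed
        then show ?thesis by (simp add: a_def sum_subtractf[symmetric])
      qed
      also have "\<dots> \<in> P" by (rule zmodule_sum[OF zP], rule omod_mult[OF oP _ pP]) (auto intro: x)
      finally have "(y - (\<Sum>i<m. of_int (c i) * x i)) + ((\<Sum>i<m. of_int (c i) * x i) - a f) \<in> P"
        using c by (intro omod_add[OF oP])
      then show "\<exists>f\<in>{..<m} \<rightarrow>\<^sub>E {..<p}. y - a f \<in> P" using f by (intro bexI[of _ f]) auto
    qed
  qed
qed

lemma coset_eq: "omod P \<Longrightarrow> (\<lambda>y. a + y) ` P = (\<lambda>y. b + y) ` P \<longleftrightarrow> a - b \<in> P"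
proof
  assume oP: "omod P"
  { assume "(\<lambda>y. a + y) ` P = (\<lambda>y. b + y) ` P"
    moreover have "a \<in> (\<lambda>y. a + y) ` P" using omod_0[OF oP] by force
    ultimately obtain y where "y \<in> P" "a = b + y" by auto
    then show "a - b \<in> P" by simp }
  assume ab: "a - b \<in> P"
  show "(\<lambda>y. a + y) ` P = (\<lambda>y. b + y) ` P"
  proof (intro equalityI image_subsetI)
    fix y assume "y \<in> P"
    then have "(a - b) + y \<in> P" "y - (a - b) \<in> P" using ab omod_add[OF oP] omod_diff[OF oP] by auto
    then have "b + ((a - b) + y) \<in> (\<lambda>y. b + y) ` P" "a + (y - (a - b)) \<in> (\<lambda>y. a + y) ` P" by blast+
    then show "a + y \<in> (\<lambda>y. b + y) ` P" "b + y \<in> (\<lambda>y. a + y) ` P" by (simp_all add: algebra_simps)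
  qed
qed

lemma norm_prime_power:
  assumes P: "P \<in> primes_over"
  shows "\<exists>m\<ge>1. ideal_norm K P = p ^ m"
proof -
  have pr: "prime_ideal K P" using P by (auto simp: primes_over_def)
  note oP = prime_ideal_omod[OF pr] 
  show ?thesis
  proof (rule residues[OF P])
    fix m :: nat and a :: "(nat \<Rightarrow> nat) \<Rightarrow> complex"
    let ?F = "{..<m} \<rightarrow>\<^sub>E {..<p}"
    assume a: "\<And>f. f \<in> ?F \<Longrightarrow> a f \<in> OK K"
      and inj: "\<And>f g. f \<in> ?F \<Longrightarrow> g \<in> ?F \<Longrightarrow> a f - a g \<in> P \<Longrightarrow> f = g"
      and surj: "\<And>y. y \<in> OK K \<Longrightarrow> \<exists>f\<in>?F. y - a f \<in> P"
    let ?h = "\<lambda>f. (\<lambda>y. a f + y) ` P"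
    have "{(\<lambda>y. b + y) ` P | b. b \<in> OK K} = ?h ` ?F"
    proof (intro equalityI subsetI)
      fix C assume "C \<in> {(\<lambda>y. b + y) ` P | b. b \<in> OK K}"
      then obtain b where b: "b \<in> OK K" "C = (\<lambda>y. b + y) ` P" by auto
      then obtain f where "f \<in> ?F" "b - a f \<in> P" using surj by blast
      then show "C \<in> ?h ` ?F" using b(2) coset_eq[OF oP, of b "a f"] by (intro image_eqI[of _ _ f]) simp_all
    qed (use a in auto)
    moreover have "inj_on ?h ?F" using inj coset_eq[OF oP] by (intro inj_onI) blast
    ultimately have "ideal_norm K P = card ?F" unfolding ideal_norm_def by (simp add: card_image)
    also have "\<dots> = p ^ m" by (simp add: card_PiE)
    finally have *: "ideal_norm K P = p ^ m" .
    \<comment> \<open>For m = 0 there would be a single residue class, and 1 would lie in P.\<close>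
    have "m \<noteq> 0"
    proof
      assume "m = 0"
      then have F: "?F = {\<lambda>_. undefined}" by simp
      obtain f g where "f \<in> ?F" "1 - a f \<in> P" "g \<in> ?F" "0 - a g \<in> P" using surj[of 1] surj[of 0] OK_1 OK_0 by blast
      moreover from this have "f = g" using F by auto
      ultimately have "(1 - a g) - (0 - a g) \<in> P" by (rule_tac omod_diff[OF oP]) simp_all
      then show False using prime_ideal_1[OF pr] by simp
    qed
    then show ?thesis using * by (intro exI[of _ m]) auto
  qed
qed

text \<open>There are finitely many residues, so two powers of x agree modulo P; cancelling the
  lower one leaves a power of x congruent to 1.\<close>

lemma inverse_mod_prime:
  assumes P: "P \<in> primes_over" and x: "x \<in> OK K" "x \<notin> P"
  obtains y where "y \<in> OK K" "x * y - 1 \<in> P"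
proof -
  have pr: "prime_ideal K P" using P by (auto simp: primes_over_def)
  note oP = prime_ideal_omod[OF pr] 
  show thesis
  proof (rule residues[OF P])
    fix m :: nat and a :: "(nat \<Rightarrow> nat) \<Rightarrow> complex"
    let ?F = "{..<m} \<rightarrow>\<^sub>E {..<p}"
    assume surj: "\<And>y. y \<in> OK K \<Longrightarrow> \<exists>f\<in>?F. y - a f \<in> P"
    have "\<forall>i. \<exists>f. f \<in> ?F \<and> x ^ i - a f \<in> P" using surj OK_power[OF x(1)] by blast
    then obtain h where h: "\<And>i::nat. h i \<in> ?F" "\<And>i. x ^ i - a (h i) \<in> P" by metis
    have "finite ?F" by (intro finite_PiE) auto
    then have "finite (range h)" using h(1) by (metis finite_subset image_subsetI)
    then have "\<not> inj h" using finite_imageD infinite_UNIV_nat by blast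
    then obtain i j where ij: "i < j" "h i = h j" by (metis injI nat_neq_iff)
    have "x ^ j - x ^ i \<in> P" using omod_diff[OF oP h(2)[of j] h(2)[of i]] ij by simp
    moreover have "x ^ j - x ^ i = x ^ i * (x * x ^ (j - i - 1) - 1)"
      using ij by (simp add: algebra_simps power_add[symmetric] power_Suc[symmetric] del: power_Suc)
    ultimately have "x ^ i \<in> P \<or> x * x ^ (j - i - 1) - 1 \<in> P"
      by (intro prime_ideal_mult[OF pr] OK_power OK_diff OK_mult OK_1 x(1)) simp
    then have "x * x ^ (j - i - 1) - 1 \<in> P" using prime_ideal_power[OF pr x(1)] x(2) by blast
    then show thesis using that[of "x ^ (j - i - 1)"] x by auto
  qed
qed

text \<open>Residue rings are fields, so one prime over p is never properly contained in another. An
  element of Q outside P can then be inverted modulo P.\<close>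

lemma comaximal:
  assumes P: "P \<in> primes_over" and Q: "Q \<in> primes_over" "P \<noteq> Q"
  obtains v where "v \<in> Q" "1 - v \<in> P"
proof -
  have pr: "prime_ideal K P" "prime_ideal K Q" using P Q by (auto simp: primes_over_def)
  note oP = prime_ideal_omod[OF pr(1)] and oQ = prime_ideal_omod[OF pr(2)]
  have "\<not> Q \<subseteq> P"
  proof
    assume QP: "Q \<subseteq> P"
    then obtain x where x: "x \<in> P" "x \<notin> Q" using Q(2) by blast
    then have "x \<in> OK K" using prime_ideal_OK[OF pr(1)] by blast
    then obtain y where y: "y \<in> OK K" "x * y - 1 \<in> Q" using inverse_mod_prime[OF Q(1)] x by blast
    then have "x * y - 1 \<in> P" using QP by blast
    from omod_diff[OF oP omod_mult2[OF oP y(1) x(1)] this] have "1 \<in> P" by simp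
    then show False using prime_ideal_1[OF pr(1)] by simp
  qed
  then obtain x where x: "x \<in> Q" "x \<notin> P" by blast
  then have "x \<in> OK K" using prime_ideal_OK[OF pr(2)] by blast
  then obtain y where y: "y \<in> OK K" "x * y - 1 \<in> P" using inverse_mod_prime[OF P] x by blast
  have "x * y \<in> Q" using x y by (intro omod_mult2[OF oQ]) 
  moreover have "1 - x * y \<in> P" using omod_uminus[OF oP y(2)] by simp
  ultimately show thesis using that by blast
qed

text \<open>A maximal proper ideal containing p, found by Zorn's lemma, is prime.\<close>

lemma primes_over_nonempty: "primes_over \<noteq> {}"
proof -
  let ?A = "{L. omod L \<and> L \<subseteq> OK K \<and> of_nat p \<in> L \<and> 1 \<notin> L}"
  have "\<exists>M\<in>?A. \<forall>X\<in>?A. M \<subseteq> X \<longrightarrow> X = M"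
  proof (rule subset_Zorn_nonempty)
    show "?A \<noteq> {}" using omod_Rad Rad_OK p_in_Rad one_notin_Rad[OF p] by blast
    fix C assume C: "C \<noteq> {}" "subset.chain ?A C"
    then have CA: "\<And>L. L \<in> C \<Longrightarrow> L \<in> ?A" and lin: "\<And>L M. L \<in> C \<Longrightarrow> M \<in> C \<Longrightarrow> L \<subseteq> M \<or> M \<subseteq> L"
      by (auto simp: subset.chain_def)
    have "omod (\<Union>C)" unfolding omod_def
    proof (intro conjI ballI)
      fix x y assume "x \<in> \<Union>C" "y \<in> \<Union>C"
      then obtain L M where LM: "L \<in> C" "x \<in> L" "M \<in> C" "y \<in> M" by auto
      then consider "L \<subseteq> M" | "M \<subseteq> L" using lin by blast
      then show "x + y \<in> \<Union>C" using LM CA omod_add by cases blast+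
    qed (use CA C(1) omod_K omod_0 omod_mult in blast)+
    then show "\<Union>C \<in> ?A" using CA C(1) by blast
  qed
  then obtain M where MA: "M \<in> ?A" and mx0: "\<forall>X\<in>?A. M \<subseteq> X \<longrightarrow> X = M" by (elim bexE)
  have M: "omod M" "M \<subseteq> OK K" "of_nat p \<in> M" "1 \<notin> M" using MA by simp_all
  have mx: "X = M" if "omod X" "X \<subseteq> OK K" "1 \<notin> X" "M \<subseteq> X" for X
    using mx0[rule_format, of X] that M(3) by auto
  have "b \<in> M" if ab: "a \<in> OK K" "b \<in> OK K" "a * b \<in> M" "a \<notin> M" for a b
  proof -
    \<comment> \<open>The ideal generated by M and a, which by maximality contains 1.\<close>
    let ?X = "{m + a * c | m c. m \<in> M \<and> c \<in> OK K}"
    have "omod ?X" unfolding omod_def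
    proof (intro conjI ballI)
      show "?X \<subseteq> K" using omod_K[OF M(1)] ab OK_imp_K by auto
      show "0 \<in> ?X" using omod_0[OF M(1)] by force
    next
      fix x y assume "x \<in> ?X" "y \<in> ?X"
      then obtain m c m' c' where *: "x = m + a * c" "m \<in> M" "c \<in> OK K" "y = m' + a * c'" "m' \<in> M" "c' \<in> OK K" by auto
      then have "x + y = (m + m') + a * (c + c')" by (simp add: algebra_simps)
      then show "x + y \<in> ?X" using * omod_add[OF M(1)] by blast
    next
      fix d x assume "d \<in> OK K" "x \<in> ?X"
      then obtain m c where *: "x = m + a * c" "m \<in> M" "c \<in> OK K" "d \<in> OK K" by auto
      then have "d * x = d * m + a * (d * c)" by (simp add: algebra_simps)
      then show "d * x \<in> ?X" using * omod_mult[OF M(1)] by blast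
    qed
    moreover have "?X \<subseteq> OK K" using M(2) ab by auto
    moreover have "M \<subseteq> ?X"
    proof
      fix x assume "x \<in> M"
      then show "x \<in> ?X" by (intro CollectI exI[of _ x] exI[of _ 0]) auto
    qed
    moreover have "?X \<noteq> M"
    proof -
      have "a \<in> ?X" using omod_0[OF M(1)] by (intro CollectI exI[of _ 0] exI[of _ 1]) auto
      then show ?thesis using ab by blast
    qed
    ultimately have "1 \<in> ?X" using mx by blast
    then obtain m c where mc: "1 = m + a * c" "m \<in> M" "c \<in> OK K" by auto
    then have "b = b * m + c * (a * b)" by (metis (no_types, lifting) distrib_left mult.assoc mult.commute mult.right_neutral)
    also have "\<dots> \<in> M" by (rule omod_add[OF M(1) omod_mult[OF M(1) ab(2) mc(2)] omod_mult[OF M(1) mc(3) ab(3)]])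
    finally show ?thesis .
  qed
  then have "prime_ideal K M" using prime_idealI[OF M(1,2,4,3)] by blast
  then show ?thesis using M by (auto simp: primes_over_def)
qed

text \<open>The conjugate prime under the inverse of \<sigma>, written as a preimage so that no
  inverse automorphism has to be named.\<close>

definition conj_ideal :: "complex set \<Rightarrow> (complex \<Rightarrow> complex) \<Rightarrow> complex set" where
  "conj_ideal P \<sigma> = {x \<in> OK K. \<sigma> x \<in> P}"

lemma conj_ideal_prime:
  assumes P: "P \<in> primes_over" and \<sigma>: "\<sigma> \<in> aut K"
  shows "conj_ideal P \<sigma> \<in> primes_over"
proof -
  have pr: "prime_ideal K P" and pP: "of_nat p \<in> P" using P by (auto simp: primes_over_def)
  note oP = prime_ideal_omod[OF pr] 
  have pc: "of_nat p \<in> conj_ideal P \<sigma>" using pP by (simp add: conj_ideal_def aut_of_nat[OF \<sigma>])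
  have "prime_ideal K (conj_ideal P \<sigma>)"
  proof (rule prime_idealI[OF _ _ _ pc])
    show "omod (conj_ideal P \<sigma>)"
      using omod_0[OF oP] omod_add[OF oP] omod_mult[OF oP aut_OK[OF \<sigma>]]
      by (auto simp: omod_def conj_ideal_def OK_imp_K aut_0[OF \<sigma>] aut_add[OF \<sigma>] aut_mult[OF \<sigma>])
    show "conj_ideal P \<sigma> \<subseteq> OK K" by (auto simp: conj_ideal_def)
    show "1 \<notin> conj_ideal P \<sigma>" using prime_ideal_1[OF pr] by (simp add: conj_ideal_def aut_1[OF \<sigma>])
    fix a b assume "a \<in> OK K" "b \<in> OK K" "a * b \<in> conj_ideal P \<sigma>" "a \<notin> conj_ideal P \<sigma>"
    then show "b \<in> conj_ideal P \<sigma>"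
      using prime_ideal_mult[OF pr aut_OK[OF \<sigma>, of a] aut_OK[OF \<sigma>, of b]]
      by (auto simp: conj_ideal_def aut_mult[OF \<sigma>] OK_imp_K)
  qed
  then show ?thesis using pc by (simp add: primes_over_def)
qed

text \<open>If Q were not conjugate to P, some x in Q would be 1 modulo every conjugate of P. Its
  norm lies in Q and in Z, hence in p Z and in P. So a conjugate \<sigma> x lies in P, that is, x
  lies in \<open>conj_ideal P \<sigma>\<close>, where it is congruent to 1.\<close>

lemma primes_over_orbit:
  assumes P: "P \<in> primes_over" and Q: "Q \<in> primes_over"
  shows "\<exists>\<sigma>\<in>aut K. Q = conj_ideal P \<sigma>"
proof (rule ccontr)
  assume *: "\<not> ?thesis"
  have pr: "prime_ideal K P" "prime_ideal K Q" using P Q by (auto simp: primes_over_def)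
  note oP = prime_ideal_omod[OF pr(1)] and oQ = prime_ideal_omod[OF pr(2)]
  have "\<exists>v. v \<in> conj_ideal P \<sigma> \<and> 1 - v \<in> Q" if \<sigma>: "\<sigma> \<in> aut K" for \<sigma>
  proof -
    have "Q \<noteq> conj_ideal P \<sigma>" using * \<sigma> by blast
    from comaximal[OF Q conj_ideal_prime[OF P \<sigma>] this] show ?thesis by metis
  qed
  then have "\<forall>\<sigma>\<in>aut K. \<exists>v. v \<in> conj_ideal P \<sigma> \<and> 1 - v \<in> Q" by simp
  then obtain v where "\<forall>\<sigma>\<in>aut K. v \<sigma> \<in> conj_ideal P \<sigma> \<and> 1 - v \<sigma> \<in> Q" by (rule bchoice[THEN exE])
  then have v: "\<And>\<sigma>. \<sigma> \<in> aut K \<Longrightarrow> v \<sigma> \<in> conj_ideal P \<sigma>" "\<And>\<sigma>. \<sigma> \<in> aut K \<Longrightarrow> 1 - v \<sigma> \<in> Q"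
    by simp_all
  have vO: "\<sigma> \<in> aut K \<Longrightarrow> v \<sigma> \<in> OK K" for \<sigma> using v(1) by (auto simp: conj_ideal_def)
  \<comment> \<open>Each \<open>v \<sigma>\<close> lies in its conjugate of P and is 1 modulo Q; so
    x lies in Q and is 1 modulo all conjugates.\<close>
  define x where "x = 1 - (\<Prod>\<sigma>\<in>aut K. v \<sigma>)"
  have xO: "x \<in> OK K" unfolding x_def using vO by (intro OK_diff OK_1 OK_prod)
  have "A \<subseteq> aut K \<Longrightarrow> 1 - (\<Prod>\<sigma>\<in>A. v \<sigma>) \<in> Q" if "finite A" for A
    using that
  proof (induction A rule: finite_induct)
    case empty
    then show ?case using omod_0[OF oQ] by simp
  next
    case (insert \<sigma> A)
    have "1 - (\<Prod>\<sigma>\<in>insert \<sigma> A. v \<sigma>) = (1 - v \<sigma>) + v \<sigma> * (1 - (\<Prod>\<sigma>\<in>A. v \<sigma>))"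
      using insert by (simp add: algebra_simps)
    also have "\<dots> \<in> Q" using insert v(2) vO by (intro omod_add[OF oQ] omod_mult[OF oQ]) auto
    finally show ?case .
  qed
  then have xQ: "x \<in> Q" unfolding x_def using finite_aut by blast
  have "nrm x = x * (\<Prod>\<sigma>\<in>aut K - {id}. \<sigma> x)"
    unfolding nrm_def using prod.remove[OF finite_aut id_aut, of "\<lambda>\<sigma>. \<sigma> x"] by simp
  also have "\<dots> \<in> Q" using aut_OK[OF _ xO] by (intro omod_mult2[OF oQ _ xQ] OK_prod) auto
  finally have nQ: "nrm x \<in> Q" .
  then have "nrm x \<in> \<int>" using fixed_prod[OF OK_imp_K[OF xO]] OK_Rats prime_ideal_OK[OF pr(2)] by blast
  then obtain z where z: "nrm x = of_int z" by (auto elim: Ints_cases)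
  have "int p dvd z" using int_in_proper_ideal[OF p oQ _ prime_ideal_1[OF pr(2)], of z] nQ z Q
    by (simp add: primes_over_def)
  then obtain w where "z = int p * w" by blast
  then have "nrm x = of_nat p * of_int w" using z by simp
  then have "nrm x \<in> smul (of_nat p) (OK K)" by (simp only: image_eqI[OF refl OK_of_int])
  then have "nrm x \<in> P" using primes_over_pO[OF P] by blast
  then obtain \<sigma> where \<sigma>: "\<sigma> \<in> aut K" "\<sigma> x \<in> P"
    using prime_ideal_prod[OF pr(1) finite_aut, of "\<lambda>\<sigma>. \<sigma> x"] aut_OK[OF _ xO] unfolding nrm_def by auto
  let ?C = "conj_ideal P \<sigma>"
  have prC: "prime_ideal K ?C" using conj_ideal_prime[OF P \<sigma>(1)] by (simp add: primes_over_def)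
  note oC = prime_ideal_omod[OF prC]
  have "(\<Prod>\<sigma>\<in>aut K. v \<sigma>) = v \<sigma> * (\<Prod>\<sigma>\<in>aut K - {\<sigma>}. v \<sigma>)" by (rule prod.remove[OF finite_aut \<sigma>(1)])
  also have "\<dots> \<in> ?C" using vO by (intro omod_mult2[OF oC _ v(1)[OF \<sigma>(1)]] OK_prod) auto
  finally have "(\<Prod>\<sigma>\<in>aut K. v \<sigma>) \<in> ?C" .
  moreover have "x \<in> ?C" using xO \<sigma> by (simp add: conj_ideal_def)
  ultimately have "x + (\<Prod>\<sigma>\<in>aut K. v \<sigma>) \<in> ?C" using omod_add[OF oC] by blast
  then show False using prime_ideal_1[OF prC] by (simp add: x_def)
qed

lemma finite_primes_over: "finite primes_over"
proof -
  obtain P where P: "P \<in> primes_over" using primes_over_nonempty by blast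
  then have "primes_over \<subseteq> conj_ideal P ` aut K" using primes_over_orbit by blast
  then show ?thesis using finite_aut finite_surj by blast
qed

text \<open>\<sigma> carries the cosets of the conjugate ideal bijectively to the cosets of
  P.\<close>

lemma norm_conj_ideal:
  assumes P: "P \<in> primes_over" and \<sigma>: "\<sigma> \<in> aut K"
  shows "ideal_norm K (conj_ideal P \<sigma>) = ideal_norm K P"
proof -
  have pr: "prime_ideal K P" using P by (auto simp: primes_over_def)
  obtain \<tau> where t: "\<tau> \<in> aut K" "\<sigma> \<circ> \<tau> = id" "\<tau> \<circ> \<sigma> = id" using aut_inv[OF \<sigma> subfield] .
  have st: "\<sigma> (\<tau> x) = x" "\<tau> (\<sigma> x) = x" for x using t by (metis comp_apply id_apply)+
  let ?C = "\<lambda>P. {(\<lambda>y. a + y) ` P | a. a \<in> OK K}"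
  have img: "\<sigma> ` ((\<lambda>y. a + y) ` conj_ideal P \<sigma>) = (\<lambda>y. \<sigma> a + y) ` P" if "a \<in> OK K" for a
  proof (intro equalityI subsetI)
    fix x assume "x \<in> \<sigma> ` ((\<lambda>y. a + y) ` conj_ideal P \<sigma>)"
    then obtain y where y: "y \<in> OK K" "\<sigma> y \<in> P" "x = \<sigma> (a + y)" by (auto simp: conj_ideal_def)
    then have "x = \<sigma> a + \<sigma> y" using that by (simp add: aut_add[OF \<sigma>] OK_imp_K)
    then show "x \<in> (\<lambda>y. \<sigma> a + y) ` P" using y by blast
  next
    fix x assume "x \<in> (\<lambda>y. \<sigma> a + y) ` P"
    then obtain y where y: "y \<in> P" "x = \<sigma> a + y" by auto
    then have yO: "y \<in> OK K" using prime_ideal_OK[OF pr] by blast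
    have "\<tau> y \<in> conj_ideal P \<sigma>" using y aut_OK[OF t(1) yO] by (simp add: conj_ideal_def st)
    moreover have "x = \<sigma> (a + \<tau> y)"
      using y that aut_OK[OF t(1) yO] by (simp add: aut_add[OF \<sigma>] OK_imp_K st)
    ultimately show "x \<in> \<sigma> ` ((\<lambda>y. a + y) ` conj_ideal P \<sigma>)" by blast
  qed
  have "(\<lambda>C. \<sigma> ` C) ` ?C (conj_ideal P \<sigma>) = ?C P"
  proof (intro equalityI subsetI)
    fix X assume "X \<in> (\<lambda>C. \<sigma> ` C) ` ?C (conj_ideal P \<sigma>)"
    then obtain a where "a \<in> OK K" "X = \<sigma> ` ((\<lambda>y. a + y) ` conj_ideal P \<sigma>)" by blast
    then show "X \<in> ?C P" using img[of a] aut_OK[OF \<sigma>, of a] by blast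
  next
    fix X assume "X \<in> ?C P"
    then obtain a where a: "a \<in> OK K" "X = (\<lambda>y. a + y) ` P" by blast
    then have "X = \<sigma> ` ((\<lambda>y. \<tau> a + y) ` conj_ideal P \<sigma>)" using img[OF aut_OK[OF t(1) a(1)]] by (simp add: st)
    then show "X \<in> (\<lambda>C. \<sigma> ` C) ` ?C (conj_ideal P \<sigma>)" using aut_OK[OF t(1) a(1)] by blast
  qed
  moreover have "inj \<sigma>" using aut_inj[OF \<sigma>] by (auto intro: injI)
  then have "inj_on (\<lambda>C. \<sigma> ` C) (?C (conj_ideal P \<sigma>))" by (intro inj_onI) (simp add: inj_image_eq_iff)
  ultimately show ?thesis unfolding ideal_norm_def by (metis (no_types, lifting) card_image)
qed

text \<open>Distinct primes over p are comaximal, so by the Chinese remainder argument their product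
  is their intersection.\<close>

lemma fold_primes:
  assumes "finite F" "F \<subseteq> primes_over"
  shows "Finite_Set.fold fid_mult (OK K) F = {x \<in> OK K. \<forall>P\<in>F. x \<in> P}"
  using assms
proof (induction F rule: finite_induct)
  case empty
  show ?case by simp
next
  case (insert P F)
  interpret comp_fun_commute fid_mult
    by standard (auto simp: fun_eq_iff fid_mult_left_commute)
  let ?I = "{x \<in> OK K. \<forall>P\<in>F. x \<in> P}"
  have pr: "prime_ideal K P" using insert by (auto simp: primes_over_def)
  note oP = prime_ideal_omod[OF pr]
  have oQ: "omod Q" if "Q \<in> F" for Q using that insert prime_ideal_omod by (auto simp: primes_over_def)
  have oI: "omod ?I" using oQ omod_K omod_0 omod_add omod_mult OK_imp_K unfolding omod_def by auto
  have Pp: "P \<in> primes_over" and Fp: "F \<subseteq> primes_over" and PF: "P \<notin> F" using insert by auto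
  have "\<exists>v. v \<in> Q \<and> 1 - v \<in> P" if Q: "Q \<in> F" for Q
  proof -
    have "P \<noteq> Q" "Q \<in> primes_over" using PF Fp Q by auto
    from comaximal[OF Pp this(2,1)] show ?thesis by metis
  qed
  then have "\<forall>Q\<in>F. \<exists>v. v \<in> Q \<and> 1 - v \<in> P" by simp
  then obtain v where v': "\<forall>Q\<in>F. v Q \<in> Q \<and> 1 - v Q \<in> P" by (rule bchoice[THEN exE])
  then have v: "\<And>Q. Q \<in> F \<Longrightarrow> v Q \<in> Q" "\<And>Q. Q \<in> F \<Longrightarrow> 1 - v Q \<in> P" by simp_all
  have vO: "v Q \<in> OK K" if Q: "Q \<in> F" for Q
  proof -
    have "prime_ideal K Q" using Q Fp by (auto simp: primes_over_def)
    from prime_ideal_OK[OF this] show ?thesis using v(1)[OF Q] by blast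
  qed
  \<comment> \<open>w lies in every member of F and is 1 modulo P.\<close>
  define w where "w = (\<Prod>Q\<in>F. v Q)"
  have "A \<subseteq> F \<Longrightarrow> 1 - (\<Prod>Q\<in>A. v Q) \<in> P" if "finite A" for A
    using that
  proof (induction A rule: finite_induct)
    case empty
    then show ?case using omod_0[OF oP] by simp
  next
    case (insert Q A)
    have "1 - (\<Prod>Q\<in>insert Q A. v Q) = (1 - v Q) + v Q * (1 - (\<Prod>Q\<in>A. v Q))"
      using insert by (simp add: algebra_simps)
    also have "\<dots> \<in> P" using insert v(2) vO by (intro omod_add[OF oP] omod_mult[OF oP]) auto
    finally show ?case .
  qed
  then have wP: "1 - w \<in> P" unfolding w_def using insert by blast
  have "w \<in> Q" if Q: "Q \<in> F" for Q
  proof -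
    have "w = v Q * (\<Prod>Q\<in>F - {Q}. v Q)" unfolding w_def by (rule prod.remove[OF \<open>finite F\<close> Q])
    also have "\<dots> \<in> Q" using vO by (intro omod_mult2[OF oQ[OF Q] _ v(1)[OF Q]] OK_prod) auto
    finally show ?thesis .
  qed
  then have wI: "w \<in> ?I" using vO by (auto simp: w_def intro: OK_prod)
  have "Finite_Set.fold fid_mult (OK K) (insert P F) = fid_mult P ?I"
    using insert by simp
  also have "\<dots> = {x \<in> OK K. \<forall>Q\<in>insert P F. x \<in> Q}"
  proof (intro equalityI subsetI)
    fix x assume x: "x \<in> fid_mult P ?I"
    have "x \<in> P" using fid_mult_subset_left[OF oP, of ?I] x by auto
    moreover have "x \<in> ?I" using fid_mult_subset_left[OF oI prime_ideal_OK[OF pr]] x by (auto simp: fid_mult_commute)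
    ultimately show "x \<in> {x \<in> OK K. \<forall>Q\<in>insert P F. x \<in> Q}" by auto
  next
    fix x assume x: "x \<in> {x \<in> OK K. \<forall>Q\<in>insert P F. x \<in> Q}"
    then have xP: "x \<in> P" and xI: "x \<in> ?I" by auto
    \<comment> \<open>In both summands the first factor lies in P and the second one in the
      intersection over F.\<close>
    have "x = x * w + (1 - w) * x" by (simp add: algebra_simps)
    also have "\<dots> \<in> fid_mult P ?I" by (intro fid_mult_add fid_mult_intro xP xI wP wI)
    finally show "x \<in> fid_mult P ?I" .
  qed
  finally show ?case .
qed

text \<open>The intersection of the primes over p is stable, contains p and is proper, so
  \<open>invariant_subset_Rad\<close> applies to it.\<close>

lemma Rad_eq_Inter: "{x \<in> OK K. \<forall>P\<in>primes_over. x \<in> P} = Rad p"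
proof
  show "Rad p \<subseteq> {x \<in> OK K. \<forall>P\<in>primes_over. x \<in> P}" using Rad_subset_prime Rad_OK by blast
  let ?L = "{x \<in> OK K. \<forall>P\<in>primes_over. x \<in> P}"
  have oQ: "omod Q" if "Q \<in> primes_over" for Q using that prime_ideal_omod by (auto simp: primes_over_def)
  have oL: "omod ?L" using oQ omod_K omod_0 omod_add omod_mult OK_imp_K unfolding omod_def by auto
  show "?L \<subseteq> Rad p"
  proof (rule invariant_subset_Rad[OF p oL])
    show "of_nat p \<in> ?L" by (auto simp: primes_over_def)
    show "1 \<notin> ?L" using primes_over_nonempty prime_ideal_1 by (auto simp: primes_over_def)
    show "\<forall>\<sigma>\<in>aut K. \<forall>x\<in>?L. \<sigma> x \<in> ?L"
    proof (intro ballI)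
      fix \<sigma> x assume *: "\<sigma> \<in> aut K" "x \<in> ?L"
      then have "\<forall>P\<in>primes_over. x \<in> conj_ideal P \<sigma>" using conj_ideal_prime by blast
      then show "\<sigma> x \<in> ?L" using * aut_OK[OF *(1), of x] by (auto simp: conj_ideal_def)
    qed
  qed auto
qed

lemma fold_primes_over: "Finite_Set.fold fid_mult (OK K) primes_over = Rad p"
  using fold_primes[OF finite_primes_over order_refl] Rad_eq_Inter by simp

text \<open>The primes over p are conjugate and share one norm; by \<open>uniq\<close> no prime
  elsewhere has this norm, so the product runs over exactly the primes above p.\<close>

lemma Pi_q_Rad:
  assumes P: "P \<in> primes_over"
    and uniq: "\<And>Q. prime_ideal K Q \<Longrightarrow> ideal_norm K Q = ideal_norm K P \<Longrightarrow> of_nat p \<in> Q"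
  shows "Pi_q K (ideal_norm K P) = Rad p"
proof -
  have "{Q. prime_ideal K Q \<and> ideal_norm K Q = ideal_norm K P} = primes_over"
  proof (intro equalityI subsetI)
    fix Q assume Q: "Q \<in> primes_over"
    then obtain \<sigma> where "\<sigma> \<in> aut K" "Q = conj_ideal P \<sigma>" using primes_over_orbit[OF P] by blast
    then show "Q \<in> {Q. prime_ideal K Q \<and> ideal_norm K Q = ideal_norm K P}"
      using norm_conj_ideal[OF P] Q by (auto simp: primes_over_def)
  qed (use uniq in \<open>auto simp: primes_over_def\<close>)
  then show ?thesis unfolding Pi_q_def by (simp add: fold_primes_over)
qed

text \<open>Write Rad = P Q with Q the product of the other primes over p, so (p) = P^e Q^e. If this
  were contained in P^(e+1), cancelling P^e would put Q^e inside P, although Q contains an element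
  that is 1 modulo P.\<close>

lemma ram_index_eq: "ram_index K p = ramif p"
  unfolding ram_index_def
proof (rule Greatest_equality)
  note dec = fid_pow_mono[OF Rad_subset_prime]
  obtain P where P: "P \<in> primes_over" using primes_over_nonempty by blast
  then have "smul (of_nat p) (OK K) \<subseteq> fid_pow K P (ramif p)"
    using dec[OF P, of "ramif p"] Rad_pow_ramif[OF p] by simp
  then show "\<exists>P. prime_ideal K P \<and> of_nat p \<in> P \<and> smul (of_nat p) (OK K) \<subseteq> fid_pow K P (ramif p)"
    using P by (auto simp: primes_over_def)
next
  fix j assume "\<exists>P. prime_ideal K P \<and> of_nat p \<in> P \<and> smul (of_nat p) (OK K) \<subseteq> fid_pow K P j"
  then obtain P where P: "P \<in> primes_over" and sub: "smul (of_nat p) (OK K) \<subseteq> fid_pow K P j"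
    by (auto simp: primes_over_def)
  have pr: "prime_ideal K P" using P by (simp add: primes_over_def)
  note oP = prime_ideal_omod[OF pr] and PO = prime_ideal_OK[OF pr]
  let ?e = "ramif p" and ?F = "primes_over - {P}"
  define Q where "Q = {x \<in> OK K. \<forall>P\<in>?F. x \<in> P}"
  interpret comp_fun_commute fid_mult
    by standard (auto simp: fun_eq_iff fid_mult_left_commute)
  have Q: "Q = Finite_Set.fold fid_mult (OK K) ?F"
    unfolding Q_def by (rule fold_primes[symmetric]) (use finite_primes_over in auto)
  have RPQ: "Rad p = fid_mult P Q"
  proof -
    have "Rad p = Finite_Set.fold fid_mult (OK K) (insert P ?F)"
      using fold_primes_over P by (simp add: insert_absorb)
    also have "\<dots> = fid_mult P (Finite_Set.fold fid_mult (OK K) ?F)"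
      by (rule fold_insert) (use finite_primes_over in auto)
    finally show ?thesis using Q by simp
  qed
  have oM: "omod M" if "M \<in> primes_over" for M using that prime_ideal_omod by (auto simp: primes_over_def)
  have oQ: "omod Q" unfolding Q_def using oM omod_K omod_0 omod_add omod_mult OK_imp_K unfolding omod_def by auto
  show "j \<le> ?e"
  proof (rule ccontr)
    assume "\<not> j \<le> ?e"
    then have "fid_pow K P j \<subseteq> fid_pow K P (Suc ?e)" by (intro fid_pow_decreasing oP PO) simp
    then have "fid_pow K (Rad p) ?e \<subseteq> fid_pow K P (Suc ?e)" using sub Rad_pow_ramif[OF p] by simp
    then have "fid_mult (fid_pow K P ?e) (fid_pow K Q ?e) \<subseteq> fid_mult (fid_pow K P ?e) P"
      by (simp add: RPQ fid_pow_mult fid_pow_Suc fid_mult_commute)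
    \<comment> \<open>P is invertible as a factor of the invertible radical: its inverse is Q times
      the inverse of the radical.\<close>
    moreover have "fid_mult (fid_pow K P ?e) (fid_pow K (fid_mult Q (inv_ideal K (Rad p))) ?e) = OK K"
    proof -
      have "fid_mult P (fid_mult Q (inv_ideal K (Rad p))) = OK K"
        using Rad_invertible[OF p] by (metis RPQ fid_mult_assoc)
      then show ?thesis by (metis fid_pow_mult fid_pow_OK)
    qed
    ultimately have QP: "fid_pow K Q ?e \<subseteq> P"
      by (intro cancel_subset[OF _ omod_fid_pow[OF oQ] oP])
    have "\<exists>v. v \<in> Q \<and> 1 - v \<in> P"
    proof -
      have "\<exists>v. v \<in> M \<and> 1 - v \<in> P" if M: "M \<in> ?F" for M
      proof -
        have "P \<noteq> M" "M \<in> primes_over" using M by auto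
        from comaximal[OF P this(2,1)] show ?thesis by metis
      qed
      then have "\<forall>M\<in>?F. \<exists>v. v \<in> M \<and> 1 - v \<in> P" by simp
      then obtain v where "\<forall>M\<in>?F. v M \<in> M \<and> 1 - v M \<in> P" by (rule bchoice[THEN exE])
      then have v: "\<And>M. M \<in> ?F \<Longrightarrow> v M \<in> M" "\<And>M. M \<in> ?F \<Longrightarrow> 1 - v M \<in> P" by simp_all
      have "\<not> Q \<subseteq> P"
      proof
        assume "Q \<subseteq> P"
        have vO: "v M \<in> OK K" if M: "M \<in> ?F" for M
        proof -
          have "prime_ideal K M" using M by (auto simp: primes_over_def)
          from prime_ideal_OK[OF this] show ?thesis using v(1)[OF M] by blast
        qed
        have "(\<Prod>M\<in>?F. v M) \<in> M" if M: "M \<in> ?F" for M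
        proof -
          have "(\<Prod>M\<in>?F. v M) = v M * (\<Prod>M\<in>?F - {M}. v M)"
            by (rule prod.remove[OF _ M]) (use finite_primes_over in auto)
          also have "\<dots> \<in> M" using vO M by (intro omod_mult2[OF oM _ v(1)[OF M]] OK_prod) auto
          finally show ?thesis .
        qed
        then have "(\<Prod>M\<in>?F. v M) \<in> Q" unfolding Q_def using vO by (auto intro: OK_prod)
        then have "(\<Prod>M\<in>?F. v M) \<in> P" using \<open>Q \<subseteq> P\<close> by blast
        then obtain M where "M \<in> ?F" "v M \<in> P"
          using prime_ideal_prod[OF pr, of ?F v] finite_primes_over vO by auto
        then have "(1 - v M) + v M \<in> P" using v(2) by (intro omod_add[OF oP]) auto
        then show False using prime_ideal_1[OF pr] by simp
      qed
      then obtain x where x: "x \<in> Q" "x \<notin> P" by blast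
      then have "x \<in> OK K" by (auto simp: Q_def)
      then obtain y where y: "y \<in> OK K" "x * y - 1 \<in> P" using inverse_mod_prime[OF P] x by blast
      then have "x * y \<in> Q" "1 - x * y \<in> P" using omod_mult2[OF oQ y(1) x(1)] omod_uminus[OF oP y(2)] by auto
      then show ?thesis by blast
    qed
    then obtain v where v: "v \<in> Q" "1 - v \<in> P" by blast
    have "v ^ ?e \<in> P" using fid_pow_power[OF v(1), of ?e] QP by blast
    then have "v \<in> P" using prime_ideal_power[OF pr] v by (auto simp: Q_def)
    then have "(1 - v) + v \<in> P" using v by (intro omod_add[OF oP])
    then show False using prime_ideal_1[OF pr] by simp
  qed
qed

end

text \<open>A nonzero element times its cofactor is a nonzero integer in P, and one of the prime
  factors of that integer lies in P.\<close>

lemma prime_ideal_over: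
  assumes P: "prime_ideal K P"
  obtains p where "prime p" "P \<in> primes_over p"
proof -
  have oP: "omod P" using P by (auto simp: prime_ideal_def frac_ideal_def omod_def)
  have P1: "1 \<notin> P" using omod_1[OF oP] P by (auto simp: prime_ideal_def)
  have PO: "P \<subseteq> OK K" using P by (simp add: prime_ideal_def)
  obtain x where x: "x \<in> P" "x \<noteq> 0" using P omod_0[OF oP] by (auto simp: prime_ideal_def frac_ideal_def)
  then obtain y m where ym: "y \<in> OK K" "x * y = of_int m" "m \<noteq> 0" using nrm_cofactor[of x] PO by blast
  have mP: "of_int m \<in> P" using omod_mult2[OF oP ym(1) x(1)] ym by simp
  then have "- of_int m \<in> P" by (rule omod_uminus[OF oP])
  then have "of_nat (nat \<bar>m\<bar>) \<in> P" using mP by (cases "m \<ge> 0") (auto simp: of_nat_nat abs_if)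
  moreover have "\<exists>p. prime p \<and> of_nat p \<in> P" if "of_nat k \<in> P" "k > 0" for k
    using that
  proof (induction k rule: less_induct)
    case (less k)
    have "k \<noteq> 1" using less P1 by auto
    then obtain q where q: "prime q" "q dvd k" using prime_factor_nat by blast
    then obtain l where l: "k = q * l" by blast
    then have "of_nat q \<in> P \<or> of_nat l \<in> P"
      using less P by (auto simp: prime_ideal_def)
    then show ?case
    proof
      assume "of_nat l \<in> P"
      moreover have "l < k" "l > 0" using l less q prime_gt_1_nat by auto
      ultimately show ?thesis using less.IH by blast
    qed (use q in blast)
  qed
  ultimately obtain p where "prime p" "of_nat p \<in> P" using ym(3) by (metis nat_0_iff not_gr_zero abs_le_zero_iff)
  then show thesis using that[of p] P by (auto simp: primes_over_def[of p])
qed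

lemma primes_over_unique:
  assumes "prime p" "prime q" "P \<in> primes_over p" "Q \<in> primes_over q" "ideal_norm K P = ideal_norm K Q"
  shows "p = q"
proof -
  obtain m l where "m \<ge> 1" "l \<ge> 1" "p ^ m = q ^ l"
    using norm_prime_power[OF assms(1,3)] norm_prime_power[OF assms(2,4)] assms(5) by metis
  then have "p dvd q ^ l" by (metis dvd_power One_nat_def Suc_le_lessD)
  then have "p dvd q" using assms(1) prime_dvd_power by blast
  then show ?thesis using assms by (simp add: primes_dvd_imp_eq)
qed

text \<open>The norm of a prime over p is a power of p, so primes of equal norm lie over the same p.
  Hence the radicals generate \<open>IG K\<close>.\<close>

lemma Pi_q_cases: "Pi_q K q = OK K \<or> (\<exists>p. prime p \<and> Pi_q K q = Rad p)"
proof (cases "\<exists>P. prime_ideal K P \<and> ideal_norm K P = q")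
  case False
  then have e: "{P. prime_ideal K P \<and> ideal_norm K P = q} = {}" by blast
  have "Pi_q K q = OK K" unfolding Pi_q_def e by simp
  then show ?thesis ..
next
  case True
  then obtain P where P: "prime_ideal K P" "ideal_norm K P = q" by blast
  then obtain p where p: "prime p" "P \<in> primes_over p" using prime_ideal_over by blast
  have "of_nat p \<in> Q" if "prime_ideal K Q" "ideal_norm K Q = ideal_norm K P" for Q
  proof -
    obtain p' where p': "prime p'" "Q \<in> primes_over p'" using prime_ideal_over[OF \<open>prime_ideal K Q\<close>] .
    then have "p = p'" using primes_over_unique[OF p(1) p'(1) p(2) p'(2)] that by simp
    then show ?thesis using p' by (auto simp: primes_over_def[OF p'(1)])
  qed
  then have "Pi_q K (ideal_norm K P) = Rad p" by (rule Pi_q_Rad[OF p])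
  then show ?thesis using p P by blast
qed

lemma Rad_in_IG:
  assumes p: "prime p" shows "Rad p \<in> IG K"
proof -
  obtain P where P: "P \<in> primes_over p" using primes_over_nonempty[OF p] by blast
  have "of_nat p \<in> Q" if "prime_ideal K Q" "ideal_norm K Q = ideal_norm K P" for Q
  proof -
    obtain p' where p': "prime p'" "Q \<in> primes_over p'" using prime_ideal_over[OF \<open>prime_ideal K Q\<close>] .
    then have "p = p'" using primes_over_unique[OF p(1) p'(1) P p'(2)] that by simp
    then show ?thesis using p' by (auto simp: primes_over_def[OF p'(1)])
  qed
  then have "Pi_q K (ideal_norm K P) = Rad p" by (rule Pi_q_Rad[OF p P])
  moreover have "ideal_norm K P \<ge> 1"
    using norm_prime_power[OF p P] prime_gt_0_nat[OF p] by auto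
  ultimately show ?thesis using IG_gen by metis
qed

end

section \<open>Quadratic and biquadratic fields\<close>

lemma subfield_Rats: "subfield \<rat>"
  by (auto simp: subfield_def)

text \<open>The sign change of s in L = F(s). It serves twice: for a quadratic field over Q and for
  the biquadratic field over a quadratic one.\<close>

lemma conjugation_aut:
  assumes L: "subfield L" and F: "subfield F" "F \<subseteq> L" and s: "s \<in> L" "s \<notin> F" "s * s \<in> F"
    and form: "\<And>z. z \<in> L \<Longrightarrow> \<exists>a\<in>F. \<exists>b\<in>F. z = a + b * s"
  shows "\<exists>\<sigma>\<in>aut L. \<forall>a\<in>F. \<forall>b\<in>F. \<sigma> (a + b * s) = a - b * s"
proof -
  interpret L: subfield_of_complex L by standard fact
  interpret F: subfield_of_complex F by standard fact
  have uniq: "a = a' \<and> b = b'" if "a \<in> F" "b \<in> F" "a' \<in> F" "b' \<in> F" "a + b * s = a' + b' * s" for a b a' b'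
  proof -
    have "(b - b') * s = a' - a" using that(5) by (simp add: algebra_simps)
    then have "b = b'"
    proof (rule_tac ccontr)
      assume "(b - b') * s = a' - a" "b \<noteq> b'"
      then have "s = (a' - a) / (b - b')" by (simp add: field_simps)
      then show False using that s F.K_divide F.K_diff by metis
    qed
    then show ?thesis using that by simp
  qed
  have "\<forall>z. \<exists>ab. z \<in> L \<longrightarrow> fst ab \<in> F \<and> snd ab \<in> F \<and> z = fst ab + snd ab * s"
    using form by fastforce
  then obtain h where h: "\<forall>z. z \<in> L \<longrightarrow> fst (h z) \<in> F \<and> snd (h z) \<in> F \<and> z = fst (h z) + snd (h z) * s"
    by (rule choice[THEN exE])
  define \<sigma> where "\<sigma> z = (if z \<in> L then fst (h z) - snd (h z) * s else z)" for z
  have inL: "a + b * s \<in> L" "a - b * s \<in> L" if "a \<in> F" "b \<in> F" for a b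
    using that F s by (auto intro!: L.K_add L.K_mult L.K_diff)
  have val: "\<sigma> (a + b * s) = a - b * s" if "a \<in> F" "b \<in> F" for a b
  proof -
    have "fst (h (a + b * s)) = a \<and> snd (h (a + b * s)) = b"
      using h inL(1)[OF that] that by (intro uniq) auto
    then show ?thesis using inL(1)[OF that] by (simp add: \<sigma>_def)
  qed
  have invol: "\<sigma> (\<sigma> z) = z \<and> \<sigma> z \<in> L" if z: "z \<in> L" for z
  proof -
    obtain a b where ab: "a \<in> F" "b \<in> F" "z = a + b * s" using form[OF z] by blast
    have "\<sigma> (a + (- b) * s) = a - (- b) * s" using ab by (intro val F.K_uminus)
    then show ?thesis using ab val[of a b] inL by simp
  qed
  have "\<sigma> \<in> aut L" unfolding aut_def
  proof (intro CollectI conjI ballI allI impI)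
    show "bij_betw \<sigma> L L" by (rule bij_betwI[of _ _ _ \<sigma>]) (use invol in auto)
    show "\<sigma> 1 = 1" using val[of 1 0] by simp
    fix x y assume "x \<in> L" "y \<in> L"
    then obtain a b c d where *: "a \<in> F" "b \<in> F" "x = a + b * s" "c \<in> F" "d \<in> F" "y = c + d * s"
      using form by metis
    have v: "\<sigma> x = a - b * s" "\<sigma> y = c - d * s" using * val by auto
    have "\<sigma> (x + y) = \<sigma> ((a + c) + (b + d) * s)" using * by (simp add: algebra_simps)
    also have "\<dots> = (a + c) - (b + d) * s" using * by (intro val F.K_add)
    finally show "\<sigma> (x + y) = \<sigma> x + \<sigma> y" unfolding v by (simp add: algebra_simps)
    have "\<sigma> (x * y) = \<sigma> ((a * c + b * d * (s * s)) + (a * d + b * c) * s)" using * by (simp add: algebra_simps)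
    also have "\<dots> = (a * c + b * d * (s * s)) - (a * d + b * c) * s"
      by (rule val[OF F.K_add[OF F.K_mult[OF *(1) *(4)] F.K_mult[OF F.K_mult[OF *(2) *(5)] s(3)]]
            F.K_add[OF F.K_mult[OF *(1) *(5)] F.K_mult[OF *(2) *(4)]]])
    finally show "\<sigma> (x * y) = \<sigma> x * \<sigma> y" unfolding v by (simp add: algebra_simps)
  qed (simp add: \<sigma>_def)
  then show ?thesis using val by blast
qed

lemma sum_atMost_2: "(\<Sum>i\<le>2::nat. f i) = f 0 + f 1 + f 2"
  by (simp add: numeral_2_eq_2)

lemma sum_atMost_4: "(\<Sum>i\<le>4::nat. f i) = f 0 + f 1 + f 2 + f 3 + f 4"
  by (simp add: eval_nat_numeral)

section \<open>Quadratic fields and their ramified primes\<close>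

locale quadratic_field =
  fixes k :: "complex set" and s :: complex and d :: int
  assumes sub: "subfield k" and dim2: "qdim_eq k 2" and s_in: "s \<in> k" and s_sq: "s * s = of_int d"
    and s_irr: "s \<notin> \<rat>" and sqf: "squarefree d"
begin

sublocale finite_dim_subfield k 2
  by standard (fact sub dim2)+

lemma quad_form:
  assumes z: "z \<in> k" shows "\<exists>a\<in>\<rat>. \<exists>b\<in>\<rat>. z = a + b * s"
proof -
  define f where "f i = (if i = 0 then 1 else if i = 1 then s else z)" for i :: nat
  have "f i \<in> k" for i using z s_in by (simp add: f_def)
  then obtain c :: "nat \<Rightarrow> rat" where c: "\<exists>i\<le>2. c i \<noteq> 0" "(\<Sum>i\<le>2. of_rat (c i) * f i) = 0"
    using rational_dependence[of f] by blast
  then have rel: "of_rat (c 0) + of_rat (c 1) * s + of_rat (c 2) * z = 0"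
    by (simp add: sum_atMost_2 f_def)
  have c2: "c 2 \<noteq> 0"
  proof
    assume 0: "c 2 = 0"
    have "c 1 = 0"
    proof (rule ccontr)
      assume "c 1 \<noteq> 0"
      then have "s = - of_rat (c 0) / of_rat (c 1)" using rel 0 by (simp add: field_simps eq_neg_iff_add_eq_0)
      then show False using s_irr by simp
    qed
    then have "c 0 = 0" using rel 0 by simp
    moreover have "i = 0 \<or> i = 1 \<or> i = 2" if "i \<le> 2" for i :: nat using that by auto
    ultimately show False using c(1) 0 \<open>c 1 = 0\<close> by metis
  qed
  have "z = (- of_rat (c 0) / of_rat (c 2)) + (- of_rat (c 1) / of_rat (c 2)) * s"
    using rel c2 by (simp add: field_simps eq_neg_iff_add_eq_0)
  then show ?thesis
    by (rule_tac bexI[of _ "- of_rat (c 0) / of_rat (c 2)"], rule_tac bexI[of _ "- of_rat (c 1) / of_rat (c 2)"]) auto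
qed

definition cj :: "complex \<Rightarrow> complex" where
  "cj = (SOME \<sigma>. \<sigma> \<in> aut k \<and> (\<forall>a\<in>\<rat>. \<forall>b\<in>\<rat>. \<sigma> (a + b * s) = a - b * s))"

lemma cj_aut: "cj \<in> aut k"
  and cj_form: "a \<in> \<rat> \<Longrightarrow> b \<in> \<rat> \<Longrightarrow> cj (a + b * s) = a - b * s"
proof -
  have "\<exists>\<sigma>\<in>aut k. \<forall>a\<in>\<rat>. \<forall>b\<in>\<rat>. \<sigma> (a + b * s) = a - b * s"
    by (rule conjugation_aut[OF sub subfield_Rats _ s_in s_irr])
       (use K_Rats s_sq quad_form in auto)
  then have "\<exists>\<sigma>. \<sigma> \<in> aut k \<and> (\<forall>a\<in>\<rat>. \<forall>b\<in>\<rat>. \<sigma> (a + b * s) = a - b * s)" by blast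
  from someI_ex[OF this] have "cj \<in> aut k \<and> (\<forall>a\<in>\<rat>. \<forall>b\<in>\<rat>. cj (a + b * s) = a - b * s)"
    unfolding cj_def .
  then show "cj \<in> aut k" "a \<in> \<rat> \<Longrightarrow> b \<in> \<rat> \<Longrightarrow> cj (a + b * s) = a - b * s" by auto
qed

lemma cj_s: "cj s = - s"
  using cj_form[of 0 1] by simp

lemma s_nz: "s \<noteq> 0"
  using s_irr by auto

lemma cj_fixed: "z \<in> k \<Longrightarrow> cj z = z \<Longrightarrow> z \<in> \<rat>"
proof -
  assume z: "z \<in> k" "cj z = z"
  obtain a b where ab: "a \<in> \<rat>" "b \<in> \<rat>" "z = a + b * s" using quad_form[OF z(1)] by blast
  then have "2 * (b * s) = 0" using cj_form[OF ab(1,2)] z(2) by (simp add: algebra_simps)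
  then have "b = 0" using s_nz by simp
  then show ?thesis using ab by simp
qed

lemma cj_cj: "z \<in> k \<Longrightarrow> cj (cj z) = z"
proof -
  assume z: "z \<in> k"
  obtain a b where ab: "a \<in> \<rat>" "b \<in> \<rat>" "z = a + b * s" using quad_form[OF z(1)] by blast
  then show ?thesis using cj_form[of a b] cj_form[of a "- b"] by simp
qed

text \<open>The square of s is rational, so an automorphism maps s to s or to -s.\<close>

lemma aut_eq: "aut k = {id, cj}"
proof
  show "{id, cj} \<subseteq> aut k" using id_aut cj_aut by auto
  show "aut k \<subseteq> {id, cj}"
  proof
    fix \<sigma> assume \<sigma>: "\<sigma> \<in> aut k"
    have val: "\<sigma> (a + b * s) = a + b * \<sigma> s" if "a \<in> \<rat>" "b \<in> \<rat>" for a b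
      using that s_in by (simp add: aut_add[OF \<sigma>] aut_mult[OF \<sigma>] aut_Rats[OF \<sigma>] K_Rats K_mult)
    have "\<sigma> s * \<sigma> s = s * s"
      using s_in s_sq by (metis aut_mult[OF \<sigma>] aut_of_int[OF \<sigma>])
    then have "(\<sigma> s - s) * (\<sigma> s + s) = 0" by (simp add: algebra_simps)
    then consider "\<sigma> s = s" | "\<sigma> s = - s" by (auto simp: eq_neg_iff_add_eq_0)
    then show "\<sigma> \<in> {id, cj}"
    proof cases
      case 1
      have "\<sigma> z = z" for z
        using quad_form[of z] val 1 aut_outside[OF \<sigma>, of z] by (cases "z \<in> k") auto
      then show ?thesis by (auto simp: fun_eq_iff)
    next
      case 2
      have "\<sigma> z = cj z" for z
        using quad_form[of z] val cj_form 2 aut_outside[OF \<sigma>, of z] aut_outside[OF cj_aut, of z]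
        by (cases "z \<in> k") auto
      then show ?thesis by (auto simp: fun_eq_iff)
    qed
  qed
qed

sublocale galois_field k 2
proof
  show "finite (aut k)" by (simp add: aut_eq)
  show "x \<in> \<rat>" if "x \<in> k" "\<And>\<sigma>. \<sigma> \<in> aut k \<Longrightarrow> \<sigma> x = x" for x
    using cj_fixed that cj_aut by blast
qed

lemma cj_neq_id: "cj \<noteq> id"
proof
  assume "cj = id"
  then have "- s = s" using cj_s by simp
  then show False using s_nz by simp
qed

lemma field_norm_eq: "field_norm k x = x * cj x"
  using cj_neq_id by (simp add: field_norm_def aut_eq)

lemma norm_Rats: "x \<in> k \<Longrightarrow> x * cj x \<in> \<rat>" and trace_Rats: "x \<in> k \<Longrightarrow> x + cj x \<in> \<rat>"
proof -
  assume x: "x \<in> k"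
  note c = aut_K[OF cj_aut x]
  show "x * cj x \<in> \<rat>" using x c by (intro cj_fixed K_mult) (simp_all add: aut_mult[OF cj_aut] cj_cj)
  show "x + cj x \<in> \<rat>" using x c by (intro cj_fixed K_add) (simp_all add: aut_add[OF cj_aut] cj_cj)
qed

lemma norm_Ints: "x \<in> OK k \<Longrightarrow> x * cj x \<in> \<int>" and trace_Ints: "x \<in> OK k \<Longrightarrow> x + cj x \<in> \<int>"
proof -
  assume x: "x \<in> OK k"
  note c = aut_OK[OF cj_aut x]
  show "x * cj x \<in> \<int>" by (rule OK_Rats[OF OK_mult[OF x c] norm_Rats[OF OK_imp_K[OF x]]])
  show "x + cj x \<in> \<int>" by (rule OK_Rats[OF OK_add[OF x c] trace_Rats[OF OK_imp_K[OF x]]])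
qed

text \<open>The order Z[\<delta>] has discriminant D prime to p; such a \<delta> certifies that p is
  unramified, and it can be reused in K over another quadratic subfield.\<close>

definition separating :: "nat \<Rightarrow> complex \<Rightarrow> int \<Rightarrow> bool" where
  "separating p \<delta> D \<longleftrightarrow> \<delta> \<in> OK k \<and> (\<delta> - cj \<delta>) * (\<delta> - cj \<delta>) = of_int D \<and> \<not> int p dvd D"

text \<open>The classical condition that p does not divide the discriminant, in terms of d;
  \<open>ramif_unramified\<close> proves that it means ramification index 1.\<close>

definition unramified :: "nat \<Rightarrow> bool" where
  "unramified p \<longleftrightarrow> (if p = 2 then d mod 4 = 1 else \<not> int p dvd d)"

lemma s_OK: "s \<in> OK k"
proof -
  have "algebraic_int (s ^ 2)" using s_sq by (simp add: power2_eq_square int_imp_algebraic_int)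
  then show ?thesis using algebraic_int_of_power[of s 2] s_in by (simp add: OK_iff)
qed

text \<open>For p = 2 take (1 + s) / 2, with D = d; for odd p take s, with D = 4 d.\<close>

lemma unramified_separating:
  assumes p: "prime p" and u: "unramified p" shows "\<exists>\<delta> D. separating p \<delta> D"
proof (cases "p = 2")
  case True
  then have "d mod 4 = 1" using u by (simp add: unramified_def)
  then obtain e where e: "d = 1 + 4 * e" by (metis add.commute mult_div_mod_eq)
  define \<delta> where "\<delta> = (1 + s) / 2"
  have "\<delta> ^ 2 = (\<Sum>i<2. of_int (if i = 0 then e else 1) * \<delta> ^ i)"
    using s_sq e by (simp add: \<delta>_def power2_eq_square numeral_2_eq_2 field_simps)
  then have "algebraic_int \<delta>" by (intro algebraic_int_if_power_relation) auto
  then have "\<delta> \<in> OK k" using s_in by (auto simp: OK_iff \<delta>_def intro!: K_divide K_add)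
  moreover have c: "cj \<delta> = (1 - s) / 2"
    using cj_form[of "1/2" "1/2"] by (simp add: \<delta>_def add_divide_distrib diff_divide_distrib)
  have "\<delta> - cj \<delta> = s" unfolding c by (simp add: \<delta>_def field_simps)
  then have "(\<delta> - cj \<delta>) * (\<delta> - cj \<delta>) = of_int d" using s_sq by simp
  moreover have "\<not> int p dvd d" using True e by presburger
  ultimately show ?thesis unfolding separating_def by blast
next
  case False
  have "(s - cj s) * (s - cj s) = of_int (4 * d)" using s_sq by (simp add: cj_s)
  moreover have "\<not> int p dvd 4 * d"
  proof
    assume "int p dvd 4 * d"
    then have "int p dvd 4" using p u False by (simp add: unramified_def prime_dvd_mult_iff)
    then have "int p dvd int (2 ^ 2)" by simp
    then have "p dvd 2 ^ 2" by (simp only: int_dvd_int_iff)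
    then have "p dvd 2" using p prime_dvd_power by blast
    then show False using False p by (metis primes_dvd_imp_eq two_is_prime_nat)
  qed
  ultimately show ?thesis using s_OK unfolding separating_def by blast
qed

text \<open>Cramer's rule: D x = z + y \<delta>, where y = (x - x')(\<delta> - \<delta>') and z are
  fixed by conjugation. For x in the radical, y and z are integers in the radical, so multiples of
  p. As D is prime to p, x itself is a multiple of p.\<close>

lemma separating_Rad:
  assumes p: "prime p" and D: "separating p \<delta> D" shows "Rad p = smul (of_nat p) (OK k)"
proof
  show "smul (of_nat p) (OK k) \<subseteq> Rad p" by (rule pO_subset_Rad)
  show "Rad p \<subseteq> smul (of_nat p) (OK k)"
  proof
    fix x assume x: "x \<in> Rad p"
    note oR = omod_Rad[of p]
    note R1 = one_notin_Rad[OF p]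
    have xO: "x \<in> OK k" and xk: "x \<in> k" using x Rad_OK OK_imp_K by blast+
    have \<delta>: "\<delta> \<in> OK k" "(\<delta> - cj \<delta>) * (\<delta> - cj \<delta>) = of_int D" "\<not> int p dvd D" using D by (auto simp: separating_def)
    define \<Delta> where "\<Delta> = \<delta> - cj \<delta>"
    have \<Delta>O: "\<Delta> \<in> OK k" unfolding \<Delta>_def using \<delta> aut_OK[OF cj_aut] by auto
    have nz: "\<Delta> \<noteq> 0" using \<delta> by (auto simp: \<Delta>_def)
    define y where "y = (x - cj x) * \<Delta>"
    have "x - cj x \<in> Rad p" using x aut_Rad[OF cj_aut] by (intro omod_diff[OF oR])
    then have yR: "y \<in> Rad p" unfolding y_def using \<Delta>O by (intro omod_mult2[OF oR])
    have "cj y = (cj x - x) * (cj \<delta> - \<delta>)" unfolding y_def \<Delta>_def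
      using xk OK_imp_K[OF \<delta>(1)] aut_K[OF cj_aut]
      by (simp add: aut_mult[OF cj_aut] aut_diff[OF cj_aut] cj_cj K_diff)
    then have "cj y = y" by (simp add: y_def \<Delta>_def algebra_simps)
    then have "y \<in> \<rat>" using cj_fixed yR Rad_OK OK_imp_K by blast
    then obtain b where b: "y = of_int b" using yR Rad_OK OK_Rats by (blast elim: Ints_cases)
    have pb: "int p dvd b" using int_in_proper_ideal[OF p oR p_in_Rad R1] yR b by simp
    define z where "z = of_int D * x - of_int b * \<delta>"
    have zR: "z \<in> Rad p" unfolding z_def using x yR \<delta>(1) b
      by (intro omod_diff[OF oR] omod_mult[OF oR OK_of_int] omod_mult2[OF oR]) auto
    have "cj z = z"
    proof -
      have "z - cj z = of_int D * (x - cj x) - of_int b * \<Delta>"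
        unfolding z_def \<Delta>_def using xk OK_imp_K[OF \<delta>(1)] 
        by (simp add: aut_mult[OF cj_aut] aut_diff[OF cj_aut] aut_of_int[OF cj_aut] K_mult algebra_simps)
      also have "\<dots> = 0" using \<delta>(2) b unfolding y_def \<Delta>_def[symmetric] by (metis diff_self mult.assoc mult.commute)
      finally show ?thesis by simp
    qed
    then have "z \<in> \<rat>" using cj_fixed zR Rad_OK OK_imp_K by blast
    then obtain a where a: "z = of_int a" using zR Rad_OK OK_Rats by (blast elim: Ints_cases)
    have pa: "int p dvd a" using int_in_proper_ideal[OF p oR p_in_Rad R1] zR a by simp
    obtain a' where a': "a = int p * a'" using pa by blast
    obtain b' where b': "b = int p * b'" using pb by blast
    note ab = a' b'
    have "of_int D * x = of_nat p * (of_int a' + of_int b' * \<delta>)"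
      using a ab b unfolding z_def by (simp add: algebra_simps)
    then have Dx: "of_int D * x \<in> smul (of_nat p) (OK k)" using \<delta>(1) by (intro image_eqI[OF _ OK_add[OF OK_of_int OK_mult[OF OK_of_int]]])
    have "coprime (int p) D" using p \<delta>(3) by (simp add: prime_imp_coprime)
    then obtain u v where "u * int p + v * D = 1" by (metis bezout_int coprime_imp_gcd_eq_1)
    then have "of_int (u * int p + v * D) = (1::complex)" by simp
    then have "x = (of_int u * of_nat p + of_int v * of_int D) * x" by simp
    then have "x = of_nat p * (of_int u * x) + of_int v * (of_int D * x)" by (simp add: algebra_simps)
    also have "\<dots> \<in> smul (of_nat p) (OK k)"
      by (rule omod_add[OF omod_pO imageI[OF OK_mult[OF OK_of_int xO]] omod_mult[OF omod_pO OK_of_int Dx]])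
    finally show "x \<in> smul (of_nat p) (OK k)" .
  qed
qed

lemma ramif_eq_1_iff: "prime p \<Longrightarrow> ramif p = 1 \<longleftrightarrow> Rad p = smul (of_nat p) (OK k)"
proof
  assume p: "prime p"
  show "ramif p = 1 \<Longrightarrow> Rad p = smul (of_nat p) (OK k)"
    using Rad_pow_ramif[OF p] by (simp add: fid_pow_1 omod_Rad)
  assume R: "Rad p = smul (of_nat p) (OK k)"
  show "ramif p = 1"
  proof (rule ccontr)
    assume "ramif p \<noteq> 1"
    then have "Suc 1 \<le> ramif p" using ramif_ge_1[OF p] by simp
    then have "fid_pow k (Rad p) (ramif p) \<subseteq> fid_pow k (Rad p) (Suc 1)"
      by (rule fid_pow_decreasing[OF omod_Rad Rad_OK])
    then have "fid_pow k (Rad p) 1 \<subseteq> fid_pow k (Rad p) (Suc 1)"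
      using Rad_pow_ramif[OF p] R fid_pow_1[OF omod_Rad, of p] by simp
    then show False using Rad_pow_strict[OF p] by blast
  qed
qed

lemma ramif_cases: "prime p \<Longrightarrow> ramif p = 1 \<or> ramif p = 2"
  using ramif_le[of p] ramif_ge_1[of p] by linarith

text \<open>Its norm would be (1 - d) / 4, which is not an integer.\<close>

lemma half_not_integral:
  assumes "d mod 4 = 3" shows "(1 + s) / 2 \<notin> OK k"
proof
  let ?y = "(1 + s) / 2"
  assume y: "?y \<in> OK k"
  have c: "cj ?y = (1 - s) / 2"
    using cj_form[of "1/2" "1/2"] by (simp add: add_divide_distrib diff_divide_distrib)
  have "?y * cj ?y = (1 - s * s) / 4" unfolding c by (simp add: field_simps)
  then have "?y * cj ?y = (1 - of_int d) / 4" by (simp only: s_sq)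
  then have "(1 - of_int d) / 4 \<in> (\<int> :: complex set)" using norm_Ints[OF y] by (simp only:)
  then obtain z where "(1 - of_int d) / 4 = (of_int z :: complex)" by (rule Ints_cases)
  then have "of_int (1 - d) = (of_int (4 * z) :: complex)" by (simp add: field_simps)
  then have "1 - d = 4 * z" using of_int_eq_iff by blast
  then show False using assms by presburger
qed

lemma d_mod_4: "d mod 4 = 1 \<or> d mod 4 = 2 \<or> d mod 4 = 3"
proof -
  have "\<not> 4 dvd d"
  proof
    assume "4 dvd d"
    then have "(2::int) ^ 2 dvd d" by simp
    then show False using squarefreeD[OF sqf, of 2] by simp
  qed
  then show ?thesis by presburger
qed

text \<open>If p divides d, then s is nilpotent modulo p; if p = 2 and d = 3 modulo 4, then 1 + s
  is. Were the radical (p), then s / p or (1 + s) / 2 would be integral, which squarefreeness of d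
  and \<open>half_not_integral\<close> exclude.\<close>

lemma ramif_unramified: "prime p \<Longrightarrow> ramif p = 1 \<longleftrightarrow> unramified p"
proof
  assume p: "prime p"
  show "unramified p \<Longrightarrow> ramif p = 1" using unramified_separating[OF p] separating_Rad[OF p] ramif_eq_1_iff[OF p] by blast
  assume "ramif p = 1"
  then have R: "Rad p = smul (of_nat p) (OK k)" using ramif_eq_1_iff[OF p] by simp
  have p0: "(of_nat p :: complex) \<noteq> 0" using p by (auto dest: prime_gt_0_nat)
  show "unramified p"
  proof (rule ccontr)
    assume nu: "\<not> unramified p"
    have "int p dvd d \<or> p = 2 \<and> d mod 4 = 3"
    proof (cases "p = 2")
      case True
      then have "d mod 4 \<noteq> 1" using nu by (simp add: unramified_def)
      then have "2 dvd d \<or> d mod 4 = 3" using d_mod_4 by presburger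
      then show ?thesis using True by simp
    next
      case False
      then show ?thesis using nu by (simp add: unramified_def)
    qed
    then consider "int p dvd d" | "p = 2" "d mod 4 = 3" by blast
    then show False
    proof cases
      case 1
      then obtain e where e: "d = int p * e" by blast
      then have "s ^ 2 = of_nat p * of_int e" using s_sq by (simp add: power2_eq_square)
      then have "s ^ 2 \<in> smul (of_nat p) (OK k)" by (simp only: image_eqI[OF refl OK_of_int])
      then have "s \<in> Rad p" using s_OK unfolding Rad_def by (auto intro!: exI[of _ "2::nat"])
      then obtain y where y: "y \<in> OK k" "s = of_nat p * y" using R by blast
      have "of_nat p * of_int e = (of_nat p * y) * (of_nat p * y)"
        using s_sq y(2) e by (metis of_int_mult of_int_of_nat_eq)
      also have "\<dots> = of_nat p * (of_nat p * (y * y))" by (simp add: ac_simps)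
      finally have "of_nat p * of_int e = of_nat p * (of_nat p * (y * y))" .
      then have "of_int e = of_nat p * (y * y)" using p0 by simp
      moreover have "of_nat p * (y * y) \<in> smul (of_nat p) (OK k)" using y by blast
      ultimately have "int p dvd e" using of_int_in_pO[of p e] prime_gt_0_nat[OF p] by simp
      then have "int p ^ 2 dvd d" using e by (auto simp: power2_eq_square)
      then have "int p dvd 1" by (rule squarefreeD[OF sqf])
      then have "p = 1" by simp
      then show False using p by simp
    next
      case 2
      have "4 dvd 1 + d" using 2 by presburger
      then obtain f where f: "1 + d = 4 * f" by blast
      have sO: "1 + s \<in> OK k" using s_OK by auto
      have "(1 + s) ^ 2 = of_int (1 + d) + 2 * s" using s_sq by (simp add: power2_eq_square algebra_simps)
      also have "\<dots> = of_nat p * (of_int (2 * f) + s)" unfolding f using 2 by simp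
      finally have "(1 + s) ^ 2 \<in> smul (of_nat p) (OK k)" using s_OK
        by (intro image_eqI[OF _ OK_add[OF OK_of_int]])
      then have "1 + s \<in> Rad p" using sO unfolding Rad_def by (auto intro!: exI[of _ "2::nat"])
      then obtain y where y: "y \<in> OK k" "1 + s = of_nat p * y" using R by blast
      then have "y = (1 + s) / 2" using 2 by simp
      then show False using half_not_integral 2 y by simp
    qed
  qed
qed

lemma finite_ramified: "finite {p. prime p \<and> ramif p = 2}"
proof -
  have "{p. prime p \<and> ramif p = 2} \<subseteq> {..nat \<bar>d\<bar> + 2}"
  proof
    fix p assume p: "p \<in> {p. prime p \<and> ramif p = 2}"
    then have "\<not> unramified p" using ramif_unramified[of p] by simp
    then have "p = 2 \<or> int p dvd d" by (auto simp: unramified_def split: if_splits)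
    moreover have "d \<noteq> 0" using s_sq s_nz by auto
    ultimately have "p = 2 \<or> int p \<le> \<bar>d\<bar>" using dvd_imp_le_int[of d "int p"] by auto
    then show "p \<in> {..nat \<bar>d\<bar> + 2}" by auto
  qed
  then show ?thesis using finite_subset by blast
qed

end

section \<open>Extension of ideals; the biquadratic field and its Galois group\<close>

lemma fid_mult_mult:
  "fid_mult (fid_mult A B) (fid_mult C D) = fid_mult (fid_mult A C) (fid_mult B D)"
  by (simp only: fid_mult_assoc fid_mult_left_commute[of B C])

lemma extend_pow:
  assumes k: "subfield k" and K: "subfield K" and kK: "k \<subseteq> K"
  shows "fid_pow K (fid_mult I (OK K)) e = fid_mult (fid_pow k I e) (OK K)"
proof -
  interpret k: subfield_of_complex k by standard fact
  interpret K: subfield_of_complex K by standard fact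
  have OO: "OK k \<subseteq> OK K" using kK by (auto simp: OK_def)
  show ?thesis
  proof (induction e)
    case 0
    have "fid_mult (OK k) (OK K) \<subseteq> OK K"
      by (rule fid_mult_least) (use OO in auto)
    moreover have "OK K \<subseteq> fid_mult (OK k) (OK K)"
    proof
      fix x assume "x \<in> OK K"
      then show "x \<in> fid_mult (OK k) (OK K)" using fid_mult_intro[OF k.OK_1, of x "OK K"] by simp
    qed
    ultimately show ?case by simp
  next
    case (Suc e)
    have "fid_mult (fid_mult I (OK K)) (fid_mult X (OK K)) = fid_mult (fid_mult I X) (fid_mult (OK K) (OK K))" for X
      by (simp only: fid_mult_assoc fid_mult_left_commute[of "OK K" X])
    then show ?case
      by (simp add: Suc K.fid_pow_Suc k.fid_pow_Suc K.fid_mult_OK[OF K.omod_OK])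
  qed
qed

lemma extend_omod:
  assumes k: "subfield k" and K: "subfield K" and kK: "k \<subseteq> K" and I: "subfield_of_complex.omod k I"
  shows "subfield_of_complex.omod K (fid_mult I (OK K))"
proof -
  interpret k: subfield_of_complex k by standard fact
  interpret K: subfield_of_complex K by standard fact
  have "I \<subseteq> K" using I kK k.omod_K by blast
  then show ?thesis using K.omod_fid_mult[OF K.omod_OK] by (simp add: fid_mult_commute)
qed

locale quadratic_pair =
  q1: quadratic_field k1 s1 d1 + q2: quadratic_field k2 s2 d2 + K: finite_dim_subfield K 4
  for K k1 k2 :: "complex set" and s1 s2 :: complex and d1 d2 :: int +
  assumes sub1: "k1 \<subseteq> K" and sub2: "k2 \<subseteq> K" and ne12: "k1 \<noteq> k2"
begin

text \<open>If s2 were in k1, then s1 would be in k2 as well, and the two fields would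
  coincide.\<close>

lemma s2_notin_k1: "s2 \<notin> k1"
proof
  assume s2: "s2 \<in> k1"
  have "k2 \<subseteq> k1"
  proof
    fix z assume "z \<in> k2"
    then obtain a b where "a \<in> \<rat>" "b \<in> \<rat>" "z = a + b * s2" using q2.quad_form by blast
    then show "z \<in> k1" using q1.K_add[OF q1.K_Rats q1.K_mult[OF q1.K_Rats s2]] by simp
  qed
  obtain a b where ab: "a \<in> \<rat>" "b \<in> \<rat>" "s2 = a + b * s1" using q1.quad_form[OF s2] by blast
  have "b \<noteq> 0" using ab q2.s_irr by auto
  then have s1': "s1 = (s2 - a) / b" using ab by (simp add: field_simps)
  have "(s2 - a) / b \<in> k2"
    by (rule q2.K_divide[OF q2.K_diff[OF q2.s_in q2.K_Rats[OF ab(1)]] q2.K_Rats[OF ab(2)]])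
  then have s1: "s1 \<in> k2" by (simp only: s1'[symmetric])
  have "k1 \<subseteq> k2"
  proof
    fix z assume "z \<in> k1"
    then obtain a b where "a \<in> \<rat>" "b \<in> \<rat>" "z = a + b * s1" using q1.quad_form by blast
    then show "z \<in> k2" using q2.K_add[OF q2.K_Rats q2.K_mult[OF q2.K_Rats s1]] by simp
  qed
  then show False using \<open>k2 \<subseteq> k1\<close> ne12 by blast
qed

text \<open>The elements 1, s1, s2, s1 s2 and z are dependent over Q, while the first four are
  independent because s2 is not in k1.\<close>

lemma form12:
  assumes z: "z \<in> K" shows "\<exists>a\<in>k1. \<exists>b\<in>k1. z = a + b * s2"
proof -
  define f where "f i = (if i = 0 then 1 else if i = 1 then s1 else if i = 2 then s2 else if i = 3 then s1 * s2 else z)" for i :: nat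
  have "f i \<in> K" for i using z q1.s_in q2.s_in sub1 sub2 K.K_mult by (auto simp: f_def)
  then obtain c :: "nat \<Rightarrow> rat" where c: "\<exists>i\<le>4. c i \<noteq> 0" "(\<Sum>i\<le>4. of_rat (c i) * f i) = 0"
    using K.rational_dependence[of f] by blast
  define u v where "u = of_rat (c 0) + of_rat (c 1) * s1" and "v = of_rat (c 2) + of_rat (c 3) * s1"
  have uv: "u \<in> k1" "v \<in> k1" unfolding u_def v_def using q1.s_in by (auto intro!: q1.K_add q1.K_mult)
  have rel: "u + v * s2 + of_rat (c 4) * z = 0"
    using c(2) by (simp add: sum_atMost_4 f_def u_def v_def algebra_simps)
  have zero: "x = 0 \<and> y = 0" if "of_rat x + of_rat y * s1 = 0" for x y :: rat
  proof -
    have "y = 0"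
    proof (rule ccontr)
      assume "y \<noteq> 0"
      then have "s1 = - of_rat x / of_rat y" using that by (simp add: field_simps eq_neg_iff_add_eq_0)
      then show False using q1.s_irr by simp
    qed
    then show ?thesis using that by simp
  qed
  have c4: "c 4 \<noteq> 0"
  proof
    assume 0: "c 4 = 0"
    have "v = 0"
    proof (rule ccontr)
      assume "v \<noteq> 0"
      then have "s2 = - u / v" using rel 0 by (simp add: field_simps eq_neg_iff_add_eq_0)
      then show False using s2_notin_k1 uv by (auto intro: q1.K_divide q1.K_uminus)
    qed
    then have "u = 0" using rel 0 by simp
    then have "c 0 = 0 \<and> c 1 = 0" "c 2 = 0 \<and> c 3 = 0" using zero \<open>v = 0\<close> unfolding u_def v_def by blast+
    moreover have "i = 0 \<or> i = 1 \<or> i = 2 \<or> i = 3 \<or> i = 4" if "i \<le> 4" for i :: nat using that by linarith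
    ultimately show False using c(1) 0 by metis
  qed
  have "z = (- u / of_rat (c 4)) + (- v / of_rat (c 4)) * s2"
    using rel c4 by (simp add: field_simps eq_neg_iff_add_eq_0)
  moreover have "- u / of_rat (c 4) \<in> k1" "- v / of_rat (c 4) \<in> k1" using uv by (auto intro!: q1.K_divide q1.K_uminus)
  ultimately show ?thesis by blast
qed

end

text \<open>The relation \<open>prod_s\<close> ties the third square root to the other two and is
  symmetric in the three fields, so \<open>rotate\<close> and \<open>swap\<close> transfer each
  lemma from one index to the others.\<close>

locale biquadratic_field =
  q1: quadratic_field k1 s1 d1 + q2: quadratic_field k2 s2 d2 + q3: quadratic_field k3 s3 d3 +
  K: finite_dim_subfield K 4
  for K k1 k2 k3 :: "complex set" and s1 s2 s3 :: complex and d1 d2 d3 m :: int +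
  assumes finK: "finite (aut K)"
    and sub1: "k1 \<subseteq> K" and sub2: "k2 \<subseteq> K" and sub3: "k3 \<subseteq> K"
    and ne12: "k1 \<noteq> k2" and ne13: "k1 \<noteq> k3" and ne23: "k2 \<noteq> k3"
    and prod_s: "s1 * s2 * s3 = of_int m"
begin

sublocale quadratic_pair K k1 k2 s1 s2 d1 d2
  by unfold_locales (fact sub1 sub2 ne12)+

lemma rotate: "biquadratic_field K k2 k3 k1 s2 s3 s1 d2 d3 d1 m"
  using sub1 sub2 sub3 ne12 ne13 ne23 prod_s finK
  by (intro biquadratic_field.intro biquadratic_field_axioms.intro
      q1.quadratic_field_axioms q2.quadratic_field_axioms q3.quadratic_field_axioms K.finite_dim_subfield_axioms)
    (auto simp: mult.commute mult.left_commute)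

lemma swap: "biquadratic_field K k2 k1 k3 s2 s1 s3 d2 d1 d3 m"
  using sub1 sub2 sub3 ne12 ne13 ne23 prod_s finK
  by (intro biquadratic_field.intro biquadratic_field_axioms.intro
      q1.quadratic_field_axioms q2.quadratic_field_axioms q3.quadratic_field_axioms K.finite_dim_subfield_axioms)
    (auto simp: mult.commute mult.left_commute)

lemma s_K: "s1 \<in> K" "s2 \<in> K" "s3 \<in> K"
  using sub1 sub2 sub3 q1.s_in q2.s_in q3.s_in by auto

text \<open>Conjugation of K over k1; its effect on s3 is read off from s3 = m / (s1 s2).\<close>

lemma ex_tau: "\<exists>\<sigma>. \<sigma> \<in> aut K \<and> (\<forall>x\<in>k1. \<sigma> x = x) \<and> \<sigma> s2 = - s2 \<and> \<sigma> s3 = - s3"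
proof -
  have "s2 * s2 \<in> k1" using q2.s_sq by simp
  then obtain \<sigma> where \<sigma>: "\<sigma> \<in> aut K" and v: "\<forall>a\<in>k1. \<forall>b\<in>k1. \<sigma> (a + b * s2) = a - b * s2"
    using conjugation_aut[OF K.subfield q1.sub sub1 s_K(2) s2_notin_k1 _ form12] by blast
  have fix1: "\<sigma> x = x" if "x \<in> k1" for x using v[rule_format, OF that q1.K_0] by simp
  have s2: "\<sigma> s2 = - s2" using v[rule_format, OF q1.K_0 q1.K_1] by simp
  have nz: "s1 \<noteq> 0" "s2 \<noteq> 0" using q1.s_nz q2.s_nz by auto
  have s3: "s3 = of_int m / (s1 * s2)" using prod_s nz by (simp add: field_simps)
  have "\<sigma> s3 = of_int m / (s1 * - s2)"
    unfolding s3 using s_K K.K_mult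
    by (simp add: K.aut_divide[OF \<sigma>] K.aut_mult[OF \<sigma>] K.aut_of_int[OF \<sigma>] fix1[OF q1.s_in] s2)
  then have "\<sigma> s3 = - s3" using s3 by simp
  then show ?thesis using \<sigma> fix1 s2 by blast
qed

text \<open>The three nontrivial automorphisms, \<open>tau1\<close> fixing k1 and so on. The
  conditions are listed in cyclic order, so that \<open>ex_tau\<close> under \<open>rotate\<close>
  has literally the form needed.\<close>

definition tau1 where "tau1 = (SOME \<sigma>. \<sigma> \<in> aut K \<and> (\<forall>x\<in>k1. \<sigma> x = x) \<and> \<sigma> s2 = - s2 \<and> \<sigma> s3 = - s3)"
definition tau2 where "tau2 = (SOME \<sigma>. \<sigma> \<in> aut K \<and> (\<forall>x\<in>k2. \<sigma> x = x) \<and> \<sigma> s3 = - s3 \<and> \<sigma> s1 = - s1)"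
definition tau3 where "tau3 = (SOME \<sigma>. \<sigma> \<in> aut K \<and> (\<forall>x\<in>k3. \<sigma> x = x) \<and> \<sigma> s1 = - s1 \<and> \<sigma> s2 = - s2)"

lemma tau1: "tau1 \<in> aut K" "\<And>x. x \<in> k1 \<Longrightarrow> tau1 x = x" "tau1 s2 = - s2" "tau1 s3 = - s3"
  using someI_ex[OF ex_tau] unfolding tau1_def[symmetric] by auto

lemma tau2: "tau2 \<in> aut K" "\<And>x. x \<in> k2 \<Longrightarrow> tau2 x = x" "tau2 s3 = - s3" "tau2 s1 = - s1"
  using someI_ex[OF biquadratic_field.ex_tau[OF rotate]] unfolding tau2_def[symmetric] by auto

lemma tau3: "tau3 \<in> aut K" "\<And>x. x \<in> k3 \<Longrightarrow> tau3 x = x" "tau3 s1 = - s1" "tau3 s2 = - s2"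
  using someI_ex[OF biquadratic_field.ex_tau[OF biquadratic_field.rotate[OF rotate]]] unfolding tau3_def[symmetric] by auto

lemma aut_eq_cj1:
  assumes \<sigma>: "\<sigma> \<in> aut K" and s: "\<sigma> s1 = - s1" and x: "x \<in> k1" shows "\<sigma> x = q1.cj x"
proof -
  obtain a b where ab: "a \<in> \<rat>" "b \<in> \<rat>" "x = a + b * s1" using q1.quad_form[OF x] by blast
  have "\<sigma> x = a - b * s1" using ab s_K s
    by (simp add: K.aut_add[OF \<sigma>] K.aut_mult[OF \<sigma>] K.aut_Rats[OF \<sigma>] K.K_Rats K.K_mult)
  then show ?thesis using q1.cj_form ab by simp
qed

lemma tau_cj:
  "x \<in> k1 \<Longrightarrow> tau2 x = q1.cj x" "x \<in> k1 \<Longrightarrow> tau3 x = q1.cj x"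
  "x \<in> k2 \<Longrightarrow> tau1 x = q2.cj x" "x \<in> k2 \<Longrightarrow> tau3 x = q2.cj x"
  "x \<in> k3 \<Longrightarrow> tau1 x = q3.cj x" "x \<in> k3 \<Longrightarrow> tau2 x = q3.cj x"
  using aut_eq_cj1[OF tau2(1,4)] aut_eq_cj1[OF tau3(1,3)]
    biquadratic_field.aut_eq_cj1[OF rotate tau1(1,3)] biquadratic_field.aut_eq_cj1[OF rotate tau3(1,4)]
    biquadratic_field.aut_eq_cj1[OF biquadratic_field.rotate[OF rotate] tau1(1,4)]
    biquadratic_field.aut_eq_cj1[OF biquadratic_field.rotate[OF rotate] tau2(1,3)] by auto

lemma fixed_form:
  assumes \<sigma>: "\<sigma> \<in> aut K" "\<And>x. x \<in> k1 \<Longrightarrow> \<sigma> x = x" "\<sigma> s2 = - s2" and z: "z \<in> K" "\<sigma> z = z"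
  shows "z \<in> k1"
proof -
  obtain a b where ab: "a \<in> k1" "b \<in> k1" "z = a + b * s2" using form12[OF z(1)] by blast
  then have "\<sigma> z = a - b * s2" using sub1 s_K \<sigma>(2,3)
    by (simp add: K.aut_add[OF \<sigma>(1)] K.aut_mult[OF \<sigma>(1)] K.K_mult subset_iff)
  then have "2 * (b * s2) = 0" using z ab by (simp add: algebra_simps)
  then have "b = 0" using q2.s_nz by simp
  then show ?thesis using ab by simp
qed

lemma fixed1: "z \<in> K \<Longrightarrow> tau1 z = z \<Longrightarrow> z \<in> k1"
  by (rule fixed_form[OF tau1(1-3)])

lemma fixed2: "z \<in> K \<Longrightarrow> tau2 z = z \<Longrightarrow> z \<in> k2"
  by (rule biquadratic_field.fixed_form[OF rotate tau2(1-3)])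

lemma fixed3: "z \<in> K \<Longrightarrow> tau3 z = z \<Longrightarrow> z \<in> k3"
  by (rule biquadratic_field.fixed_form[OF biquadratic_field.rotate[OF rotate] tau3(1-3)])

lemma fixed12: "z \<in> K \<Longrightarrow> tau1 z = z \<Longrightarrow> tau2 z = z \<Longrightarrow> z \<in> \<rat>"
  using fixed1 tau_cj(1) q1.cj_fixed by metis

sublocale K: galois_field K 4
  by standard (use finK fixed12 tau1 tau2 in blast)+

text \<open>An automorphism is determined by its values at s1 and s2; this reduces the
  multiplication table of the Klein four-group to a comparison of signs.\<close>

lemma aut_ext:
  assumes \<sigma>: "\<sigma> \<in> aut K" "\<tau> \<in> aut K" and s: "\<sigma> s1 = \<tau> s1" "\<sigma> s2 = \<tau> s2" and z: "z \<in> K"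
  shows "\<sigma> z = \<tau> z"
proof -
  have 1: "\<sigma> x = \<tau> x" if "x \<in> k1" for x
  proof -
    obtain a b where ab: "a \<in> \<rat>" "b \<in> \<rat>" "x = a + b * s1" using q1.quad_form[OF \<open>x \<in> k1\<close>] by blast
    then show ?thesis using s_K s
      by (simp add: K.aut_add[OF \<sigma>(1)] K.aut_mult[OF \<sigma>(1)] K.aut_Rats[OF \<sigma>(1)]
          K.aut_add[OF \<sigma>(2)] K.aut_mult[OF \<sigma>(2)] K.aut_Rats[OF \<sigma>(2)] K.K_Rats K.K_mult)
  qed
  obtain a b where ab: "a \<in> k1" "b \<in> k1" "z = a + b * s2" using form12[OF z] by blast
  have abK: "a \<in> K" "b \<in> K" using ab sub1 by auto
  show ?thesis unfolding ab(3) using abK s_K 1[OF ab(1)] 1[OF ab(2)] s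
    by (simp add: K.aut_add[OF \<sigma>(1)] K.aut_mult[OF \<sigma>(1)] K.aut_add[OF \<sigma>(2)] K.aut_mult[OF \<sigma>(2)] K.K_mult)
qed

lemma tau_K: "x \<in> K \<Longrightarrow> tau1 x \<in> K" "x \<in> K \<Longrightarrow> tau2 x \<in> K" "x \<in> K \<Longrightarrow> tau3 x \<in> K"
  using K.aut_K[OF tau1(1)] K.aut_K[OF tau2(1)] K.aut_K[OF tau3(1)] by auto

lemma tau_comp:
  assumes z: "z \<in> K"
  shows "tau1 (tau2 z) = tau3 z" "tau2 (tau1 z) = tau3 z" "tau1 (tau1 z) = z" "tau2 (tau2 z) = z"
    "tau1 (tau3 z) = tau2 z" "tau2 (tau3 z) = tau1 z"
proof -
  note u1 = K.aut_uminus[OF tau1(1)] and u2 = K.aut_uminus[OF tau2(1)] and u3 = K.aut_uminus[OF tau3(1)]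
  note f = tau1(2)[OF q1.s_in] tau2(2)[OF q2.s_in] tau3(2)[OF q3.s_in]
  note all = tau1(3,4) tau2(3,4) tau3(3,4) f u1 u2 u3 s_K
  have "(tau1 \<circ> tau2) z = tau3 z" "(tau2 \<circ> tau1) z = tau3 z" "(tau1 \<circ> tau1) z = id z" "(tau2 \<circ> tau2) z = id z"
    "(tau1 \<circ> tau3) z = tau2 z" "(tau2 \<circ> tau3) z = tau1 z"
    by (rule aut_ext[OF aut_comp[OF tau1(1) tau2(1)] tau3(1) _ _ z]
          aut_ext[OF aut_comp[OF tau2(1) tau1(1)] tau3(1) _ _ z]
          aut_ext[OF aut_comp[OF tau1(1) tau1(1)] K.id_aut _ _ z]
          aut_ext[OF aut_comp[OF tau2(1) tau2(1)] K.id_aut _ _ z]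
          aut_ext[OF aut_comp[OF tau1(1) tau3(1)] tau2(1) _ _ z]
          aut_ext[OF aut_comp[OF tau2(1) tau3(1)] tau1(1) _ _ z]; simp add: all)+
  then show "tau1 (tau2 z) = tau3 z" "tau2 (tau1 z) = tau3 z" "tau1 (tau1 z) = z" "tau2 (tau2 z) = z"
    "tau1 (tau3 z) = tau2 z" "tau2 (tau3 z) = tau1 z" by simp_all
qed

section \<open>Ramification in K compared with the quadratic subfields\<close>

lemma OK_sub: "OK k1 \<subseteq> OK K" "OK k2 \<subseteq> OK K" "OK k3 \<subseteq> OK K"
  using sub1 sub2 sub3 by (auto simp: OK_def)

text \<open>If x^m = p y with x in k1, then y = x^m / p lies in k1 too and is integral
  there.\<close>

lemma Rad_contract: "x \<in> k1 \<Longrightarrow> x \<in> K.Rad p \<Longrightarrow> p > 0 \<Longrightarrow> x \<in> q1.Rad p"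
proof -
  assume x: "x \<in> k1" "x \<in> K.Rad p" and p: "p > 0"
  then obtain m y where m: "m > 0" "x ^ m = of_nat p * y" "y \<in> OK K" "x \<in> OK K" by (auto simp: K.Rad_def)
  have "y = x ^ m / of_nat p" using m p by simp
  then have "y \<in> k1" using x q1.K_power q1.K_divide q1.K_of_nat by metis
  then have "y \<in> OK k1" "x \<in> OK k1" using m x by (auto simp: OK_def)
  then show ?thesis using m unfolding q1.Rad_def by blast
qed

lemma Rad_extend: "x \<in> q1.Rad p \<Longrightarrow> x \<in> K.Rad p"
  using OK_sub(1) unfolding q1.Rad_def K.Rad_def by blast

text \<open>Extension respects powers, so (p) is the power of the radical of K with exponent
  \<open>q1.ramif p\<close> and also the one with exponent \<open>K.ramif p\<close>; the powers are
  pairwise distinct.\<close>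

lemma K_Rad_eq_imp_ramif:
  assumes p: "prime p" and R: "K.Rad p = fid_mult (q1.Rad p) (OK K)"
  shows "K.ramif p = q1.ramif p"
proof -
  have "fid_pow K (K.Rad p) (q1.ramif p) = fid_mult (fid_pow k1 (q1.Rad p) (q1.ramif p)) (OK K)"
    unfolding R by (rule extend_pow[OF q1.sub K.subfield sub1])
  also have "\<dots> = smul (of_nat p) (fid_mult (OK k1) (OK K))"
    using q1.Rad_pow_ramif[OF p] by (simp add: fid_mult_smul)
  also have "fid_mult (OK k1) (OK K) = OK K"
    using extend_pow[OF q1.sub K.subfield sub1, of "OK k1" 0] by simp
  finally have eq: "fid_pow K (K.Rad p) (q1.ramif p) = fid_pow K (K.Rad p) (K.ramif p)"
    using K.Rad_pow_ramif[OF p] by simp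
  have "\<not> i < j" if "fid_pow K (K.Rad p) i = fid_pow K (K.Rad p) j" for i j
  proof
    assume "i < j"
    then have "fid_pow K (K.Rad p) j \<subseteq> fid_pow K (K.Rad p) (Suc i)"
      by (intro K.fid_pow_decreasing[OF K.omod_Rad K.Rad_OK]) simp
    then show False using K.Rad_pow_strict[OF p, of i] that by simp
  qed
  from this[OF eq] this[OF eq[symmetric]] show ?thesis by simp
qed

text \<open>K is generated by k1 and k3, so above p it is unramified over k1. The argument of
  \<open>separating_Rad\<close> is run relative to k1: \<delta> comes from k3, the conjugation is
  \<open>tau1\<close>, and the elements y and z now lie in k1.\<close>

lemma ramif_eq_if_unramified3:
  assumes p: "prime p" and u: "q3.unramified p"
  shows "K.ramif p = q1.ramif p"
proof (rule K_Rad_eq_imp_ramif[OF p])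
  obtain \<delta> D where D: "q3.separating p \<delta> D" using q3.unramified_separating[OF p u] by blast
  then have \<delta>: "\<delta> \<in> OK k3" "(\<delta> - q3.cj \<delta>) * (\<delta> - q3.cj \<delta>) = of_int D" "\<not> int p dvd D"
    by (auto simp: q3.separating_def)
  have \<delta>3: "\<delta> \<in> k3" and \<delta>O: "\<delta> \<in> OK K" and \<delta>K: "\<delta> \<in> K" using \<delta>(1) OK_sub sub3 q3.OK_imp_K by auto
  have t\<delta>: "tau1 \<delta> = q3.cj \<delta>" by (rule tau_cj(5)[OF \<delta>3])
  define \<Delta> where "\<Delta> = \<delta> - tau1 \<delta>"
  have \<Delta>O: "\<Delta> \<in> OK K" unfolding \<Delta>_def by (rule K.OK_diff[OF \<delta>O K.aut_OK[OF tau1(1) \<delta>O]])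
  have \<Delta>2: "\<Delta> * \<Delta> = of_int D" using \<delta>(2) t\<delta> by (simp add: \<Delta>_def)
  have p0: "p > 0" using p by (simp add: prime_gt_0_nat)
  let ?A = "fid_mult (q1.Rad p) (OK K)"
  have oA: "K.omod ?A" by (rule extend_omod[OF q1.sub K.subfield sub1 q1.omod_Rad])
  have RA: "q1.Rad p \<subseteq> ?A"
  proof
    fix x assume "x \<in> q1.Rad p"
    then show "x \<in> ?A" using fid_mult_intro[OF _ K.OK_1, of x "q1.Rad p"] by simp
  qed
  have "K.Rad p \<subseteq> ?A"
  proof
    fix x assume x: "x \<in> K.Rad p"
    note oR = K.omod_Rad[of p]
    have xO: "x \<in> OK K" and xK: "x \<in> K" using x K.Rad_OK K.OK_imp_K by blast+
    have txK: "tau1 x \<in> K" "tau1 \<delta> \<in> K" by (rule tau_K[OF xK] tau_K[OF \<delta>K])+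
    define y where "y = (x - tau1 x) * \<Delta>"
    have yR: "y \<in> K.Rad p" unfolding y_def
      by (rule K.omod_mult2[OF oR \<Delta>O K.omod_diff[OF oR x K.aut_Rad[OF tau1(1) x]]])
    have yK: "y \<in> K" by (rule K.omod_K[OF oR yR])
    have "tau1 y = (tau1 x - x) * (tau1 \<delta> - \<delta>)" unfolding y_def \<Delta>_def
      using xK \<delta>K txK by (simp add: K.aut_mult[OF tau1(1)] K.aut_diff[OF tau1(1)] tau_comp K.K_diff)
    then have "tau1 y = y" by (simp add: y_def \<Delta>_def algebra_simps)
    then have y1: "y \<in> q1.Rad p" using Rad_contract[OF fixed1[OF yK] yR p0] by simp
    define z where "z = of_int D * x - y * \<delta>"
    have zR: "z \<in> K.Rad p" unfolding z_def
      by (rule K.omod_diff[OF oR K.omod_mult[OF oR K.OK_of_int x] K.omod_mult2[OF oR \<delta>O yR]])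
    have zK: "z \<in> K" by (rule K.omod_K[OF oR zR])
    have "tau1 z = of_int D * tau1 x - y * tau1 \<delta>" unfolding z_def
      using xK \<delta>K yK \<open>tau1 y = y\<close>
      by (simp add: K.aut_mult[OF tau1(1)] K.aut_diff[OF tau1(1)] K.aut_of_int[OF tau1(1)] K.K_mult)
    then have "z - tau1 z = of_int D * (x - tau1 x) - y * \<Delta>" unfolding z_def \<Delta>_def by (simp add: algebra_simps)
    also have "y * \<Delta> = of_int D * (x - tau1 x)" unfolding y_def \<Delta>2[symmetric] by (simp add: ac_simps)
    finally have "tau1 z = z" by simp
    then have z1: "z \<in> q1.Rad p" using Rad_contract[OF fixed1[OF zK] zR p0] by simp
    have "of_int D * x = z + y * \<delta>" by (simp add: z_def)
    also have "\<dots> \<in> ?A" using z1 y1 RA by (intro fid_mult_add fid_mult_intro \<delta>O) auto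
    finally have Dx: "of_int D * x \<in> ?A" .
    have px: "of_nat p * x \<in> ?A" by (rule fid_mult_intro[OF q1.p_in_Rad xO])
    have "coprime (int p) D" using p \<delta>(3) by (simp add: prime_imp_coprime)
    then obtain u v where "u * int p + v * D = 1" by (metis bezout_int coprime_imp_gcd_eq_1)
    then have "of_int (u * int p + v * D) = (1::complex)" by simp
    then have "x = (of_int u * of_nat p + of_int v * of_int D) * x" by simp
    then have "x = of_int u * (of_nat p * x) + of_int v * (of_int D * x)" by (simp add: algebra_simps)
    also have "\<dots> \<in> ?A"
      by (rule K.omod_add[OF oA K.omod_mult[OF oA K.OK_of_int px] K.omod_mult[OF oA K.OK_of_int Dx]])
    finally show "x \<in> ?A" .
  qed
  moreover have "?A \<subseteq> K.Rad p"
    by (rule fid_mult_least)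
      (auto intro: K.omod_mult2[OF K.omod_Rad] Rad_extend K.omod_0[OF K.omod_Rad] K.omod_add[OF K.omod_Rad])
  ultimately show "K.Rad p = ?A" by blast
qed

lemma square_in_Rad: "x \<in> OK K \<Longrightarrow> x * x \<in> K.Rad p \<Longrightarrow> x \<in> K.Rad p"
proof -
  assume x: "x \<in> OK K" "x * x \<in> K.Rad p"
  then obtain m where "m > 0" "(x * x) ^ m \<in> smul (of_nat p) (OK K)" by (auto simp: K.Rad_def)
  then have "x ^ (2 * m) \<in> smul (of_nat p) (OK K)" by (simp add: power_mult power2_eq_square)
  then show ?thesis using x(1) \<open>m > 0\<close> unfolding K.Rad_def by (intro CollectI conjI exI[of _ "2 * m"]) auto
qed

text \<open>Elements of B have their squares in the radical, hence lie in it themselves; the radical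
  would then be contained in its own square.\<close>

lemma no_square_root_of_Rad:
  assumes p: "prime p" and B: "B \<subseteq> OK K" "fid_mult B B = K.Rad p" shows False
proof -
  have "B \<subseteq> K.Rad p"
  proof
    fix b assume b: "b \<in> B"
    then have "b * b \<in> K.Rad p" using fid_mult_intro[OF b b] B(2) by simp
    then show "b \<in> K.Rad p" using square_in_Rad B(1) b by blast
  qed
  then have "fid_mult B B \<subseteq> fid_mult (K.Rad p) (K.Rad p)" by (rule fid_mult_mono[OF _ \<open>B \<subseteq> K.Rad p\<close>])
  then have "fid_pow K (K.Rad p) (Suc 0) \<subseteq> fid_pow K (K.Rad p) (Suc (Suc 0))"
    using B(2) K.fid_pow_1[OF K.omod_Rad] by (simp add: K.fid_pow_Suc[of _ "Suc 0"])
  then show False using K.Rad_pow_strict[OF p] by blast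
qed

lemma extension_square:
  assumes p: "prime p" and e: "q1.ramif p = 2"
  shows "fid_mult (fid_mult (q1.Rad p) (OK K)) (fid_mult (q1.Rad p) (OK K)) = smul (of_nat p) (OK K)"
proof -
  let ?A = "fid_mult (q1.Rad p) (OK K)"
  have oA: "K.omod ?A" by (rule extend_omod[OF q1.sub K.subfield sub1 q1.omod_Rad])
  have "fid_mult ?A ?A = fid_pow K ?A (q1.ramif p)"
    using K.fid_pow_1[OF oA] by (simp add: e numeral_2_eq_2 K.fid_pow_Suc[of _ "Suc 0"])
  also have "\<dots> = fid_mult (fid_pow k1 (q1.Rad p) (q1.ramif p)) (OK K)"
    by (rule extend_pow[OF q1.sub K.subfield sub1])
  also have "\<dots> = smul (of_nat p) (fid_mult (OK k1) (OK K))"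
    using q1.Rad_pow_ramif[OF p] by (simp add: fid_mult_smul)
  also have "fid_mult (OK k1) (OK K) = OK K"
    using extend_pow[OF q1.sub K.subfield sub1, of "OK k1" 0] by simp
  finally show ?thesis .
qed

text \<open>Let A be the radical of 2 in k1 extended to K, so that A A = (2). If the index is 1 or
  3, then A or A Rad^(-1) is a square root of the radical. If it is 2, a suitable element z shows
  that (1 + s1) / 2 would be integral.\<close>

lemma totally_ramified_2:
  assumes d: "d1 mod 4 = 3" "d2 mod 4 = 2" and e1: "q1.ramif 2 = 2"
  shows "K.ramif 2 = 4"
proof (rule ccontr)
  assume ne: "K.ramif 2 \<noteq> 4"
  have p: "prime (2::nat)" by simp
  let ?R = "K.Rad 2" and ?J = "inv_ideal K (K.Rad 2)" and ?A = "fid_mult (q1.Rad 2) (OK K)"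
  note oR = K.omod_Rad[of 2] and oJ = K.omod_inv_Rad[OF p] and RJ = K.Rad_invertible[OF p]
  have oA: "K.omod ?A" by (rule extend_omod[OF q1.sub K.subfield sub1 q1.omod_Rad])
  have A2: "fid_mult ?A ?A = smul (of_nat 2) (OK K)" by (rule extension_square[OF p e1])
  have AR: "?A \<subseteq> ?R"
    by (rule fid_mult_least)
      (auto intro: K.omod_mult2[OF oR] Rad_extend K.omod_0[OF oR] K.omod_add[OF oR])
  have R1: "fid_pow K ?R 1 = ?R" "fid_pow K ?R 2 = fid_mult ?R ?R" "fid_pow K ?R 3 = fid_mult ?R (fid_mult ?R ?R)"
    using K.fid_pow_1[OF oR] by (simp_all add: numeral_2_eq_2 numeral_3_eq_3 K.fid_pow_Suc[of _ "Suc _"])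
  have Re: "fid_pow K ?R (K.ramif 2) = smul (of_nat 2) (OK K)" by (rule K.Rad_pow_ramif[OF p])
  have "K.ramif 2 \<le> 4" "1 \<le> K.ramif 2" using K.ramif_le[OF p] K.ramif_ge_1[OF p] by auto
  then consider "K.ramif 2 = 1" | "K.ramif 2 = 2" | "K.ramif 2 = 3" using ne by linarith
  then show False
  proof cases
    case 1
    then have "fid_mult ?A ?A = ?R" using A2 Re R1 by simp
    then show False using no_square_root_of_Rad[OF p, of ?A] AR K.Rad_OK by blast
  next
    case 3
    \<comment> \<open>A A is the cube of the radical, so A divided by the radical has the radical as
      its square.\<close>
    let ?B = "fid_mult ?A ?J"
    have "?B \<subseteq> fid_mult ?R ?J" by (rule fid_mult_mono[OF AR order_refl])
    then have BO: "?B \<subseteq> OK K" using RJ by simp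
    have "fid_mult ?B ?B = fid_mult (fid_mult ?A ?A) (fid_mult ?J ?J)"
      by (rule fid_mult_mult)
    also have "fid_mult ?A ?A = fid_mult ?R (fid_mult ?R ?R)" using A2 Re R1 3 by simp
    also have "fid_mult (fid_mult ?R (fid_mult ?R ?R)) (fid_mult ?J ?J)
      = fid_mult ?R (fid_mult (fid_mult ?R ?J) (fid_mult ?R ?J))"
      by (simp only: fid_mult_assoc fid_mult_left_commute[of ?J ?R])
    also have "\<dots> = ?R" by (simp add: RJ K.fid_mult_OK[OF K.omod_OK] K.fid_mult_OK2[OF oR])
    finally show False using no_square_root_of_Rad[OF p BO] by simp
  next
    case 2
    have R2: "fid_mult ?R ?R = smul (of_nat 2) (OK K)" using Re R1 2 by simp
    have s1O: "s1 \<in> OK K" and s2O: "s2 \<in> OK K" using q1.s_OK q2.s_OK OK_sub by auto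
    have "4 dvd 1 + d1" using d(1) by presburger
    then obtain a where a: "1 + d1 = 4 * a" by blast
    have b': "d2 = 4 * (d2 div 4) + 2" using d(2) by presburger
    then obtain b where b: "d2 = 4 * b + 2" by blast
    have "(1 + s1) * (1 + s1) = of_nat 2 * (of_int (2 * a) + s1)"
    proof -
      have "(1 + s1) * (1 + s1) = of_int (1 + d1) + 2 * s1" using q1.s_sq by (simp add: algebra_simps)
      then show ?thesis unfolding a by simp
    qed
    then have "(1 + s1) * (1 + s1) \<in> smul (of_nat 2) (OK K)" using s1O by (intro image_eqI[OF _ K.OK_add[OF K.OK_of_int]])
    then have t1: "1 + s1 \<in> ?R" using square_in_Rad[OF K.OK_add[OF K.OK_1 s1O]] K.pO_subset_Rad by blast
    have "s2 * s2 = of_nat 2 * of_int (2 * b + 1)" using q2.s_sq b by simp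
    then have "s2 * s2 \<in> smul (of_nat 2) (OK K)" by (intro image_eqI[OF _ K.OK_of_int])
    then have t2: "s2 \<in> ?R" using square_in_Rad[OF s2O] K.pO_subset_Rad by blast
    have t12: "s2 * (1 + s1) \<in> smul (of_nat 2) (OK K)" using fid_mult_intro[OF t2 t1] R2 by simp
    \<comment> \<open>Chosen so that z^2 = 2 w with w in the radical. Then z^2 lies in Rad^3, which
      forces z into Rad^2 = (2); hence w lies in (2). But w is congruent to 1 + s1 modulo 2.\<close>
    define z where "z = 1 + s1 + s2"
    define w where "w = of_nat 2 * of_int (a + b) + (1 + s1) + s2 * (1 + s1)"
    have zz: "z * z = of_nat 2 * w"
    proof -
      have "z * z = (1 + s1 * s1 + s2 * s2) + 2 * s1 + 2 * s2 * (1 + s1)" by (simp add: z_def algebra_simps)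
      also have "1 + s1 * s1 + s2 * s2 = of_int (1 + d1 + d2)" using q1.s_sq q2.s_sq by simp
      also have "1 + d1 + d2 = 4 * (a + b) + 2" using a b by simp
      finally show ?thesis by (simp add: w_def algebra_simps)
    qed
    have zR: "z \<in> ?R" unfolding z_def by (rule K.omod_add[OF oR t1 t2])
    have wR: "w \<in> ?R" unfolding w_def
      by (rule K.omod_add[OF oR K.omod_add[OF oR K.omod_mult2[OF oR K.OK_of_int K.p_in_Rad] t1] subsetD[OF K.pO_subset_Rad t12]])
    have zzR: "z * z \<in> fid_mult ?R (fid_mult ?R ?R)"
    proof -
      have "w * of_nat 2 \<in> fid_mult ?R (fid_mult ?R ?R)" using wR K.p_in_pO[of 2] R2 by (intro fid_mult_intro) auto
      then show ?thesis using zz by (simp add: mult.commute)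
    qed
    \<comment> \<open>For c in the inverse of the radical, (z c)^2 lies in Rad^3 Rad^(-2) = Rad, so
      z c lies in the radical.\<close>
    have zc: "z * c \<in> ?R" if c: "c \<in> ?J" for c
    proof -
      have zcO: "z * c \<in> OK K" using fid_mult_intro[OF zR c] RJ by simp
      have "(z * z) * (c * c) \<in> fid_mult (fid_mult ?R (fid_mult ?R ?R)) (fid_mult ?J ?J)"
        by (rule fid_mult_intro[OF zzR fid_mult_intro[OF c c]])
      also have "fid_mult (fid_mult ?R (fid_mult ?R ?R)) (fid_mult ?J ?J)
        = fid_mult ?R (fid_mult (fid_mult ?R ?J) (fid_mult ?R ?J))"
        by (simp only: fid_mult_assoc fid_mult_left_commute[of ?J ?R])
      also have "\<dots> = ?R" by (simp add: RJ K.fid_mult_OK[OF K.omod_OK] K.fid_mult_OK2[OF oR])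
      finally have "(z * c) * (z * c) \<in> ?R" by (simp add: ac_simps)
      then show ?thesis by (rule square_in_Rad[OF zcO])
    qed
    then have "smul z ?J \<subseteq> ?R" by blast
    then have "fid_mult (smul z ?J) ?R \<subseteq> fid_mult ?R ?R" by (rule fid_mult_mono[OF _ order_refl])
    moreover have "fid_mult (smul z ?J) ?R = smul z (OK K)"
      by (simp only: fid_mult_smul fid_mult_commute[of ?J ?R] RJ)
    ultimately have "smul z (OK K) \<subseteq> smul (of_nat 2) (OK K)" using R2 by simp
    then have "z * 1 \<in> smul (of_nat 2) (OK K)" using K.OK_1 by blast
    then obtain y where y: "y \<in> OK K" "z = of_nat 2 * y" by auto
    then have "of_nat 2 * w = of_nat 2 * (of_nat 2 * (y * y))" using zz by (simp add: ac_simps)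
    then have "w = of_nat 2 * (y * y)" by simp
    then have w2: "w \<in> smul (of_nat 2) (OK K)" using y(1) by blast
    note oN = K.omod_pO[of 2]
    have "1 + s1 = w - of_nat 2 * of_int (a + b) - s2 * (1 + s1)" by (simp add: w_def)
    also have "\<dots> \<in> smul (of_nat 2) (OK K)"
      by (rule K.omod_diff[OF oN K.omod_diff[OF oN w2 imageI[OF K.OK_of_int]] t12])
    finally obtain v where v: "v \<in> OK K" "1 + s1 = of_nat 2 * v" by blast
    then have v2: "(1 + s1) / 2 = v" by simp
    moreover have "(1 + s1) / 2 \<in> k1" using q1.s_in by (intro q1.K_divide q1.K_add) auto
    ultimately have "v \<in> OK k1" using v(1) by (simp add: OK_def)
    then have "(1 + s1) / 2 \<in> OK k1" by (simp only: v2)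
    then show False using q1.half_not_integral[OF d(1)] by simp
  qed
qed

lemma prod_d: "d1 * d2 * d3 = m * m"
proof -
  have "(s1 * s2 * s3) * (s1 * s2 * s3) = (s1 * s1) * (s2 * s2) * (s3 * s3)" by (simp add: ac_simps)
  then have "of_int (m * m) = (of_int (d1 * d2 * d3) :: complex)"
    by (simp add: prod_s q1.s_sq q2.s_sq q3.s_sq)
  then show ?thesis using of_int_eq_iff by metis
qed

text \<open>d1 d2 d3 is a square. A prime dividing all three squarefree factors would divide it
  exactly three times, so p = 2. Each residue modulo 4 is 2 or 3, not all are 2, and a square
  product forces one 3 and two 2s; some rotation then fits
  \<open>totally_ramified_2\<close>.\<close>

lemma all_ramified_imp_4:
  assumes p: "prime p" and e: "q1.ramif p = 2" "q2.ramif p = 2" "q3.ramif p = 2"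
  shows "K.ramif p = 4"
proof -
  have nu: "\<not> q1.unramified p" "\<not> q2.unramified p" "\<not> q3.unramified p"
    using q1.ramif_unramified[OF p] q2.ramif_unramified[OF p] q3.ramif_unramified[OF p] e by auto
  have not_all: "\<not> (int p dvd d1 \<and> int p dvd d2 \<and> int p dvd d3)"
  proof
    assume "int p dvd d1 \<and> int p dvd d2 \<and> int p dvd d3"
    then obtain a b c where abc: "d1 = int p * a" "d2 = int p * b" "d3 = int p * c" by (elim conjE dvdE)
    have pi: "prime (int p)" using p by simp
    have p0: "int p \<noteq> 0" using p by auto
    have na: "\<not> int p dvd x" if "squarefree (int p * x)" for x
    proof
      assume "int p dvd x"
      then have "int p ^ 2 dvd int p * x" by (simp add: power2_eq_square)
      then have "int p dvd 1" by (rule squarefreeD[OF that])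
      then show False using p by (simp add: prime_nat_iff)
    qed
    have n: "\<not> int p dvd a" "\<not> int p dvd b" "\<not> int p dvd c"
      using na q1.sqf q2.sqf q3.sqf abc by auto
    have mm: "m * m = int p * (int p * (int p * (a * b * c)))" using prod_d abc by (simp add: ac_simps)
    then have "int p dvd m * m" by simp
    then have "int p dvd m" using pi prime_dvd_mult_iff by blast
    then obtain x where x: "m = int p * x" by blast
    then have "int p * (int p * (x * x)) = int p * (int p * (int p * (a * b * c)))" using mm by (simp add: ac_simps)
    then have xx: "x * x = int p * (a * b * c)" using p0 by simp
    then have "int p dvd x * x" by simp
    then have "int p dvd x" using pi prime_dvd_mult_iff by blast
    then obtain y where "x = int p * y" by blast
    then have "int p * (int p * (y * y)) = int p * (a * b * c)" using xx by (simp add: ac_simps)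
    then have "a * b * c = int p * (y * y)" using p0 by simp
    then have "int p dvd a * b * c" by simp
    then show False using n pi by (simp add: prime_dvd_mult_iff)
  qed
  have p2: "p = 2"
  proof (rule ccontr)
    assume "p \<noteq> 2"
    then show False using nu not_all by (simp add: q1.unramified_def q2.unramified_def q3.unramified_def)
  qed
  have md: "d1 mod 4 = 2 \<or> d1 mod 4 = 3" "d2 mod 4 = 2 \<or> d2 mod 4 = 3" "d3 mod 4 = 2 \<or> d3 mod 4 = 3"
    using nu q1.d_mod_4 q2.d_mod_4 q3.d_mod_4 by (simp_all add: p2 q1.unramified_def q2.unramified_def q3.unramified_def)
  have modm: "(d1 * d2 * d3) mod 4 = 0 \<or> (d1 * d2 * d3) mod 4 = 1"
  proof -
    have "(m * m) mod 4 = 0 \<or> (m * m) mod 4 = 1"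
    proof (cases "even m")
      case True
      then obtain x where "m = 2 * x" by blast
      then show ?thesis by simp
    next
      case False
      then obtain x where "m = 2 * x + 1" by (rule oddE)
      then have "m * m = 4 * (x * x + x) + 1" by (simp add: algebra_simps)
      then show ?thesis by presburger
    qed
    then show ?thesis by (simp add: prod_d)
  qed
  have mm: "(d1 * d2 * d3) mod 4 = ((d1 mod 4) * (d2 mod 4) * (d3 mod 4)) mod 4"
    by (intro mod_mult_cong) simp_all
  have ev: "d mod 4 = 2 \<Longrightarrow> int p dvd d" for d using p2 by presburger
  have "d1 mod 4 = 3 \<and> d2 mod 4 = 2 \<or> d2 mod 4 = 3 \<and> d3 mod 4 = 2 \<or> d3 mod 4 = 3 \<and> d1 mod 4 = 2"
    using md not_all ev modm mm by (elim disjE) simp_all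
  then show ?thesis
    using totally_ramified_2 biquadratic_field.totally_ramified_2[OF rotate]
      biquadratic_field.totally_ramified_2[OF biquadratic_field.rotate[OF rotate]] e p2 by auto
qed

end

section \<open>Square classes of units\<close>

definition mgrp :: "complex set \<Rightarrow> bool" where
  "mgrp H \<longleftrightarrow> 1 \<in> H \<and> 0 \<notin> H \<and> (\<forall>x\<in>H. \<forall>y\<in>H. x * y \<in> H) \<and> (\<forall>x\<in>H. inverse x \<in> H)"

lemma mgrp_1: "mgrp H \<Longrightarrow> 1 \<in> H" and mgrp_nz: "mgrp H \<Longrightarrow> x \<in> H \<Longrightarrow> x \<noteq> 0"
  and mgrp_mult: "mgrp H \<Longrightarrow> x \<in> H \<Longrightarrow> y \<in> H \<Longrightarrow> x * y \<in> H"
  and mgrp_inverse: "mgrp H \<Longrightarrow> x \<in> H \<Longrightarrow> inverse x \<in> H"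
  by (auto simp: mgrp_def)

lemma mgrp_divide: "mgrp H \<Longrightarrow> x \<in> H \<Longrightarrow> y \<in> H \<Longrightarrow> x / y \<in> H"
  by (simp add: divide_inverse mgrp_mult mgrp_inverse)

text \<open>For a subgroup N of H this is H / N. Its \<open>card\<close> is the index only if it is
  finite, since infinite sets get 0; finiteness is therefore carried along.\<close>

definition cosets :: "complex set \<Rightarrow> complex set \<Rightarrow> complex set set" where
  "cosets H N = (\<lambda>u. smul u N) ` H"

definition squares :: "complex set \<Rightarrow> complex set" where
  "squares H = (\<lambda>x. x * x) ` H"

lemma mgrp_squares: "mgrp H \<Longrightarrow> mgrp (squares H)"
  unfolding mgrp_def squares_def
proof (elim conjE, intro conjI ballI)
  assume H: "1 \<in> H" "0 \<notin> H" "\<forall>x\<in>H. \<forall>y\<in>H. x * y \<in> H" "\<forall>x\<in>H. inverse x \<in> H"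
  show "1 \<in> (\<lambda>x. x * x) ` H" using H(1) by force
  show "0 \<notin> (\<lambda>x. x * x) ` H" using H(2) by auto
  fix x assume "x \<in> (\<lambda>x. x * x) ` H"
  then obtain a where a: "a \<in> H" "x = a * a" by blast
  have "inverse x = inverse a * inverse a" using a by simp
  then show "inverse x \<in> (\<lambda>x. x * x) ` H" using H(4) a by blast
  fix y assume "y \<in> (\<lambda>x. x * x) ` H"
  then obtain b where b: "b \<in> H" "y = b * b" by blast
  have "x * y = (a * b) * (a * b)" using a b by simp
  then show "x * y \<in> (\<lambda>x. x * x) ` H" using H(3) a b by blast
qed

lemma squares_subset: "mgrp H \<Longrightarrow> squares H \<subseteq> H"
  by (auto simp: squares_def mgrp_mult)

lemma smul_coset_eq:
  assumes N: "mgrp N" and u: "u \<noteq> 0" "v \<noteq> 0"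
  shows "smul u N = smul v N \<longleftrightarrow> u / v \<in> N"
proof
  assume "smul u N = smul v N"
  moreover have "u * 1 \<in> smul u N" using mgrp_1[OF N] by blast
  ultimately obtain x where "x \<in> N" "u = v * x" by auto
  then show "u / v \<in> N" using u by simp
next
  assume uv: "u / v \<in> N"
  have sub: "smul a N \<subseteq> smul b N" if "a / b \<in> N" "b \<noteq> 0" for a b
  proof (rule image_subsetI)
    fix x assume "x \<in> N"
    then have "b * (a / b * x) \<in> smul b N" using mgrp_mult[OF N that(1)] by blast
    then show "a * x \<in> smul b N" using that(2) by simp
  qed
  have "v / u \<in> N" using mgrp_inverse[OF N uv] by simp
  then show "smul u N = smul v N" using sub uv u by blast
qed

text \<open>H is parametrized by g on X, and the invariant \<phi> separates exactly the cosets of N;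
  the index becomes the number of values of \<phi>.\<close>

lemma card_cosets_param:
  assumes N: "mgrp N" and H: "H = g ` X" "0 \<notin> H"
    and \<phi>: "\<And>x y. x \<in> X \<Longrightarrow> y \<in> X \<Longrightarrow> g x / g y \<in> N \<longleftrightarrow> \<phi> x = \<phi> y"
  shows "\<exists>h. bij_betw h (cosets H N) (\<phi> ` X)"
proof -
  have *: "smul (g x) N = smul (g y) N \<longleftrightarrow> \<phi> x = \<phi> y" if "x \<in> X" "y \<in> X" for x y
  proof -
    have "g x \<noteq> 0" "g y \<noteq> 0" using H that by auto
    then show ?thesis using smul_coset_eq[OF N] \<phi>[OF that] by simp
  qed
  let ?k = "\<lambda>x. smul (g x) N"
  have "cosets H N = ?k ` X" by (auto simp: cosets_def H(1))
  moreover have "bij_betw (\<lambda>C. \<phi> (SOME x. x \<in> X \<and> ?k x = C)) (?k ` X) (\<phi> ` X)"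
  proof (rule bij_betw_imageI)
    have sel: "(SOME x'. x' \<in> X \<and> ?k x' = ?k x) \<in> X \<and> ?k (SOME x'. x' \<in> X \<and> ?k x' = ?k x) = ?k x" if "x \<in> X" for x
      by (rule someI_ex) (use that in blast)
    have val: "\<phi> (SOME x'. x' \<in> X \<and> ?k x' = ?k x) = \<phi> x" if "x \<in> X" for x
      by (rule *[OF conjunct1[OF sel[OF that]] that, THEN iffD1, OF conjunct2[OF sel[OF that]]])
    show "inj_on (\<lambda>C. \<phi> (SOME x. x \<in> X \<and> ?k x = C)) (?k ` X)"
    proof (rule inj_onI)
      fix A B assume "A \<in> ?k ` X" "B \<in> ?k ` X"
        and eq: "\<phi> (SOME x. x \<in> X \<and> ?k x = A) = \<phi> (SOME x. x \<in> X \<and> ?k x = B)"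
      then obtain x y where xy: "x \<in> X" "A = ?k x" "y \<in> X" "B = ?k y" by blast
      then have "\<phi> x = \<phi> y" using eq val by simp
      then show "A = B" using * xy by simp
    qed
    show "(\<lambda>C. \<phi> (SOME x. x \<in> X \<and> ?k x = C)) ` (?k ` X) = \<phi> ` X"
      unfolding image_image by (rule image_cong[OF refl val])
  qed
  ultimately show ?thesis by auto
qed

lemma card_cosets_eq:
  assumes "mgrp N" "H = g ` X" "0 \<notin> H"
    "\<And>x y. x \<in> X \<Longrightarrow> y \<in> X \<Longrightarrow> g x / g y \<in> N \<longleftrightarrow> \<phi> x = \<phi> y"
  shows "card (cosets H N) = card (\<phi> ` X)" "finite (\<phi> ` X) \<Longrightarrow> finite (cosets H N)"
proof -
  obtain h where h: "bij_betw h (cosets H N) (\<phi> ` X)" using card_cosets_param[OF assms] by blast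
  show "card (cosets H N) = card (\<phi> ` X)" by (rule bij_betw_same_card[OF h])
  show "finite (\<phi> ` X) \<Longrightarrow> finite (cosets H N)" using bij_betw_finite[OF h] by simp
qed

lemma card_fibers:
  assumes fin: "finite (f ` A)" and fib: "\<And>a. a \<in> A \<Longrightarrow> finite {x\<in>A. f x = f a} \<and> card {x\<in>A. f x = f a} = c"
  shows "finite A" "card A = card (f ` A) * c"
proof -
  have "A = (\<Union>b\<in>f ` A. {x\<in>A. f x = b})" by auto
  moreover have "finite (\<Union>b\<in>f ` A. {x\<in>A. f x = b})" by (rule finite_UN_I[OF fin]) (use fib in auto)
  ultimately show finA: "finite A" by simp
  have "card A = (\<Sum>x\<in>A. 1)" by simp
  also have "\<dots> = (\<Sum>b\<in>f ` A. \<Sum>x\<in>{x\<in>A. f x = b}. 1)" by (rule sum.image_gen[OF finA])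
  also have "\<dots> = (\<Sum>b\<in>f ` A. c)" using fib by (intro sum.cong) auto
  finally show "card A = card (f ` A) * c" by simp
qed

text \<open>f sends a coset of N to the coset of M that contains it, and every fibre is a translate
  of \<open>cosets M N\<close>.\<close>

lemma cosets_tower:
  assumes H: "mgrp H" and M: "mgrp M" and N: "mgrp N" and sub: "N \<subseteq> M" "M \<subseteq> H"
    and fin: "finite (cosets H N)"
  shows "card (cosets H N) = card (cosets H M) * card (cosets M N)"
proof -
  define f where "f C = {u \<in> H. \<exists>c\<in>C. u / c \<in> M}" for C
  have f: "f (smul u N) = smul u M" if u: "u \<in> H" for u
  proof (intro equalityI subsetI)
    fix v assume "v \<in> f (smul u N)"
    then obtain x where x: "v \<in> H" "x \<in> N" "v / (u * x) \<in> M" unfolding f_def by blast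
    have "v / (u * x) * x \<in> M" using x sub by (intro mgrp_mult[OF M]) auto
    then have "u * (v / (u * x) * x) \<in> smul u M" by blast
    then show "v \<in> smul u M" using mgrp_nz[OF H u] mgrp_nz[OF N x(2)] by simp
  next
    fix v assume "v \<in> smul u M"
    then obtain x where x: "x \<in> M" "v = u * x" by blast
    have "v \<in> H" using x u sub mgrp_mult[OF H] by auto
    moreover have "v / (u * 1) \<in> M" using x mgrp_nz[OF H u] by simp
    ultimately show "v \<in> f (smul u N)" using mgrp_1[OF N] unfolding f_def by blast
  qed
  have img: "f ` cosets H N = cosets H M" unfolding cosets_def image_image by (rule image_cong[OF refl f])
  have fib: "finite {x \<in> cosets H N. f x = f a} \<and> card {x \<in> cosets H N. f x = f a} = card (cosets M N)"
    if a: "a \<in> cosets H N" for a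
  proof -
    obtain u where u: "u \<in> H" "a = smul u N" using a by (auto simp: cosets_def)
    have u0: "u \<noteq> 0" by (rule mgrp_nz[OF H u(1)])
    have "{x \<in> cosets H N. f x = f a} = (\<lambda>C. smul u C) ` cosets M N"
    proof (intro equalityI subsetI)
      fix C assume "C \<in> {x \<in> cosets H N. f x = f a}"
      then obtain v where v: "v \<in> H" "C = smul v N" "smul v M = smul u M" using f u by (auto simp: cosets_def)
      then have "v / u \<in> M" using smul_coset_eq[OF M mgrp_nz[OF H v(1)] u0] by simp
      then have "smul (v / u) N \<in> cosets M N" unfolding cosets_def by (rule imageI)
      moreover have "C = smul u (smul (v / u) N)" unfolding smul_smul using u0 v(2) by simp
      ultimately show "C \<in> (\<lambda>C. smul u C) ` cosets M N" by (rule rev_image_eqI)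
    next
      fix C assume "C \<in> (\<lambda>C. smul u C) ` cosets M N"
      then obtain v where v: "v \<in> M" "C = smul u (smul v N)" by (auto simp: cosets_def)
      have C: "C = smul (u * v) N" unfolding v(2) smul_smul ..
      have uv: "u * v \<in> H" using mgrp_mult[OF H u(1)] v sub by auto
      have "u * v / u \<in> M" using v u0 by simp
      then have "f C = f a" unfolding C u(2) f[OF uv] f[OF u(1)]
        using smul_coset_eq[OF M mgrp_nz[OF H uv] u0] by simp
      then show "C \<in> {x \<in> cosets H N. f x = f a}" using C uv by (auto simp: cosets_def)
    qed
    moreover have "inj_on (\<lambda>C. smul u C) (cosets M N)"
      using smul_cancel[OF u0] by (intro inj_onI) blast
    ultimately have "card {x \<in> cosets H N. f x = f a} = card (cosets M N)" by (simp add: card_image)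
    then show ?thesis using fin by simp
  qed
  show ?thesis using card_fibers(2)[of f "cosets H N", OF finite_imageI[OF fin] fib] img by simp
qed

lemma finite_cosets_sub:
  assumes "mgrp N" "M \<subseteq> H" "finite (cosets H N)" shows "finite (cosets M N)"
  using assms finite_subset[of "cosets M N" "cosets H N"] by (auto simp: cosets_def)

text \<open>Squaring has kernel {1, -1}, and in a finite group the index of the image equals the
  order of the kernel.\<close>

lemma finite_group_squares:
  assumes M: "mgrp M" "finite M" "-1 \<in> M"
  shows "card (cosets M (squares M)) = 2"
proof -
  have one: "mgrp {1}" by (simp add: mgrp_def)
  have c1: "card (cosets H {1}) = card H" if "mgrp H" for H
    using card_cosets_eq(1)[OF one, of H id H id] that by (auto simp: mgrp_def)
  have nz: "x \<noteq> 0" if "x \<in> M" for x using mgrp_nz[OF M(1) that] .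
  have "card M = card (squares M) * 2"
    unfolding squares_def
  proof (rule card_fibers(2))
    fix a assume a: "a \<in> M"
    have "{x \<in> M. x * x = a * a} = {a, - a}"
      using a mgrp_mult[OF M(1) M(3) a] by (auto simp: square_eq_iff)
    moreover have "a + a \<noteq> 0" using nz[OF a] by (simp flip: mult_2)
    then have "a \<noteq> - a" by (metis add.right_inverse)
    ultimately show "finite {x \<in> M. x * x = a * a} \<and> card {x \<in> M. x * x = a * a} = 2" by simp
  qed (use M in simp)
  moreover have "card (cosets M {1}) = card (cosets M (squares M)) * card (cosets (squares M) {1})"
    by (rule cosets_tower[OF M(1) mgrp_squares[OF M(1)] one])
      (use mgrp_1[OF mgrp_squares[OF M(1)]] squares_subset[OF M(1)] M(2) in \<open>auto simp: cosets_def\<close>)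
  ultimately have "card (squares M) * 2 = card (cosets M (squares M)) * card (squares M)"
    by (simp add: c1 M mgrp_squares)
  moreover have "card (squares M) > 0" using M mgrp_1[OF mgrp_squares[OF M(1)]] by (auto simp: card_gt_0_iff squares_def)
  ultimately show ?thesis by simp
qed

section \<open>Positive rationals modulo squares\<close>

definition prime_set :: "nat set \<Rightarrow> bool" where
  "prime_set C \<longleftrightarrow> finite C \<and> (\<forall>p\<in>C. prime p)"

definition is_sq :: "complex set \<Rightarrow> complex \<Rightarrow> bool" where
  "is_sq F x \<longleftrightarrow> (\<exists>\<alpha>\<in>F. x = \<alpha> * \<alpha>)"

definition CC :: "complex set \<Rightarrow> nat set set" where
  "CC F = {C. prime_set C \<and> (\<exists>u\<in>unit_set F. is_sq F (of_nat (\<Prod>C) * u))}"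

text \<open>The positive rationals, up to squares, that become squares in F. They measure how far a
  unit class fails to determine its set of primes: see the fibres in \<open>card_CC\<close>.\<close>

definition Dset :: "complex set \<Rightarrow> nat set set" where
  "Dset F = {C. prime_set C \<and> is_sq F (of_nat (\<Prod>C))}"

text \<open>Sets of primes stand for the positive rationals modulo squares, so negative factors are
  excluded here; this is what makes the signs of units matter.\<close>

definition Uplus :: "complex set \<Rightarrow> complex set" where
  "Uplus F = {u \<in> unit_set F. \<exists>C. prime_set C \<and> is_sq F (of_nat (\<Prod>C) * u)}"

lemma prime_set_pos: "prime_set C \<Longrightarrow> \<Prod>C > 0"
  by (auto simp: prime_set_def intro!: prod_pos dest: prime_gt_0_nat)

lemma prime_set_sym_diff: "prime_set A \<Longrightarrow> prime_set B \<Longrightarrow> prime_set (sym_diff A B)"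
  by (auto simp: prime_set_def)

text \<open>Symmetric difference of sets of primes is multiplication modulo squares.\<close>

lemma prod_sym_diff:
  assumes "finite A" "finite B"
  shows "\<Prod>A * \<Prod>B = \<Prod>(sym_diff A B) * ((\<Prod>(A \<inter> B)) * (\<Prod>(A \<inter> B)) :: nat)"
proof -
  have "\<Prod>A = \<Prod>(A - B) * \<Prod>(A \<inter> B)" using assms by (subst prod.union_disjoint[symmetric]) (auto simp: Un_Diff_Int)
  moreover have "\<Prod>B = \<Prod>(B - A) * \<Prod>(A \<inter> B)"
    using assms by (subst prod.union_disjoint[symmetric]) (auto simp: Un_Diff_Int Int_commute[of A B])
  moreover have "\<Prod>(sym_diff A B) = \<Prod>(A - B) * \<Prod>(B - A)" using assms by (subst prod.union_disjoint) auto
  ultimately show ?thesis by simp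
qed

lemma prime_set_prime_factors:
  assumes "prime_set C" shows "prime_factors (\<Prod>C) = C" "squarefree (\<Prod>C)"
proof -
  have fin: "finite C" and pr: "\<And>p. p \<in> C \<Longrightarrow> prime p" using assms by (auto simp: prime_set_def)
  have "prime_factorization (\<Prod>C) = mset_set C"
    using fin pr
  proof (induction C rule: finite_induct)
    case (insert p C)
    have "0 \<notin> C" using insert.prems[of 0] by auto
    then have "\<Prod>C \<noteq> 0" using insert.hyps by simp
    moreover have "prime p" using insert.prems by simp
    moreover from this have "p \<noteq> 0" by auto
    ultimately show ?case using insert by (simp add: prime_factorization_mult prime_factorization_prime)
  qed simp
  then show pf: "prime_factors (\<Prod>C) = C" using fin by simp
  have "\<Prod>C \<noteq> 0" using prime_set_pos[OF assms] by simp
  moreover have "multiplicity p (\<Prod>C) = 1" if "p \<in> C" for p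
  proof -
    have "multiplicity p (\<Prod>C) = count (prime_factorization (\<Prod>C)) p"
      using pr[OF that] by (simp add: count_prime_factorization_prime)
    also have "\<dots> = 1" using \<open>prime_factorization (\<Prod>C) = mset_set C\<close> fin that by simp
    finally show ?thesis .
  qed
  ultimately show "squarefree (\<Prod>C)" using pf by (simp add: squarefree_factorial_semiring')
qed

lemma squarefree_prod_prime_factors:
  assumes "squarefree (n::nat)" "n > 0" shows "prime_set (prime_factors n)" "\<Prod>(prime_factors n) = n"
proof -
  show "prime_set (prime_factors n)" by (auto simp: prime_set_def)
  have m: "\<forall>p\<in>prime_factors n. multiplicity p n = 1"
    using assms squarefree_factorial_semiring'[of n] by simp
  have "n = (\<Prod>p\<in>prime_factors n. p ^ multiplicity p n)" using prime_factorization_nat assms(2) by blast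
  also have "\<dots> = \<Prod>(prime_factors n)" using m by (intro prod.cong) auto
  finally show "\<Prod>(prime_factors n) = n" by simp
qed

text \<open>a / b differs from the integer a b by the square of b; the primes are those of the
  squarefree part of a b.\<close>

lemma positive_rational_squarefree:
  assumes r: "r \<in> \<rat>" "r \<in> \<real>" "Re r > 0"
  obtains C q where "prime_set C" "q \<in> \<rat>" "q \<noteq> 0" "of_nat (\<Prod>C) = r * (q * q)"
proof -
  obtain a b :: int where ab: "b > 0" "r = of_int a / of_int b" using r(1) by (metis Rats_cases')
  have "Re r = of_int a / of_int b" using ab by simp
  then have "a > 0" using r(3) ab by (simp add: zero_less_divide_iff)
  define n where "n = nat (a * b)"
  have n: "n > 0" "int n = a * b" using \<open>a > 0\<close> ab by (auto simp: n_def)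
  define f g where "f = squarefree_part n" and "g = square_part n"
  have fg: "n = f * g ^ 2" unfolding f_def g_def by (rule squarefree_decompose)
  have f1: "squarefree f" unfolding f_def by simp
  have f2: "f > 0" "g > 0" using n(1) fg by (cases "f = 0"; cases "g = 0"; simp)+
  note f = f1 f2
  have "of_int a * of_int b = (of_nat f * (of_nat g * of_nat g) :: complex)"
  proof -
    have "a * b = int f * (int g * int g)" using n(2) fg by (simp add: power2_eq_square)
    then have "of_int (a * b) = (of_int (int f * (int g * int g)) :: complex)" by simp
    then show ?thesis by simp
  qed
  moreover have "(of_int b :: complex) \<noteq> 0" "(of_nat g :: complex) \<noteq> 0" using ab f by auto
  ultimately have "of_nat f = r * ((of_int b / of_nat g) * (of_int b / of_nat g))"
    unfolding ab(2) by (simp add: field_simps)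
  then show thesis using that[of "prime_factors f" "of_int b / of_nat g"] squarefree_prod_prime_factors[OF f(1,2)] ab f by simp
qed

text \<open>With b = u / v in lowest terms, v^2 divides c and u^2 divides a; both a and c are
  squarefree, so u and v are 1 or -1.\<close>

lemma squarefree_ratio:
  assumes a: "squarefree (a::nat)" "a > 0" and c: "squarefree (c::nat)" "c > 0"
    and b: "b \<in> \<rat>" "of_nat a = b * b * (of_nat c :: complex)"
  shows "a = c"
proof -
  obtain u v :: int where uv: "v > 0" "coprime u v" "b = of_int u / of_int v" using b(1) by (metis Rats_cases')
  have "(of_int v :: complex) \<noteq> 0" using uv by simp
  then have "of_nat a * (of_int v * of_int v) = (of_int u * of_int u * of_nat c :: complex)"
    using b(2) unfolding uv(3) by (simp add: field_simps)
  then have "of_int (int a * (v * v)) = (of_int (u * u * int c) :: complex)" by simp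
  then have eq: "int a * (v * v) = u * u * int c" using of_int_eq_iff by blast
  define x y where "x = nat \<bar>u\<bar>" and "y = nat \<bar>v\<bar>"
  have "int (a * y ^ 2) = int (x ^ 2 * c)" using eq by (simp add: x_def y_def power2_eq_square abs_mult_self_eq)
  then have e: "a * y ^ 2 = x ^ 2 * c" using of_nat_eq_iff by blast
  have cop: "coprime x y" using uv(2) by (simp add: x_def y_def coprime_int_iff[symmetric])
  have "y ^ 2 dvd x ^ 2 * c" "x ^ 2 dvd a * y ^ 2" using e by (metis dvd_triv_right, metis dvd_triv_left)
  then have "y ^ 2 dvd c" "x ^ 2 dvd a" using cop
    by (simp_all add: coprime_dvd_mult_right_iff coprime_dvd_mult_left_iff coprime_commute)
  then have "y dvd 1" "x dvd 1" using squarefreeD a c by blast+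
  then show ?thesis using e by simp
qed

context subfield_of_complex
begin

lemma is_sq_mult: "is_sq K x \<Longrightarrow> is_sq K y \<Longrightarrow> is_sq K (x * y)"
proof -
  assume "is_sq K x" "is_sq K y"
  then obtain a b where "a \<in> K" "b \<in> K" "x = a * a" "y = b * b" by (auto simp: is_sq_def)
  then have "x * y = (a * b) * (a * b)" "a * b \<in> K" by (auto simp: ac_simps)
  then show ?thesis unfolding is_sq_def by blast
qed

lemma is_sq_square: "x \<in> K \<Longrightarrow> is_sq K (x * x)"
  by (auto simp: is_sq_def)

lemma is_sq_cancel: "is_sq K (x * y) \<Longrightarrow> is_sq K x \<Longrightarrow> x \<noteq> 0 \<Longrightarrow> is_sq K y"
proof -
  assume "is_sq K (x * y)" "is_sq K x" and x: "x \<noteq> 0"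
  then obtain a b where ab: "a \<in> K" "b \<in> K" "x * y = a * a" "x = b * b" by (auto simp: is_sq_def)
  then have "y = (a / b) * (a / b)" using x by (simp add: field_simps)
  then show ?thesis using K_divide[OF ab(1,2)] unfolding is_sq_def by blast
qed

lemma is_sq_mult_square_iff: "q \<in> K \<Longrightarrow> q \<noteq> 0 \<Longrightarrow> is_sq K (x * (q * q)) \<longleftrightarrow> is_sq K x"
  using is_sq_mult[of x "q * q"] is_sq_cancel[of "q * q" x] is_sq_square[of q] by (auto simp: ac_simps)

lemma unit_setD: "u \<in> unit_set K \<Longrightarrow> u \<in> OK K" "u \<in> unit_set K \<Longrightarrow> u \<noteq> 0" "u \<in> unit_set K \<Longrightarrow> u \<in> K"
  by (auto simp: unit_set_def OK_imp_K)

lemma mgrp_unit_set: "mgrp (unit_set K)"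
  by (auto simp: mgrp_def unit_set_def OK_mult)

lemma minus_1_unit: "- 1 \<in> unit_set K"
  by (auto simp: unit_set_def OK_uminus)

lemma unit_sqrt: "a \<in> K \<Longrightarrow> a * a \<in> unit_set K \<Longrightarrow> a \<in> unit_set K"
proof -
  assume a: "a \<in> K" "a * a \<in> unit_set K"
  have int: "x \<in> OK K" if "x \<in> K" "x * x \<in> OK K" for x
    using that algebraic_int_of_power[of x 2] by (simp add: OK_iff power2_eq_square)
  have "a \<in> OK K" using a int by (auto simp: unit_set_def)
  moreover have "inverse a \<in> OK K" using a int[OF K_inverse[OF a(1)]] by (auto simp: unit_set_def)
  ultimately show ?thesis using a by (auto simp: unit_set_def)
qed

lemma prod_nz: "prime_set C \<Longrightarrow> (of_nat (\<Prod>C) :: complex) \<noteq> 0"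
  using prime_set_pos[of C] by (simp only: of_nat_eq_0_iff) simp

lemma is_sq_sym_diff:
  assumes "prime_set A" "prime_set B"
  shows "is_sq K (of_nat (\<Prod>(sym_diff A B)) * x) \<longleftrightarrow> is_sq K (of_nat (\<Prod>A) * of_nat (\<Prod>B) * x)"
proof -
  let ?q = "of_nat (\<Prod>(A \<inter> B)) :: complex"
  have fin: "finite A" "finite B" using assms by (auto simp: prime_set_def)
  have "prime_set (A \<inter> B)" using assms by (auto simp: prime_set_def)
  then have q: "?q \<in> K" "?q \<noteq> 0" by (simp only: K_of_nat, rule prod_nz)
  have "(of_nat (\<Prod>A * \<Prod>B) :: complex) = of_nat (\<Prod>(sym_diff A B) * (\<Prod>(A \<inter> B) * \<Prod>(A \<inter> B)))"
    by (simp only: prod_sym_diff[OF fin])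
  then have eq: "of_nat (\<Prod>A) * of_nat (\<Prod>B) * x = (of_nat (\<Prod>(sym_diff A B)) * x) * (?q * ?q)"
    by (simp only: of_nat_mult ac_simps)
  show ?thesis unfolding eq by (simp only: is_sq_mult_square_iff[OF q])
qed

lemma squares_unit_subset_Uplus: "squares (unit_set K) \<subseteq> Uplus K"
proof
  fix u assume "u \<in> squares (unit_set K)"
  then obtain v where v: "v \<in> unit_set K" "u = v * v" by (auto simp: squares_def)
  have "is_sq K (of_nat (\<Prod>{}) * u)" using v is_sq_square unit_setD by simp
  moreover have "prime_set {}" by (simp add: prime_set_def)
  ultimately show "u \<in> Uplus K" unfolding Uplus_def using v mgrp_mult[OF mgrp_unit_set] by blast
qed

lemma Uplus_if:
  assumes u: "u \<in> unit_set K" and r: "r \<in> \<rat>" "r \<in> \<real>" "Re r > 0" "is_sq K (r * u)"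
  shows "u \<in> Uplus K"
proof -
  obtain C q where C: "prime_set C" "q \<in> \<rat>" "q \<noteq> 0" "of_nat (\<Prod>C) = r * (q * q)"
    using positive_rational_squarefree[OF r(1-3)] by blast
  have "is_sq K (r * u * (q * q))" using is_sq_mult_square_iff[OF K_Rats[OF C(2)] C(3)] r(4) by blast
  moreover have "of_nat (\<Prod>C) * u = r * u * (q * q)" unfolding C(4) by (simp only: ac_simps)
  ultimately have "is_sq K (of_nat (\<Prod>C) * u)" by (simp only:)
  then show ?thesis using C(1) u unfolding Uplus_def by blast
qed

lemma mgrp_Uplus: "mgrp (Uplus K)"
  unfolding mgrp_def
proof (intro conjI ballI)
  show "1 \<in> Uplus K" using squares_unit_subset_Uplus mgrp_1[OF mgrp_squares[OF mgrp_unit_set]] by blast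
  show "0 \<notin> Uplus K" by (simp add: Uplus_def unit_set_def)
  fix u assume "u \<in> Uplus K"
  then obtain A where A: "u \<in> unit_set K" "prime_set A" "is_sq K (of_nat (\<Prod>A) * u)" by (auto simp: Uplus_def)
  have "is_sq K (of_nat (\<Prod>A) * u * (inverse u * inverse u))"
    by (rule is_sq_mult[OF A(3) is_sq_square[OF K_inverse[OF unit_setD(3)[OF A(1)]]]])
  then have "is_sq K (of_nat (\<Prod>A) * inverse u)" using unit_setD(2)[OF A(1)] by (simp add: field_simps)
  then show "inverse u \<in> Uplus K" using A mgrp_inverse[OF mgrp_unit_set] by (auto simp: Uplus_def)
  fix v assume "v \<in> Uplus K"
  then obtain B where B: "v \<in> unit_set K" "prime_set B" "is_sq K (of_nat (\<Prod>B) * v)" by (auto simp: Uplus_def)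
  have "is_sq K (of_nat (\<Prod>A) * u * (of_nat (\<Prod>B) * v))" by (rule is_sq_mult[OF A(3) B(3)])
  then have "is_sq K (of_nat (\<Prod>A) * of_nat (\<Prod>B) * (u * v))" by (simp only: ac_simps)
  then have "is_sq K (of_nat (\<Prod>(sym_diff A B)) * (u * v))" by (simp only: is_sq_sym_diff[OF A(2) B(2)])
  then show "u * v \<in> Uplus K" using prime_set_sym_diff[OF A(2) B(2)] A B mgrp_mult[OF mgrp_unit_set]
    unfolding Uplus_def by blast
qed

text \<open>Send C to the set of units u for which u times the product of C is a square. This is one
  coset of the squares of units, the cosets that occur are those in \<open>Uplus K\<close>, and two
  sets have the same image iff their symmetric difference lies in \<open>Dset K\<close>.\<close>

lemma card_CC:
  assumes D: "finite (Dset K)" and fin: "finite (cosets (Uplus K) (squares (unit_set K)))"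
  shows "finite (CC K)" "card (CC K) = card (cosets (Uplus K) (squares (unit_set K))) * card (Dset K)"
proof -
  let ?E2 = "squares (unit_set K)"
  note mE = mgrp_unit_set
  define g where "g C = {u \<in> unit_set K. is_sq K (of_nat (\<Prod>C) * u)}" for C
  have g: "g C = smul u ?E2" if C: "prime_set C" and u: "u \<in> g C" for C u
  proof (intro equalityI subsetI)
    have uE: "u \<in> unit_set K" "is_sq K (of_nat (\<Prod>C) * u)" using u by (auto simp: g_def)
    fix v
    { assume "v \<in> g C"
      then have v: "v \<in> unit_set K" "is_sq K (of_nat (\<Prod>C) * v)" by (auto simp: g_def)
      obtain a b where ab: "a \<in> K" "b \<in> K" "of_nat (\<Prod>C) * u = a * a" "of_nat (\<Prod>C) * v = b * b"
        using v uE unfolding is_sq_def by blast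
      have nz: "(of_nat (\<Prod>C) :: complex) \<noteq> 0" "u \<noteq> 0" "a \<noteq> 0" using prod_nz[OF C] unit_setD(2)[OF uE(1)] ab(3) by auto
      \<comment> \<open>The quotient of two members of \<open>g C\<close> is a unit and a square in
        K, and the square root of a unit is a unit.\<close>
      have "(b / a) * (b / a) = (of_nat (\<Prod>C) * v) / (of_nat (\<Prod>C) * u)" unfolding ab(3,4) by simp
      also have "\<dots> = v / u" using nz by simp
      finally have sq: "(b / a) * (b / a) = v / u" .
      have "v / u \<in> unit_set K" by (rule mgrp_divide[OF mE v(1) uE(1)])
      then have "b / a \<in> unit_set K" using sq unit_sqrt[OF K_divide[OF ab(2,1)]] by simp
      then have "(b / a) * (b / a) \<in> ?E2" unfolding squares_def by (rule imageI)
      then have "v / u \<in> ?E2" by (simp only: sq)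
      then have "u * (v / u) \<in> smul u ?E2" by (rule imageI)
      then show "v \<in> smul u ?E2" using nz by simp }
    { assume "v \<in> smul u ?E2"
      then obtain e where e: "e \<in> unit_set K" "v = u * (e * e)" by (auto simp: squares_def)
      have "is_sq K (of_nat (\<Prod>C) * u * (e * e))" by (rule is_sq_mult[OF uE(2) is_sq_square[OF unit_setD(3)[OF e(1)]]])
      moreover have "v \<in> unit_set K" unfolding e(2) by (intro mgrp_mult[OF mE] uE e)
      ultimately show "v \<in> g C" by (simp add: g_def e(2) mult.assoc) }
  qed
  have nonempty: "\<exists>u. u \<in> g C" if "C \<in> CC K" for C using that by (auto simp: CC_def g_def)
  have img: "g ` CC K = cosets (Uplus K) ?E2"
  proof (intro equalityI subsetI)
    fix X assume "X \<in> g ` CC K"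
    then obtain C where C: "C \<in> CC K" "X = g C" by blast
    then obtain u where u: "u \<in> g C" using nonempty by blast
    have pC: "prime_set C" using C by (simp add: CC_def)
    have "u \<in> Uplus K" using u pC by (auto simp: g_def Uplus_def)
    then show "X \<in> cosets (Uplus K) ?E2" using g[OF pC u] C by (auto simp: cosets_def)
  next
    fix X assume "X \<in> cosets (Uplus K) ?E2"
    then obtain u where u: "u \<in> Uplus K" "X = smul u ?E2" by (auto simp: cosets_def)
    then obtain C where C: "prime_set C" "u \<in> g C" by (auto simp: Uplus_def g_def)
    then have "C \<in> CC K" by (auto simp: CC_def g_def)
    then show "X \<in> g ` CC K" using g[OF C] u by blast
  qed
  have eq_iff: "g C = g C0 \<longleftrightarrow> sym_diff C C0 \<in> Dset K" if C: "C \<in> CC K" and C0: "C0 \<in> CC K" for C C0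
  proof -
    have p: "prime_set C" "prime_set C0" using C C0 by (auto simp: CC_def)
    have D_iff: "sym_diff C C0 \<in> Dset K \<longleftrightarrow> is_sq K (of_nat (\<Prod>C) * of_nat (\<Prod>C0) * 1)"
      using is_sq_sym_diff[OF p, of 1] prime_set_sym_diff[OF p] by (simp only: Dset_def mult_1_right) simp
    obtain u where u: "u \<in> g C" using nonempty[OF C] by blast
    then have u': "u \<in> unit_set K" "is_sq K (of_nat (\<Prod>C) * u)" by (auto simp: g_def)
    have nz: "of_nat (\<Prod>C) * u \<noteq> 0" using prod_nz[OF p(1)] unit_setD(2)[OF u'(1)] by (metis mult_eq_0_iff)
    have u0: "u * u \<noteq> 0" using unit_setD(2)[OF u'(1)] by simp
    show ?thesis
    proof
      assume "g C = g C0"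
      then have "is_sq K (of_nat (\<Prod>C0) * u)" using u by (auto simp: g_def)
      then have "is_sq K ((of_nat (\<Prod>C) * u) * (of_nat (\<Prod>C0) * u))" using is_sq_mult u' by blast
      then have "is_sq K ((u * u) * (of_nat (\<Prod>C) * of_nat (\<Prod>C0) * 1))" by (simp only: ac_simps mult_1_left mult_1_right)
      then show "sym_diff C C0 \<in> Dset K" unfolding D_iff
        by (rule is_sq_cancel[OF _ is_sq_square[OF unit_setD(3)[OF u'(1)]] u0])
    next
      assume "sym_diff C C0 \<in> Dset K"
      then have "is_sq K ((of_nat (\<Prod>C) * of_nat (\<Prod>C0) * 1) * (u * u))"
        unfolding D_iff using is_sq_mult is_sq_square[OF unit_setD(3)[OF u'(1)]] by blast
      then have "is_sq K ((of_nat (\<Prod>C) * u) * (of_nat (\<Prod>C0) * u))" by (simp only: ac_simps mult_1_left mult_1_right)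
      then have "is_sq K (of_nat (\<Prod>C0) * u)" by (rule is_sq_cancel[OF _ u'(2) nz])
      then have "u \<in> g C0" using u' by (simp add: g_def)
      then show "g C = g C0" using g[OF p(1) u] g[OF p(2)] by simp
    qed
  qed
  have fib: "finite {C \<in> CC K. g C = g C0} \<and> card {C \<in> CC K. g C = g C0} = card (Dset K)" if C0: "C0 \<in> CC K" for C0
  proof -
    have p0: "prime_set C0" using C0 by (simp add: CC_def)
    have inv: "sym_diff (sym_diff A C0) C0 = A" for A by auto
    have mem: "sym_diff A C0 \<in> CC K \<and> g (sym_diff A C0) = g C0" if A: "A \<in> Dset K" for A
    proof -
      have pA: "prime_set A" "is_sq K (of_nat (\<Prod>A))" using A by (auto simp: Dset_def)
      obtain u where u: "u \<in> unit_set K" "is_sq K (of_nat (\<Prod>C0) * u)" using C0 by (auto simp: CC_def)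
      have "is_sq K (of_nat (\<Prod>A) * (of_nat (\<Prod>C0) * u))" by (rule is_sq_mult[OF pA(2) u(2)])
      then have "is_sq K (of_nat (\<Prod>(sym_diff A C0)) * u)" unfolding is_sq_sym_diff[OF pA(1) p0] by (simp only: mult.assoc)
      then have c: "sym_diff A C0 \<in> CC K" using u prime_set_sym_diff[OF pA(1) p0] unfolding CC_def by blast
      have "sym_diff (sym_diff A C0) C0 \<in> Dset K" using A by (simp only: inv)
      then show ?thesis using eq_iff[OF c C0] c by blast
    qed
    have "bij_betw (\<lambda>C. sym_diff C C0) {C \<in> CC K. g C = g C0} (Dset K)"
    proof (rule bij_betwI[of _ _ _ "\<lambda>C. sym_diff C C0"])
      show "(\<lambda>C. sym_diff C C0) \<in> {C \<in> CC K. g C = g C0} \<rightarrow> Dset K" using eq_iff C0 by blast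
      show "(\<lambda>C. sym_diff C C0) \<in> Dset K \<rightarrow> {C \<in> CC K. g C = g C0}" using mem by blast
    qed (rule inv)+
    then show ?thesis using D bij_betw_same_card bij_betw_finite by blast
  qed
  show "finite (CC K)" by (rule card_fibers(1)[of g]) (use img fin fib in auto)
  show "card (CC K) = card (cosets (Uplus K) ?E2) * card (Dset K)"
    using card_fibers(2)[of g "CC K" "card (Dset K)"] img fin fib by simp
qed

end

section \<open>Units and square classes of quadratic fields\<close>

lemma dirichlet_approximation:
  fixes t :: real and N :: nat
  assumes "N > 0"
  obtains p q :: int where "q > 0" "q \<le> int N" "\<bar>of_int p - of_int q * t\<bar> * of_nat N < 1"
proof -
  define f where "f i = \<lfloor>of_nat N * frac (of_nat i * t)\<rfloor>" for i :: nat
  have rng: "f ` {0..N} \<subseteq> {0..<int N}"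
  proof (rule image_subsetI)
    fix i
    have "0 \<le> frac (of_nat i * t)" "frac (of_nat i * t) < 1" by (simp_all add: frac_lt_1)
    then have "0 \<le> of_nat N * frac (of_nat i * t)" "of_nat N * frac (of_nat i * t) < of_nat N" using assms by simp_all
    then show "f i \<in> {0..<int N}" unfolding f_def by (simp add: floor_less_iff)
  qed
  \<comment> \<open>N + 1 multiples of t fall into N intervals of length 1 / N.\<close>
  have "\<not> inj_on f {0..N}"
  proof
    assume "inj_on f {0..N}"
    then have "card {0..N} \<le> card {0..<int N}" using card_inj_on_le[OF _ rng] by simp
    then show False by simp
  qed
  then obtain a b where "a \<noteq> b" "a \<le> N" "b \<le> N" "f a = f b" unfolding inj_on_def by auto
  then obtain i j where ij: "i < j" "j \<le> N" "f i = f j" by (metis linorder_neqE_nat)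
  define p q where "p = \<lfloor>of_nat j * t\<rfloor> - \<lfloor>of_nat i * t\<rfloor>" and "q = int j - int i"
  have pq: "of_int p - of_int q * t = frac (of_nat i * t) - frac (of_nat j * t)"
    unfolding p_def q_def frac_def by (simp add: algebra_simps)
  have "\<bar>of_nat N * frac (of_nat i * t) - of_nat N * frac (of_nat j * t)\<bar> < 1"
    using ij(3) unfolding f_def by linarith
  moreover have "\<bar>of_nat N * frac (of_nat i * t) - of_nat N * frac (of_nat j * t)\<bar> = \<bar>of_int p - of_int q * t\<bar> * of_nat N"
    unfolding pq by (simp add: abs_mult right_diff_distrib[symmetric] mult.commute)
  ultimately show thesis using that[of q p] ij by (simp add: q_def)
qed

lemma finite_quadratic_roots: "finite {z::complex. z * z - t * z + c = 0}"
proof (cases "\<exists>z0. z0 * z0 - t * z0 + c = 0")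
  case True
  then obtain z0 where z0: "z0 * z0 - t * z0 + c = 0" by blast
  have "{z. z * z - t * z + c = 0} \<subseteq> {z0, t - z0}"
  proof
    fix z assume "z \<in> {z. z * z - t * z + c = 0}"
    moreover have "(z - z0) * (z - (t - z0)) = (z * z - t * z + c) - (z0 * z0 - t * z0 + c)"
      by (simp add: algebra_simps)
    ultimately have "(z - z0) * (z - (t - z0)) = 0" using z0 by simp
    then show "z \<in> {z0, t - z0}" by auto
  qed
  then show ?thesis using finite_subset by blast
qed simp

lemma Rats_imp_Reals: "(z::complex) \<in> \<rat> \<Longrightarrow> z \<in> \<real>"
  by (auto elim!: Rats_cases')

context quadratic_field
begin

lemma unit_norm: "u \<in> unit_set k \<Longrightarrow> u * cj u = 1 \<or> u * cj u = -1"
proof -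
  assume u: "u \<in> unit_set k"
  then have u': "u \<in> OK k" "inverse u \<in> OK k" "u \<noteq> 0" "u \<in> k" by (auto simp: unit_set_def OK_imp_K)
  obtain a where a: "u * cj u = of_int a" using norm_Ints[OF u'(1)] by (rule Ints_cases)
  obtain b where b: "inverse u * cj (inverse u) = of_int b" using norm_Ints[OF u'(2)] by (rule Ints_cases)
  have "cj u \<noteq> 0" using u'(3) aut_eq_0[OF cj_aut] by simp
  then have "(u * cj u) * (inverse u * cj (inverse u)) = 1" using u'(3) unfolding aut_inverse[OF cj_aut u'(4)] by (simp add: field_simps)
  then have "of_int (a * b) = (1 :: complex)" using a b by simp
  then have "a * b = 1" using of_int_eq_1_iff by blast
  then have "a = 1 \<or> a = -1" using zmult_eq_1_iff by blast
  then show ?thesis using a by auto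
qed

lemma cj_unit: "u \<in> unit_set k \<Longrightarrow> cj u \<in> unit_set k"
  using aut_OK[OF cj_aut] aut_eq_0[OF cj_aut] by (auto simp: unit_set_def aut_inverse[OF cj_aut, symmetric] OK_imp_K)

text \<open>A unit is a root of T^2 - a T + c with c = 1 or -1, where the integer a, its trace, is
  at most 2 B in absolute value.\<close>

lemma finite_bounded_units: "finite {u \<in> unit_set k. norm u \<le> B \<and> norm (cj u) \<le> B}"
proof -
  let ?I = "{- \<lceil>2 * B\<rceil>..\<lceil>2 * B\<rceil>} \<times> {1, -1::complex}"
  have "{u \<in> unit_set k. norm u \<le> B \<and> norm (cj u) \<le> B} \<subseteq> (\<Union>(a, c)\<in>?I. {z. z * z - of_int a * z + c = 0})"
  proof
    fix u assume "u \<in> {u \<in> unit_set k. norm u \<le> B \<and> norm (cj u) \<le> B}"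
    then have u: "u \<in> unit_set k" "norm u \<le> B" "norm (cj u) \<le> B" by auto
    obtain a where a: "u + cj u = of_int a" using trace_Ints[OF unit_setD(1)[OF u(1)]] by (rule Ints_cases)
    have "norm (u + cj u) \<le> 2 * B" using norm_triangle_ineq[of u "cj u"] u by linarith
    then have "\<bar>of_int a\<bar> \<le> 2 * B" unfolding a by simp
    then have "a \<in> {- \<lceil>2 * B\<rceil>..\<lceil>2 * B\<rceil>}" by (auto simp: abs_le_iff) linarith+
    moreover have "u * cj u \<in> {1, -1}" using unit_norm[OF u(1)] by auto
    moreover have "u * u - of_int a * u + u * cj u = 0" unfolding a[symmetric] by (simp add: algebra_simps)
    ultimately show "u \<in> (\<Union>(a, c)\<in>?I. {z. z * z - of_int a * z + c = 0})" by blast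
  qed
  moreover have "finite (\<Union>(a, c)\<in>?I. {z. z * z - of_int a * z + c = 0})"
    using finite_quadratic_roots by auto
  ultimately show ?thesis by (rule finite_subset)
qed

lemma square_rational_cases:
  assumes \<alpha>: "\<alpha> \<in> k" "\<alpha> * \<alpha> \<in> \<rat>" shows "\<alpha> \<in> \<rat> \<or> (\<exists>b\<in>\<rat>. \<alpha> = b * s)"
proof -
  obtain a b where ab: "a \<in> \<rat>" "b \<in> \<rat>" "\<alpha> = a + b * s" using quad_form[OF \<alpha>(1)] by blast
  have "cj \<alpha> * cj \<alpha> = \<alpha> * \<alpha>" using aut_Rats[OF cj_aut \<alpha>(2)] aut_mult[OF cj_aut \<alpha>(1) \<alpha>(1)] by simp
  then consider "cj \<alpha> = \<alpha>" | "cj \<alpha> = - \<alpha>" by (auto simp: square_eq_iff)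
  then show ?thesis
  proof cases
    case 1 then show ?thesis using cj_fixed \<alpha> by blast
  next
    case 2
    then have "2 * a = 0" using cj_form[OF ab(1,2)] ab(3) by (simp add: algebra_simps)
    then show ?thesis using ab by auto
  qed
qed

lemma trivial_prime_set:
  assumes "prime_set C" "(a::complex) \<in> \<rat>" "of_nat (\<Prod>C) = a * a" shows "C = {}"
proof -
  have "\<Prod>C = 1" by (rule squarefree_ratio[OF prime_set_prime_factors(2)[OF assms(1)] prime_set_pos[OF assms(1)] _ _ assms(2)])
    (use assms(3) in simp_all)
  then have "prime_factors (\<Prod>C) = {}" by simp
  then show ?thesis using prime_set_prime_factors(1)[OF assms(1)] by simp
qed

lemma d_nz: "d \<noteq> 0" and d_neq_1: "d \<noteq> 1"
proof -
  show "d \<noteq> 0" using s_sq s_nz by auto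
  show "d \<noteq> 1"
  proof
    assume "d = 1"
    then have "s * s = 1 * 1" using s_sq by simp
    then have "s = 1 \<or> s = -1" by (simp only: square_eq_iff)
    then show False using s_irr by auto
  qed
qed

text \<open>The product of C is d times the square of a rational, so d is positive, and two
  squarefree numbers in the same square class are equal.\<close>

lemma multiple_prime_set:
  assumes C: "prime_set C" "b \<in> \<rat>" "of_nat (\<Prod>C) = (b * s) * (b * s)"
  shows "d > 0" "C = prime_factors (nat d)"
proof -
  have eq: "of_nat (\<Prod>C) = b * b * (of_int d :: complex)"
    unfolding C(3) s_sq[symmetric] by (simp only: ac_simps)
  obtain q where q: "b = of_rat q" using C(2) by (auto elim: Rats_cases)
  have "of_rat (of_nat (\<Prod>C)) = (of_rat (q * q * of_int d) :: complex)"
    using eq unfolding q by (simp only: of_rat_of_nat_eq of_rat_mult of_rat_of_int_eq)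
  then have "of_nat (\<Prod>C) = q * q * of_int d" by (simp only: of_rat_eq_iff)
  moreover have "(of_nat (\<Prod>C) :: rat) > 0" using prime_set_pos[OF C(1)] by (simp only: of_nat_0_less_iff)
  moreover have "q * q \<ge> 0" by simp
  ultimately have "(of_int d :: rat) > 0" using zero_less_mult_iff[of "q * q" "of_int d"] by linarith
  then show d0: "d > 0" by simp
  then have dn: "of_nat (nat d) = (of_int d :: complex)" by simp
  have sf: "squarefree (nat d)"
  proof (rule squarefreeI)
    fix x assume "x ^ 2 dvd nat d"
    then have "int (x ^ 2) dvd int (nat d)" by (simp only: of_nat_dvd_iff)
    then have "int x ^ 2 dvd d" using d0 by simp
    then have "int x dvd 1" using squarefreeD[OF sqf, of "int x"] by simp
    then show "x dvd 1" by simp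
  qed
  have "\<Prod>C = nat d"
    by (rule squarefree_ratio[OF prime_set_prime_factors(2)[OF C(1)] prime_set_pos[OF C(1)] sf _ C(2)])
      (use d0 eq dn in simp_all)
  then show "C = prime_factors (nat d)" using prime_set_prime_factors(1)[OF C(1)] by simp
qed

lemma factors_d:
  assumes "d > 0"
  shows "prime_set (prime_factors (nat d))" "of_nat (\<Prod>(prime_factors (nat d))) = s * s" "prime_factors (nat d) \<noteq> {}"
proof -
  have sf: "squarefree (nat d)"
  proof (rule squarefreeI)
    fix x assume "x ^ 2 dvd nat d"
    then have "int (x ^ 2) dvd int (nat d)" by (simp only: of_nat_dvd_iff)
    then have "int x ^ 2 dvd d" using assms by simp
    then have "int x dvd 1" using squarefreeD[OF sqf, of "int x"] by simp
    then show "x dvd 1" by simp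
  qed
  have pr: "\<Prod>(prime_factors (nat d)) = nat d" by (rule squarefree_prod_prime_factors(2)[OF sf]) (use assms in simp)
  show "prime_set (prime_factors (nat d))" by (rule squarefree_prod_prime_factors(1)[OF sf]) (use assms in simp)
  show "of_nat (\<Prod>(prime_factors (nat d))) = s * s" unfolding pr s_sq using assms by simp
  show "prime_factors (nat d) \<noteq> {}"
  proof
    assume "prime_factors (nat d) = {}"
    then have "nat d = 1" using pr by simp
    then show False using d_neq_1 assms by simp
  qed
qed

text \<open>A square root in k of a rational is rational or a rational multiple of s; this leaves
  the square class of 1 and, if it is positive, that of d.\<close>

lemma Dset_eq: "Dset k = (if d > 0 then {{}, prime_factors (nat d)} else {{}})"
proof (intro equalityI subsetI)
  fix C assume "C \<in> Dset k"
  then obtain \<alpha> where C: "prime_set C" "\<alpha> \<in> k" "of_nat (\<Prod>C) = \<alpha> * \<alpha>" by (auto simp only: Dset_def is_sq_def)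
  have "of_nat (\<Prod>C) \<in> (\<rat> :: complex set)" by (rule Rats_of_nat)
  then have "\<alpha> * \<alpha> \<in> \<rat>" by (simp only: C(3))
  then consider "\<alpha> \<in> \<rat>" | b where "b \<in> \<rat>" "\<alpha> = b * s" using square_rational_cases[OF C(2)] by blast
  then show "C \<in> (if d > 0 then {{}, prime_factors (nat d)} else {{}})"
  proof cases
    case 1
    then show ?thesis using trivial_prime_set[OF C(1) _ C(3)] by simp
  next
    case 2
    then show ?thesis using multiple_prime_set[OF C(1) 2(1)] C(3) by simp
  qed
next
  fix C assume C: "C \<in> (if d > 0 then {{}, prime_factors (nat d)} else {{}})"
  have "{} \<in> Dset k" using is_sq_square[OF K_1] by (simp add: Dset_def prime_set_def)
  moreover have "prime_factors (nat d) \<in> Dset k" if "d > 0"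
    using factors_d[OF that] is_sq_square[OF s_in] by (simp only: Dset_def mem_Collect_eq)
  ultimately show "C \<in> Dset k" using C by (auto split: if_splits)
qed

lemma card_Dset: "card (Dset k) = (if d > 0 then 2 else 1)" "finite (Dset k)"
proof -
  have "card {{}, X} = 2" if "X \<noteq> {}" for X :: "nat set" using that by auto
  from this[OF factors_d(3)] show "card (Dset k) = (if d > 0 then 2 else 1)" by (simp add: Dset_eq)
  show "finite (Dset k)" by (simp add: Dset_eq)
qed

text \<open>Hilbert 90 made explicit: if u u' = 1, then (1 + u)^2 = (2 + u + u') u, and 2 + u + u'
  is rational.\<close>

lemma norm_1_square:
  assumes u: "u \<in> unit_set k" "u * cj u = 1"
  shows "is_sq k ((2 + (u + cj u)) * u)"
proof -
  have "(2 + (u + cj u)) * u = (1 + u) * (1 + u)" using u(2) by (simp add: algebra_simps)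
  then show ?thesis using is_sq_square[of "1 + u"] unit_setD(3)[OF u(1)] by (simp add: K_add)
qed

lemma s_real_or_imaginary: "s = of_real (sqrt (of_int d)) \<or> s = - of_real (sqrt (of_int d))" if "d > 0"
proof -
  have "of_real (sqrt (of_int d)) * of_real (sqrt (of_int d)) = (of_int d :: complex)"
    using that by (simp flip: of_real_mult)
  then show ?thesis using s_sq by (metis square_eq_iff)
qed

lemma real_if_pos: "d > 0 \<Longrightarrow> k \<subseteq> \<real>"
proof
  fix z assume d: "d > 0" and z: "z \<in> k"
  have sR: "s \<in> \<real>" using s_real_or_imaginary[OF d] by (auto simp del: of_real_sqrt)
  obtain a b where ab: "a \<in> \<rat>" "b \<in> \<rat>" "z = a + b * s" using quad_form[OF z] by blast
  have "a \<in> \<real>" "b \<in> \<real>" using ab Rats_imp_Reals by blast+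
  then show "z \<in> \<real>" unfolding ab(3) using sR by (intro Reals_add Reals_mult)
qed

lemma not_real_if_neg: "d < 0 \<Longrightarrow> s \<notin> \<real>"
proof
  assume d: "d < 0" and "s \<in> \<real>"
  then obtain x where "s = of_real x" by (auto elim: Reals_cases)
  then have "of_real (x * x) = (of_real (of_int d) :: complex)" using s_sq by simp
  then have "x * x = of_int d" using of_real_eq_iff by blast
  then show False using d by (metis of_int_less_0_iff not_square_less_zero)
qed

lemma real_iff: "k \<subseteq> \<real> \<longleftrightarrow> d > 0"
  using real_if_pos not_real_if_neg s_in d_nz by (metis linorder_neqE_linordered_idom subsetD)

lemma cj_cnj: assumes "d < 0" "z \<in> k" shows "cj z = cnj z"
proof -
  obtain a b where ab: "a \<in> \<rat>" "b \<in> \<rat>" "z = a + b * s" using quad_form[OF assms(2)] by blast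
  have "a \<in> \<real>" "b \<in> \<real>" using ab Rats_imp_Reals by blast+
  then have c: "cnj a = a" "cnj b = b" by (simp_all add: Reals_cnj_iff)
  have "cnj s * cnj s = s * s" using s_sq by (metis complex_cnj_mult complex_cnj_of_int)
  then have "cnj s = s \<or> cnj s = - s" by (simp only: square_eq_iff)
  then have "cnj s = - s" using not_real_if_neg[OF assms(1)] by (auto simp: Reals_cnj_iff)
  then show ?thesis using cj_form[OF ab(1,2)] ab(3) c by simp
qed

lemma imaginary_unit: assumes "d < 0" "u \<in> unit_set k" shows "norm u = 1" "u * cj u = 1"
proof -
  have e: "u * cj u = of_real ((norm u) ^ 2)"
    using cj_cnj[OF assms(1) unit_setD(3)[OF assms(2)]] by (simp only: complex_norm_square)
  then have "of_real ((norm u)\<^sup>2) = (of_real 1 :: complex) \<or> of_real ((norm u)\<^sup>2) = (of_real (-1) :: complex)"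
    using unit_norm[OF assms(2)] by simp
  then have "(norm u)\<^sup>2 = 1 \<or> (norm u)\<^sup>2 = -1" by (simp only: of_real_eq_iff)
  moreover have "(norm u)\<^sup>2 \<ge> 0" by simp
  ultimately have n: "(norm u)\<^sup>2 = 1" by linarith
  then show "norm u = 1" using norm_ge_zero[of u] by (auto simp: power2_eq_1_iff)
  show "u * cj u = 1" using e n by simp
qed

lemma imaginary_finite_units: "d < 0 \<Longrightarrow> finite (unit_set k)"
proof -
  assume d: "d < 0"
  have "unit_set k \<subseteq> {u \<in> unit_set k. norm u \<le> 1 \<and> norm (cj u) \<le> 1}"
    using imaginary_unit[OF d] cj_unit by force
  then show ?thesis using finite_bounded_units finite_subset by blast
qed

text \<open>The factor 2 + u + u' of \<open>norm_1_square\<close> is 2 + 2 Re u, which is positive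
  because u has absolute value 1 and differs from -1. For u = -1 the positive rational -d serves, as
  (-d)(-1) = s^2.\<close>

lemma imaginary_Uplus: "d < 0 \<Longrightarrow> Uplus k = unit_set k"
proof
  assume d: "d < 0"
  show "Uplus k \<subseteq> unit_set k" by (auto simp: Uplus_def)
  show "unit_set k \<subseteq> Uplus k"
  proof
    fix u assume u: "u \<in> unit_set k"
    show "u \<in> Uplus k"
    proof (cases "u = -1")
      case True
      have "of_int (- d) * u = s * s" using True s_sq by simp
      then have "is_sq k (of_int (- d) * u)" using is_sq_square[OF s_in] by (simp only:)
      then show ?thesis by (intro Uplus_if[OF u, of "of_int (- d)"]) (use d in auto)
    next
      case False
      let ?r = "2 + (u + cj u)"
      have n: "norm u = 1" using imaginary_unit[OF d u] by simp
      have r: "?r = of_real (2 + 2 * Re u)"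
        using cj_cnj[OF d unit_setD(3)[OF u]] by (simp add: complex_add_cnj)
      have "(Re u)\<^sup>2 + (Im u)\<^sup>2 = 1" using n by (simp add: cmod_def)
      have "Re u > -1"
      proof (rule ccontr)
        assume "\<not> Re u > -1"
        then have "1 \<le> - Re u" by simp
        then have "1 \<le> (- Re u)\<^sup>2" by (rule one_le_power)
        then have "1 \<le> (Re u)\<^sup>2" by simp
        moreover have "(Im u)\<^sup>2 \<ge> 0" by simp
        ultimately have "(Im u)\<^sup>2 = 0" "(Re u)\<^sup>2 = 1" using \<open>(Re u)\<^sup>2 + (Im u)\<^sup>2 = 1\<close> by linarith+
        then have "Im u = 0" "Re u = 1 \<or> Re u = -1" by (simp_all add: power2_eq_1_iff)
        then have "u = -1" using \<open>\<not> Re u > -1\<close> by (simp add: complex_eq_iff)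
        then show False using False by simp
      qed
      then have "Re ?r > 0" unfolding r by simp
      moreover have "?r \<in> \<real>" unfolding r by simp
      moreover have "?r \<in> \<rat>" using trace_Rats[OF unit_setD(3)[OF u]] by simp
      ultimately show ?thesis using Uplus_if[OF u _ _ _ norm_1_square[OF u imaginary_unit(2)[OF d u]]] by blast
    qed
  qed
qed

lemma card_CC_imaginary: assumes "d < 0" shows "finite (CC k)" "card (CC k) = 2"
proof -
  have c: "card (cosets (Uplus k) (squares (unit_set k))) = 2"
    unfolding imaginary_Uplus[OF assms]
    by (rule finite_group_squares[OF mgrp_unit_set imaginary_finite_units[OF assms] minus_1_unit])
  \<comment> \<open>A nonzero cardinality implies finiteness, since \<open>card\<close> is 0 on
    infinite sets.\<close>
  then have fin: "finite (cosets (Uplus k) (squares (unit_set k)))" using card.infinite by fastforce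
  show "finite (CC k)" "card (CC k) = 2" using card_CC[OF card_Dset(2) fin] c card_Dset(1) assms by auto
qed

end

section \<open>Fundamental units of real quadratic fields\<close>

lemma powi_double: "x \<noteq> 0 \<Longrightarrow> x powi (2 * m) = x powi m * x powi m" for x :: complex
  using power_int_add[of x m m] by (simp only: mult_2) simp

context quadratic_field
begin

text \<open>The norm of p + q s.\<close>

definition qform :: "int \<Rightarrow> int \<Rightarrow> int" where
  "qform p q = p * p - d * (q * q)"

lemma qform_eq: "of_int (qform p q) = (of_int p + of_int q * s) * (of_int p - of_int q * s)"
  using s_sq by (simp add: qform_def algebra_simps)

lemma int_s_eq: assumes "of_int p + of_int q * s = of_int p' + of_int q' * s" shows "p = p'" "q = q'"
proof -
  have e: "of_int (q - q') * s = of_int (p' - p)" using assms by (simp add: algebra_simps)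
  show "q = q'"
  proof (rule ccontr)
    assume "q \<noteq> q'"
    then have "(of_int (q - q') :: complex) \<noteq> 0" by (metis of_int_eq_0_iff right_minus_eq)
    then have "s = of_int (p' - p) / of_int (q - q')" using e by (metis nonzero_mult_div_cancel_left)
    then show False using s_irr Rats_divide[OF Rats_of_int Rats_of_int] by metis
  qed
  then show "p = p'" using assms by simp
qed

lemma qform_nz: assumes "q \<noteq> 0" shows "qform p q \<noteq> 0"
proof
  assume "qform p q = 0"
  then have "(of_int p + of_int q * s) * (of_int p - of_int q * s) = 0" using qform_eq[of p q] by simp
  then have "of_int p + of_int q * s = of_int 0 + of_int 0 * s \<or> of_int p + of_int (- q) * s = of_int 0 + of_int 0 * s" by simp
  then show False using int_s_eq[of p q 0 0] int_s_eq[of p "- q" 0 0] assms by auto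
qed

text \<open>The numerator is \<alpha> + n \<beta> with \<alpha> the denominator and \<beta> = a + b
  s. As n = \<alpha> \<alpha>', the quotient is 1 + \<beta> \<alpha>', and X + Y s is the expansion
  of \<beta> \<alpha>'.\<close>

lemma quotient_integral:
  assumes n: "qform p q = n" "qform p' q' = n" "n \<noteq> 0" and c: "n dvd p - p'" "n dvd q - q'"
  shows "(of_int p + of_int q * s) / (of_int p' + of_int q' * s) \<in> OK k"
proof -
  obtain a b where ab: "p = p' + n * a" "q = q' + n * b" using c by (metis add_diff_cancel_left' diff_add_cancel add.commute dvdE)
  define X Y where "X = a * p' - d * b * q'" and "Y = b * p' - a * q'"
  have nn: "n = p' * p' - d * (q' * q')" using n(2) by (simp add: qform_def)
  have e1: "p = p' + (X * p' + d * (Y * q'))" unfolding ab(1) X_def Y_def nn by (simp add: algebra_simps)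
  have e2: "q = q' + (X * q' + Y * p')" unfolding ab(2) X_def Y_def nn by (simp add: algebra_simps)
  have nz: "of_int p' + of_int q' * s \<noteq> 0" using qform_eq[of p' q'] n by auto
  have "(1 + of_int X + of_int Y * s) * (of_int p' + of_int q' * s)
    = (of_int p' + of_int (X * p')) + (of_int q' + of_int (X * q' + Y * p')) * s + of_int (Y * q') * (s * s)"
    by (simp add: algebra_simps)
  also have "\<dots> = of_int (p' + (X * p' + d * (Y * q'))) + of_int (q' + (X * q' + Y * p')) * s"
    unfolding s_sq by (simp add: algebra_simps)
  also have "\<dots> = of_int p + of_int q * s" by (simp only: e1[symmetric] e2[symmetric])
  finally have "(of_int p + of_int q * s) / (of_int p' + of_int q' * s) = 1 + of_int X + of_int Y * s"
    using nz by (simp add: field_simps)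
  then show ?thesis using s_OK by (simp add: OK_add OK_mult)
qed

text \<open>The argument for Pell's equation: good approximations to t yield infinitely many p + q s
  of bounded norm. Two of them agree in the norm n and in p and q modulo n, so their quotient is a
  unit. The condition q > 0 rules out the quotient -1.\<close>

lemma exists_unit:
  assumes dp: "d > 0" obtains u where "u \<in> unit_set k" "Re u > 1"
proof -
  define t where "t = sqrt (real_of_int d)"
  have tt: "t * t = real_of_int d" and t0: "t > 0" using dp by (auto simp: t_def)
  \<comment> \<open>If |p - q t| < 1 / q \<le> 1, then |p + q t| \<le> |p - q t| + 2 q t, and the
    product of the two is at most 1 + 2 t.\<close>
  define B where "B = \<lceil>1 + 2 * t\<rceil>"
  define P where "P = {(p, q). q > 0 \<and> \<bar>qform p q\<bar> \<le> B}"
  have irr: "of_int p - of_int q * t \<noteq> 0" if "q > 0" for p q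
  proof
    assume "of_int p - of_int q * t = 0"
    then have "(of_int p - of_int q * t) * (of_int p + of_int q * t) = 0" by simp
    then have "real_of_int (qform p q) = 0" using tt by (simp add: qform_def algebra_simps)
    then show False using qform_nz[of q p] that by simp
  qed
  have "infinite P"
  proof
    assume fin: "finite P"
    define f where "f = (\<lambda>(p, q). \<bar>of_int p - of_int q * t\<bar>)"
    \<comment> \<open>Were P finite, the distances |p - q t| would have a positive minimum, and an
      approximation with N > 1 / \<delta> would beat it. The inserted 1 covers an empty P.\<close>
    define \<delta> where "\<delta> = Min (insert 1 (f ` P))"
    have "\<delta> \<in> insert 1 (f ` P)" unfolding \<delta>_def using fin by (intro Min_in) auto
    then have \<delta>0: "\<delta> > 0" using irr by (auto simp: f_def P_def)
    obtain N :: nat where N2: "1 / \<delta> < of_nat N" using reals_Archimedean2 by blast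
    have "0 < 1 / \<delta>" using \<delta>0 by simp
    then have "0 < real N" using N2 by linarith
    then have N: "N > 0" "1 / \<delta> < of_nat N" using N2 by simp_all
    obtain p q :: int where pq: "q > 0" "q \<le> int N" "\<bar>of_int p - of_int q * t\<bar> * of_nat N < 1"
      using dirichlet_approximation[OF N(1)] by blast
    define a where "a = \<bar>of_int p - of_int q * t\<bar>"
    have a0: "a \<ge> 0" by (simp add: a_def)
    have aq: "a * of_int q < 1"
    proof -
      have "a * of_int q \<le> a * of_nat N" using pq(2) a0 by (intro mult_left_mono) linarith+
      then show ?thesis using pq(3) by (simp add: a_def)
    qed
    have a1: "a < 1"
    proof -
      have "a * 1 \<le> a * of_int q" using pq(1) a0 by (intro mult_left_mono) linarith+
      then show ?thesis using aq by simp
    qed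
    have "(of_int p - of_int q * t) * (of_int p + of_int q * t) = of_int p * of_int p - (t * t) * (of_int q * of_int q)"
      by (simp add: algebra_simps)
    then have "(of_int p - of_int q * t) * (of_int p + of_int q * t) = real_of_int (qform p q)"
      unfolding tt by (simp add: qform_def)
    then have "real_of_int \<bar>qform p q\<bar> = a * \<bar>of_int p + of_int q * t\<bar>"
      unfolding a_def abs_mult[symmetric] by simp
    also have "\<bar>of_int p + of_int q * t\<bar> \<le> a + 2 * (of_int q * t)"
    proof -
      have "of_int q * t > 0" using pq(1) t0 by simp
      then show ?thesis unfolding a_def by linarith
    qed
    then have "a * \<bar>of_int p + of_int q * t\<bar> \<le> a * (a + 2 * (of_int q * t))" using a0 by (rule mult_left_mono)
    also have "\<dots> = a * a + 2 * t * (a * of_int q)" by (simp add: algebra_simps)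
    also have "\<dots> \<le> 1 + 2 * t"
    proof -
      have "a * a \<le> 1 * 1" using a0 a1 by (intro mult_mono) auto
      moreover have "2 * t * (a * of_int q) \<le> 2 * t * 1" using aq t0 by (intro mult_left_mono) auto
      ultimately show ?thesis by simp
    qed
    finally have "\<bar>qform p q\<bar> \<le> B" unfolding B_def by linarith
    then have "(p, q) \<in> P" using pq by (simp add: P_def)
    then have "\<delta> \<le> a" unfolding \<delta>_def using fin by (intro Min_le) (auto simp: f_def a_def intro!: rev_image_eqI)
    then have "\<delta> * of_nat N \<le> a * of_nat N" by (intro mult_right_mono) auto
    moreover have "1 < \<delta> * of_nat N" using N(2) \<delta>0 by (simp add: field_simps)
    ultimately show False using pq(3) by (simp add: a_def)
  qed
  \<comment> \<open>The norm is bounded on P, so it and the residues modulo it take finitely many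
    values.\<close>
  define g where "g = (\<lambda>(p, q). (qform p q, p mod \<bar>qform p q\<bar>, q mod \<bar>qform p q\<bar>))"
  have "g ` P \<subseteq> {-B..B} \<times> {0..B} \<times> {0..B}"
  proof (rule image_subsetI)
    fix x assume "x \<in> P"
    then obtain p q where x: "x = (p, q)" "q > 0" "\<bar>qform p q\<bar> \<le> B" by (auto simp: P_def)
    have n: "\<bar>qform p q\<bar> > 0" using qform_nz[of q p] x by simp
    have m: "0 \<le> p mod \<bar>qform p q\<bar>" "p mod \<bar>qform p q\<bar> < \<bar>qform p q\<bar>"
      "0 \<le> q mod \<bar>qform p q\<bar>" "q mod \<bar>qform p q\<bar> < \<bar>qform p q\<bar>" using n by auto
    have "p mod \<bar>qform p q\<bar> \<le> B" "q mod \<bar>qform p q\<bar> \<le> B" using m x(3) by linarith+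
    moreover have "- B \<le> qform p q" "qform p q \<le> B" using x(3) by linarith+
    ultimately have "p mod \<bar>qform p q\<bar> \<in> {0..B}" "q mod \<bar>qform p q\<bar> \<in> {0..B}" "qform p q \<in> {-B..B}"
      using m by simp_all
    then show "g x \<in> {-B..B} \<times> {0..B} \<times> {0..B}" by (simp add: g_def x(1))
  qed
  then have "finite (g ` P)" by (rule finite_subset) auto
  from pigeonhole_infinite[OF \<open>infinite P\<close> this]
  obtain x where x: "x \<in> P" "infinite {a \<in> P. g a = g x}" by blast
  then have "infinite ({a \<in> P. g a = g x} - {x})" by simp
  then have "{a \<in> P. g a = g x} - {x} \<noteq> {}" by (metis finite.emptyI)
  then obtain y where y: "y \<in> P" "g y = g x" "y \<noteq> x" by blast
  obtain p q where pq: "x = (p, q)" by (cases x)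
  obtain p' q' where pq': "y = (p', q')" by (cases y)
  define n where "n = qform p q"
  have qq: "q > 0" "q' > 0" using x y pq pq' by (auto simp: P_def)
  have n': "qform p' q' = n" and mods: "p' mod \<bar>n\<bar> = p mod \<bar>n\<bar>" "q' mod \<bar>n\<bar> = q mod \<bar>n\<bar>"
    using y(2) pq pq' by (auto simp: g_def n_def)
  have n0: "n \<noteq> 0" using qform_nz[of q p] qq by (simp add: n_def)
  have dv: "n dvd p - p'" "n dvd q - q'" "n dvd p' - p" "n dvd q' - q"
    using mods by (metis abs_dvd_iff mod_eq_dvd_iff)+
  define u where "u = (of_int p + of_int q * s) / (of_int p' + of_int q' * s)"
  have nz: "of_int p + of_int q * s \<noteq> 0" "of_int p' + of_int q' * s \<noteq> 0"
    using qform_eq[of p q] qform_eq[of p' q'] n0 n' by (auto simp: n_def)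
  have uO: "u \<in> OK k" unfolding u_def by (rule quotient_integral[OF _ n' n0 dv(1,2)]) (simp add: n_def)
  have uI: "inverse u \<in> OK k" unfolding u_def inverse_divide
    by (rule quotient_integral[OF n' _ n0 dv(3,4)]) (simp add: n_def)
  have uE: "u \<in> unit_set k" using uO uI nz by (auto simp: unit_set_def u_def)
  have u1: "u \<noteq> 1"
  proof
    assume "u = 1"
    then have "of_int p + of_int q * s = of_int p' + of_int q' * s" using nz by (simp add: u_def)
    then show False using int_s_eq y(3) pq pq' by blast
  qed
  have um1: "u \<noteq> -1"
  proof
    assume "u = -1"
    then have "of_int p + of_int q * s = - (of_int p' + of_int q' * s)" using nz by (simp add: u_def divide_eq_eq)
    then have "of_int p + of_int q * s = of_int (- p') + of_int (- q') * s" by simp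
    then have "q = - q'" by (rule int_s_eq(2))
    then show False using qq by simp
  qed
  obtain r where r: "u = of_real r" using real_if_pos[OF dp] unit_setD(3)[OF uE] by (auto elim: Reals_cases)
  have rr: "r \<noteq> 0" "r \<noteq> 1" "r \<noteq> -1" using r u1 um1 unit_setD(2)[OF uE] by auto
  have mE: "- v \<in> unit_set k" if "v \<in> unit_set k" for v
    using mgrp_mult[OF mgrp_unit_set minus_1_unit that] by simp
  \<comment> \<open>Correspondingly u, 1/u, -1/u or -u exceeds 1.\<close>
  consider "r > 1" | "0 < r" "r < 1" | "-1 < r" "r < 0" | "r < -1" using rr by linarith
  then show thesis
  proof cases
    case 1 then show ?thesis using that[OF uE] r by simp
  next
    case 2
    then have "Re (inverse u) > 1" using r by (simp add: one_less_inverse flip: of_real_inverse)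
    then show ?thesis using that[OF mgrp_inverse[OF mgrp_unit_set uE]] by blast
  next
    case 3
    then have "inverse (- r) > 1" by (intro one_less_inverse) auto
    then have "Re (- inverse u) > 1" using r by (simp flip: of_real_inverse)
    then show ?thesis using that[OF mE[OF mgrp_inverse[OF mgrp_unit_set uE]]] by blast
  next
    case 4 then show ?thesis using that[OF mE[OF uE]] r by simp
  qed
qed

lemma real_unit_conj_bound:
  assumes "u \<in> unit_set k" "Re u > 1" shows "norm (cj u) \<le> 1"
proof -
  have "norm u * norm (cj u) = 1" using unit_norm[OF assms(1)] by (metis norm_minus_cancel norm_mult norm_one)
  moreover have "norm u > 1" using assms(2) complex_Re_le_cmod[of u] by linarith
  ultimately show ?thesis
  proof (rule_tac ccontr)
    assume a: "norm u * norm (cj u) = 1" "norm u > 1" "\<not> norm (cj u) \<le> 1"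
    then have "1 * 1 < norm u * norm (cj u)" by (intro mult_strict_mono) auto
    then show False using a by simp
  qed
qed

text \<open>Units above 1 have conjugates of absolute value at most 1, so only finitely many lie
  below a given unit and a least one exists. This gives the \<open>THE\<close> in the definition of
  \<open>fund_unit\<close> its meaning.\<close>

lemma fund_unit:
  assumes dp: "d > 0"
  shows "fund_unit k \<in> unit_set k" "fund_unit k \<in> \<real>" "Re (fund_unit k) > 1"
    "u \<in> unit_set k \<Longrightarrow> Re u > 1 \<Longrightarrow> Re (fund_unit k) \<le> Re u"
proof -
  have real: "v \<in> \<real>" if "v \<in> unit_set k" for v using real_if_pos[OF dp] unit_setD(3)[OF that] by blast
  obtain u0 where u0: "u0 \<in> unit_set k" "Re u0 > 1" using exists_unit[OF dp] .
  let ?F = "{u \<in> unit_set k. Re u > 1 \<and> Re u \<le> Re u0}"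
  have "?F \<subseteq> {u \<in> unit_set k. norm u \<le> Re u0 \<and> norm (cj u) \<le> Re u0}"
  proof
    fix u assume u: "u \<in> ?F"
    then have "u = of_real (Re u)" using real by (simp add: of_real_Re)
    then have "norm u = \<bar>Re u\<bar>" by (metis norm_of_real)
    then show "u \<in> {u \<in> unit_set k. norm u \<le> Re u0 \<and> norm (cj u) \<le> Re u0}"
      using u real_unit_conj_bound[of u] u0 by auto
  qed
  then have fin: "finite ?F" using finite_bounded_units finite_subset by blast
  have "u0 \<in> ?F" using u0 by simp
  then have ne: "Re ` ?F \<noteq> {}" by blast
  have "Min (Re ` ?F) \<in> Re ` ?F" by (rule Min_in) (use fin ne in auto)
  then obtain e where e: "e \<in> ?F" "Re e = Min (Re ` ?F)" by auto
  have emin: "Re e \<le> Re u" if u: "u \<in> unit_set k" "Re u > 1" for u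
  proof (cases "Re u \<le> Re u0")
    case True
    then have "Re u \<in> Re ` ?F" using u by blast
    then show ?thesis unfolding e(2) using fin by (intro Min_le) auto
  next
    case False then show ?thesis using e(1) by simp
  qed
  have "fund_unit k = e" unfolding fund_unit_def
  proof (rule the_equality)
    show "e \<in> unit_set k \<and> e \<in> \<real> \<and> 1 < Re e \<and> (\<forall>u\<in>unit_set k. u \<in> \<real> \<and> 1 < Re u \<longrightarrow> Re e \<le> Re u)"
      using e(1) real emin by auto
    fix e' assume e': "e' \<in> unit_set k \<and> e' \<in> \<real> \<and> 1 < Re e' \<and> (\<forall>u\<in>unit_set k. u \<in> \<real> \<and> 1 < Re u \<longrightarrow> Re e' \<le> Re u)"
    then have "Re e' \<le> Re e" "Re e \<le> Re e'" using e(1) real emin by auto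
    then have "Re e' = Re e" by simp
    then show "e' = e" using e' e(1) real by (metis (no_types, lifting) mem_Collect_eq of_real_Re)
  qed
  then show "fund_unit k \<in> unit_set k" "fund_unit k \<in> \<real>" "Re (fund_unit k) > 1"
    "u \<in> unit_set k \<Longrightarrow> Re u > 1 \<Longrightarrow> Re (fund_unit k) \<le> Re u" using e(1) real emin by auto
qed

lemma powi_unit: "u \<in> unit_set k \<Longrightarrow> u powi m \<in> unit_set k"
proof -
  assume u: "u \<in> unit_set k"
  have p: "x ^ i \<in> unit_set k" if "x \<in> unit_set k" for x and i :: nat
    using that by (induction i) (auto intro: mgrp_mult[OF mgrp_unit_set] mgrp_1[OF mgrp_unit_set])
  show ?thesis using p[OF u] p[OF mgrp_inverse[OF mgrp_unit_set u]] by (auto simp: power_int_def)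
qed

text \<open>Let m be the integer part of ln u / ln \<epsilon>. Then u / \<epsilon>^m is at least 1
  and less than \<epsilon>, so it is 1 by minimality of \<epsilon>.\<close>

lemma positive_unit_power:
  assumes dp: "d > 0" and u: "u \<in> unit_set k" "Re u > 0"
  shows "\<exists>m. u = fund_unit k powi m"
proof -
  define e where "e = Re (fund_unit k)"
  define x where "x = Re u"
  note f = fund_unit[OF dp]
  have e: "fund_unit k = of_real e" "e > 1" using f by (simp_all add: e_def of_real_Re)
  have "u \<in> \<real>" using real_if_pos[OF dp] unit_setD(3)[OF u(1)] by blast
  then have x: "u = of_real x" "x > 0" using u by (simp_all add: x_def of_real_Re)
  define m where "m = \<lfloor>ln x / ln e\<rfloor>"
  have le: "ln e > 0" using e by simp
  have "of_int m \<le> ln x / ln e" "ln x / ln e < of_int m + 1" unfolding m_def by linarith+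
  then have b: "of_int m * ln e \<le> ln x" "ln x < (of_int m + 1) * ln e" using le by (simp_all add: field_simps)
  have pw: "e powi m = exp (of_int m * ln e)" using e powr_real_of_int'[of e m] by (simp add: powr_def)
  have "e powi m \<le> x"
  proof -
    have "exp (of_int m * ln e) \<le> exp (ln x)" using b by simp
    then show ?thesis using x pw by simp
  qed
  have "x < e powi m * e"
  proof -
    have "exp (ln x) < exp (of_int m * ln e + ln e)" using b by (simp add: algebra_simps)
    then show ?thesis using x e pw by (simp add: exp_add)
  qed
  have ep: "e powi m > 0" using e by (simp add: zero_less_power_int)
  define w where "w = u / fund_unit k powi m"
  have wE: "w \<in> unit_set k" unfolding w_def by (rule mgrp_divide[OF mgrp_unit_set u(1) powi_unit[OF f(1)]])
  define y where "y = x / e powi m"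
  have w: "w = of_real y" unfolding w_def x(1) e(1) y_def by simp
  have "y \<ge> 1" "y < e" unfolding y_def using \<open>e powi m \<le> x\<close> \<open>x < e powi m * e\<close> ep by (simp_all add: field_simps)
  moreover have "\<not> y > 1"
  proof
    assume "y > 1"
    then have "Re w > 1" unfolding w by simp
    then have "e \<le> Re w" using f(4)[OF wE] by (simp add: e_def)
    then show False using \<open>y < e\<close> unfolding w by simp
  qed
  ultimately have "y = 1" by linarith
  then have "w = 1" unfolding w by simp
  moreover have "fund_unit k powi m \<noteq> 0" using unit_setD(2)[OF powi_unit[OF f(1)]] .
  ultimately show ?thesis unfolding w_def by (intro exI[of _ m]) simp
qed

lemma nu_eq: "nu k = (if d > 0 \<and> fund_unit k * cj (fund_unit k) = 1 then 1 else 0)"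
  by (simp add: nu_def real_iff field_norm_eq)

lemma cj_powi: "x \<in> k \<Longrightarrow> cj (x powi m) = cj x powi m"
  by (simp add: power_int_def aut_power[OF cj_aut] aut_inverse[OF cj_aut] K_inverse)

lemma norm_powi: "x \<in> k \<Longrightarrow> x powi m * cj (x powi m) = (x * cj x) powi m"
  by (simp add: cj_powi power_int_mult_distrib)

lemma fund_powi_Re: "d > 0 \<Longrightarrow> Re (fund_unit k powi m) > 0 \<and> fund_unit k powi m \<in> \<real>"
proof -
  assume dp: "d > 0"
  have e: "fund_unit k = of_real (Re (fund_unit k))" using fund_unit(2)[OF dp] by (simp add: of_real_Re)
  have 1: "fund_unit k powi m = of_real (Re (fund_unit k) powi m)" by (subst e) simp
  have 2: "Re (fund_unit k) powi m > 0" using fund_unit(3)[OF dp] by (simp add: zero_less_power_int)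
  have "Re (fund_unit k powi m) > 0" using 2 by (subst 1) (simp only: Re_complex_of_real)
  moreover have "fund_unit k powi m \<in> \<real>" by (subst 1) (rule Reals_of_real)
  ultimately show ?thesis ..
qed

lemma fund_powi_inj:
  assumes dp: "d > 0" and eq: "fund_unit k powi m = fund_unit k powi l" shows "m = l"
proof -
  define e where "e = Re (fund_unit k)"
  have e: "fund_unit k = of_real e" "e > 1" using fund_unit[OF dp] by (simp_all add: e_def of_real_Re)
  have "of_real (e powi m) = (of_real (e powi l) :: complex)" using eq unfolding e(1) by simp
  then have "e powi m = e powi l" using of_real_eq_iff by blast
  then have "e powr of_int m = e powr of_int l"
    using powr_real_of_int'[of e m] powr_real_of_int'[of e l] e(2) by simp
  then have "real_of_int m = of_int l" using powr_inj[of e "of_int m" "of_int l"] e(2) by simp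
  then show ?thesis by simp
qed

text \<open>If c u = \<alpha>^2 with c > 0, then u > 0 and c^2 N(u) = N(\<alpha>)^2 > 0, so N(u) =
  1. Conversely 2 + u + 1/u is positive and \<open>norm_1_square\<close> applies.\<close>

lemma real_Uplus:
  assumes dp: "d > 0" shows "Uplus k = {u \<in> unit_set k. Re u > 0 \<and> u * cj u = 1}"
proof (intro equalityI subsetI)
  have real: "v \<in> \<real>" if "v \<in> k" for v using real_if_pos[OF dp] that by blast
  fix u assume "u \<in> Uplus k"
  then obtain C \<alpha> where u: "u \<in> unit_set k" "prime_set C" "\<alpha> \<in> k" "of_nat (\<Prod>C) * u = \<alpha> * \<alpha>"
    by (auto simp only: Uplus_def is_sq_def)
  define c where "c = real (\<Prod>C)"
  have c: "c > 0" "of_nat (\<Prod>C) = (of_real c :: complex)"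
    using prime_set_pos[OF u(2)] by (simp_all only: c_def of_nat_0_less_iff of_real_of_nat_eq)
  have u0: "u \<noteq> 0" by (rule unit_setD(2)[OF u(1)])
  obtain r where r: "u = of_real r" using real[OF unit_setD(3)[OF u(1)]] by (auto elim: Reals_cases)
  obtain a where a: "\<alpha> = of_real a" using real[OF u(3)] by (auto elim: Reals_cases)
  have "of_real (c * r) = (of_real (a * a) :: complex)" using u(4) c(2) r a by simp
  then have cr: "c * r = a * a" using of_real_eq_iff by blast
  have "r \<noteq> 0" using r u0 by simp
  then have "c * r > 0" using cr c by (metis mult_eq_0_iff less_irrefl not_square_less_zero linorder_neqE_linordered_idom)
  then have r0: "r > 0" using c by (simp add: zero_less_mult_iff)
  obtain b where b: "cj \<alpha> = of_real b" using real[OF aut_K[OF cj_aut u(3)]] by (auto elim: Reals_cases)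
  have "of_nat (\<Prod>C) * cj u = cj \<alpha> * cj \<alpha>"
    using u(4) aut_mult[OF cj_aut] aut_of_nat[OF cj_aut] K_of_nat u(3) unit_setD(3)[OF u(1)] by metis
  then have "(of_nat (\<Prod>C) * u) * (of_nat (\<Prod>C) * cj u) = (\<alpha> * \<alpha>) * (cj \<alpha> * cj \<alpha>)" by (simp only: u(4))
  then have "(of_nat (\<Prod>C) * of_nat (\<Prod>C)) * (u * cj u) = (\<alpha> * cj \<alpha>) * (\<alpha> * cj \<alpha>)" by (simp only: ac_simps)
  then have N: "of_real (c * c) * (u * cj u) = of_real ((a * b) * (a * b))"
    by (simp only: c(2) b) (simp add: a)
  have "u * cj u \<noteq> -1"
  proof
    assume "u * cj u = -1"
    then have "of_real (- (c * c)) = (of_real ((a * b) * (a * b)) :: complex)" using N by simp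
    then have "- (c * c) = (a * b) * (a * b)" using of_real_eq_iff by blast
    moreover have "c * c > 0" using c by simp
    moreover have "(a * b) * (a * b) \<ge> 0" by simp
    ultimately show False by linarith
  qed
  then show "u \<in> {u \<in> unit_set k. Re u > 0 \<and> u * cj u = 1}" using unit_norm[OF u(1)] u(1) r r0 by simp
next
  fix u assume "u \<in> {u \<in> unit_set k. Re u > 0 \<and> u * cj u = 1}"
  then have u: "u \<in> unit_set k" "Re u > 0" "u * cj u = 1" by auto
  have "u \<in> \<real>" using real_if_pos[OF dp] unit_setD(3)[OF u(1)] by blast
  then obtain r where r: "u = of_real r" by (auto elim: Reals_cases)
  have r0: "r > 0" using r u(2) by simp
  have "cj u = of_real (inverse r)" using u(3) r r0 by (simp add: field_simps)
  then have t: "2 + (u + cj u) = of_real (2 + r + inverse r)" using r by simp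
  have "2 + r + inverse r > 0" using r0 by (simp add: add_pos_pos)
  then have r3: "Re (2 + (u + cj u)) > 0" by (simp only: t Re_complex_of_real)
  have r2: "2 + (u + cj u) \<in> \<real>" by (simp only: t Reals_of_real)
  have r1: "2 + (u + cj u) \<in> \<rat>" using trace_Rats[OF unit_setD(3)[OF u(1)]] by simp
  show "u \<in> Uplus k" by (rule Uplus_if[OF u(1) r1 r2 r3 norm_1_square[OF u(1,3)]])
qed

text \<open>Signs disappear on squaring, so only the even powers of the fundamental unit
  remain.\<close>

lemma squares_units_real:
  assumes dp: "d > 0" shows "squares (unit_set k) = range (\<lambda>m. fund_unit k powi (2 * m))"
proof (intro equalityI subsetI)
  fix v assume "v \<in> squares (unit_set k)"
  then obtain u where u: "u \<in> unit_set k" "v = u * u" by (auto simp: squares_def)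
  have "u \<in> \<real>" using real_if_pos[OF dp] unit_setD(3)[OF u(1)] by blast
  then have "Re u \<noteq> 0" using unit_setD(2)[OF u(1)] by (auto simp: complex_is_Real_iff complex_eq_iff)
  have "\<exists>w. w \<in> unit_set k \<and> Re w > 0 \<and> v = w * w"
  proof (cases "Re u > 0")
    case False
    have "- u \<in> unit_set k" using mgrp_mult[OF mgrp_unit_set minus_1_unit u(1)] by simp
    then show ?thesis using False \<open>Re u \<noteq> 0\<close> u(2) by (intro exI[of _ "- u"]) auto
  qed (use u in blast)
  then obtain w m where "v = w * w" "w = fund_unit k powi m" using positive_unit_power[OF dp] by blast
  then have "v = fund_unit k powi (2 * m)" by (simp only: powi_double[OF unit_setD(2)[OF fund_unit(1)[OF dp]]])
  then show "v \<in> range (\<lambda>m. fund_unit k powi (2 * m))" by blast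
next
  fix v assume "v \<in> range (\<lambda>m. fund_unit k powi (2 * m))"
  then obtain m where "v = fund_unit k powi m * fund_unit k powi m"
    by (auto simp only: powi_double[OF unit_setD(2)[OF fund_unit(1)[OF dp]]])
  then show "v \<in> squares (unit_set k)" using powi_unit[OF fund_unit(1)[OF dp]] by (auto simp: squares_def)
qed

text \<open>If N(\<epsilon>) = 1, \<open>Uplus k\<close> consists of all powers of \<epsilon>,
  otherwise of the even ones only; over the squares of units this gives 2 cosets or 1. The further
  factor 2 is the order of \<open>Dset k\<close>.\<close>

lemma card_CC_real:
  assumes dp: "d > 0" shows "finite (CC k)" "card (CC k) = 2 ^ (1 + nu k)"
proof -
  let ?e = "fund_unit k" and ?E2 = "squares (unit_set k)"
  note f = fund_unit[OF dp]
  have ek: "?e \<in> k" by (rule unit_setD(3)[OF f(1)])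
  have e0: "?e \<noteq> 0" by (rule unit_setD(2)[OF f(1)])
  have "finite (cosets (Uplus k) ?E2) \<and> card (cosets (Uplus k) ?E2) = 2 ^ nu k"
  proof (cases "?e * cj ?e = 1")
    case True
    have U: "Uplus k = range (\<lambda>m. ?e powi m)"
    proof (intro equalityI subsetI)
      fix u assume "u \<in> Uplus k"
      then show "u \<in> range (\<lambda>m. ?e powi m)" using positive_unit_power[OF dp] unfolding real_Uplus[OF dp] by blast
    next
      fix u assume "u \<in> range (\<lambda>m. ?e powi m)"
      then obtain m where m: "u = ?e powi m" by blast
      have "u * cj u = 1" unfolding m norm_powi[OF ek] True by simp
      then show "u \<in> Uplus k" unfolding real_Uplus[OF dp] using m powi_unit[OF f(1)] fund_powi_Re[OF dp] by simp
    qed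
    have iff: "?e powi x / ?e powi y \<in> ?E2 \<longleftrightarrow> x mod 2 = y mod 2" for x y
    proof -
      have "?e powi x / ?e powi y = ?e powi (x - y)" using e0 by (simp add: power_int_diff)
      then have "?e powi x / ?e powi y \<in> ?E2 \<longleftrightarrow> (\<exists>m. x - y = 2 * m)"
        unfolding squares_units_real[OF dp] using fund_powi_inj[OF dp] by auto
      also have "\<dots> \<longleftrightarrow> x mod 2 = y mod 2" by presburger
      finally show ?thesis .
    qed
    have r: "range (\<lambda>x::int. x mod 2) = {0, 1}"
    proof (intro equalityI subsetI)
      fix z :: int assume "z \<in> {0, 1}"
      then have "z = z mod 2" by auto
      then show "z \<in> range (\<lambda>x. x mod 2)" by blast
    qed auto
    have "0 \<notin> Uplus k" using mgrp_Uplus by (simp add: mgrp_def)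
    from card_cosets_eq[OF mgrp_squares[OF mgrp_unit_set] U this iff]
    show ?thesis using r nu_eq dp True by simp
  next
    case False
    then have m1: "?e * cj ?e = -1" using unit_norm[OF f(1)] by blast
    have "Uplus k \<subseteq> ?E2"
    proof
      fix u assume "u \<in> Uplus k"
      then have u: "u \<in> unit_set k" "Re u > 0" "u * cj u = 1" unfolding real_Uplus[OF dp] by auto
      then obtain m where m: "u = ?e powi m" using positive_unit_power[OF dp] by blast
      have "(-1 :: complex) powi m = 1" using u(3) unfolding m norm_powi[OF ek] m1 .
      then have "even m" by (cases "even m") (simp_all add: power_int_minus_left_odd)
      then show "u \<in> ?E2" unfolding squares_units_real[OF dp] m by (auto elim!: evenE)
    qed
    then have each: "smul u ?E2 = ?E2" if "u \<in> Uplus k" for u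
      using smul_coset_eq[OF mgrp_squares[OF mgrp_unit_set] mgrp_nz[OF mgrp_Uplus that], of 1] that by auto
    have "cosets (Uplus k) ?E2 = (\<lambda>u. ?E2) ` Uplus k" unfolding cosets_def by (rule image_cong[OF refl each])
    then have "cosets (Uplus k) ?E2 = {?E2}" using mgrp_1[OF mgrp_Uplus] by auto
    then show ?thesis using nu_eq False by simp
  qed
  then show "finite (CC k)" "card (CC k) = 2 ^ (1 + nu k)"
    using card_CC[OF card_Dset(2)] card_Dset(1) dp by auto
qed

lemma card_CC_quadratic: "finite (CC k) \<and> card (CC k) = 2 ^ (1 + nu k)"
proof (cases "d > 0")
  case True
  then show ?thesis using card_CC_real by simp
next
  case False
  then have "d < 0" using d_nz by simp
  then show ?thesis using card_CC_imaginary nu_eq False by simp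
qed

end

section \<open>Units of biquadratic fields\<close>

context biquadratic_field
begin

lemma unit_set_sub: "x \<in> unit_set k1 \<Longrightarrow> x \<in> unit_set K" "x \<in> unit_set k2 \<Longrightarrow> x \<in> unit_set K" "x \<in> unit_set k3 \<Longrightarrow> x \<in> unit_set K"
  using OK_sub by (auto simp: unit_set_def)

lemma unit_set_restrict:
  "x \<in> unit_set K \<Longrightarrow> x \<in> k1 \<Longrightarrow> x \<in> unit_set k1" "x \<in> unit_set K \<Longrightarrow> x \<in> k2 \<Longrightarrow> x \<in> unit_set k2"
  "x \<in> unit_set K \<Longrightarrow> x \<in> k3 \<Longrightarrow> x \<in> unit_set k3"
  using q1.K_inverse q2.K_inverse q3.K_inverse by (auto simp: unit_set_def OK_def)

text \<open>Each automorphism multiplies \<alpha> by 1 or -1. If both \<open>tau1\<close> and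
  \<open>tau2\<close> give -1, then \<open>tau3\<close> fixes \<alpha>.\<close>

lemma square_rational_cases_K:
  assumes a: "\<alpha> \<in> K" "\<alpha> * \<alpha> \<in> \<rat>" shows "\<alpha> \<in> k1 \<or> \<alpha> \<in> k2 \<or> \<alpha> \<in> k3"
proof -
  have c: "\<sigma> \<alpha> = \<alpha> \<or> \<sigma> \<alpha> = - \<alpha>" if \<sigma>: "\<sigma> \<in> aut K" for \<sigma>
  proof -
    have "\<sigma> \<alpha> * \<sigma> \<alpha> = \<alpha> * \<alpha>" using K.aut_Rats[OF \<sigma> a(2)] K.aut_mult[OF \<sigma> a(1) a(1)] by simp
    then show ?thesis by (simp only: square_eq_iff)
  qed
  consider "tau1 \<alpha> = \<alpha>" | "tau2 \<alpha> = \<alpha>" | "tau1 \<alpha> = - \<alpha>" "tau2 \<alpha> = - \<alpha>" using c[OF tau1(1)] c[OF tau2(1)] by blast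
  then show ?thesis
  proof cases
    case 3
    have "tau3 \<alpha> = tau1 (- \<alpha>)" using tau_comp(1)[OF a(1)] 3 by simp
    also have "\<dots> = \<alpha>" using 3 K.aut_uminus[OF tau1(1) a(1)] by simp
    finally show ?thesis using fixed3[OF a(1)] by simp
  qed (use fixed1 fixed2 a in blast)+
qed

lemma Dset_K: "Dset K = Dset k1 \<union> Dset k2 \<union> Dset k3"
proof (intro equalityI subsetI)
  fix C assume "C \<in> Dset K"
  then obtain \<alpha> where C: "prime_set C" "\<alpha> \<in> K" "of_nat (\<Prod>C) = \<alpha> * \<alpha>" by (auto simp only: Dset_def is_sq_def)
  have "of_nat (\<Prod>C) \<in> (\<rat> :: complex set)" by (rule Rats_of_nat)
  then have "\<alpha> * \<alpha> \<in> \<rat>" by (simp only: C(3))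
  then have "\<alpha> \<in> k1 \<or> \<alpha> \<in> k2 \<or> \<alpha> \<in> k3" by (rule square_rational_cases_K[OF C(2)])
  then show "C \<in> Dset k1 \<union> Dset k2 \<union> Dset k3" using C(1,3) unfolding Dset_def is_sq_def by blast
next
  fix C assume "C \<in> Dset k1 \<union> Dset k2 \<union> Dset k3"
  then show "C \<in> Dset K" using sub1 sub2 sub3 unfolding Dset_def is_sq_def by blast
qed

lemma factors_ne12: "d1 > 0 \<Longrightarrow> d2 > 0 \<Longrightarrow> prime_factors (nat d1) \<noteq> prime_factors (nat d2)"
proof
  assume d: "d1 > 0" "d2 > 0" and "prime_factors (nat d1) = prime_factors (nat d2)"
  then have "s2 * s2 = s1 * s1" using q1.factors_d(2)[OF d(1)] q2.factors_d(2)[OF d(2)] by (simp only:)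
  then have "s2 = s1 \<or> s2 = - s1" by (simp only: square_eq_iff)
  then show False using s2_notin_k1 q1.s_in q1.K_uminus[OF q1.s_in] by auto
qed

text \<open>d1 d2 d3 = m^2 is positive: either K is real or exactly one quadratic subfield
  is.\<close>

lemma signs: "d1 > 0 \<and> d2 > 0 \<and> d3 > 0 \<or> d1 > 0 \<and> d2 < 0 \<and> d3 < 0 \<or> d1 < 0 \<and> d2 > 0 \<and> d3 < 0 \<or> d1 < 0 \<and> d2 < 0 \<and> d3 > 0"
proof -
  have "d1 * d2 * d3 \<ge> 0" using prod_d by simp
  moreover have "d1 * d2 * d3 \<noteq> 0" using q1.d_nz q2.d_nz q3.d_nz by simp
  ultimately have "d1 * d2 * d3 > 0" by linarith
  then show ?thesis by (auto simp: zero_less_mult_iff mult_less_0_iff)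
qed

lemma K_real_iff: "K \<subseteq> \<real> \<longleftrightarrow> d1 > 0 \<and> d2 > 0 \<and> d3 > 0"
proof
  assume "K \<subseteq> \<real>"
  then show "d1 > 0 \<and> d2 > 0 \<and> d3 > 0" using q1.real_iff q2.real_iff q3.real_iff sub1 sub2 sub3 by blast
next
  assume d: "d1 > 0 \<and> d2 > 0 \<and> d3 > 0"
  show "K \<subseteq> \<real>"
  proof
    fix z assume "z \<in> K"
    then obtain a b where ab: "a \<in> k1" "b \<in> k1" "z = a + b * s2" using form12 by blast
    have "a \<in> \<real>" "b \<in> \<real>" "s2 \<in> \<real>" using ab d q1.real_if_pos q2.real_if_pos q2.s_in by blast+
    then show "z \<in> \<real>" unfolding ab(3) by (intro Reals_add Reals_mult)
  qed
qed

text \<open>The trivial square class together with those of the positive d_i, which are distinct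
  because the fields are.\<close>

lemma card_Dset_K: "finite (Dset K)" "card (Dset K) = (if K \<subseteq> \<real> then 4 else 2)"
proof -
  show "finite (Dset K)" unfolding Dset_K using q1.card_Dset(2) q2.card_Dset(2) q3.card_Dset(2) by simp
  have card4: "card ({{}, X} \<union> {{}, Y} \<union> {{}, Z}) = 4" if "X \<noteq> {}" "Y \<noteq> {}" "Z \<noteq> {}" "X \<noteq> Y" "Y \<noteq> Z" "Z \<noteq> X" for X Y Z :: "nat set"
  proof -
    have "{{}, X} \<union> {{}, Y} \<union> {{}, Z} = {{}, X, Y, Z}" by auto
    then show ?thesis using that by (simp add: card_insert_if)
  qed
  have card2: "card ({{}, X} \<union> {{}} \<union> {{}}) = 2" "card ({{}} \<union> {{}, X} \<union> {{}}) = 2" "card ({{}} \<union> {{}} \<union> {{}, X}) = 2"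
    if "X \<noteq> {}" for X :: "nat set" using that by (auto simp: card_insert_if)
  consider "d1 > 0" "d2 > 0" "d3 > 0" | "d1 > 0" "d2 < 0" "d3 < 0" | "d1 < 0" "d2 > 0" "d3 < 0" | "d1 < 0" "d2 < 0" "d3 > 0"
    using signs by blast
  then show "card (Dset K) = (if K \<subseteq> \<real> then 4 else 2)"
  proof cases
    case 1
    have "card (Dset K) = 4" unfolding Dset_K q1.Dset_eq q2.Dset_eq q3.Dset_eq using 1
      by (simp only: if_True)
        (rule card4[OF q1.factors_d(3)[OF 1(1)] q2.factors_d(3)[OF 1(2)] q3.factors_d(3)[OF 1(3)] factors_ne12[OF 1(1,2)]
           biquadratic_field.factors_ne12[OF rotate 1(2,3)] biquadratic_field.factors_ne12[OF biquadratic_field.rotate[OF rotate] 1(3,1)]])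
    then show ?thesis using K_real_iff 1 by simp
  next
    case 2
    then have n: "\<not> 0 < d2" "\<not> 0 < d3" by auto
    have "card (Dset K) = 2" unfolding Dset_K q1.Dset_eq q2.Dset_eq q3.Dset_eq using 2(1) n
      by (simp only: if_True if_False) (rule card2(1)[OF q1.factors_d(3)[OF 2(1)]])
    then show ?thesis using K_real_iff n by simp
  next
    case 3
    then have n: "\<not> 0 < d1" "\<not> 0 < d3" by auto
    have "card (Dset K) = 2" unfolding Dset_K q1.Dset_eq q2.Dset_eq q3.Dset_eq using 3(2) n
      by (simp only: if_True if_False) (rule card2(2)[OF q2.factors_d(3)[OF 3(2)]])
    then show ?thesis using K_real_iff n by simp
  next
    case 4
    then have n: "\<not> 0 < d1" "\<not> 0 < d2" by auto
    have "card (Dset K) = 2" unfolding Dset_K q1.Dset_eq q2.Dset_eq q3.Dset_eq using 4(3) n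
      by (simp only: if_True if_False) (rule card2(3)[OF q3.factors_d(3)[OF 4(3)]])
    then show ?thesis using K_real_iff n by simp
  qed
qed

text \<open>Norms of units from imaginary quadratic fields are 1, so e = -1 can occur only if K is
  real.\<close>

definition equal_norms :: "complex \<Rightarrow> complex \<Rightarrow> complex \<Rightarrow> complex \<Rightarrow> bool" where
  "equal_norms e b1 b2 b3 \<longleftrightarrow> b1 \<in> unit_set k1 \<and> b2 \<in> unit_set k2 \<and> b3 \<in> unit_set k3 \<and> (e = 1 \<or> e = -1)
     \<and> b1 * q1.cj b1 = e \<and> b2 * q2.cj b2 = e \<and> b3 * q3.cj b3 = e"

text \<open>If r u = \<alpha>^2, let b_i be the norm of \<alpha> from K to k_i divided by r. The
  square of b_i is u times its conjugate over k_i, so b_i is a unit; each b_i has norm e =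
  N(\<alpha>) / r^2, and b1 b2 b3 = u e.\<close>

lemma Uplus_imp_equal_norms:
  assumes "u \<in> Uplus K" shows "\<exists>e b1 b2 b3. equal_norms e b1 b2 b3 \<and> u = e * (b1 * b2 * b3)"
proof -
  obtain C \<alpha> where u: "u \<in> unit_set K" "prime_set C" "\<alpha> \<in> K" "of_nat (\<Prod>C) * u = \<alpha> * \<alpha>"
    using assms by (auto simp only: Uplus_def is_sq_def)
  define r where "r = (of_nat (\<Prod>C) :: complex)"
  have r0: "r \<noteq> 0" unfolding r_def by (rule K.prod_nz[OF u(2)])
  have rQ: "r \<in> \<rat>" and rK: "r \<in> K" unfolding r_def by (rule Rats_of_nat K.K_of_nat)+
  have ru: "r * u = \<alpha> * \<alpha>" using u(4) by (simp only: r_def)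
  have uK: "u \<in> K" by (rule K.unit_setD(3)[OF u(1)])
  define t1 t2 t3 where "t1 = tau1 \<alpha>" and "t2 = tau2 \<alpha>" and "t3 = tau3 \<alpha>"
  have tK: "t1 \<in> K" "t2 \<in> K" "t3 \<in> K" unfolding t1_def t2_def t3_def using tau_K[OF u(3)] by auto
  note comp = tau_comp[OF u(3), folded t1_def t2_def t3_def]
  note A = K.aut_mult[OF tau1(1)] K.aut_mult[OF tau2(1)] K.aut_divide[OF tau1(1)] K.aut_divide[OF tau2(1)]
     K.aut_mult[OF tau3(1)] K.aut_divide[OF tau3(1)]
     K.aut_Rats[OF tau1(1) rQ] K.aut_Rats[OF tau2(1) rQ] K.aut_Rats[OF tau3(1) rQ] K.K_mult u(3) tK rK
     comp t1_def[symmetric] t2_def[symmetric] t3_def[symmetric]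
  have t33: "tau3 t3 = \<alpha>"
  proof -
    have "tau3 t3 = tau1 (tau2 t3)" using tau_comp(1)[OF tK(3)] by simp
    also have "\<dots> = \<alpha>" using comp by simp
    finally show ?thesis .
  qed
  define b1 b2 b3 where "b1 = \<alpha> * t1 / r" and "b2 = \<alpha> * t2 / r" and "b3 = \<alpha> * t3 / r"
  have bK: "b1 \<in> K" "b2 \<in> K" "b3 \<in> K" unfolding b1_def b2_def b3_def using u(3) tK rK by (auto intro!: K.K_divide K.K_mult)
  have f: "tau1 b1 = b1" "tau2 b2 = b2" "tau3 b3 = b3" unfolding b1_def b2_def b3_def
    by (simp_all add: A t33 mult.commute)
  have c: "tau2 b1 = t2 * t3 / r" "tau1 b2 = t1 * t3 / r" "tau1 b3 = t1 * t2 / r"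
    unfolding b1_def b2_def b3_def by (simp_all add: A)
  have bk: "b1 \<in> k1" "b2 \<in> k2" "b3 \<in> k3" using f bK fixed1 fixed2 fixed3 by auto
  have sq: "b1 * b1 = u * tau1 u" "b2 * b2 = u * tau2 u" "b3 * b3 = u * tau3 u"
  proof -
    have U: "u = \<alpha> * \<alpha> / r" using ru r0 by (simp add: field_simps)
    have "tau1 u = t1 * t1 / r" "tau2 u = t2 * t2 / r" "tau3 u = t3 * t3 / r" unfolding U by (simp_all add: A)
    then show "b1 * b1 = u * tau1 u" "b2 * b2 = u * tau2 u" "b3 * b3 = u * tau3 u"
      unfolding b1_def b2_def b3_def by (simp_all add: U)
  qed
  have tE: "\<sigma> u \<in> unit_set K" if \<sigma>: "\<sigma> \<in> aut K" for \<sigma>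
    using u(1) K.aut_OK[OF \<sigma>, of u] K.aut_OK[OF \<sigma>, of "inverse u"] K.aut_eq_0[OF \<sigma>, of u] K.aut_inverse[OF \<sigma> uK]
    by (auto simp: unit_set_def)
  have bE: "b1 \<in> unit_set k1" "b2 \<in> unit_set k2" "b3 \<in> unit_set k3"
    using K.unit_sqrt[OF bK(1)] K.unit_sqrt[OF bK(2)] K.unit_sqrt[OF bK(3)] unfolding sq
    using K.mgrp_unit_set mgrp_mult u(1) tE tau1(1) tau2(1) tau3(1) unit_set_restrict bk by metis+
  define e where "e = \<alpha> * t1 * t2 * t3 / (r * r)"
  have N: "b1 * q1.cj b1 = e" "b2 * q2.cj b2 = e" "b3 * q3.cj b3 = e"
    unfolding tau_cj(1)[OF bk(1), symmetric] tau_cj(3)[OF bk(2), symmetric] tau_cj(5)[OF bk(3), symmetric] c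
    unfolding b1_def b2_def b3_def e_def by (simp_all add: ac_simps)
  have e: "e = 1 \<or> e = -1" using q1.unit_norm[OF bE(1)] N(1) by simp
  have "b1 * b2 * b3 = (\<alpha> * \<alpha>) * e / r" unfolding b1_def b2_def b3_def e_def using r0 by (simp add: field_simps)
  also have "\<dots> = u * e" unfolding ru[symmetric] using r0 by simp
  finally have *: "e * (b1 * b2 * b3) = u * (e * e)" by (simp add: ac_simps)
  have "e * e = 1" using e by auto
  then have "u = e * (b1 * b2 * b3)" unfolding * by simp
  then show ?thesis using bE e N unfolding equal_norms_def by blast
qed

text \<open>Hilbert 90 for the cocycle with values 1, 1/(b2 b3), 1/(b1 b3), e/(b1 b2).\<close>

lemma equal_norms_resolvent:
  assumes "equal_norms e b1 b2 b3"
  shows "\<exists>\<alpha>\<in>K. \<alpha> \<noteq> 0 \<and> \<alpha> * \<alpha> * (b1 * b2 * b3) \<in> \<rat>"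
proof -
  have b: "b1 \<in> unit_set k1" "b2 \<in> unit_set k2" "b3 \<in> unit_set k3" "e = 1 \<or> e = -1"
    "b1 * q1.cj b1 = e" "b2 * q2.cj b2 = e" "b3 * q3.cj b3 = e" using assms by (auto simp: equal_norms_def)
  have bk: "b1 \<in> k1" "b2 \<in> k2" "b3 \<in> k3" using b q1.unit_setD q2.unit_setD q3.unit_setD by auto
  have bK: "b1 \<in> K" "b2 \<in> K" "b3 \<in> K" using bk sub1 sub2 sub3 by auto
  have nz: "b1 \<noteq> 0" "b2 \<noteq> 0" "b3 \<noteq> 0" using b q1.unit_setD q2.unit_setD q3.unit_setD by auto
  have ee: "e * e = 1" "e \<noteq> 0" "e \<in> \<rat>" "inverse e = e" using b(4) by auto
  have eK: "e \<in> K" using ee K.K_Rats by blast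
  have cj: "q1.cj b1 = e / b1" "q2.cj b2 = e / b2" "q3.cj b3 = e / b3" using b(5-7) nz by (simp_all add: field_simps)
  have v: "tau1 b1 = b1" "tau1 b2 = e / b2" "tau1 b3 = e / b3" "tau2 b1 = e / b1" "tau2 b2 = b2" "tau2 b3 = e / b3"
    using tau1(2)[OF bk(1)] tau2(2)[OF bk(2)] tau_cj[of b1] tau_cj[of b2] tau_cj[of b3] bk cj by auto
  note A1 = K.aut_mult[OF tau1(1)] K.aut_divide[OF tau1(1)] K.aut_add[OF tau1(1)] K.aut_Rats[OF tau1(1) ee(3)] K.aut_1[OF tau1(1)]
  note A2 = K.aut_mult[OF tau2(1)] K.aut_divide[OF tau2(1)] K.aut_add[OF tau2(1)] K.aut_Rats[OF tau2(1) ee(3)] K.aut_1[OF tau2(1)]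
  define c1 c2 c3 where "c1 = 1 / (b2 * b3)" and "c2 = 1 / (b1 * b3)" and "c3 = e / (b1 * b2)"
  have cK: "c1 \<in> K" "c2 \<in> K" "c3 \<in> K" unfolding c1_def c2_def c3_def using bK eK by (auto intro!: K.K_divide K.K_mult)
  have tc: "tau1 c1 = b2 * b3 * (e * e)" "tau1 c2 = inverse e * b3 / b1" "tau1 c3 = (e * inverse e) * b2 / b1"
    "tau2 c1 = inverse e * b3 / b2" "tau2 c2 = b1 * b3 * (e * e)" "tau2 c3 = (e * inverse e) * b1 / b2"
    unfolding c1_def c2_def c3_def using bK eK K.K_mult nz ee(1,2,4)
    by (simp_all add: A1 A2 v field_simps)
  \<comment> \<open>The resolvent of the cocycle. A nonzero value \<alpha> is multiplied by b2 b3
    under \<open>tau1\<close> and by b1 b3 under \<open>tau2\<close>; in \<alpha>^2 b1 b2 b3 these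
    factors cancel up to e^2 = 1.\<close>
  define A where "A \<theta> = \<theta> + c1 * tau1 \<theta> + c2 * tau2 \<theta> + c3 * tau3 \<theta>" for \<theta>
  have AK: "A \<theta> \<in> K" if "\<theta> \<in> K" for \<theta> unfolding A_def using that cK tau_K[OF that] by (intro K.K_add K.K_mult)
  have tA: "tau1 (A \<theta>) = b2 * b3 * A \<theta>" "tau2 (A \<theta>) = b1 * b3 * A \<theta>" if \<theta>: "\<theta> \<in> K" for \<theta>
  proof -
    note tk = tau_K[OF \<theta>]
    define x0 x1 x2 x3 where x: "x0 = \<theta>" "x1 = tau1 \<theta>" "x2 = tau2 \<theta>" "x3 = tau3 \<theta>"
    have "tau1 (A \<theta>) = x1 + tau1 c1 * x0 + tau1 c2 * x3 + tau1 c3 * x2"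
      unfolding A_def x using \<theta> tk cK tau_comp[OF \<theta>] by (simp add: A1 K.K_mult K.K_add)
    also have "\<dots> = b2 * b3 * (x0 + c1 * x1 + c2 * x2 + c3 * x3)"
      by (simp only: tc ee(4) ee(1) mult_1_left mult_1_right)
        (simp add: c1_def c2_def c3_def nz field_simps)
    finally show "tau1 (A \<theta>) = b2 * b3 * A \<theta>" unfolding A_def x .
    have "tau2 (A \<theta>) = x2 + tau2 c1 * x3 + tau2 c2 * x0 + tau2 c3 * x1"
      unfolding A_def x using \<theta> tk cK tau_comp[OF \<theta>] by (simp add: A2 K.K_mult K.K_add)
    also have "\<dots> = b1 * b3 * (x0 + c1 * x1 + c2 * x2 + c3 * x3)"
      by (simp only: tc ee(4) ee(1) mult_1_left mult_1_right)
        (simp add: c1_def c2_def c3_def nz field_simps)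
    finally show "tau2 (A \<theta>) = b1 * b3 * A \<theta>" unfolding A_def x .
  qed
  have snz: "s1 \<noteq> 0" "s2 \<noteq> 0" "s3 \<noteq> 0" using q1.s_nz q2.s_nz q3.s_nz by auto
  have As: "A 1 = 1 + c1 + c2 + c3" "A s1 = (1 + c1 - c2 - c3) * s1" "A s2 = (1 - c1 + c2 - c3) * s2" "A s3 = (1 - c1 - c2 + c3) * s3"
    unfolding A_def using tau1 tau2 tau3 q1.s_in q2.s_in q3.s_in K.aut_1[OF tau1(1)] K.aut_1[OF tau2(1)] K.aut_1[OF tau3(1)]
    by (simp_all add: algebra_simps)
  \<comment> \<open>On 1, s1, s2, s3 the resolvent is multiplication by the four character sums of
    1, c1, c2, c3. These sums add up to 4, so they do not all vanish.\<close>
  have "\<exists>\<theta>\<in>K. A \<theta> \<noteq> 0"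
  proof (rule ccontr)
    assume "\<not> ?thesis"
    then have "A 1 = 0" "A s1 = 0" "A s2 = 0" "A s3 = 0" using s_K K.K_1 by blast+
    then have z: "1 + c1 + c2 + c3 = 0" "1 + c1 - c2 - c3 = 0" "1 - c1 + c2 - c3 = 0" "1 - c1 - c2 + c3 = 0"
      using As snz by simp_all
    have "(4::complex) = (1 + c1 + c2 + c3) + (1 + c1 - c2 - c3) + (1 - c1 + c2 - c3) + (1 - c1 - c2 + c3)" by simp
    then show False unfolding z by simp
  qed
  then obtain \<theta> where \<theta>: "\<theta> \<in> K" "A \<theta> \<noteq> 0" by blast
  define \<alpha> where "\<alpha> = A \<theta>"
  have \<alpha>: "\<alpha> \<in> K" "\<alpha> \<noteq> 0" "tau1 \<alpha> = b2 * b3 * \<alpha>" "tau2 \<alpha> = b1 * b3 * \<alpha>"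
    unfolding \<alpha>_def using AK \<theta> tA by auto
  define y where "y = \<alpha> * \<alpha> * (b1 * b2 * b3)"
  have yK: "y \<in> K" unfolding y_def using \<alpha> bK by (intro K.K_mult)
  have "tau1 y = (e * e) * y" unfolding y_def using \<alpha> bK nz by (simp add: A1 K.K_mult v field_simps)
  moreover have "tau2 y = (e * e) * y" unfolding y_def using \<alpha> bK nz by (simp add: A2 K.K_mult v field_simps)
  ultimately have "y \<in> \<rat>" using fixed12[OF yK] ee(1) by simp
  then show ?thesis using \<alpha> unfolding y_def by blast
qed

text \<open>The resolvent makes \<alpha>^2 u a rational q, and q u = (\<alpha> u)^2; only the sign
  of q matters. In a real K it is that of u. Otherwise a negative q is corrected by replacing
  \<alpha> with s \<alpha>, where s in K has negative square.\<close>

lemma equal_norms_imp_Uplus: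
  assumes b: "equal_norms e b1 b2 b3" and u: "u = b1 * b2 * b3" and pos: "K \<subseteq> \<real> \<Longrightarrow> Re u > 0"
  shows "u \<in> Uplus K"
proof -
  have uE: "u \<in> unit_set K" unfolding u using b unit_set_sub unfolding equal_norms_def
    by (intro mgrp_mult[OF K.mgrp_unit_set]) auto
  have u0: "u \<noteq> 0" and uK: "u \<in> K" using K.unit_setD[OF uE] by auto
  obtain \<alpha> where \<alpha>: "\<alpha> \<in> K" "\<alpha> \<noteq> 0" "\<alpha> * \<alpha> * u \<in> \<rat>" using equal_norms_resolvent[OF b] u by blast
  have key: "u \<in> Uplus K" if x: "x \<in> K" "x \<noteq> 0" "x * x * u = of_real q" "of_real q \<in> (\<rat> :: complex set)" "q > 0" for x q
  proof (rule K.Uplus_if[OF uE x(4)])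
    have "of_real q * u = (x * u) * (x * u)" unfolding x(3)[symmetric] by (simp add: ac_simps)
    then show "is_sq K (of_real q * u)" using K.is_sq_square[OF K.K_mult[OF x(1) uK]] by (simp only:)
  qed (use x in auto)
  obtain q where q: "\<alpha> * \<alpha> * u = of_real q" using Rats_imp_Reals[OF \<alpha>(3)] by (auto elim: Reals_cases)
  have "q \<noteq> 0"
  proof
    assume "q = 0"
    then have "\<alpha> * \<alpha> * u = 0" using q by simp
    then show False using \<alpha>(2) u0 by simp
  qed
  have qQ: "of_real q \<in> (\<rat> :: complex set)" using \<alpha>(3) q by simp
  show ?thesis
  proof (cases "q > 0")
    case True then show ?thesis using key[OF \<alpha>(1,2) q qQ] by simp
  next
    case False
    then have q0: "q < 0" using \<open>q \<noteq> 0\<close> by simp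
    have nr: "\<not> K \<subseteq> \<real>"
    proof
      assume R: "K \<subseteq> \<real>"
      obtain a where a: "\<alpha> = of_real a" using R \<alpha>(1) by (auto elim: Reals_cases)
      obtain w where w: "u = of_real w" using R uK by (auto elim: Reals_cases)
      have "of_real (a * a * w) = (of_real q :: complex)" using q a w by simp
      then have "a * a * w = q" using of_real_eq_iff by blast
      moreover have "w > 0" using pos[OF R] w by simp
      then have "a * a * w \<ge> 0" by simp
      ultimately show False using q0 by simp
    qed
    have "\<exists>s d. s \<in> K \<and> s \<noteq> 0 \<and> s * s = of_int d \<and> d < 0"
      using nr signs K_real_iff s_K q1.s_sq q2.s_sq q3.s_sq q1.s_nz q2.s_nz q3.s_nz by blast
    then obtain s d where s: "s \<in> K" "s \<noteq> 0" "s * s = of_int d" "d < 0" by blast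
    have "(s * \<alpha>) * (s * \<alpha>) * u = (s * s) * (\<alpha> * \<alpha> * u)" by (simp add: ac_simps)
    also have "\<dots> = of_real (of_int d * q)" unfolding q s(3) by simp
    finally have e: "(s * \<alpha>) * (s * \<alpha>) * u = of_real (of_int d * q)" .
    show ?thesis
    proof (rule key[OF _ _ e])
      show "s * \<alpha> \<in> K" using s \<alpha> by (intro K.K_mult)
      show "s * \<alpha> \<noteq> 0" using s \<alpha> by simp
      show "of_real (of_int d * q) \<in> (\<rat> :: complex set)" using qQ by simp
      show "of_int d * q > 0" using s(4) q0 by (simp add: mult_neg_neg)
    qed
  qed
qed

lemma Uplus_real_pos:
  assumes R: "K \<subseteq> \<real>" and u: "u \<in> Uplus K" shows "Re u > 0"
proof -
  obtain C \<alpha> where *: "u \<in> unit_set K" "prime_set C" "\<alpha> \<in> K" "of_nat (\<Prod>C) * u = \<alpha> * \<alpha>"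
    using u by (auto simp only: Uplus_def is_sq_def)
  define c where "c = real (\<Prod>C)"
  have c: "c > 0" "of_nat (\<Prod>C) = (of_real c :: complex)"
    using prime_set_pos[OF *(2)] by (simp_all only: c_def of_nat_0_less_iff of_real_of_nat_eq)
  obtain w where w: "u = of_real w" using R K.unit_setD(3)[OF *(1)] by (auto elim: Reals_cases)
  obtain a where a: "\<alpha> = of_real a" using R *(3) by (auto elim: Reals_cases)
  have "of_real (c * w) = (of_real (a * a) :: complex)" using *(4) c(2) w a by simp
  then have cw: "c * w = a * a" using of_real_eq_iff by blast
  have "w \<noteq> 0" using w K.unit_setD(2)[OF *(1)] by auto
  moreover have "c * w \<ge> 0" unfolding cw by simp
  then have "w \<ge> 0" using c(1) by (simp add: zero_le_mult_iff)
  ultimately show ?thesis using w by simp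
qed

definition unit_product :: "complex set" where
  "unit_product = {a * b * c | a b c. a \<in> unit_set k1 \<and> b \<in> unit_set k2 \<and> c \<in> unit_set k3}"

lemma unit_productI: "a \<in> unit_set k1 \<Longrightarrow> b \<in> unit_set k2 \<Longrightarrow> c \<in> unit_set k3 \<Longrightarrow> a * b * c \<in> unit_product"
  unfolding unit_product_def by blast

lemma mgrp_unit_product: "mgrp unit_product"
  unfolding mgrp_def
proof (intro conjI ballI)
  note g = q1.mgrp_unit_set q2.mgrp_unit_set q3.mgrp_unit_set
  show "1 \<in> unit_product" using unit_productI[OF mgrp_1[OF g(1)] mgrp_1[OF g(2)] mgrp_1[OF g(3)]] by simp
  show "0 \<notin> unit_product" unfolding unit_product_def using mgrp_nz[OF g(1)] mgrp_nz[OF g(2)] mgrp_nz[OF g(3)] by auto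
  fix x assume "x \<in> unit_product"
  then obtain a b c where x: "a \<in> unit_set k1" "b \<in> unit_set k2" "c \<in> unit_set k3" "x = a * b * c" unfolding unit_product_def by blast
  show "inverse x \<in> unit_product"
    using unit_productI[OF mgrp_inverse[OF g(1) x(1)] mgrp_inverse[OF g(2) x(2)] mgrp_inverse[OF g(3) x(3)]] x(4) by simp
  fix y assume "y \<in> unit_product"
  then obtain a' b' c' where y: "a' \<in> unit_set k1" "b' \<in> unit_set k2" "c' \<in> unit_set k3" "y = a' * b' * c'" unfolding unit_product_def by blast
  have "x * y = (a * a') * (b * b') * (c * c')" unfolding x y by (simp add: ac_simps)
  then show "x * y \<in> unit_product"
    using unit_productI[OF mgrp_mult[OF g(1) x(1) y(1)] mgrp_mult[OF g(2) x(2) y(2)] mgrp_mult[OF g(3) x(3) y(3)]] by simp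
qed

lemma unit_product_sub: "unit_product \<subseteq> unit_set K"
  unfolding unit_product_def using unit_set_sub mgrp_mult[OF K.mgrp_unit_set] by blast

lemma unit_index_eq: "unit_index K k1 k2 k3 = card (cosets (unit_set K) unit_product)"
  unfolding unit_index_def Let_def unit_product_def[symmetric] cosets_def by (simp add: setcompr_eq_image)

lemma Uplus_subset: "Uplus K \<subseteq> unit_product"
proof
  fix u assume "u \<in> Uplus K"
  then obtain e b1 b2 b3 where b: "equal_norms e b1 b2 b3" "u = e * (b1 * b2 * b3)" using Uplus_imp_equal_norms by blast
  then have "e = 1 \<or> e = -1" "b1 \<in> unit_set k1" "b2 \<in> unit_set k2" "b3 \<in> unit_set k3" by (auto simp: equal_norms_def)
  moreover from this have "e * b1 \<in> unit_set k1"
    using mgrp_mult[OF q1.mgrp_unit_set q1.minus_1_unit] by auto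
  ultimately show "u \<in> unit_product" using unit_productI[of "e * b1" b2 b3] b(2) by (simp add: ac_simps)
qed

text \<open>Squaring turns the unit index into an index below the group of squares of units.\<close>

lemma unit_index_squares:
  assumes W: "mgrp W" "W \<subseteq> unit_product" "\<And>x. x \<in> unit_product \<Longrightarrow> x \<in> W \<or> - x \<in> W"
    and fin: "finite (cosets W (squares W))" and UW: "Uplus K \<subseteq> W"
  shows "card (cosets W (squares W)) = card (cosets W (Uplus K)) * card (cosets (Uplus K) (squares (unit_set K))) * unit_index K k1 k2 k3"
    "finite (cosets (Uplus K) (squares (unit_set K)))"
proof -
  let ?E2 = "squares (unit_set K)"
  note mE = K.mgrp_unit_set
  \<comment> \<open>With E the units of K, the chain is W^2 inside E^2 inside \<open>Uplus K\<close>
    inside W, and its indices multiply.\<close>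
  have s: "squares W \<subseteq> ?E2" using W(2) unit_product_sub by (auto simp: squares_def)
  have E2U: "?E2 \<subseteq> Uplus K" by (rule K.squares_unit_subset_Uplus)
  have t1: "card (cosets W (squares W)) = card (cosets W (Uplus K)) * card (cosets (Uplus K) (squares W))"
    by (rule cosets_tower[OF W(1) K.mgrp_Uplus mgrp_squares[OF W(1)] _ UW fin]) (use s E2U in auto)
  have fin2: "finite (cosets (Uplus K) (squares W))" by (rule finite_cosets_sub[OF mgrp_squares[OF W(1)] UW fin])
  have t2: "card (cosets (Uplus K) (squares W)) = card (cosets (Uplus K) ?E2) * card (cosets ?E2 (squares W))"
    by (rule cosets_tower[OF K.mgrp_Uplus mgrp_squares[OF mE] mgrp_squares[OF W(1)] s E2U fin2])
  \<comment> \<open>Squaring has kernel {1, -1}, and W together with -W is the product of the unit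
    groups. So E^2 modulo W^2 corresponds to E modulo that product, which is the unit index.\<close>
  have iff: "(x * x) / (y * y) \<in> squares W \<longleftrightarrow> smul x unit_product = smul y unit_product"
    if xy: "x \<in> unit_set K" "y \<in> unit_set K" for x y
  proof -
    have nz: "x \<noteq> 0" "y \<noteq> 0" using xy K.unit_setD by auto
    have "(x * x) / (y * y) \<in> squares W \<longleftrightarrow> x / y \<in> unit_product"
    proof
      assume "(x * x) / (y * y) \<in> squares W"
      then obtain w where w: "w \<in> W" "(x * x) / (y * y) = w * w" by (auto simp: squares_def)
      then have "(x / y) * (x / y) = w * w" by simp
      then have "x / y = w \<or> x / y = - w" by (simp only: square_eq_iff)
      moreover have "- w \<in> unit_product" if "w \<in> unit_product" for w
      proof -
        have "- 1 \<in> unit_product" using unit_productI[OF q1.minus_1_unit mgrp_1[OF q2.mgrp_unit_set] mgrp_1[OF q3.mgrp_unit_set]] by simp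
        then show ?thesis using mgrp_mult[OF mgrp_unit_product _ that, of "-1"] by simp
      qed
      ultimately show "x / y \<in> unit_product" using w W(2) by (metis subsetD)
    next
      assume "x / y \<in> unit_product"
      then obtain w where w: "w \<in> W" "x / y = w \<or> x / y = - w" using W(3)[of "x / y"] by (metis minus_minus)
      then have "(x * x) / (y * y) = w * w" by (metis minus_mult_minus times_divide_times_eq)
      then show "(x * x) / (y * y) \<in> squares W" using w by (auto simp: squares_def)
    qed
    then show ?thesis using smul_coset_eq[OF mgrp_unit_product nz] by simp
  qed
  have "card (cosets ?E2 (squares W)) = card ((\<lambda>x. smul x unit_product) ` unit_set K)"
    by (rule card_cosets_eq(1)[OF mgrp_squares[OF W(1)], of _ "\<lambda>x. x * x", OF _ _ iff])
      (use mgrp_squares[OF mE] in \<open>auto simp: squares_def mgrp_def\<close>)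
  then have "card (cosets ?E2 (squares W)) = unit_index K k1 k2 k3" by (simp add: unit_index_eq cosets_def)
  then show "card (cosets W (squares W)) = card (cosets W (Uplus K)) * card (cosets (Uplus K) ?E2) * unit_index K k1 k2 k3"
    using t1 t2 by simp
  \<comment> \<open>A coset of E^2 is recovered from any coset of W^2 inside it, so there are at
    most as many of the former as of the latter.\<close>
  have "cosets (Uplus K) ?E2 \<subseteq> (\<lambda>C. \<Union>((\<lambda>c. smul c ?E2) ` C)) ` cosets (Uplus K) (squares W)"
  proof
    fix X assume "X \<in> cosets (Uplus K) ?E2"
    then obtain u where u: "u \<in> Uplus K" "X = smul u ?E2" by (auto simp: cosets_def)
    have u0: "u \<noteq> 0" by (rule mgrp_nz[OF K.mgrp_Uplus u(1)])
    have "smul (u * w) ?E2 = X" if "w \<in> squares W" for w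
    proof -
      have "w \<noteq> 0" using that mgrp_nz[OF mgrp_squares[OF W(1)]] by blast
      moreover have "u * w / u = w" using u0 by simp
      ultimately show ?thesis using smul_coset_eq[OF mgrp_squares[OF mE], of "u * w" u] u u0 that s by auto
    qed
    moreover have "squares W \<noteq> {}" using mgrp_1[OF mgrp_squares[OF W(1)]] by blast
    ultimately have eq: "X = \<Union>((\<lambda>c. smul c ?E2) ` smul u (squares W))" by auto
    have m: "smul u (squares W) \<in> cosets (Uplus K) (squares W)" unfolding cosets_def by (rule imageI[OF u(1)])
    show "X \<in> (\<lambda>C. \<Union>((\<lambda>c. smul c ?E2) ` C)) ` cosets (Uplus K) (squares W)" 
      by (subst eq) (rule imageI[OF m, of "\<lambda>C. \<Union>((\<lambda>c. smul c ?E2) ` C)"])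
  qed
  then show "finite (cosets (Uplus K) ?E2)" using fin2 finite_surj by blast
qed

end

section \<open>Counting unit classes of real and imaginary biquadratic fields\<close>

lemma (in quadratic_field) real_unit_power:
  assumes "d > 0" "u \<in> unit_set k" shows "\<exists>m. u = fund_unit k powi m \<or> u = - (fund_unit k powi m)"
proof -
  have "u \<in> \<real>" using real_if_pos[OF assms(1)] unit_setD(3)[OF assms(2)] by blast
  then have "Re u \<noteq> 0" using unit_setD(2)[OF assms(2)] by (auto simp: complex_is_Real_iff complex_eq_iff)
  then consider "Re u > 0" | "Re (- u) > 0" by fastforce
  then show ?thesis
  proof cases
    case 1 then show ?thesis using positive_unit_power[OF assms(1,2)] by blast
  next
    case 2
    have "- u \<in> unit_set k" using mgrp_mult[OF mgrp_unit_set minus_1_unit assms(2)] by simp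
    then obtain m where "- u = fund_unit k powi m" using positive_unit_power[OF assms(1) _ 2] by blast
    then have "u = - (fund_unit k powi m)" by (metis minus_minus)
    then show ?thesis by blast
  qed
qed

lemma range_powi_sign:
  assumes "n = 1 \<or> n = (-1 :: complex)"
  shows "range (\<lambda>m::int. n powi m) = (if n = 1 then {1} else {1, -1})"
proof (cases "n = 1")
  case False
  then have n: "n = -1" using assms by simp
  have "range (\<lambda>m::int. (-1::complex) powi m) = {1, -1}"
  proof (intro equalityI subsetI)
    fix z assume "z \<in> range (\<lambda>m::int. (-1::complex) powi m)"
    then obtain m :: int where "z = (-1) powi m" by blast
    then show "z \<in> {1, -1}" by (cases "even m") (simp_all add: power_int_minus_left_odd)
  next
    fix z :: complex assume "z \<in> {1, -1}"
    then have "z = (-1) powi 0 \<or> z = (-1) powi 1" by auto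
    then show "z \<in> range (\<lambda>m::int. (-1::complex) powi m)" by blast
  qed
  then show ?thesis using n by simp
qed auto

lemma sign_powi: "n = 1 \<or> n = (-1 :: complex) \<Longrightarrow> n powi m = 1 \<or> n powi m = -1"
  using range_powi_sign[of n] by (metis (no_types, lifting) insertE rangeI singletonD)

lemma real_square_neg: "x \<in> \<real> \<Longrightarrow> x * x \<noteq> (-1 :: complex)"
proof
  assume "x \<in> \<real>" "x * x = -1"
  then obtain r where "x = of_real r" by (auto elim: Reals_cases)
  then have "of_real (r * r) = (of_real (-1) :: complex)" using \<open>x * x = -1\<close> by simp
  then have "r * r = -1" using of_real_eq_iff by blast
  moreover have "r * r \<ge> 0" by simp
  ultimately show False by linarith
qed

context biquadratic_field
begin

text \<open>Multiply the relation by its image under \<open>tau1\<close>: this gives b1^2 N(b2)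
  N(b3) = 1, where both norms are 1 or -1.\<close>

lemma unit_relation:
  assumes b: "b1 \<in> unit_set k1" "b2 \<in> unit_set k2" "b3 \<in> unit_set k3" "b1 * b2 * b3 = 1"
  shows "b1 * b1 = 1 \<or> b1 * b1 = -1"
proof -
  have bk: "b1 \<in> k1" "b2 \<in> k2" "b3 \<in> k3" using b q1.unit_setD q2.unit_setD q3.unit_setD by auto
  have bK: "b1 \<in> K" "b2 \<in> K" "b3 \<in> K" using bk sub1 sub2 sub3 by auto
  have "tau1 (b1 * b2 * b3) = b1 * q2.cj b2 * q3.cj b3"
    using bK by (simp add: K.aut_mult[OF tau1(1)] K.K_mult tau1(2)[OF bk(1)] tau_cj(3)[OF bk(2)] tau_cj(5)[OF bk(3)])
  then have "b1 * q2.cj b2 * q3.cj b3 = 1" using b(4) K.aut_1[OF tau1(1)] by simp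
  then have "(b1 * b2 * b3) * (b1 * q2.cj b2 * q3.cj b3) = 1" using b(4) by simp
  then have e: "b1 * b1 * ((b2 * q2.cj b2) * (b3 * q3.cj b3)) = 1" by (simp only: ac_simps)
  have "b2 * q2.cj b2 = 1 \<or> b2 * q2.cj b2 = -1" "b3 * q3.cj b3 = 1 \<or> b3 * q3.cj b3 = -1"
    using q2.unit_norm[OF b(2)] q3.unit_norm[OF b(3)] by auto
  then have "(b2 * q2.cj b2) * (b3 * q3.cj b3) = 1 \<or> (b2 * q2.cj b2) * (b3 * q3.cj b3) = -1" by (elim disjE) simp_all
  then show ?thesis using e by (elim disjE) (simp_all add: minus_equation_iff[of "b1 * b1"])
qed

lemma unit_relation1:
  assumes "d1 > 0" and b: "b1 \<in> unit_set k1" "b2 \<in> unit_set k2" "b3 \<in> unit_set k3" "b1 * b2 * b3 = 1"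
  shows "b1 = 1 \<or> b1 = -1"
proof -
  have "b1 \<in> \<real>" using q1.real_if_pos[OF assms(1)] q1.unit_setD(3)[OF b(1)] by blast
  then have "b1 * b1 = 1 * 1" using unit_relation[OF b] real_square_neg by auto
  then show ?thesis by (simp only: square_eq_iff)
qed

definition n1 where "n1 = fund_unit k1 * q1.cj (fund_unit k1)"
definition n2 where "n2 = fund_unit k2 * q2.cj (fund_unit k2)"
definition n3 where "n3 = fund_unit k3 * q3.cj (fund_unit k3)"

lemma n_sign: "d1 > 0 \<Longrightarrow> n1 = 1 \<or> n1 = -1" "d2 > 0 \<Longrightarrow> n2 = 1 \<or> n2 = -1" "d3 > 0 \<Longrightarrow> n3 = 1 \<or> n3 = -1"
  unfolding n1_def n2_def n3_def using q1.unit_norm[OF q1.fund_unit(1)] q2.unit_norm[OF q2.fund_unit(1)] q3.unit_norm[OF q3.fund_unit(1)] by auto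

lemma norm_sign_mult:
  assumes "b \<in> unit_set k1" "t = 1 \<or> t = -1" shows "(t * b) * q1.cj (t * b) = b * q1.cj b"
  using assms(2) q1.aut_uminus[OF q1.cj_aut q1.unit_setD(3)[OF assms(1)]] by auto

text \<open>Two factorizations differ by a relation among units, so by \<open>unit_relation1\<close>
  c1 agrees with b1 up to sign, and the sign does not affect the norm. Thus membership in
  \<open>Uplus K\<close> can be read off from any factorization.\<close>

lemma Uplus_norm1:
  assumes d: "d1 > 0" and c: "c1 \<in> unit_set k1" "c2 \<in> unit_set k2" "c3 \<in> unit_set k3"
    and e: "equal_norms e b1 b2 b3" "c1 * c2 * c3 = e * (b1 * b2 * b3)"
  shows "c1 * q1.cj c1 = e"
proof -
  have b: "b1 \<in> unit_set k1" "b2 \<in> unit_set k2" "b3 \<in> unit_set k3" "e = 1 \<or> e = -1" "b1 * q1.cj b1 = e"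
    using e(1) by (auto simp: equal_norms_def)
  note g1 = q1.mgrp_unit_set and g2 = q2.mgrp_unit_set and g3 = q3.mgrp_unit_set
  have eE: "e \<in> unit_set k1" using b(4) q1.minus_1_unit mgrp_1[OF g1] by auto
  have nz: "b1 \<noteq> 0" "b2 \<noteq> 0" "b3 \<noteq> 0" "e \<noteq> 0" using mgrp_nz[OF g1 b(1)] mgrp_nz[OF g2 b(2)] mgrp_nz[OF g3 b(3)] b(4) by auto
  have "(c1 / (e * b1)) * (c2 / b2) * (c3 / b3) = (c1 * c2 * c3) / (e * (b1 * b2 * b3))" by simp
  also have "\<dots> = 1" unfolding e(2) using nz by simp
  finally have rel: "(c1 / (e * b1)) * (c2 / b2) * (c3 / b3) = 1" .
  have "c1 / (e * b1) = 1 \<or> c1 / (e * b1) = -1"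
    by (rule unit_relation1[OF d mgrp_divide[OF g1 c(1) mgrp_mult[OF g1 eE b(1)]] mgrp_divide[OF g2 c(2) b(2)] mgrp_divide[OF g3 c(3) b(3)] rel])
  then have "c1 = e * b1 \<or> c1 = - (e * b1)" using nz by (auto simp: field_simps)
  then have "\<exists>t. (t = 1 \<or> t = -1) \<and> c1 = t * b1" using b(4) by auto
  then obtain t where t: "t = 1 \<or> t = -1" "c1 = t * b1" by blast
  show ?thesis unfolding t(2) norm_sign_mult[OF b(1) t(1)] by (rule b(5))
qed

lemma equal_norms_rotate: "equal_norms e b1 b2 b3 \<Longrightarrow> biquadratic_field.equal_norms k2 k3 k1 s2 s3 s1 e b2 b3 b1"
  unfolding equal_norms_def biquadratic_field.equal_norms_def[OF rotate] by blast

text \<open>The three fundamental units generate a free group W of rank 3 without -1, so W / W^2 has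
  order 8. Elements of W lie in \<open>Uplus K\<close> iff their three components have equal norms,
  which gives the index of \<open>Uplus K\<close> in W; \<open>unit_index_squares\<close> and
  \<open>card_CC\<close> do the rest.\<close>

lemma CC_real:
  assumes d: "d1 > 0" "d2 > 0" "d3 > 0"
  shows "finite (CC K)" "card (CC K) * unit_index K k1 k2 k3 =
    (if nu k1 = 0 \<and> nu k2 = 0 \<and> nu k3 = 0 then 8 else 2 ^ (2 + nu k1 + nu k2 + nu k3))"
proof -
  have KR: "K \<subseteq> \<real>" using K_real_iff d by simp
  let ?e1 = "fund_unit k1" and ?e2 = "fund_unit k2" and ?e3 = "fund_unit k3"
  define g :: "int \<times> int \<times> int \<Rightarrow> complex" where "g = (\<lambda>(a, b, c). ?e1 powi a * ?e2 powi b * ?e3 powi c)"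
  have E: "?e1 powi a \<in> unit_set k1" "?e2 powi a \<in> unit_set k2" "?e3 powi a \<in> unit_set k3" for a
    using q1.powi_unit[OF q1.fund_unit(1)[OF d(1)]] q2.powi_unit[OF q2.fund_unit(1)[OF d(2)]] q3.powi_unit[OF q3.fund_unit(1)[OF d(3)]] by auto
  have e0: "?e1 \<noteq> 0" "?e2 \<noteq> 0" "?e3 \<noteq> 0"
    using q1.unit_setD(2)[OF q1.fund_unit(1)[OF d(1)]] q2.unit_setD(2)[OF q2.fund_unit(1)[OF d(2)]] q3.unit_setD(2)[OF q3.fund_unit(1)[OF d(3)]] by auto
  have pos: "Re (g z) > 0" for z
  proof -
    obtain a b c where z: "z = (a, b, c)" by (cases z)
    obtain x y w where r: "?e1 powi a = of_real x" "?e2 powi b = of_real y" "?e3 powi c = of_real w"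
      using q1.fund_powi_Re[OF d(1), of a] q2.fund_powi_Re[OF d(2), of b] q3.fund_powi_Re[OF d(3), of c] by (auto elim!: Reals_cases)
    have "x > 0" "y > 0" "w > 0"
      using q1.fund_powi_Re[OF d(1), of a] q2.fund_powi_Re[OF d(2), of b] q3.fund_powi_Re[OF d(3), of c] r by auto
    then have "x * y * w > 0" by simp
    moreover have "g z = of_real (x * y * w)" unfolding g_def z by (simp add: r)
    ultimately show ?thesis by simp
  qed
  have g_div: "g (a, b, c) / g (a', b', c') = g (a - a', b - b', c - c')" for a b c a' b' c'
    unfolding g_def by (simp add: power_int_diff e0)
  have g_inj: "a = a' \<and> b = b' \<and> c = c'" if "g (a, b, c) = g (a', b', c')" for a b c a' b' c'
  proof -
    have gz: "g (a', b', c') \<noteq> 0" using pos[of "(a', b', c')"] by auto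
    have "g (a - a', b - b', c - c') = 1" unfolding g_div[symmetric] that using gz by simp
    then have r: "?e1 powi (a - a') * ?e2 powi (b - b') * ?e3 powi (c - c') = 1" unfolding g_def by simp
    then have r2: "?e2 powi (b - b') * ?e3 powi (c - c') * ?e1 powi (a - a') = 1"
      and r3: "?e3 powi (c - c') * ?e1 powi (a - a') * ?e2 powi (b - b') = 1" by (simp_all only: ac_simps)
    \<comment> \<open>A relation among the powers makes each of them 1 or -1, and positivity
      excludes -1.\<close>
    have u1: "?e1 powi (a - a') = 1 \<or> ?e1 powi (a - a') = -1" by (rule unit_relation1[OF d(1) E(1,2,3) r])
    have u2: "?e2 powi (b - b') = 1 \<or> ?e2 powi (b - b') = -1"
      by (rule biquadratic_field.unit_relation1[OF rotate d(2) E(2,3,1) r2])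
    have u3: "?e3 powi (c - c') = 1 \<or> ?e3 powi (c - c') = -1"
      by (rule biquadratic_field.unit_relation1[OF biquadratic_field.rotate[OF rotate] d(3) E(3,1,2) r3])
    have "?e1 powi (a - a') = ?e1 powi 0" "?e2 powi (b - b') = ?e2 powi 0" "?e3 powi (c - c') = ?e3 powi 0"
      using u1 u2 u3 q1.fund_powi_Re[OF d(1), of "a - a'"] q2.fund_powi_Re[OF d(2), of "b - b'"] q3.fund_powi_Re[OF d(3), of "c - c'"]
      by auto
    from q1.fund_powi_inj[OF d(1) this(1)] q2.fund_powi_inj[OF d(2) this(2)] q3.fund_powi_inj[OF d(3) this(3)]
    show ?thesis by simp
  qed
  define W where "W = range g"
  have W: "mgrp W" unfolding mgrp_def
  proof (intro conjI ballI)
    show "1 \<in> W" unfolding W_def by (rule range_eqI[of _ _ "(0, 0, 0)"]) (simp add: g_def)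
    show "0 \<notin> W" using pos unfolding W_def by (metis (no_types, lifting) imageE less_irrefl zero_complex.sel(1))
    fix x assume "x \<in> W"
    then obtain a b c where x: "x = g (a, b, c)" unfolding W_def by auto
    have "inverse x = g (- a, - b, - c)" unfolding x g_def by (simp add: power_int_minus)
    then show "inverse x \<in> W" unfolding W_def by blast
    fix y assume "y \<in> W"
    then obtain a' b' c' where y: "y = g (a', b', c')" unfolding W_def by auto
    have "x * y = g (a + a', b + b', c + c')" unfolding x y g_def by (simp add: power_int_add e0 ac_simps)
    then show "x * y \<in> W" unfolding W_def by blast
  qed
  have WP: "W \<subseteq> unit_product"
  proof
    fix x assume "x \<in> W"
    then obtain a b c where "x = g (a, b, c)" unfolding W_def by auto
    then show "x \<in> unit_product" using unit_productI[OF E(1,2,3), of a b c] by (simp add: g_def)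
  qed
  have PW: "x \<in> W \<or> - x \<in> W" if xP: "x \<in> unit_product" for x
  proof -
    obtain a b c where x: "a \<in> unit_set k1" "b \<in> unit_set k2" "c \<in> unit_set k3" "x = a * b * c"
      using xP unfolding unit_product_def by blast
    obtain i where i: "a = ?e1 powi i \<or> a = - (?e1 powi i)" using q1.real_unit_power[OF d(1) x(1)] by blast
    obtain j where j: "b = ?e2 powi j \<or> b = - (?e2 powi j)" using q2.real_unit_power[OF d(2) x(2)] by blast
    obtain l where l: "c = ?e3 powi l \<or> c = - (?e3 powi l)" using q3.real_unit_power[OF d(3) x(3)] by blast
    have "x = g (i, j, l) \<or> - x = g (i, j, l)" unfolding x(4) g_def using i j l by (elim disjE) simp_all
    then show ?thesis unfolding W_def by (metis rangeI)
  qed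
  have UW: "Uplus K \<subseteq> W"
  proof
    fix u assume u: "u \<in> Uplus K"
    have p: "Re u > 0" by (rule Uplus_real_pos[OF KR u])
    have "u \<in> W \<or> - u \<in> W" using PW Uplus_subset u by blast
    then show "u \<in> W"
    proof
      assume "- u \<in> W"
      then obtain z where "- u = g z" unfolding W_def by blast
      then have "Re (- u) > 0" using pos[of z] by simp
      then show ?thesis using p by simp
    qed
  qed
  \<comment> \<open>The coset invariant for W / W^2: the parities of the exponents.\<close>
  define par :: "int \<times> int \<times> int \<Rightarrow> int \<times> int \<times> int" where "par = (\<lambda>(a, b, c). (a mod 2, b mod 2, c mod 2))"
  have sq_iff: "g x / g y \<in> squares W \<longleftrightarrow> par x = par y" for x y
  proof -
    obtain a b c a' b' c' where xy: "x = (a, b, c)" "y = (a', b', c')" by (metis prod_cases3)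
    have gg: "g (i, j, l) * g (i, j, l) = g (2 * i, 2 * j, 2 * l)" for i j l
      unfolding g_def prod.case powi_double[OF e0(1)] powi_double[OF e0(2)] powi_double[OF e0(3)] by (simp only: ac_simps)
    have "g x / g y \<in> squares W \<longleftrightarrow> (\<exists>i j l. g (a - a', b - b', c - c') = g (2 * i, 2 * j, 2 * l))"
      unfolding xy g_div
    proof
      assume "g (a - a', b - b', c - c') \<in> squares W"
      then obtain w where w: "g (a - a', b - b', c - c') = g w * g w" unfolding squares_def W_def by blast
      obtain i j l where "w = (i, j, l)" by (rule prod_cases3)
      then have "g (a - a', b - b', c - c') = g (2 * i, 2 * j, 2 * l)" using w gg by (simp only:)
      then show "\<exists>i j l. g (a - a', b - b', c - c') = g (2 * i, 2 * j, 2 * l)" by blast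
    next
      assume "\<exists>i j l. g (a - a', b - b', c - c') = g (2 * i, 2 * j, 2 * l)"
      then obtain i j l where w: "g (a - a', b - b', c - c') = g (i, j, l) * g (i, j, l)" unfolding gg[symmetric] by blast
      have "g (i, j, l) \<in> W" unfolding W_def by (rule rangeI)
      then show "g (a - a', b - b', c - c') \<in> squares W" unfolding squares_def w by (rule imageI)
    qed
    also have "\<dots> \<longleftrightarrow> (\<exists>i j l. a - a' = 2 * i \<and> b - b' = 2 * j \<and> c - c' = 2 * l)"
    proof
      assume "\<exists>i j l. g (a - a', b - b', c - c') = g (2 * i, 2 * j, 2 * l)"
      then obtain i j l where "g (a - a', b - b', c - c') = g (2 * i, 2 * j, 2 * l)" by blast
      from g_inj[OF this] show "\<exists>i j l. a - a' = 2 * i \<and> b - b' = 2 * j \<and> c - c' = 2 * l" by blast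
    next
      assume "\<exists>i j l. a - a' = 2 * i \<and> b - b' = 2 * j \<and> c - c' = 2 * l"
      then show "\<exists>i j l. g (a - a', b - b', c - c') = g (2 * i, 2 * j, 2 * l)" by metis
    qed
    also have "\<dots> \<longleftrightarrow> 2 dvd a - a' \<and> 2 dvd b - b' \<and> 2 dvd c - c'" by (auto simp: dvd_def)
    also have "\<dots> \<longleftrightarrow> par x = par y" unfolding xy par_def by (simp add: mod_eq_dvd_iff)
    finally show ?thesis .
  qed
  have par_img: "range par = {0, 1} \<times> {0, 1} \<times> {0, 1}"
  proof (intro equalityI subsetI)
    fix z assume "z \<in> range par"
    then obtain w where w: "z = par w" by blast
    obtain a b c where abc: "w = (a, b, c)" by (rule prod_cases3)
    have m: "i mod 2 \<in> {0, 1}" for i :: int using pos_mod_bound[of 2 i] pos_mod_sign[of 2 i] by simp linarith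
    show "z \<in> {0, 1} \<times> {0, 1} \<times> {0, 1}" unfolding w abc par_def prod.case by (intro SigmaI m)
  next
    fix z :: "int \<times> int \<times> int" assume z: "z \<in> {0, 1} \<times> {0, 1} \<times> {0, 1}"
    obtain a b c where abc: "z = (a, b, c)" by (rule prod_cases3)
    have m: "i mod 2 = i" if "i \<in> {0, 1}" for i :: int using that by (elim insertE emptyE) simp_all
    have "a \<in> {0, 1}" "b \<in> {0, 1}" "c \<in> {0, 1}" using z unfolding abc by blast+
    then have "par z = z" unfolding abc par_def prod.case by (simp only: m)
    then show "z \<in> range par" using rangeI[of par z] by simp
  qed
  have W0: "0 \<notin> W" using W by (simp add: mgrp_def)
  note csq = card_cosets_eq[OF mgrp_squares[OF W] W_def W0 sq_iff]
  have c8: "card (cosets W (squares W)) = 8" unfolding csq(1) par_img by (simp add: card_cartesian_product)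
  have fin: "finite (cosets W (squares W))" by (rule csq(2)) (simp add: par_img)
  have ek: "?e1 \<in> k1" "?e2 \<in> k2" "?e3 \<in> k3"
    using q1.unit_setD(3)[OF q1.fund_unit(1)[OF d(1)]] q2.unit_setD(3)[OF q2.fund_unit(1)[OF d(2)]] q3.unit_setD(3)[OF q3.fund_unit(1)[OF d(3)]] by auto
  note ns = n_sign(1)[OF d(1)] n_sign(2)[OF d(2)] n_sign(3)[OF d(3)]
  have Nm: "?e1 powi a * q1.cj (?e1 powi a) = n1 powi a" "?e2 powi a * q2.cj (?e2 powi a) = n2 powi a"
    "?e3 powi a * q3.cj (?e3 powi a) = n3 powi a" for a
    unfolding n1_def n2_def n3_def by (rule q1.norm_powi[OF ek(1)] q2.norm_powi[OF ek(2)] q3.norm_powi[OF ek(3)])+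
  have g_U: "g (a, b, c) \<in> Uplus K \<longleftrightarrow> n1 powi a = n2 powi b \<and> n1 powi a = n3 powi c" for a b c
  proof
    assume eq: "n1 powi a = n2 powi b \<and> n1 powi a = n3 powi c"
    have "equal_norms (n1 powi a) (?e1 powi a) (?e2 powi b) (?e3 powi c)"
      unfolding equal_norms_def Nm using E sign_powi[OF ns(1), of a] conjunct1[OF eq] conjunct2[OF eq] by metis
    then show "g (a, b, c) \<in> Uplus K"
      by (rule equal_norms_imp_Uplus) (use pos[of "(a, b, c)"] in \<open>auto simp: g_def\<close>)
  next
    assume "g (a, b, c) \<in> Uplus K"
    then obtain e b1 b2 b3 where b: "equal_norms e b1 b2 b3" "g (a, b, c) = e * (b1 * b2 * b3)" using Uplus_imp_equal_norms by blast
    have r: "?e1 powi a * ?e2 powi b * ?e3 powi c = e * (b1 * b2 * b3)" using b(2) by (simp add: g_def)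
    then have r2: "?e2 powi b * ?e3 powi c * ?e1 powi a = e * (b2 * b3 * b1)"
      and r3: "?e3 powi c * ?e1 powi a * ?e2 powi b = e * (b3 * b1 * b2)" by (simp_all only: ac_simps)
    note b2 = equal_norms_rotate[OF b(1)]
    note b3 = biquadratic_field.equal_norms_rotate[OF rotate b2]
    have "n1 powi a = e" using Uplus_norm1[OF d(1) E(1,2,3) b(1) r] Nm(1) by simp
    moreover have "n2 powi b = e" using biquadratic_field.Uplus_norm1[OF rotate d(2) E(2,3,1) b2 r2] Nm(2) by simp
    moreover have "n3 powi c = e"
      using biquadratic_field.Uplus_norm1[OF biquadratic_field.rotate[OF rotate] d(3) E(3,1,2) b3 r3] Nm(3) by simp
    ultimately show "n1 powi a = n2 powi b \<and> n1 powi a = n3 powi c" by simp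
  qed
  \<comment> \<open>The coset invariant for \<open>Uplus K\<close> in W: the second and third norm
    compared with the first. Norms are signs, so products serve as quotients.\<close>
  define ph where "ph = (\<lambda>(a, b, c). (n1 powi a * n2 powi b, n1 powi a * n3 powi c))"
  have n0: "n1 \<noteq> 0" "n2 \<noteq> 0" "n3 \<noteq> 0" using ns by auto
  have U_iff: "g x / g y \<in> Uplus K \<longleftrightarrow> ph x = ph y" for x y
  proof -
    obtain a b c a' b' c' where xy: "x = (a, b, c)" "y = (a', b', c')" by (metis prod_cases3)
    have key: "p / p' = q / q' \<longleftrightarrow> p * q = p' * q'"
      if "p = 1 \<or> p = -1" "p' = 1 \<or> p' = -1" "q = 1 \<or> q = -1" "q' = 1 \<or> q' = -1" for p p' q q' :: complex
      using that by (elim disjE) simp_all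
    note sp = sign_powi[OF ns(1)] sign_powi[OF ns(2)] sign_powi[OF ns(3)]
    show ?thesis unfolding xy g_div g_U ph_def power_int_diff[OF disjI1[OF n0(1)]] power_int_diff[OF disjI1[OF n0(2)]] power_int_diff[OF disjI1[OF n0(3)]]
      using key[OF sp(1,1) sp(2,2)] key[OF sp(1,1) sp(3,3)] by simp
  qed
  have ph_img: "range ph = (\<lambda>(x, y, z). (x * y, x * z)) ` (range (\<lambda>m::int. n1 powi m) \<times> range (\<lambda>m::int. n2 powi m) \<times> range (\<lambda>m::int. n3 powi m))"
  proof (intro equalityI subsetI)
    fix w assume "w \<in> range ph"
    then obtain a b c where w: "w = (n1 powi a * n2 powi b, n1 powi a * n3 powi c)" by (auto simp: ph_def)
    show "w \<in> (\<lambda>(x, y, z). (x * y, x * z)) ` (range (\<lambda>m::int. n1 powi m) \<times> range (\<lambda>m::int. n2 powi m) \<times> range (\<lambda>m::int. n3 powi m))"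
      by (rule image_eqI[of _ _ "(n1 powi a, n2 powi b, n3 powi c)"]) (auto simp: w)
  next
    fix w assume "w \<in> (\<lambda>(x, y, z). (x * y, x * z)) ` (range (\<lambda>m::int. n1 powi m) \<times> range (\<lambda>m::int. n2 powi m) \<times> range (\<lambda>m::int. n3 powi m))"
    then obtain a b c where w: "w = (n1 powi a * n2 powi b, n1 powi a * n3 powi c)" by auto
    show "w \<in> range ph" by (rule range_eqI[of _ _ "(a, b, c)"]) (simp add: w ph_def)
  qed
  have cU: "card (cosets W (Uplus K)) = card (range ph)" by (rule card_cosets_eq(1)[OF K.mgrp_Uplus W_def W0 U_iff])
  define x where "x = card (cosets (Uplus K) (squares (unit_set K)))"
  note ui = unit_index_squares[OF W WP PW fin UW]
  have eq8: "8 = card (range ph) * x * unit_index K k1 k2 k3" using ui(1) c8 cU by (simp add: x_def)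
  note CCK = K.card_CC[OF card_Dset_K(1) ui(2)]
  show "finite (CC K)" by (rule CCK(1))
  have cc: "card (CC K) = x * 4" using CCK(2) card_Dset_K(2) KR by (simp add: x_def)
  have nus: "nu k1 = (if n1 = 1 then 1 else 0)" "nu k2 = (if n2 = 1 then 1 else 0)" "nu k3 = (if n3 = 1 then 1 else 0)"
    unfolding q1.nu_eq q2.nu_eq q3.nu_eq n1_def n2_def n3_def using d by auto
  have img: "range ph = (\<lambda>(x, y, z). (x * y, x * z)) `
     ((if n1 = 1 then {1} else {1, -1}) \<times> (if n2 = 1 then {1} else {1, -1}) \<times> (if n3 = 1 then {1} else {1, -1}))"
    unfolding ph_img by (simp only: range_powi_sign[OF ns(1)] range_powi_sign[OF ns(2)] range_powi_sign[OF ns(3)])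
  \<comment> \<open>There is one free sign for each fundamental unit of norm -1. Comparison with the
    first sign is injective unless all three are free; then the diagonal sign is lost and 4 values
    remain instead of 8.\<close>
  have cr: "card (range ph) = (if n1 \<noteq> 1 \<and> n2 \<noteq> 1 \<and> n3 \<noteq> 1 then 4 else 2 ^ (3 - (nu k1 + nu k2 + nu k3)))"
    unfolding img nus by (cases "n1 = 1"; cases "n2 = 1"; cases "n3 = 1") (simp_all add: insert_Times_insert card_insert_if)
  show "card (CC K) * unit_index K k1 k2 k3 =
    (if nu k1 = 0 \<and> nu k2 = 0 \<and> nu k3 = 0 then 8 else 2 ^ (2 + nu k1 + nu k2 + nu k3))"
    using eq8 unfolding cc cr nus by (cases "n1 = 1"; cases "n2 = 1"; cases "n3 = 1") simp_all
qed

text \<open>The units of k2 and k3 generate a finite group M, which also absorbs the signs of units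
  of k1. So the product of the unit groups is the direct product of M and the powers of the
  fundamental unit of k1, and its squares have index 2 times 2. Norms from k2 and k3 are 1, so
  \<open>Uplus K\<close> is cut out by the norm of the power alone.\<close>

lemma CC_imaginary1:
  assumes d: "d1 > 0" "d2 < 0" "d3 < 0"
  shows "finite (CC K)" "card (CC K) * unit_index K k1 k2 k3 = 2 ^ (2 + nu k1 + nu k2 + nu k3)"
proof -
  have KR: "\<not> K \<subseteq> \<real>" using K_real_iff d by simp
  let ?e = "fund_unit k1"
  define M where "M = (\<lambda>(b, c). b * c) ` (unit_set k2 \<times> unit_set k3)"
  note f2 = q2.imaginary_finite_units[OF d(2)] and f3 = q3.imaginary_finite_units[OF d(3)]
  note g1 = q1.mgrp_unit_set and g2 = q2.mgrp_unit_set and g3 = q3.mgrp_unit_set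
  have finM: "finite M" unfolding M_def using f2 f3 by simp
  have MI: "b * c \<in> M" if "b \<in> unit_set k2" "c \<in> unit_set k3" for b c unfolding M_def using that by force
  have M: "mgrp M" unfolding mgrp_def
  proof (intro conjI ballI)
    show "1 \<in> M" using MI[OF mgrp_1[OF g2] mgrp_1[OF g3]] by simp
    show "0 \<notin> M" unfolding M_def using mgrp_nz[OF g2] mgrp_nz[OF g3] by auto
    fix x assume "x \<in> M"
    then obtain b c where x: "b \<in> unit_set k2" "c \<in> unit_set k3" "x = b * c" unfolding M_def by auto
    show "inverse x \<in> M" using MI[OF mgrp_inverse[OF g2 x(1)] mgrp_inverse[OF g3 x(2)]] x(3) by simp
    fix y assume "y \<in> M"
    then obtain b' c' where y: "b' \<in> unit_set k2" "c' \<in> unit_set k3" "y = b' * c'" unfolding M_def by auto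
    have "x * y = (b * b') * (c * c')" unfolding x y by (simp add: ac_simps)
    then show "x * y \<in> M" using MI[OF mgrp_mult[OF g2 x(1) y(1)] mgrp_mult[OF g3 x(2) y(2)]] by simp
  qed
  have m1M: "-1 \<in> M" using MI[OF q2.minus_1_unit mgrp_1[OF g3]] by simp
  have normM: "norm z = 1" if "z \<in> M" for z
    using that q2.imaginary_unit(1)[OF d(2)] q3.imaginary_unit(1)[OF d(3)] unfolding M_def by (auto simp: norm_mult)
  note fe = q1.fund_unit(1)[OF d(1)]
  have E: "?e powi a \<in> unit_set k1" for a by (rule q1.powi_unit[OF fe])
  have e0: "?e \<noteq> 0" by (rule q1.unit_setD(2)[OF fe])
  have ek: "?e \<in> k1" by (rule q1.unit_setD(3)[OF fe])
  have norm_e: "a = 0" if "norm (?e powi a) = 1" for a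
  proof -
    obtain r where r: "?e powi a = of_real r" "r > 0" using q1.fund_powi_Re[OF d(1), of a] by (auto elim!: Reals_cases)
    then have "r = 1" using that by simp
    then have "?e powi a = ?e powi 0" using r by simp
    then show ?thesis by (rule q1.fund_powi_inj[OF d(1)])
  qed
  define g :: "int \<times> complex \<Rightarrow> complex" where "g = (\<lambda>(a, z). ?e powi a * z)"
  let ?X = "UNIV \<times> M"
  have Wg: "unit_product = g ` ?X"
  proof (intro equalityI subsetI)
    fix x assume "x \<in> unit_product"
    then obtain a b c where x: "a \<in> unit_set k1" "b \<in> unit_set k2" "c \<in> unit_set k3" "x = a * b * c" unfolding unit_product_def by blast
    obtain i where i: "a = ?e powi i \<or> a = - (?e powi i)" using q1.real_unit_power[OF d(1) x(1)] by blast
    have bc: "b * c \<in> M" by (rule MI[OF x(2,3)])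
    have nbc: "- (b * c) \<in> M" using mgrp_mult[OF M m1M bc] by simp
    have "x = g (i, b * c) \<or> x = g (i, - (b * c))" unfolding x(4) g_def using i by (auto simp: ac_simps)
    then show "x \<in> g ` ?X" using bc nbc by blast
  next
    fix x assume "x \<in> g ` ?X"
    then obtain i b c where "b \<in> unit_set k2" "c \<in> unit_set k3" "x = ?e powi i * (b * c)" unfolding g_def M_def by auto
    then show "x \<in> unit_product" using unit_productI[OF E, of b c i] by (simp add: mult.assoc)
  qed
  let ?W = unit_product
  have W0: "0 \<notin> ?W" using mgrp_unit_product by (simp add: mgrp_def)
  define ph where "ph = (\<lambda>(a::int, z). (a mod 2, smul z (squares M)))"
  have g_div: "g (a, z) / g (a', z') = ?e powi (a - a') * (z / z')" for a z a' z'
    unfolding g_def by (simp add: power_int_diff e0)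
  have sq_iff: "g x / g y \<in> squares ?W \<longleftrightarrow> ph x = ph y" if "x \<in> ?X" "y \<in> ?X" for x y
  proof -
    obtain a z a' z' where xy: "x = (a, z)" "y = (a', z')" "z \<in> M" "z' \<in> M" using \<open>x \<in> ?X\<close> \<open>y \<in> ?X\<close> by auto
    have zz: "z / z' \<in> M" by (rule mgrp_divide[OF M xy(3,4)])
    have nz: "z \<noteq> 0" "z' \<noteq> 0" using mgrp_nz[OF M] xy by auto
    have "?e powi (a - a') * (z / z') \<in> squares ?W \<longleftrightarrow> 2 dvd a - a' \<and> z / z' \<in> squares M"
    proof
      assume "?e powi (a - a') * (z / z') \<in> squares ?W"
      then obtain w where w: "w \<in> ?W" "?e powi (a - a') * (z / z') = w * w" by (auto simp: squares_def)
      then obtain j v where v: "v \<in> M" "w = ?e powi j * v" unfolding Wg g_def by auto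
      have "w * w = ?e powi (2 * j) * (v * v)" unfolding v(2) powi_double[OF e0] by (simp only: ac_simps)
      then have eq: "?e powi (a - a') * (z / z') = ?e powi (2 * j) * (v * v)" using w(2) by simp
      \<comment> \<open>Elements of M have absolute value 1, so absolute values determine the
        exponent of the fundamental unit.\<close>
      have n: "norm (z / z') = 1" "norm (v * v) = 1" using normM[OF zz] normM[OF v(1)] by (simp_all add: norm_mult)
      have "norm (?e powi (a - a')) = norm (?e powi (2 * j))"
        using norm_mult[of "?e powi (a - a')" "z / z'"] norm_mult[of "?e powi (2 * j)" "v * v"] arg_cong[OF eq, of norm] n
        by (metis mult_1_right)
      moreover have "?e powi (2 * j) \<noteq> 0" using e0 by simp
      ultimately have "norm (?e powi (a - a') / ?e powi (2 * j)) = 1" by (simp add: norm_divide)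
      then have "norm (?e powi (a - a' - 2 * j)) = 1" by (simp only: power_int_diff[OF disjI1[OF e0]])
      then have aj: "a - a' = 2 * j" using norm_e by fastforce
      have "?e powi (2 * j) * (z / z') = ?e powi (2 * j) * (v * v)" using eq unfolding aj .
      then have "z / z' = v * v" using mult_left_cancel[OF \<open>?e powi (2 * j) \<noteq> 0\<close>] by blast
      then show "2 dvd a - a' \<and> z / z' \<in> squares M" using aj v(1) by (auto simp: squares_def)
    next
      assume "2 dvd a - a' \<and> z / z' \<in> squares M"
      then obtain j v where v: "a - a' = 2 * j" "v \<in> M" "z / z' = v * v" unfolding squares_def dvd_def by blast
      have "?e powi (a - a') * (z / z') = (?e powi j * v) * (?e powi j * v)" unfolding v(1,3) powi_double[OF e0] by (simp only: ac_simps)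
      moreover have "?e powi j * v \<in> ?W" unfolding Wg g_def using v(2) by force
      ultimately show "?e powi (a - a') * (z / z') \<in> squares ?W" unfolding squares_def by (simp only: image_eqI)
    qed
    also have "\<dots> \<longleftrightarrow> ph x = ph y"
      unfolding xy ph_def using smul_coset_eq[OF mgrp_squares[OF M] nz] by (simp add: mod_eq_dvd_iff)
    finally show ?thesis unfolding xy g_div .
  qed
  have ph_img: "ph ` ?X = {0, 1} \<times> cosets M (squares M)"
  proof (intro equalityI subsetI)
    fix w assume "w \<in> ph ` ?X"
    then show "w \<in> {0, 1} \<times> cosets M (squares M)" by (auto simp: ph_def cosets_def)
  next
    fix w :: "int \<times> complex set" assume "w \<in> {0, 1} \<times> cosets M (squares M)"
    then obtain z where "z \<in> M" "w = (0, smul z (squares M)) \<or> w = (1, smul z (squares M))" by (auto simp: cosets_def)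
    then have w: "w = ph (0, z) \<or> w = ph (1, z)" and X: "(0, z) \<in> ?X" "(1, z) \<in> ?X" by (auto simp: ph_def)
    show "w \<in> ph ` ?X" using w imageI[OF X(1), of ph] imageI[OF X(2), of ph] by (elim disjE) simp_all
  qed
  have cM: "card (cosets M (squares M)) = 2" by (rule finite_group_squares[OF M finM m1M])
  have fM: "finite (cosets M (squares M))" unfolding cosets_def using finM by simp
  note csq = card_cosets_eq[OF mgrp_squares[OF mgrp_unit_product] Wg W0 sq_iff]
  have c4: "card (cosets ?W (squares ?W)) = 4" using csq(1) unfolding ph_img by (simp add: card_cartesian_product cM)
  have fin: "finite (cosets ?W (squares ?W))" by (rule csq(2)) (simp_all add: ph_img fM)
  note ns = n_sign(1)[OF d(1)]
  have Nm: "?e powi a * q1.cj (?e powi a) = n1 powi a" for a unfolding n1_def by (rule q1.norm_powi[OF ek])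
  have U_iff: "g x / g y \<in> Uplus K \<longleftrightarrow> n1 powi fst x = n1 powi fst y" if "x \<in> ?X" "y \<in> ?X" for x y
  proof -
    obtain a z a' z' where xy: "x = (a, z)" "y = (a', z')" "z \<in> M" "z' \<in> M" using \<open>x \<in> ?X\<close> \<open>y \<in> ?X\<close> by auto
    have "z / z' \<in> M" by (rule mgrp_divide[OF M xy(3,4)])
    then obtain c2 c3 where c: "c2 \<in> unit_set k2" "c3 \<in> unit_set k3" "z / z' = c2 * c3" unfolding M_def by auto
    have "?e powi (a - a') * (z / z') \<in> Uplus K \<longleftrightarrow> n1 powi (a - a') = 1"
    proof
      assume "?e powi (a - a') * (z / z') \<in> Uplus K"
      then obtain e b1 b2 b3 where b: "equal_norms e b1 b2 b3" "?e powi (a - a') * (z / z') = e * (b1 * b2 * b3)"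
        using Uplus_imp_equal_norms by blast
      have "?e powi (a - a') * c2 * c3 = e * (b1 * b2 * b3)" using b(2) c(3) by (simp add: mult.assoc)
      from Uplus_norm1[OF d(1) E c(1,2) b(1) this] have "n1 powi (a - a') = e" by (simp add: Nm)
      moreover have "e = 1" using b(1) q2.imaginary_unit(2)[OF d(2), of b2] by (simp add: equal_norms_def)
      ultimately show "n1 powi (a - a') = 1" by simp
    next
      assume "n1 powi (a - a') = 1"
      then have en: "equal_norms 1 (?e powi (a - a')) c2 c3"
        unfolding equal_norms_def using E c Nm q2.imaginary_unit(2)[OF d(2) c(1)] q3.imaginary_unit(2)[OF d(3) c(2)] by simp
      show "?e powi (a - a') * (z / z') \<in> Uplus K"
        by (rule equal_norms_imp_Uplus[OF en]) (use KR c(3) in \<open>simp_all add: mult.assoc\<close>)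
    qed
    also have "\<dots> \<longleftrightarrow> n1 powi a = n1 powi a'"
    proof -
      have n0: "n1 \<noteq> 0" using ns by auto
      show ?thesis unfolding power_int_diff[OF disjI1[OF n0]] using n0 by simp
    qed
    finally show ?thesis unfolding xy g_div by simp
  qed
  have cU: "card (cosets ?W (Uplus K)) = card ((\<lambda>x. n1 powi fst x) ` ?X)" by (rule card_cosets_eq(1)[OF K.mgrp_Uplus Wg W0 U_iff])
  have "(\<lambda>x. n1 powi fst x) ` ?X = range (\<lambda>m::int. n1 powi m)" using mgrp_1[OF M] by force
  then have cU': "card (cosets ?W (Uplus K)) = (if n1 = 1 then 1 else 2)" unfolding cU range_powi_sign[OF ns] by simp
  define x where "x = card (cosets (Uplus K) (squares (unit_set K)))"
  note ui = unit_index_squares[OF mgrp_unit_product order_refl _ fin Uplus_subset]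
  have eq4: "4 = (if n1 = 1 then 1 else 2) * x * unit_index K k1 k2 k3" using ui(1) c4 cU' by (simp add: x_def)
  have fU: "finite (cosets (Uplus K) (squares (unit_set K)))" using ui(2) by simp
  note CCK = K.card_CC[OF card_Dset_K(1) fU]
  show "finite (CC K)" by (rule CCK(1))
  have cc: "card (CC K) = x * 2" using CCK(2) card_Dset_K(2) KR by (simp add: x_def)
  have nus: "nu k1 = (if n1 = 1 then 1 else 0)" "nu k2 = 0" "nu k3 = 0"
    unfolding q1.nu_eq q2.nu_eq q3.nu_eq n1_def using d by auto
  show "card (CC K) * unit_index K k1 k2 k3 = 2 ^ (2 + nu k1 + nu k2 + nu k3)"
    using eq4 unfolding cc nus by (cases "n1 = 1") simp_all
qed

lemma unit_index_rotate: "unit_index K k2 k3 k1 = unit_index K k1 k2 k3"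
proof -
  have "{a * b * c | a b c. a \<in> unit_set k2 \<and> b \<in> unit_set k3 \<and> c \<in> unit_set k1}
    = {a * b * c | a b c. a \<in> unit_set k1 \<and> b \<in> unit_set k2 \<and> c \<in> unit_set k3}" (is "?L = ?R")
  proof (intro equalityI subsetI)
    fix x assume "x \<in> ?L"
    then obtain a b c where "a \<in> unit_set k2" "b \<in> unit_set k3" "c \<in> unit_set k1" "x = a * b * c" by blast
    moreover from this have "x = c * a * b" by (simp add: ac_simps)
    ultimately show "x \<in> ?R" by blast
  next
    fix x assume "x \<in> ?R"
    then obtain a b c where "a \<in> unit_set k1" "b \<in> unit_set k2" "c \<in> unit_set k3" "x = a * b * c" by blast
    moreover from this have "x = b * c * a" by (simp add: ac_simps)
    ultimately show "x \<in> ?L" by blast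
  qed
  then show ?thesis by (simp only: unit_index_def)
qed

lemma card_CC_K:
  "finite (CC K) \<and> card (CC K) * unit_index K k1 k2 k3 =
    (if K \<subseteq> \<real> \<and> nu k1 = 0 \<and> nu k2 = 0 \<and> nu k3 = 0 then 8 else 2 ^ (2 + nu k1 + nu k2 + nu k3))"
proof -
  interpret r: biquadratic_field K k2 k3 k1 s2 s3 s1 d2 d3 d1 m by (rule rotate)
  interpret rr: biquadratic_field K k3 k1 k2 s3 s1 s2 d3 d1 d2 m by (rule r.rotate)
  consider "d1 > 0" "d2 > 0" "d3 > 0" | "d1 > 0" "d2 < 0" "d3 < 0" | "d2 > 0" "d3 < 0" "d1 < 0" | "d3 > 0" "d1 < 0" "d2 < 0"
    using signs by blast
  then show ?thesis
  proof cases
    case 1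
    then show ?thesis using CC_real K_real_iff by simp
  next
    case 2
    then show ?thesis using CC_imaginary1 K_real_iff by simp
  next
    case 3
    then show ?thesis using r.CC_imaginary1 K_real_iff by (simp add: unit_index_rotate ac_simps)
  next
    case 4
    then show ?thesis using rr.CC_imaginary1 K_real_iff by (simp add: r.unit_index_rotate unit_index_rotate ac_simps)
  qed
qed

end

section \<open>Ambiguous ideals\<close>

lemma fid_mult_smul2: "fid_mult (smul a I) (smul b J) = smul (a * b) (fid_mult I J)"
proof -
  have "fid_mult (smul a I) (smul b J) = smul a (fid_mult I (smul b J))" by (rule fid_mult_smul)
  also have "\<dots> = smul a (smul b (fid_mult I J))" unfolding fid_mult_smul_right ..
  finally show ?thesis unfolding smul_smul .
qed

context subfield_of_complex
begin

text \<open>(L M)^2 = (x^2) gives L M = (x) = L L by \<open>square_eq_principal\<close>; then cancel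
  the invertible L.\<close>

lemma square_inj:
  assumes L: "omod L" and M: "omod M" and x: "x \<in> K" "x \<noteq> 0"
    and sq: "fid_mult L L = smul x (OK K)" "fid_mult M M = smul x (OK K)"
  shows "L = M"
proof -
  have ix: "inverse x \<in> K" using x by blast
  note LM = omod_fid_mult'[OF L M]
  have one: "fid_mult (OK K) (OK K) = OK K" by (rule fid_mult_OK[OF omod_OK])
  have "fid_mult (fid_mult L M) (fid_mult L M) = fid_mult (fid_mult L L) (fid_mult M M)"
    by (rule fid_mult_mult)
  also have "\<dots> = smul (x * x) (OK K)"
    unfolding sq by (simp only: fid_mult_smul fid_mult_smul_right smul_smul one)
  finally have "fid_mult (fid_mult L M) (fid_mult L M) = smul (x ^ 2) (OK K)" by (simp only: power2_eq_square)
  then have LM': "fid_mult L M = smul x (OK K)" by (rule square_eq_principal[OF LM x])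
  have inv: "fid_mult L (smul (inverse x) L) = OK K"
    unfolding fid_mult_smul_right sq smul_smul using x by simp
  show ?thesis
    by (rule subset_antisym; rule cancel_subset[OF inv]) (simp_all only: L M LM' sq order_refl)
qed

lemma inv_ideal_eq:
  assumes I: "omod I" and J: "omod J" and IJ: "fid_mult I J = OK K"
  shows "inv_ideal K I = J"
proof
  show "J \<subseteq> inv_ideal K I"
  proof
    fix x assume x: "x \<in> J"
    have "x * y \<in> OK K" if y: "y \<in> I" for y
      using fid_mult_intro[OF y x] unfolding IJ by (simp only: mult.commute)
    then show "x \<in> inv_ideal K I" using omod_K[OF J x] by (simp add: inv_ideal_def)
  qed
  show "inv_ideal K I \<subseteq> J"
  proof
    fix x assume x: "x \<in> inv_ideal K I"
    have "smul x I \<subseteq> OK K" using x by (auto simp: inv_ideal_def)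
    then have "fid_mult (smul x I) J \<subseteq> fid_mult (OK K) J" by (rule fid_mult_mono) simp
    then have "smul x (OK K) \<subseteq> J" unfolding fid_mult_smul IJ fid_mult_OK[OF J] .
    moreover have "x * 1 \<in> smul x (OK K)" by (rule imageI) simp
    ultimately show "x \<in> J" by auto
  qed
qed

lemma smul_unit:
  assumes u: "u \<in> unit_set K" shows "smul u (OK K) = OK K"
proof
  show "smul u (OK K) \<subseteq> OK K" using unit_setD(1)[OF u] by auto
  show "OK K \<subseteq> smul u (OK K)"
  proof
    fix x assume x: "x \<in> OK K"
    have "inverse u \<in> OK K" using u by (simp add: unit_set_def)
    then have "inverse u * x \<in> OK K" using x by blast
    moreover have "x = u * (inverse u * x)" using unit_setD(2)[OF u] by simp
    ultimately show "x \<in> smul u (OK K)" by blast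
  qed
qed

lemma principalI: "x \<in> K \<Longrightarrow> x \<noteq> 0 \<Longrightarrow> I = smul x (OK K) \<Longrightarrow> principal K I"
  unfolding principal_def by (intro bexI[of _ x] conjI)

lemma principalE:
  assumes "principal K I" obtains x where "x \<in> K" "x \<noteq> 0" "I = smul x (OK K)"
  using assms unfolding principal_def by (elim conjE bexE)

text \<open>If L = (x), then x^2 and n generate the same ideal and differ by a unit. Conversely, if
  n u = a^2, then L and (a) have the same square.\<close>

lemma principal_sqrt_iff:
  assumes L: "omod L" and n: "n > 0" and sq: "fid_mult L L = smul (of_nat n) (OK K)"
  shows "principal K L \<longleftrightarrow> (\<exists>u\<in>unit_set K. is_sq K (of_nat n * u))"
proof
  have n0: "(of_nat n :: complex) \<noteq> 0" using n by simp
  assume "principal K L"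
  then obtain x where x: "x \<in> K" "x \<noteq> 0" "L = smul x (OK K)" by (rule principalE)
  have eq: "smul (x * x) (OK K) = smul (of_nat n) (OK K)"
    unfolding sq[symmetric] x(3) fid_mult_smul fid_mult_smul_right smul_smul fid_mult_OK[OF omod_OK] ..
  have "x * x * 1 \<in> smul (x * x) (OK K)" by (rule imageI) simp
  then have "x * x \<in> smul (of_nat n) (OK K)" unfolding eq by simp
  then obtain u where u: "u \<in> OK K" "x * x = of_nat n * u" by blast
  have "of_nat n * 1 \<in> smul (of_nat n) (OK K)" by (rule imageI) simp
  then have "of_nat n \<in> smul (x * x) (OK K)" unfolding eq by simp
  then obtain v where v: "v \<in> OK K" "of_nat n = x * x * v" by blast
  have "x * x * (u * v) = x * x * 1" using u(2) v(2) by (metis mult.assoc mult.commute mult_1_right)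
  then have "u * v = 1" using x(2) by simp
  then have "u \<noteq> 0" "inverse u = v" by (auto simp: inverse_unique)
  then have "u \<in> unit_set K" using u v by (simp add: unit_set_def)
  moreover have "is_sq K (of_nat n * u)" unfolding is_sq_def u(2)[symmetric] using x by blast
  ultimately show "\<exists>u\<in>unit_set K. is_sq K (of_nat n * u)" by blast
next
  have n0: "(of_nat n :: complex) \<noteq> 0" using n by simp
  assume "\<exists>u\<in>unit_set K. is_sq K (of_nat n * u)"
  then obtain u a where u: "u \<in> unit_set K" "a \<in> K" "of_nat n * u = a * a" unfolding is_sq_def by blast
  have a0: "a \<noteq> 0" using u(3) n0 unit_setD(2)[OF u(1)] by auto
  have "fid_mult L L = smul (of_nat n) (smul u (OK K))" unfolding sq smul_unit[OF u(1)] ..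
  then have "fid_mult L L = smul (a ^ 2) (OK K)" unfolding smul_smul u(3) power2_eq_square .
  then have "L = smul a (OK K)" by (rule square_eq_principal[OF L u(2) a0])
  then show "principal K L" by (rule principalI[OF u(2) a0])
qed

lemma principal_smul_iff:
  assumes x: "x \<in> K" "x \<noteq> 0" shows "principal K (smul x I) \<longleftrightarrow> principal K I"
proof
  assume "principal K I"
  then obtain y where y: "y \<in> K" "y \<noteq> 0" "I = smul y (OK K)" by (rule principalE)
  have "x * y \<in> K" "x * y \<noteq> 0" using x y(1,2) by auto
  then show "principal K (smul x I)" by (rule principalI) (simp only: y(3) smul_smul)
next
  assume "principal K (smul x I)"
  then obtain y where y: "y \<in> K" "y \<noteq> 0" "smul x I = smul y (OK K)" by (rule principalE)
  have "smul (inverse x) (smul x I) = smul (inverse x * y) (OK K)" unfolding y(3) smul_smul ..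
  then have "I = smul (inverse x * y) (OK K)" unfolding smul_smul using x by simp
  moreover have "inverse x * y \<in> K" "inverse x * y \<noteq> 0" using x y(1,2) by auto
  ultimately show "principal K I" using principalI by blast
qed

lemma CC_sym_diff:
  assumes "A \<in> CC K" "B \<in> CC K" shows "sym_diff A B \<in> CC K"
proof -
  obtain u v where A: "prime_set A" "u \<in> unit_set K" "is_sq K (of_nat (\<Prod>A) * u)"
    and B: "prime_set B" "v \<in> unit_set K" "is_sq K (of_nat (\<Prod>B) * v)"
    using assms by (auto simp: CC_def)
  have "is_sq K ((of_nat (\<Prod>A) * u) * (of_nat (\<Prod>B) * v))" by (rule is_sq_mult[OF A(3) B(3)])
  then have "is_sq K (of_nat (\<Prod>A) * of_nat (\<Prod>B) * (u * v))" by (simp only: ac_simps)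
  then have "is_sq K (of_nat (\<Prod>(sym_diff A B)) * (u * v))" using is_sq_sym_diff[OF A(1) B(1)] by blast
  then show ?thesis
    unfolding CC_def using prime_set_sym_diff[OF A(1) B(1)] mgrp_mult[OF mgrp_unit_set A(2) B(2)] by blast
qed

lemma polya_classI:
  assumes "L \<in> IG K" "x \<in> K" "x \<noteq> 0" "L = smul x I" shows "L \<in> polya_class K I"
  unfolding polya_class_def mem_Collect_eq by (intro conjI bexI[of _ x] assms)

lemma polya_classE:
  assumes "L \<in> polya_class K I"
  obtains x where "L \<in> IG K" "x \<in> K" "x \<noteq> 0" "L = smul x I"
  using assms unfolding polya_class_def mem_Collect_eq by (elim conjE bexE)

lemma polya_class_eq_iff:
  assumes I: "I \<in> IG K" and J: "J \<in> IG K"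
  shows "polya_class K I = polya_class K J \<longleftrightarrow> (\<exists>x\<in>K. x \<noteq> 0 \<and> J = smul x I)"
proof
  assume eq: "polya_class K I = polya_class K J"
  have "J = smul 1 J" by simp
  then have "J \<in> polya_class K J" by (rule polya_classI[OF J K_1 one_neq_zero])
  then have "J \<in> polya_class K I" unfolding eq .
  then obtain x where "x \<in> K" "x \<noteq> 0" "J = smul x I" by (rule polya_classE)
  then show "\<exists>x\<in>K. x \<noteq> 0 \<and> J = smul x I" by (intro bexI[of _ x] conjI)
next
  assume "\<exists>x\<in>K. x \<noteq> 0 \<and> J = smul x I"
  then obtain x where x: "x \<in> K" "x \<noteq> 0" "J = smul x I" by (elim bexE conjE)
  have I': "I = smul (inverse x) J" unfolding x(3) smul_smul using x(2) by simp
  show "polya_class K I = polya_class K J"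
  proof
    show "polya_class K I \<subseteq> polya_class K J"
    proof
      fix L assume "L \<in> polya_class K I"
      then obtain y where y: "L \<in> IG K" "y \<in> K" "y \<noteq> 0" "L = smul y I" by (rule polya_classE)
      have e: "L = smul (y * inverse x) J" unfolding y(4) by (subst I') (rule smul_smul)
      have n: "y * inverse x \<in> K" "y * inverse x \<noteq> 0" using x(1,2) y(2,3) by auto
      show "L \<in> polya_class K J" by (rule polya_classI[OF y(1) n e])
    qed
    show "polya_class K J \<subseteq> polya_class K I"
    proof
      fix L assume "L \<in> polya_class K J"
      then obtain y where y: "L \<in> IG K" "y \<in> K" "y \<noteq> 0" "L = smul y J" by (rule polya_classE)
      have e: "L = smul (y * x) I" unfolding y(4) x(3) by (rule smul_smul)
      have n: "y * x \<in> K" "y * x \<noteq> 0" using x(1,2) y(2,3) by auto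
      show "L \<in> polya_class K I" by (rule polya_classI[OF y(1) n e])
    qed
  qed
qed

end

lemma CC_mono:
  assumes "k \<subseteq> K" shows "CC k \<subseteq> CC K"
proof -
  have "unit_set k \<subseteq> unit_set K" "is_sq k x \<Longrightarrow> is_sq K x" for x
    using assms by (auto simp: unit_set_def OK_def is_sq_def)
  then show ?thesis unfolding CC_def by blast
qed

context galois_field
begin

text \<open>Suppose a^2 = p N u with p unramified and not dividing N. Then a lies in the radical,
  which is (p), so p^2 divides a^2 and p divides N, a contradiction.\<close>

lemma CC_ramified:
  assumes C: "C \<in> CC K" "p \<in> C" shows "ramif p \<noteq> 1"
proof
  assume r1: "ramif p = 1"
  obtain u a where u: "prime_set C" "u \<in> unit_set K" "a \<in> K" "of_nat (\<Prod>C) * u = a * a"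
    using C unfolding CC_def is_sq_def by blast
  have fC: "finite C" and pr: "\<And>q. q \<in> C \<Longrightarrow> prime q" using u(1) by (auto simp: prime_set_def)
  have p: "prime p" by (rule pr[OF C(2)])
  have p0: "(of_nat p :: complex) \<noteq> 0" using prime_gt_0_nat[OF p] by simp
  have R: "Rad p = smul (of_nat p) (OK K)"
    using Rad_pow_ramif[OF p] fid_pow_1[OF omod_Rad, of p] r1 by simp
  define N where "N = \<Prod>(C - {p})"
  have CN: "(of_nat (\<Prod>C) :: complex) = of_nat p * of_nat N"
    unfolding N_def using prod.remove[OF fC C(2), of "\<lambda>x. x"] by (simp only: of_nat_mult)
  note uO = unit_setD(1)[OF u(2)]
  have aa: "a ^ 2 = of_nat p * (of_nat N * u)" unfolding power2_eq_square u(4)[symmetric] CN by (rule mult.assoc)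
  have NuO: "of_nat N * u \<in> OK K" by (rule OK_mult[OF OK_of_nat uO])
  have "a ^ 2 \<in> OK K" unfolding aa by (rule OK_mult[OF OK_of_nat NuO])
  then have aO: "a \<in> OK K" using algebraic_int_of_power[of a 2] u(3) by (simp add: OK_iff)
  have "a ^ 2 \<in> smul (of_nat p) (OK K)" unfolding aa by (rule imageI[OF NuO])
  then have "a \<in> Rad p" unfolding Rad_def using aO by (auto intro!: exI[of _ "2::nat"])
  then obtain b where b: "b \<in> OK K" "a = of_nat p * b" unfolding R by blast
  have "of_nat p * (of_nat p * (b * b)) = of_nat p * (of_nat N * u)"
    using aa unfolding b(2) by (simp only: power2_eq_square ac_simps)
  then have "of_nat p * (b * b) = of_nat N * u" using p0 by simp
  then have "of_nat N = of_nat p * (b * b * inverse u)" using unit_setD(2)[OF u(2)] by (simp add: field_simps)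
  moreover have "b * b * inverse u \<in> OK K" using b(1) u(2) by (auto simp: unit_set_def)
  ultimately have "of_int (int N) \<in> smul (of_nat p) (OK K)" by auto
  then have "int p dvd int N" using of_int_in_pO prime_gt_0_nat[OF p] by blast
  then have "p dvd N" by simp
  then obtain q where "q \<in> C - {p}" "p dvd q" unfolding N_def using fC p by (auto simp: prime_dvd_prod_iff)
  then show False using pr[of q] p primes_dvd_imp_eq[of p q] by auto
qed

end

section \<open>Normal form of the stable ideals of a quadratic field\<close>

context quadratic_field
begin

definition ramified :: "nat set" where
  "ramified = {p. prime p \<and> ramif p = 2}"

lemma finite_ramified_set: "finite ramified"
  unfolding ramified_def by (rule finite_ramified)

lemma ramified_subset:
  assumes "A \<subseteq> ramified" shows "finite A" "prime_set A"
  using assms finite_subset[OF assms finite_ramified_set] by (auto simp: prime_set_def ramified_def)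

lemma CC_subset_ramified: "CC k \<subseteq> Pow ramified"
proof
  fix C assume C: "C \<in> CC k"
  have "p \<in> ramified" if "p \<in> C" for p
    using CC_ramified[OF C that] ramif_cases[of p] C that by (auto simp: ramified_def CC_def prime_set_def)
  then show "C \<in> Pow ramified" by blast
qed

definition RA :: "nat set \<Rightarrow> complex set" where
  "RA A = Finite_Set.fold (\<lambda>p. fid_mult (Rad p)) (OK k) A"

lemma RA_empty: "RA {} = OK k"
  by (simp add: RA_def)

lemma RA_insert: "finite A \<Longrightarrow> p \<notin> A \<Longrightarrow> RA (insert p A) = fid_mult (Rad p) (RA A)"
proof -
  interpret comp_fun_commute "\<lambda>p. fid_mult (Rad p)"
    by standard (simp add: fun_eq_iff fid_mult_left_commute)
  show "finite A \<Longrightarrow> p \<notin> A \<Longrightarrow> RA (insert p A) = fid_mult (Rad p) (RA A)"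
    unfolding RA_def by (rule fold_insert)
qed

lemma RA_omod: "finite A \<Longrightarrow> omod (RA A)"
proof (induction A rule: finite_induct)
  case empty
  then show ?case unfolding RA_empty by (rule omod_OK)
next
  case (insert p A)
  show ?case unfolding RA_insert[OF insert.hyps] by (rule omod_fid_mult'[OF omod_Rad insert.IH])
qed

lemma RA_IG: "finite A \<Longrightarrow> A \<subseteq> ramified \<Longrightarrow> RA A \<in> IG k"
proof (induction A rule: finite_induct)
  case empty
  show ?case unfolding RA_empty by (rule IG_one)
next
  case (insert p A)
  then have "Rad p \<in> IG k" by (intro Rad_in_IG) (auto simp: ramified_def)
  moreover have "RA A \<in> IG k" using insert by blast
  ultimately show ?case unfolding RA_insert[OF insert.hyps] by (rule IG_mult)
qed

lemma Rad_sq: "p \<in> ramified \<Longrightarrow> fid_mult (Rad p) (Rad p) = smul (of_nat p) (OK k)"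
  using Rad_pow_ramif[of p] by (simp add: ramified_def numeral_2_eq_2 fid_pow_Suc fid_mult_OK2[OF omod_Rad])

lemma RA_sq: "finite A \<Longrightarrow> A \<subseteq> ramified \<Longrightarrow> fid_mult (RA A) (RA A) = smul (of_nat (\<Prod>A)) (OK k)"
proof (induction A rule: finite_induct)
  case empty
  then show ?case unfolding RA_empty by (simp add: fid_mult_OK[OF omod_OK])
next
  case (insert p A)
  have p: "p \<in> ramified" and A: "fid_mult (RA A) (RA A) = smul (of_nat (\<Prod>A)) (OK k)" using insert by auto
  have P: "\<Prod>(insert p A) = p * \<Prod>A" using insert.hyps by (rule prod.insert)
  have "fid_mult (RA (insert p A)) (RA (insert p A)) = fid_mult (fid_mult (Rad p) (Rad p)) (fid_mult (RA A) (RA A))"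
    unfolding RA_insert[OF insert.hyps] by (rule fid_mult_mult)
  also have "\<dots> = smul (of_nat p * of_nat (\<Prod>A)) (OK k)"
    unfolding A Rad_sq[OF p] fid_mult_smul2 fid_mult_OK[OF omod_OK] ..
  finally show ?case unfolding P of_nat_mult .
qed

text \<open>Both sides have the same principal square, so \<open>square_inj\<close> applies.\<close>

lemma RA_mult:
  assumes A: "A \<subseteq> ramified" and B: "B \<subseteq> ramified"
  shows "fid_mult (RA A) (RA B) = smul (of_nat (\<Prod>(A \<inter> B))) (RA (sym_diff A B))"
proof -
  note fA = ramified_subset(1)[OF A] and fB = ramified_subset(1)[OF B]
  have D: "sym_diff A B \<subseteq> ramified" "finite (sym_diff A B)" using A B fA fB by auto
  have N: "of_nat (\<Prod>A) * of_nat (\<Prod>B) \<noteq> (0::complex)"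
    by (rule no_zero_divisors[OF prod_nz[OF ramified_subset(2)[OF A]] prod_nz[OF ramified_subset(2)[OF B]]])
  have NK: "of_nat (\<Prod>A) * of_nat (\<Prod>B) \<in> k" by (rule K_mult[OF K_of_nat K_of_nat])
  have l: "fid_mult (fid_mult (RA A) (RA B)) (fid_mult (RA A) (RA B)) = smul (of_nat (\<Prod>A) * of_nat (\<Prod>B)) (OK k)"
    unfolding fid_mult_mult[of "RA A" "RA B"] RA_sq[OF fA A] RA_sq[OF fB B] fid_mult_smul2 fid_mult_OK[OF omod_OK] ..
  have e: "of_nat (\<Prod>(A \<inter> B)) * of_nat (\<Prod>(A \<inter> B)) * of_nat (\<Prod>(sym_diff A B)) = (of_nat (\<Prod>A) * of_nat (\<Prod>B) :: complex)"
    unfolding of_nat_mult[symmetric] prod_sym_diff[OF fA fB] by (simp only: mult.commute)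
  have r: "fid_mult (smul (of_nat (\<Prod>(A \<inter> B))) (RA (sym_diff A B))) (smul (of_nat (\<Prod>(A \<inter> B))) (RA (sym_diff A B)))
      = smul (of_nat (\<Prod>A) * of_nat (\<Prod>B)) (OK k)"
    unfolding fid_mult_smul2 RA_sq[OF D(2,1)] smul_smul e ..
  show ?thesis
    by (rule square_inj[OF omod_fid_mult'[OF RA_omod[OF fA] RA_omod[OF fB]]
          omod_smul[OF RA_omod[OF D(2)] K_of_nat] NK N l r])
qed

text \<open>Radicals of unramified primes are (p), products reduce by \<open>RA_mult\<close>, and
  the inverse of \<open>RA A\<close> is \<open>RA A\<close> divided by the product of A.\<close>

lemma IG_normal_form:
  assumes "I \<in> IG k"
  shows "\<exists>r A. r \<in> \<rat> \<and> r \<noteq> 0 \<and> A \<subseteq> ramified \<and> I = smul r (RA A)"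
  using assms
proof (induction rule: IG.induct)
  case IG_one
  have "OK k = smul 1 (RA {})" by (simp add: RA_empty)
  then show ?case using Rats_1 one_neq_zero by blast
next
  case (IG_gen q)
  from Pi_q_cases[of q] show ?case
  proof
    assume "Pi_q k q = OK k"
    then have "Pi_q k q = smul 1 (RA {})" by (simp add: RA_empty)
    then show ?thesis using Rats_1 one_neq_zero by blast
  next
    assume "\<exists>p. prime p \<and> Pi_q k q = Rad p"
    then obtain p where p: "prime p" "Pi_q k q = Rad p" by blast
    from ramif_cases[OF p(1)] show ?thesis
    proof
      assume "ramif p = 1"
      then have "Pi_q k q = smul (of_nat p) (RA {})" using ramif_eq_1_iff[OF p(1)] p(2) by (simp add: RA_empty)
      moreover have "(of_nat p :: complex) \<noteq> 0" using prime_gt_0_nat[OF p(1)] by simp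
      ultimately show ?thesis using Rats_of_nat by blast
    next
      assume "ramif p = 2"
      then have "{p} \<subseteq> ramified" using p by (simp add: ramified_def)
      moreover have "Pi_q k q = smul 1 (RA {p})"
        using p(2) RA_insert[of "{}" p] by (simp add: RA_empty fid_mult_OK2[OF omod_Rad])
      ultimately show ?thesis using Rats_1 one_neq_zero by blast
    qed
  qed
next
  case (IG_inv I)
  then obtain r A where A: "r \<in> \<rat>" "r \<noteq> 0" "A \<subseteq> ramified" "I = smul r (RA A)" by blast
  note f = ramified_subset(1)[OF A(3)]
  define t where "t = inverse (r * of_nat (\<Prod>A))"
  have nz: "r * of_nat (\<Prod>A) \<noteq> 0" by (rule no_zero_divisors[OF A(2) prod_nz[OF ramified_subset(2)[OF A(3)]]])
  have t: "t \<in> \<rat>" "t \<noteq> 0" unfolding t_def using nz A(1) by (auto intro!: Rats_inverse Rats_mult)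
  have "fid_mult I (smul t (RA A)) = smul (r * t * of_nat (\<Prod>A)) (OK k)"
    unfolding A(4) fid_mult_smul2 RA_sq[OF f A(3)] smul_smul ..
  also have "r * t * of_nat (\<Prod>A) = t * (r * of_nat (\<Prod>A))" by (simp only: ac_simps)
  also have "\<dots> = 1" unfolding t_def by (rule left_inverse[OF nz])
  finally have IJ: "fid_mult I (smul t (RA A)) = OK k" by simp
  have oI: "omod I" unfolding A(4) by (rule omod_smul[OF RA_omod[OF f] K_Rats[OF A(1)]])
  have "inv_ideal k I = smul t (RA A)"
    by (rule inv_ideal_eq[OF oI omod_smul[OF RA_omod[OF f] K_Rats[OF t(1)]] IJ])
  then show ?case using t A(3) by blast
next
  case (IG_mult I J)
  then obtain r A t B where A: "r \<in> \<rat>" "r \<noteq> 0" "A \<subseteq> ramified" "I = smul r (RA A)"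
    and B: "t \<in> \<rat>" "t \<noteq> 0" "B \<subseteq> ramified" "J = smul t (RA B)" by blast
  have D: "sym_diff A B \<subseteq> ramified" using A B by blast
  have "prime_set (A \<inter> B)" using ramified_subset(2)[of "A \<inter> B"] A by blast
  then have nz: "(of_nat (\<Prod>(A \<inter> B)) :: complex) \<noteq> 0" by (rule prod_nz)
  have "fid_mult I J = smul (r * t * of_nat (\<Prod>(A \<inter> B))) (RA (sym_diff A B))"
    unfolding A(4) B(4) fid_mult_smul2 RA_mult[OF A(3) B(3)] smul_smul ..
  moreover have "r * t * of_nat (\<Prod>(A \<inter> B)) \<in> \<rat>" using A(1) B(1) by (intro Rats_mult Rats_of_nat)
  moreover have "r * t * of_nat (\<Prod>(A \<inter> B)) \<noteq> 0" by (intro no_zero_divisors A(2) B(2) nz)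
  ultimately show ?case using D by blast
qed

lemma principal_RA:
  assumes A: "A \<subseteq> ramified" shows "principal k (RA A) \<longleftrightarrow> A \<in> CC k"
  using principal_sqrt_iff[OF RA_omod[OF ramified_subset(1)[OF A]] prime_set_pos[OF ramified_subset(2)[OF A]]
      RA_sq[OF ramified_subset(1)[OF A] A]] ramified_subset(2)[OF A]
  unfolding CC_def by blast

text \<open>\<open>RA A\<close> is its own inverse up to a principal ideal, so equality of classes
  means that the product of the two ideals is principal, and this product is \<open>RA\<close> of
  the symmetric difference up to a rational factor.\<close>

lemma polya_class_RA_eq_iff:
  assumes A: "A \<subseteq> ramified" and B: "B \<subseteq> ramified"
  shows "polya_class k (RA A) = polya_class k (RA B) \<longleftrightarrow> sym_diff A B \<in> CC k"
proof -
  note fA = ramified_subset(1)[OF A] and fB = ramified_subset(1)[OF B]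
  have D: "sym_diff A B \<subseteq> ramified" using A B by blast
  have "prime_set (A \<inter> B)" using ramified_subset(2)[of "A \<inter> B"] A by blast
  then have nz: "(of_nat (\<Prod>(A \<inter> B)) :: complex) \<noteq> 0" by (rule prod_nz)
  have nA: "(of_nat (\<Prod>A) :: complex) \<noteq> 0" by (rule prod_nz[OF ramified_subset(2)[OF A]])
  have "(\<exists>x\<in>k. x \<noteq> 0 \<and> RA B = smul x (RA A)) \<longleftrightarrow> principal k (fid_mult (RA A) (RA B))"
  proof
    assume "\<exists>x\<in>k. x \<noteq> 0 \<and> RA B = smul x (RA A)"
    then obtain x where x: "x \<in> k" "x \<noteq> 0" "RA B = smul x (RA A)" by (elim bexE conjE)
    have "fid_mult (RA A) (RA B) = smul (x * of_nat (\<Prod>A)) (OK k)"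
      unfolding x(3) fid_mult_smul_right RA_sq[OF fA A] smul_smul ..
    moreover have "x * of_nat (\<Prod>A) \<in> k" by (rule K_mult[OF x(1) K_of_nat])
    ultimately show "principal k (fid_mult (RA A) (RA B))"
      using principalI no_zero_divisors[OF x(2) nA] by blast
  next
    assume "principal k (fid_mult (RA A) (RA B))"
    then obtain y where y: "y \<in> k" "y \<noteq> 0" "fid_mult (RA A) (RA B) = smul y (OK k)" by (rule principalE)
    have "fid_mult (RA A) (fid_mult (RA A) (RA B)) = smul y (RA A)"
      unfolding y(3) fid_mult_smul_right fid_mult_OK2[OF RA_omod[OF fA]] ..
    moreover have "fid_mult (RA A) (fid_mult (RA A) (RA B)) = smul (of_nat (\<Prod>A)) (RA B)"
      unfolding fid_mult_assoc[symmetric] RA_sq[OF fA A] fid_mult_smul fid_mult_OK[OF RA_omod[OF fB]] ..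
    ultimately have e: "smul (of_nat (\<Prod>A)) (RA B) = smul y (RA A)" by simp
    have "smul (inverse (of_nat (\<Prod>A))) (smul (of_nat (\<Prod>A)) (RA B)) = RA B"
      unfolding smul_smul left_inverse[OF nA] by simp
    then have "RA B = smul (inverse (of_nat (\<Prod>A)) * y) (RA A)" unfolding e smul_smul by (rule sym)
    moreover have "inverse (of_nat (\<Prod>A)) * y \<in> k" by (rule K_mult[OF K_inverse[OF K_of_nat] y(1)])
    moreover have "inverse (of_nat (\<Prod>A)) * y \<noteq> 0" by (rule no_zero_divisors[OF nonzero_imp_inverse_nonzero[OF nA] y(2)])
    ultimately show "\<exists>x\<in>k. x \<noteq> 0 \<and> RA B = smul x (RA A)" by (intro bexI[of _ "inverse (of_nat (\<Prod>A)) * y"] conjI)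
  qed
  also have "\<dots> \<longleftrightarrow> principal k (RA (sym_diff A B))"
    unfolding RA_mult[OF A B] by (rule principal_smul_iff[OF K_of_nat nz])
  finally show ?thesis
    unfolding polya_class_eq_iff[OF RA_IG[OF fA A] RA_IG[OF fB B]] principal_RA[OF D] .
qed

lemma polya_class_normal_form:
  assumes "I \<in> IG k"
  shows "\<exists>r A. r \<in> k \<and> r \<noteq> 0 \<and> A \<subseteq> ramified \<and> I = smul r (RA A) \<and> polya_class k I = polya_class k (RA A)"
proof -
  obtain r A where A: "r \<in> \<rat>" "r \<noteq> 0" "A \<subseteq> ramified" "I = smul r (RA A)" using IG_normal_form[OF assms] by blast
  have r: "r \<in> k" by (rule K_Rats[OF A(1)])
  have "polya_class k (RA A) = polya_class k I"
    unfolding polya_class_eq_iff[OF RA_IG[OF ramified_subset(1)[OF A(3)] A(3)] assms] using A r by blast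
  then show ?thesis using A r by metis
qed

end

section \<open>Counting the kernel\<close>

text \<open>Under \<open>tdiff\<close> the triples of sets form a vector space over the field with
  two elements, and \<open>tsum\<close> is the linear map adding the three components.\<close>

definition tsum :: "nat set \<times> nat set \<times> nat set \<Rightarrow> nat set" where
  "tsum = (\<lambda>(A, B, C). sym_diff (sym_diff A B) C)"

definition tdiff :: "nat set \<times> nat set \<times> nat set \<Rightarrow> nat set \<times> nat set \<times> nat set \<Rightarrow> nat set \<times> nat set \<times> nat set" where
  "tdiff = (\<lambda>(A, B, C) (A', B', C'). (sym_diff A A', sym_diff B B', sym_diff C C'))"

lemma mem_sym_diff: "p \<in> sym_diff A B \<longleftrightarrow> (p \<in> A) \<noteq> (p \<in> B)"
  by blast

lemma tdiff_tdiff: "tdiff x (tdiff x y) = y"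
proof -
  have s: "sym_diff A (sym_diff A B) = B" for A B :: "nat set" by blast
  show ?thesis by (cases x; cases y) (simp only: tdiff_def prod.case s)
qed

lemma tsum_tdiff: "tsum (tdiff x y) = sym_diff (tsum x) (tsum y)"
proof -
  obtain A B C A' B' C' where xy: "x = (A, B, C)" "y = (A', B', C')" by (metis prod_cases3)
  show ?thesis unfolding xy tsum_def tdiff_def prod.case
    by (rule Set.set_eqI) (simp only: mem_sym_diff, argo)
qed

lemma sym_diff_empty_iff: "sym_diff A B = {} \<longleftrightarrow> A = B"
  by blast

text \<open>f behaves like a homomorphism with kernel N: its fibre through a is the translate of N
  by a, as \<open>tdiff\<close> is both addition and subtraction.\<close>

lemma card_tdiff_fibers:
  assumes X: "finite X" and eq: "\<And>x y. x \<in> X \<Longrightarrow> y \<in> X \<Longrightarrow> f x = f y \<longleftrightarrow> tdiff x y \<in> N"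
    and cl: "\<And>x y. x \<in> X \<Longrightarrow> y \<in> N \<Longrightarrow> tdiff x y \<in> X"
  shows "card X = card (f ` X) * card N"
proof (rule card_fibers(2)[OF finite_imageI[OF X]])
  fix a assume a: "a \<in> X"
  have "{x \<in> X. f x = f a} = tdiff a ` N"
  proof
    show "{x \<in> X. f x = f a} \<subseteq> tdiff a ` N"
    proof
      fix x assume "x \<in> {x \<in> X. f x = f a}"
      then have x: "x \<in> X" "f a = f x" by auto
      have "tdiff a x \<in> N" using eq[OF a x(1)] x(2) by blast
      then have "tdiff a (tdiff a x) \<in> tdiff a ` N" by (rule imageI)
      then show "x \<in> tdiff a ` N" unfolding tdiff_tdiff .
    qed
    show "tdiff a ` N \<subseteq> {x \<in> X. f x = f a}"
    proof
      fix x assume "x \<in> tdiff a ` N"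
      then obtain y where y: "y \<in> N" "x = tdiff a y" by blast
      have x: "x \<in> X" unfolding y(2) by (rule cl[OF a y(1)])
      have "tdiff a x \<in> N" unfolding y(2) tdiff_tdiff by (rule y(1))
      then show "x \<in> {x \<in> X. f x = f a}" using eq[OF a x] x by simp
    qed
  qed
  moreover have inj: "inj_on (tdiff a) N" by (rule inj_onI) (metis tdiff_tdiff)
  moreover have "finite N"
  proof (rule finite_imageD[OF _ inj])
    show "finite (tdiff a ` N)" using X cl[OF a] by (auto intro: finite_subset[of _ X])
  qed
  ultimately show "finite {x \<in> X. f x = f a} \<and> card {x \<in> X. f x = f a} = card N"
    using X by (simp add: card_image)
qed

section \<open>Triples of sets of ramified primes and the kernel\<close>

context biquadratic_field
begin

lemma ramif_1_imp:
  assumes "prime p" "q3.ramif p = 1" shows "K.ramif p = q1.ramif p" "K.ramif p = q2.ramif p"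
proof -
  have u: "q3.unramified p" using q3.ramif_unramified[OF assms(1)] assms(2) by simp
  show "K.ramif p = q1.ramif p" by (rule ramif_eq_if_unramified3[OF assms(1) u])
  show "K.ramif p = q2.ramif p" by (rule biquadratic_field.ramif_eq_if_unramified3[OF swap assms(1) u])
qed

text \<open>If p is unramified in one k_i, the other two and K share one index by
  \<open>ramif_1_imp\<close>; if p ramifies in all three, the index in K is 4. So a ramified p has
  indices 2, 2, 1 with e = 2, or 2, 2, 2 with e = 4.\<close>

lemma ramif_relation:
  assumes p: "prime p"
  shows "q1.ramif p * q2.ramif p * q3.ramif p = (if K.ramif p = 1 then 1 else 2 * K.ramif p)"
    and "K.ramif p \<noteq> 1 \<longleftrightarrow> q1.ramif p = 2 \<or> q2.ramif p = 2"
    and "q3.ramif p = 2 \<Longrightarrow> q1.ramif p = 2 \<or> q2.ramif p = 2"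
proof -
  note u3 = ramif_1_imp[OF p] and u1 = biquadratic_field.ramif_1_imp[OF rotate p]
    and u2 = biquadratic_field.ramif_1_imp[OF biquadratic_field.rotate[OF rotate] p]
  note all = q1.ramif_cases[OF p] q2.ramif_cases[OF p] q3.ramif_cases[OF p] u1 u2 u3 all_ramified_imp_4[OF p]
  show "q1.ramif p * q2.ramif p * q3.ramif p = (if K.ramif p = 1 then 1 else 2 * K.ramif p)"
    "K.ramif p \<noteq> 1 \<longleftrightarrow> q1.ramif p = 2 \<or> q2.ramif p = 2"
    "q3.ramif p = 2 \<Longrightarrow> q1.ramif p = 2 \<or> q2.ramif p = 2"
    using all by (elim disjE; simp)+
qed

text \<open>Two of the fields suffice, since no prime ramifies in k3 alone by
  \<open>ramif_relation\<close>.\<close>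

definition ramifiedK :: "nat set" where
  "ramifiedK = q1.ramified \<union> q2.ramified"

lemma ramified_subset_ramifiedK: "q1.ramified \<subseteq> ramifiedK" "q2.ramified \<subseteq> ramifiedK" "q3.ramified \<subseteq> ramifiedK"
proof -
  show "q1.ramified \<subseteq> ramifiedK" "q2.ramified \<subseteq> ramifiedK" by (auto simp: ramifiedK_def)
  show "q3.ramified \<subseteq> ramifiedK"
    using ramif_relation(3) by (auto simp: ramifiedK_def q1.ramified_def q2.ramified_def q3.ramified_def)
qed

lemma finite_ramifiedK: "finite ramifiedK"
  by (simp add: ramifiedK_def q1.finite_ramified_set q2.finite_ramified_set)

lemma ramifiedK_eq: "ramifiedK = {p. prime p \<and> ram_index K p \<noteq> 1}"
proof (rule Set.set_eqI)
  fix p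
  show "p \<in> ramifiedK \<longleftrightarrow> p \<in> {p. prime p \<and> ram_index K p \<noteq> 1}"
    using ramif_relation(2)[of p] K.ram_index_eq[of p]
    by (cases "prime p") (simp_all add: ramifiedK_def q1.ramified_def q2.ramified_def)
qed

lemma CC_K_subset: "CC K \<subseteq> Pow ramifiedK"
proof
  fix C assume C: "C \<in> CC K"
  have "p \<in> ramifiedK" if p: "p \<in> C" for p
  proof -
    have pr: "prime p" using C p by (auto simp: CC_def prime_set_def)
    show ?thesis unfolding ramifiedK_eq using K.CC_ramified[OF C p] K.ram_index_eq[OF pr] pr by simp
  qed
  then show "C \<in> Pow ramifiedK" by blast
qed

text \<open>Writing the powers of 2 as products over one common set of primes lets
  \<open>ramif_relation\<close> be applied prime by prime.\<close>

lemma pow_card_ramified: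
  "2 ^ card q1.ramified = (\<Prod>p\<in>ramifiedK. q1.ramif p)"
  "2 ^ card q2.ramified = (\<Prod>p\<in>ramifiedK. q2.ramif p)"
  "2 ^ card q3.ramified = (\<Prod>p\<in>ramifiedK. q3.ramif p)"
proof -
  have *: "2 ^ card R = (\<Prod>p\<in>ramifiedK. f p)"
    if "R \<subseteq> ramifiedK" "\<And>p. p \<in> R \<Longrightarrow> f p = 2" "\<And>p. p \<in> ramifiedK - R \<Longrightarrow> f p = 1" for R and f :: "nat \<Rightarrow> nat"
  proof -
    have "(\<Prod>p\<in>ramifiedK. f p) = (\<Prod>p\<in>R. f p)"
      by (rule prod.mono_neutral_right[OF finite_ramifiedK that(1)]) (use that(3) in blast)
    also have "\<dots> = (\<Prod>p\<in>R. 2)" by (rule prod.cong[OF refl that(2)])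
    finally show ?thesis by simp
  qed
  have pr: "prime p" if "p \<in> ramifiedK" for p using that by (simp add: ramifiedK_eq)
  show "2 ^ card q1.ramified = (\<Prod>p\<in>ramifiedK. q1.ramif p)"
    by (rule *[OF ramified_subset_ramifiedK(1)]) (use q1.ramif_cases pr in \<open>auto simp: q1.ramified_def\<close>)
  show "2 ^ card q2.ramified = (\<Prod>p\<in>ramifiedK. q2.ramif p)"
    by (rule *[OF ramified_subset_ramifiedK(2)]) (use q2.ramif_cases pr in \<open>auto simp: q2.ramified_def\<close>)
  show "2 ^ card q3.ramified = (\<Prod>p\<in>ramifiedK. q3.ramif p)"
    by (rule *[OF ramified_subset_ramifiedK(3)]) (use q3.ramif_cases pr in \<open>auto simp: q3.ramified_def\<close>)
qed

definition triples :: "(nat set \<times> nat set \<times> nat set) set" where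
  "triples = Pow q1.ramified \<times> Pow q2.ramified \<times> Pow q3.ramified"

lemma finite_triples: "finite triples"
  by (simp add: triples_def q1.finite_ramified_set q2.finite_ramified_set q3.finite_ramified_set)

lemma card_triples: "card triples = 2 ^ card ramifiedK * (\<Prod>p\<in>ramifiedK. K.ramif p)"
proof -
  have "card triples = 2 ^ card q1.ramified * (2 ^ card q2.ramified * 2 ^ card q3.ramified)"
    by (simp add: triples_def card_cartesian_product card_Pow q1.finite_ramified_set q2.finite_ramified_set q3.finite_ramified_set)
  also have "\<dots> = (\<Prod>p\<in>ramifiedK. q1.ramif p * q2.ramif p * q3.ramif p)"
    unfolding pow_card_ramified prod.distrib by (simp only: mult.assoc)
  also have "\<dots> = (\<Prod>p\<in>ramifiedK. 2 * K.ramif p)"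
  proof (rule prod.cong[OF refl])
    fix p assume "p \<in> ramifiedK"
    then have p: "prime p" "K.ramif p \<noteq> 1" using K.ram_index_eq[of p] by (auto simp: ramifiedK_eq)
    show "q1.ramif p * q2.ramif p * q3.ramif p = 2 * K.ramif p" using ramif_relation(1)[OF p(1)] p(2) by simp
  qed
  also have "\<dots> = 2 ^ card ramifiedK * (\<Prod>p\<in>ramifiedK. K.ramif p)" by (simp add: prod.distrib)
  finally show ?thesis .
qed

lemma tdiff_triples: "x \<in> triples \<Longrightarrow> y \<in> triples \<Longrightarrow> tdiff x y \<in> triples"
  unfolding triples_def tdiff_def by auto

lemma tsum_surj:
  assumes C: "C \<subseteq> ramifiedK" shows "\<exists>x\<in>triples. tsum x = C"
proof
  \<comment> \<open>Primes of C that do not ramify in k1 ramify in k2, so the third component can be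
    empty.\<close>
  show "(C \<inter> q1.ramified, C - q1.ramified, {}) \<in> triples" using C by (auto simp: triples_def ramifiedK_def)
  show "tsum (C \<inter> q1.ramified, C - q1.ramified, {}) = C" by (auto simp: tsum_def)
qed

definition kernel_triples :: "(nat set \<times> nat set \<times> nat set) set" where
  "kernel_triples = {x \<in> triples. tsum x \<in> CC K}"

text \<open>\<open>tsum\<close> maps all triples onto the subsets of \<open>ramifiedK\<close>, so by
  \<open>card_triples\<close> its kernel has order the product of the e_p. The kernel triples are
  the full preimage of \<open>CC K\<close>.\<close>

lemma card_kernel_triples: "card kernel_triples = card (CC K) * (\<Prod>p\<in>ramifiedK. K.ramif p)"
proof -
  define N where "N = {x \<in> triples. tsum x = {}}"
  have eq: "tsum x = tsum y \<longleftrightarrow> tdiff x y \<in> N" if "x \<in> triples" "y \<in> triples" for x y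
    unfolding N_def using tdiff_triples[OF that] by (simp only: mem_Collect_eq tsum_tdiff sym_diff_empty_iff simp_thms)
  have tN: "tsum (tdiff x y) = tsum x" if "y \<in> N" for x y
  proof -
    have "tsum y = {}" using that by (simp add: N_def)
    then show ?thesis unfolding tsum_tdiff by simp
  qed
  have NT: "N \<subseteq> triples" by (auto simp: N_def)
  have "card triples = card (tsum ` triples) * card N"
    by (rule card_tdiff_fibers[OF finite_triples eq]) (use tdiff_triples NT in auto)
  also have "tsum ` triples = Pow ramifiedK"
  proof
    show "tsum ` triples \<subseteq> Pow ramifiedK"
      using ramified_subset_ramifiedK by (auto simp: triples_def tsum_def)
    show "Pow ramifiedK \<subseteq> tsum ` triples" using tsum_surj by blast
  qed
  finally have "2 ^ card ramifiedK * (\<Prod>p\<in>ramifiedK. K.ramif p) = 2 ^ card ramifiedK * card N"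
    unfolding card_triples card_Pow[OF finite_ramifiedK] .
  then have N: "card N = (\<Prod>p\<in>ramifiedK. K.ramif p)" by simp
  have fin: "finite kernel_triples" unfolding kernel_triples_def using finite_triples by simp
  have "card kernel_triples = card (tsum ` kernel_triples) * card N"
  proof (rule card_tdiff_fibers[OF fin])
    show "tsum x = tsum y \<longleftrightarrow> tdiff x y \<in> N" if "x \<in> kernel_triples" "y \<in> kernel_triples" for x y
      using eq that by (simp only: kernel_triples_def mem_Collect_eq)
    fix x y assume x: "x \<in> kernel_triples" and y: "y \<in> N"
    have "tdiff x y \<in> triples"
      by (rule tdiff_triples) (use x y NT in \<open>simp_all only: kernel_triples_def mem_Collect_eq subset_iff\<close>)
    then show "tdiff x y \<in> kernel_triples"
      using x unfolding kernel_triples_def mem_Collect_eq tN[OF y] by blast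
  qed
  also have "tsum ` kernel_triples = CC K"
  proof
    show "tsum ` kernel_triples \<subseteq> CC K" by (auto simp: kernel_triples_def)
    show "CC K \<subseteq> tsum ` kernel_triples" using tsum_surj CC_K_subset unfolding kernel_triples_def by blast
  qed
  finally show ?thesis unfolding N .
qed

lemma extend_OK: "fid_mult (OK k1) (OK K) = OK K" "fid_mult (OK k2) (OK K) = OK K" "fid_mult (OK k3) (OK K) = OK K"
  using extend_pow[OF q1.sub K.subfield sub1, of "OK k1" 0] extend_pow[OF q2.sub K.subfield sub2, of "OK k2" 0]
    extend_pow[OF q3.sub K.subfield sub3, of "OK k3" 0] by simp_all

definition extension :: "complex set \<Rightarrow> complex set \<Rightarrow> complex set \<Rightarrow> complex set" where
  "extension I J L = fid_mult (fid_mult (fid_mult I J) L) (OK K)"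

lemma omod_extension:
  assumes "I \<subseteq> K" "J \<subseteq> K" "L \<subseteq> K" shows "K.omod (extension I J L)"
proof -
  have m: "fid_mult A B \<subseteq> K" if "A \<subseteq> K" "B \<subseteq> K" for A B
    using that by (intro fid_mult_least) (auto intro: K.K_mult K.K_add)
  have "K.omod (fid_mult (OK K) (fid_mult (fid_mult I J) L))"
    by (rule K.omod_fid_mult[OF K.omod_OK m[OF m[OF assms(1,2)] assms(3)]])
  then show ?thesis unfolding extension_def by (simp only: fid_mult_commute[of _ "OK K"])
qed

text \<open>The square of the extended ideal is generated by the product of all members of A, B and
  C, which differs from the product of \<open>tsum (A, B, C)\<close> by a square;
  \<open>principal_sqrt_iff\<close> concludes.\<close>

lemma principal_extension_iff:
  assumes A: "A \<subseteq> q1.ramified" and B: "B \<subseteq> q2.ramified" and C: "C \<subseteq> q3.ramified"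
  shows "principal K (extension (q1.RA A) (q2.RA B) (q3.RA C)) \<longleftrightarrow> tsum (A, B, C) \<in> CC K"
proof -
  note pA = q1.ramified_subset[OF A] and pB = q2.ramified_subset[OF B] and pC = q3.ramified_subset[OF C]
  let ?I = "q1.RA A" and ?J = "q2.RA B" and ?L = "q3.RA C"
  let ?a = "of_nat (\<Prod>A) :: complex" and ?b = "of_nat (\<Prod>B) :: complex" and ?c = "of_nat (\<Prod>C) :: complex"
  have sub: "?I \<subseteq> K" "?J \<subseteq> K" "?L \<subseteq> K"
    using q1.omod_K[OF q1.RA_omod[OF pA(1)]] q2.omod_K[OF q2.RA_omod[OF pB(1)]] q3.omod_K[OF q3.RA_omod[OF pC(1)]]
      sub1 sub2 sub3 by blast+
  have "fid_mult (extension ?I ?J ?L) (extension ?I ?J ?L)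
      = fid_mult (fid_mult (fid_mult (fid_mult ?I ?I) (fid_mult ?J ?J)) (fid_mult ?L ?L)) (fid_mult (OK K) (OK K))"
    unfolding extension_def
      fid_mult_mult[of "fid_mult (fid_mult ?I ?J) ?L" "OK K" "fid_mult (fid_mult ?I ?J) ?L" "OK K"]
      fid_mult_mult[of "fid_mult ?I ?J" ?L "fid_mult ?I ?J" ?L] fid_mult_mult[of ?I ?J ?I ?J] ..
  also have "\<dots> = smul (?a * (?b * ?c)) (OK K)"
    unfolding q1.RA_sq[OF pA(1) A] q2.RA_sq[OF pB(1) B] q3.RA_sq[OF pC(1) C] K.fid_mult_OK[OF K.omod_OK] fid_mult_smul2
    unfolding fid_mult_smul fid_mult_assoc extend_OK mult.assoc ..
  finally have sq: "fid_mult (extension ?I ?J ?L) (extension ?I ?J ?L) = smul (of_nat (\<Prod>A * (\<Prod>B * \<Prod>C))) (OK K)"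
    unfolding of_nat_mult .
  have pos: "\<Prod>A * (\<Prod>B * \<Prod>C) > 0" using prime_set_pos[OF pA(2)] prime_set_pos[OF pB(2)] prime_set_pos[OF pC(2)] by (simp only: nat_0_less_mult_iff simp_thms)
  have pS: "prime_set (tsum (A, B, C))"
    unfolding tsum_def prod.case by (rule prime_set_sym_diff[OF prime_set_sym_diff[OF pA(2) pB(2)] pC(2)])
  have "is_sq K (of_nat (\<Prod>A * (\<Prod>B * \<Prod>C)) * u) \<longleftrightarrow> is_sq K (of_nat (\<Prod>(tsum (A, B, C))) * u)" for u
  proof -
    have "is_sq K (of_nat (\<Prod>(tsum (A, B, C))) * u) \<longleftrightarrow> is_sq K (of_nat (\<Prod>(sym_diff A B)) * ?c * u)"
      unfolding tsum_def prod.case by (rule K.is_sq_sym_diff[OF prime_set_sym_diff[OF pA(2) pB(2)] pC(2)])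
    also have "of_nat (\<Prod>(sym_diff A B)) * ?c * u = of_nat (\<Prod>(sym_diff A B)) * (?c * u)" by (rule mult.assoc)
    also have "is_sq K (of_nat (\<Prod>(sym_diff A B)) * (?c * u)) \<longleftrightarrow> is_sq K (?a * ?b * (?c * u))"
      by (rule K.is_sq_sym_diff[OF pA(2) pB(2)])
    finally show ?thesis unfolding of_nat_mult by (simp only: mult.assoc)
  qed
  then show ?thesis
    unfolding K.principal_sqrt_iff[OF omod_extension[OF sub] pos sq] CC_def using pS by blast
qed

definition class_map :: "nat set \<times> nat set \<times> nat set \<Rightarrow> complex set set \<times> complex set set \<times> complex set set" where
  "class_map = (\<lambda>(A, B, C). (polya_class k1 (q1.RA A), polya_class k2 (q2.RA B), polya_class k3 (q3.RA C)))"

text \<open>Scaling by elements of the k_i changes neither the classes nor principality in K, so the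
  representatives may be taken in normal form.\<close>

lemma ker_psi_eq: "ker_psi K k1 k2 k3 = class_map ` kernel_triples"
proof
  show "ker_psi K k1 k2 k3 \<subseteq> class_map ` kernel_triples"
  proof
    fix z assume "z \<in> ker_psi K k1 k2 k3"
    then obtain a1 a2 a3 where z: "z = (polya_class k1 a1, polya_class k2 a2, polya_class k3 a3)"
      "a1 \<in> IG k1" "a2 \<in> IG k2" "a3 \<in> IG k3" "principal K (extension a1 a2 a3)"
      unfolding ker_psi_def extension_def by blast
    obtain r1 A where A: "r1 \<in> k1" "r1 \<noteq> 0" "A \<subseteq> q1.ramified" "a1 = smul r1 (q1.RA A)"
      "polya_class k1 a1 = polya_class k1 (q1.RA A)" using q1.polya_class_normal_form[OF z(2)] by blast
    obtain r2 B where B: "r2 \<in> k2" "r2 \<noteq> 0" "B \<subseteq> q2.ramified" "a2 = smul r2 (q2.RA B)"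
      "polya_class k2 a2 = polya_class k2 (q2.RA B)" using q2.polya_class_normal_form[OF z(3)] by blast
    obtain r3 C where C: "r3 \<in> k3" "r3 \<noteq> 0" "C \<subseteq> q3.ramified" "a3 = smul r3 (q3.RA C)"
      "polya_class k3 a3 = polya_class k3 (q3.RA C)" using q3.polya_class_normal_form[OF z(4)] by blast
    have e: "extension a1 a2 a3 = smul (r1 * r2 * r3) (extension (q1.RA A) (q2.RA B) (q3.RA C))"
      unfolding A(4) B(4) C(4) extension_def fid_mult_smul2 unfolding fid_mult_smul ..
    have "r1 \<in> K" "r2 \<in> K" "r3 \<in> K" using A(1) B(1) C(1) sub1 sub2 sub3 by auto
    then have nz: "r1 * r2 * r3 \<in> K" "r1 * r2 * r3 \<noteq> 0" using A(2) B(2) C(2) by auto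
    have "principal K (extension (q1.RA A) (q2.RA B) (q3.RA C))"
      using z(5) unfolding e by (rule K.principal_smul_iff[OF nz, THEN iffD1])
    then have "(A, B, C) \<in> kernel_triples"
      unfolding principal_extension_iff[OF A(3) B(3) C(3)] kernel_triples_def triples_def using A(3) B(3) C(3) by blast
    moreover have "z = class_map (A, B, C)" unfolding z(1) class_map_def by (simp only: prod.case A(5) B(5) C(5))
    ultimately show "z \<in> class_map ` kernel_triples" by blast
  qed
  show "class_map ` kernel_triples \<subseteq> ker_psi K k1 k2 k3"
  proof
    fix z assume "z \<in> class_map ` kernel_triples"
    then obtain A B C where x: "(A, B, C) \<in> kernel_triples" "z = class_map (A, B, C)" by (metis imageE prod_cases3)
    have sub: "A \<subseteq> q1.ramified" "B \<subseteq> q2.ramified" "C \<subseteq> q3.ramified" "tsum (A, B, C) \<in> CC K"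
      using x(1) by (auto simp: kernel_triples_def triples_def)
    have IG: "q1.RA A \<in> IG k1" "q2.RA B \<in> IG k2" "q3.RA C \<in> IG k3"
      by (rule q1.RA_IG[OF q1.ramified_subset(1)[OF sub(1)] sub(1)] q2.RA_IG[OF q2.ramified_subset(1)[OF sub(2)] sub(2)]
          q3.RA_IG[OF q3.ramified_subset(1)[OF sub(3)] sub(3)])+
    have "principal K (extension (q1.RA A) (q2.RA B) (q3.RA C))"
      using sub(4) principal_extension_iff[OF sub(1-3)] by blast
    then show "z \<in> ker_psi K k1 k2 k3"
      unfolding x(2) class_map_def prod.case ker_psi_def extension_def using IG by blast
  qed
qed

text \<open>Two triples give the same classes iff their difference lies in the product of the
  \<open>CC k_i\<close>; this product is mapped into \<open>CC K\<close> by \<open>tsum\<close>, so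
  translation by it preserves the kernel triples.\<close>

lemma card_kernel:
  "card (ker_psi K k1 k2 k3) * (card (CC k1) * (card (CC k2) * card (CC k3))) = card (CC K) * (\<Prod>p\<in>ramifiedK. K.ramif p)"
proof -
  let ?N = "CC k1 \<times> CC k2 \<times> CC k3"
  have fin: "finite kernel_triples" unfolding kernel_triples_def using finite_triples by simp
  have "card kernel_triples = card (class_map ` kernel_triples) * card ?N"
  proof (rule card_tdiff_fibers[OF fin])
    fix x y assume xy: "x \<in> kernel_triples" "y \<in> kernel_triples"
    obtain A B C A' B' C' where e: "x = (A, B, C)" "y = (A', B', C')" by (metis prod_cases3)
    have s: "A \<subseteq> q1.ramified" "B \<subseteq> q2.ramified" "C \<subseteq> q3.ramified" "A' \<subseteq> q1.ramified" "B' \<subseteq> q2.ramified" "C' \<subseteq> q3.ramified"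
      using xy unfolding e kernel_triples_def triples_def by blast+
    show "class_map x = class_map y \<longleftrightarrow> tdiff x y \<in> ?N"
      unfolding e class_map_def tdiff_def prod.case prod.inject mem_Times_iff fst_conv snd_conv
        q1.polya_class_RA_eq_iff[OF s(1,4)] q2.polya_class_RA_eq_iff[OF s(2,5)] q3.polya_class_RA_eq_iff[OF s(3,6)] ..
  next
    fix x y assume x: "x \<in> kernel_triples" and y: "y \<in> ?N"
    have yT: "y \<in> triples"
      using y q1.CC_subset_ramified q2.CC_subset_ramified q3.CC_subset_ramified unfolding triples_def by blast
    obtain A B C where e: "y = (A, B, C)" "A \<in> CC k1" "B \<in> CC k2" "C \<in> CC k3" using y by blast
    have "tsum y \<in> CC K" unfolding e(1) tsum_def prod.case
      using e(2-4) CC_mono[OF sub1] CC_mono[OF sub2] CC_mono[OF sub3] by (intro K.CC_sym_diff) blast+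
    then have "tsum (tdiff x y) \<in> CC K"
      unfolding tsum_tdiff using x by (intro K.CC_sym_diff) (simp_all only: kernel_triples_def mem_Collect_eq)
    moreover have "tdiff x y \<in> triples" using x yT by (intro tdiff_triples) (simp_all only: kernel_triples_def mem_Collect_eq)
    ultimately show "tdiff x y \<in> kernel_triples" unfolding kernel_triples_def by blast
  qed
  then show ?thesis unfolding card_kernel_triples ker_psi_eq[symmetric] card_cartesian_product by (rule sym)
qed

text \<open>With t the sum of the nu, the order of the kernel times 2^(3+t) is
  \<open>card (CC K)\<close> times the product of the e_p, and \<open>card (CC K)\<close> times the
  unit index is 8 (where t = 0) or 2^(2+t). The powers of 2 leave the factor 1 or 1/2.\<close>

theorem kernel_formula:
  "real (card (ker_psi K k1 k2 k3)) =
     (if K \<subseteq> \<real> \<and> nu k1 = 0 \<and> nu k2 = 0 \<and> nu k3 = 0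
      then (\<Prod>p\<in>{p. prime p \<and> ram_index K p \<noteq> 1}. real (ram_index K p)) / real (unit_index K k1 k2 k3)
      else (\<Prod>p\<in>{p. prime p \<and> ram_index K p \<noteq> 1}. real (ram_index K p)) / (2 * real (unit_index K k1 k2 k3)))"
proof -
  define x q E where "x = card (ker_psi K k1 k2 k3)" and "q = unit_index K k1 k2 k3" and "E = (\<Prod>p\<in>ramifiedK. K.ramif p)"
  define t where "t = nu k1 + nu k2 + nu k3"
  define real0 where "real0 \<longleftrightarrow> K \<subseteq> \<real> \<and> nu k1 = 0 \<and> nu k2 = 0 \<and> nu k3 = 0"
  have P: "(\<Prod>p\<in>{p. prime p \<and> ram_index K p \<noteq> 1}. real (ram_index K p)) = real E"
    unfolding E_def of_nat_prod ramifiedK_eq by (rule prod.cong[OF refl]) (simp add: K.ram_index_eq)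
  have cK: "card (CC K) * q = (if real0 then 8 else 2 ^ (2 + t))"
    using card_CC_K by (simp only: q_def real0_def t_def add.assoc)
  have "x * (2 ^ (1 + nu k1) * (2 ^ (1 + nu k2) * 2 ^ (1 + nu k3))) = card (CC K) * E"
    using card_kernel q1.card_CC_quadratic q2.card_CC_quadratic q3.card_CC_quadratic unfolding x_def E_def by simp
  then have ck: "x * (8 * 2 ^ t) = card (CC K) * E" by (simp add: t_def power_add mult.assoc mult.left_commute)
  have "x * (8 * 2 ^ t) * q = (if real0 then 8 else 2 ^ (2 + t)) * E"
    unfolding ck cK[symmetric] by (simp only: ac_simps)
  then have eq: "8 * 2 ^ t * (x * q) = (if real0 then 8 else 4 * 2 ^ t) * E"
    by (simp add: power_add ac_simps)
  \<comment> \<open>The product with \<open>card (CC K)\<close> is nonzero, so the unit index is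
    finite and division by it is sound.\<close>
  have q0: "q > 0" using cK by (cases "q = 0") (auto split: if_splits)
  show ?thesis
  proof (cases real0)
    case True
    then have "t = 0" by (simp add: real0_def t_def)
    then have "x * q = E" using eq True by simp
    then have "real x * real q = real E" by (metis of_nat_mult)
    then have "real x = real E / real q" using q0 by (simp add: field_simps)
    then show ?thesis using True unfolding P x_def q_def real0_def by simp
  next
    case False
    then have "4 * 2 ^ t * (2 * (x * q)) = 4 * 2 ^ t * E" using eq by simp
    then have "2 * (x * q) = E" by (simp add: ac_simps)
    then have "2 * (real x * real q) = real E" by (metis of_nat_mult of_nat_numeral)
    then have "real x = real E / (2 * real q)" using q0 by (simp add: field_simps)
    then show ?thesis using False unfolding P x_def q_def real0_def by auto
  qed
qed

end

section \<open>Square roots that generate the given fields\<close>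

lemma sum_lessThan_2: "(\<Sum>i<2::nat. f i) = f 0 + f 1"
  by (simp add: numeral_2_eq_2)

text \<open>Complete the square in a quadratic equation of an irrational element, clear the
  denominator and divide out the square part.\<close>

lemma quadratic_field_exists:
  assumes k: "subfield k" and dim: "qdim_eq k 2"
  shows "\<exists>s d. quadratic_field k s d"
proof -
  interpret finite_dim_subfield k 2 by standard (fact k dim)+
  have "\<exists>x\<in>k. x \<notin> \<rat>"
  proof (rule ccontr)
    assume "\<not> (\<exists>x\<in>k. x \<notin> \<rat>)"
    then have kQ: "x \<in> \<rat>" if "x \<in> k" for x using that by blast
    obtain b :: "nat \<Rightarrow> complex" where b: "\<forall>i<2. b i \<in> k"
      "\<forall>c :: nat \<Rightarrow> rat. (\<Sum>i<2. of_rat (c i) * b i) = 0 \<longrightarrow> (\<forall>i<2. c i = 0)"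
      using dim unfolding qdim_eq_def by blast
    have "b 0 \<in> \<rat>" "b 1 \<in> \<rat>" using b(1) kQ by auto
    obtain r where r: "b 0 = of_rat r" using \<open>b 0 \<in> \<rat>\<close> by (rule Rats_cases)
    obtain t where t: "b 1 = of_rat t" using \<open>b 1 \<in> \<rat>\<close> by (rule Rats_cases)
    have ind: "x = 0 \<and> y = 0" if h: "of_rat x * b 0 + of_rat y * b 1 = 0" for x y :: rat
    proof -
      define c where "c i = (if i = 0 then x else y)" for i :: nat
      have "(\<Sum>i<2. of_rat (c i) * b i) = 0" unfolding sum_lessThan_2 c_def using h by simp
      then have "\<forall>i<2. c i = 0" using b(2) by blast
      then have "c 0 = 0" "c 1 = 0" by simp_all
      then show ?thesis by (simp add: c_def)
    qed
    \<comment> \<open>Two rationals r and t satisfy t r - r t = 0, so independence makes both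
      vanish, which contradicts it again.\<close>
    have "of_rat t * b 0 + of_rat (- r) * b 1 = 0" unfolding r t by (simp add: of_rat_minus)
    then have "t = 0 \<and> - r = 0" by (rule ind)
    then have "of_rat 1 * b 0 + of_rat 1 * b 1 = 0" unfolding r t by simp
    then show False using ind by fastforce
  qed
  then obtain x where x: "x \<in> k" "x \<notin> \<rat>" by blast
  obtain c :: "nat \<Rightarrow> rat" where c: "\<exists>i\<le>2. c i \<noteq> 0" "(\<Sum>i\<le>2. of_rat (c i) * x ^ i) = 0"
    using rational_dependence[of "\<lambda>i. x ^ i"] K_power[OF x(1)] by blast
  define a b e :: complex where "a = of_rat (c 2)" and "b = of_rat (c 1)" and "e = of_rat (c 0)"
  have rel: "e + b * x + a * (x * x) = 0"
    using c(2) by (simp add: sum_atMost_2 a_def b_def e_def power2_eq_square)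
  have Q: "a \<in> \<rat>" "b \<in> \<rat>" "e \<in> \<rat>" by (simp_all add: a_def b_def e_def)
  have a0: "a \<noteq> 0"
  proof
    assume a: "a = 0"
    have "b = 0"
    proof (rule ccontr)
      assume b: "b \<noteq> 0"
      then have "x = - e / b" using rel a by (simp add: field_simps eq_neg_iff_add_eq_0)
      then show False using x(2) Q by simp
    qed
    moreover have "e = 0" using rel a \<open>b = 0\<close> by simp
    ultimately have "c 0 = 0" "c 1 = 0" "c 2 = 0" using a by (simp_all add: a_def b_def e_def)
    moreover have "i = 0 \<or> i = 1 \<or> i = 2" if "i \<le> 2" for i :: nat using that by auto
    ultimately show False using c(1) by metis
  qed
  define y where "y = 2 * a * x + b"
  have "y * y = 4 * a * (e + b * x + a * (x * x)) + (b * b - 4 * a * e)" by (simp add: y_def algebra_simps)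
  then have yy: "y * y = b * b - 4 * a * e" unfolding rel by simp
  have yk: "y \<in> k" unfolding y_def using x K_Rats Q by (intro K_add K_mult K_numeral) auto
  have yQ: "y \<notin> \<rat>"
  proof
    assume "y \<in> \<rat>"
    then have "(y - b) / (2 * a) \<in> \<rat>" using Q by simp
    moreover have "(y - b) / (2 * a) = x" using a0 by (simp add: y_def)
    ultimately show False using x by simp
  qed
  have "y * y \<in> \<rat>" unfolding yy using Q by (intro Rats_diff Rats_mult) simp_all
  then obtain m n :: int where mn: "n > 0" "y * y = of_int m / of_int n" by (rule Rats_cases')
  \<comment> \<open>n y has the square n^2 (m / n) = m n, an integer.\<close>
  define N where "N = m * n"
  define z where "z = of_int n * y"
  have n0: "(of_int n :: complex) \<noteq> 0" using mn(1) by simp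
  have "z * z = of_int n * of_int n * (y * y)" by (simp add: z_def ac_simps)
  then have zz: "z * z = of_int N" unfolding mn(2) N_def using n0 by simp
  have zQ: "z \<notin> \<rat>"
  proof
    assume "z \<in> \<rat>"
    then have "z / of_int n \<in> \<rat>" by simp
    moreover have "z / of_int n = y" using n0 by (simp add: z_def)
    ultimately show False using yQ by simp
  qed
  then have "N \<noteq> 0" using zz by auto
  define q where "q = square_part N"
  define d where "d = squarefree_part N"
  have q0: "(of_int q :: complex) \<noteq> 0" using \<open>N \<noteq> 0\<close> by (simp add: q_def)
  have N: "N = d * q ^ 2" unfolding d_def q_def by (rule squarefree_decompose)
  define s where "s = z / of_int q"
  have "s * s = (z * z) / (of_int q * of_int q)" by (simp add: s_def)
  also have "\<dots> = of_int d" unfolding zz N using q0 by (simp add: power2_eq_square)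
  finally have ss: "s * s = of_int d" .
  have sk: "s \<in> k" unfolding s_def z_def by (intro K_divide K_mult K_of_int yk)
  have sQ: "s \<notin> \<rat>"
  proof
    assume "s \<in> \<rat>"
    then have "s * of_int q \<in> \<rat>" by (intro Rats_mult) simp_all
    moreover have "s * of_int q = z" using q0 by (simp add: s_def)
    ultimately show False using zQ by simp
  qed
  have "squarefree d" unfolding d_def by simp
  then have "quadratic_field k s d" using k dim sk ss sQ by (intro quadratic_field.intro)
  then show ?thesis by blast
qed

text \<open>Write s3 = a + b s2 over k1. As the square of s3 is rational and s2 is not in k1, a b =
  0; and b = 0 would put s3 into k1. So s3 = b s2 with b^2 rational. If b were rational, s3 would
  lie in k2, so b is a rational multiple of s1. Hence s1 s2 s3 is rational, and being integral it is
  an integer.\<close>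

lemma biquadratic_field_exists:
  assumes K: "biquadratic_bicyclic K"
    and k: "quadratic_subfield k1 K" "quadratic_subfield k2 K" "quadratic_subfield k3 K"
    and ne: "k1 \<noteq> k2" "k1 \<noteq> k3" "k2 \<noteq> k3"
  shows "\<exists>s1 s2 s3 d1 d2 d3 m. biquadratic_field K k1 k2 k3 s1 s2 s3 d1 d2 d3 m"
proof -
  obtain s1 d1 where q1: "quadratic_field k1 s1 d1"
    using quadratic_field_exists k(1) unfolding quadratic_subfield_def by blast
  obtain s2 d2 where q2: "quadratic_field k2 s2 d2"
    using quadratic_field_exists k(2) unfolding quadratic_subfield_def by blast
  obtain s3 d3 where q3: "quadratic_field k3 s3 d3"
    using quadratic_field_exists k(3) unfolding quadratic_subfield_def by blast
  interpret K: finite_dim_subfield K 4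
    using K by unfold_locales (auto simp: biquadratic_bicyclic_def)
  interpret q1: quadratic_field k1 s1 d1 by (rule q1)
  interpret q2: quadratic_field k2 s2 d2 by (rule q2)
  interpret q3: quadratic_field k3 s3 d3 by (rule q3)
  have sub: "k1 \<subseteq> K" "k2 \<subseteq> K" "k3 \<subseteq> K" using k by (auto simp: quadratic_subfield_def)
  interpret q12: quadratic_pair K k1 k2 s1 s2 d1 d2 by unfold_locales (fact sub ne)+
  interpret q13: quadratic_pair K k1 k3 s1 s3 d1 d3 by unfold_locales (fact sub ne)+
  interpret q23: quadratic_pair K k2 k3 s2 s3 d2 d3 by unfold_locales (fact sub ne)+
  have finK: "finite (aut K)" using K by (intro card_ge_0_finite) (simp add: biquadratic_bicyclic_def)
  have s3K: "s3 \<in> K" using sub(3) q3.s_in by blast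
  obtain a b where ab: "a \<in> k1" "b \<in> k1" "s3 = a + b * s2" using q12.form12[OF s3K] by blast
  have ab0: "a * b = 0"
  proof (rule ccontr)
    assume nz: "a * b \<noteq> 0"
    have "of_int d3 = (a + b * s2) * (a + b * s2)" using q3.s_sq ab(3) by simp
    also have "\<dots> = a * a + b * b * (s2 * s2) + 2 * (a * b) * s2" by (simp add: algebra_simps)
    finally have "2 * (a * b) * s2 = of_int d3 - a * a - b * b * of_int d2" unfolding q2.s_sq by simp
    then have "s2 = (of_int d3 - a * a - b * b * of_int d2) / (2 * (a * b))" using nz by (simp add: field_simps)
    also have "\<dots> \<in> k1"
      by (intro q1.K_divide q1.K_diff q1.K_mult q1.K_of_int q1.K_numeral ab(1,2))
    finally show False using q12.s2_notin_k1 by blast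
  qed
  have "b \<noteq> 0" using ab q13.s2_notin_k1 by auto
  then have a: "a = 0" using ab0 by simp
  have s3: "s3 = b * s2" using ab(3) a by simp
  have "of_int d3 = (b * s2) * (b * s2)" using q3.s_sq s3 by simp
  also have "\<dots> = b * b * of_int d2" unfolding q2.s_sq[symmetric] by (simp only: ac_simps)
  finally have "b * b = of_int d3 / of_int d2" using q2.d_nz by (simp add: field_simps)
  then have "b * b \<in> \<rat>" by simp
  from q1.square_rational_cases[OF ab(2) this] obtain y where y: "y \<in> \<rat>" "b = y * s1"
  proof
    assume "b \<in> \<rat>"
    then have "s3 \<in> k2" unfolding s3 by (intro q2.K_mult q2.K_Rats q2.s_in)
    then show ?thesis using q23.s2_notin_k1 by blast
  qed blast
  have "s1 * s2 * s3 = y * (s1 * s1) * (s2 * s2)" unfolding s3 y(2) by (simp only: ac_simps)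
  then have "s1 * s2 * s3 = y * of_int d1 * of_int d2" unfolding q1.s_sq q2.s_sq .
  then have Q: "s1 * s2 * s3 \<in> \<rat>" using y(1) by simp
  have "s1 \<in> OK K" "s2 \<in> OK K" "s3 \<in> OK K"
    using q1.s_OK q2.s_OK q3.s_OK sub by (auto simp: OK_def)
  then have "s1 * s2 * s3 \<in> OK K" by (intro K.OK_mult)
  then have "s1 * s2 * s3 \<in> \<int>" using Q by (rule K.OK_Rats)
  then obtain m where m: "s1 * s2 * s3 = of_int m" by (rule Ints_cases)
  have "biquadratic_field K k1 k2 k3 s1 s2 s3 d1 d2 d3 m"
    by unfold_locales (fact finK sub ne m)+
  then show ?thesis by blast
qed

theorem mainTheorem1:
  fixes K k1 k2 k3 :: "complex set"
  assumes "biquadratic_bicyclic K"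
    and "quadratic_subfield k1 K" and "quadratic_subfield k2 K" and "quadratic_subfield k3 K"
    and "k1 \<noteq> k2" and "k1 \<noteq> k3" and "k2 \<noteq> k3"
  shows "real (card (ker_psi K k1 k2 k3)) =
     (if K \<subseteq> \<real> \<and> nu k1 = 0 \<and> nu k2 = 0 \<and> nu k3 = 0
      then (\<Prod>p\<in>{p. prime p \<and> ram_index K p \<noteq> 1}. real (ram_index K p)) / real (unit_index K k1 k2 k3)
      else (\<Prod>p\<in>{p. prime p \<and> ram_index K p \<noteq> 1}. real (ram_index K p)) / (2 * real (unit_index K k1 k2 k3)))"
proof -
  obtain s1 s2 s3 d1 d2 d3 m where "biquadratic_field K k1 k2 k3 s1 s2 s3 d1 d2 d3 m"
    using biquadratic_field_exists[OF assms] by blast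
  then interpret biquadratic_field K k1 k2 k3 s1 s2 s3 d1 d2 d3 m .
  show ?thesis by (rule kernel_formula)
qed

end
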